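(* Let $(\Omega,\mathscr{F},(\mathscr{F}_t)_{t\ge0},\mathbb{P})$ be a filtered probability space satisfying the usual conditions, let $V$ be a separable Hilbert space, $W$ a Banach space, $T>0$, $H\in(\frac13,\frac12]$ and $\alpha\in(\frac13,H)$. Let $f_0:W\to W$ be Lipschitz continuous, let $f:W\to L(V,W)$ be of class $C_b^3$, and let $\mathcal{M}$ be a finite dimensional $C^3$-submanifold of $W$. Let $Q$ be a nuclear, self-adjoint, positive definite linear operator on $V$, let $X$ be a $V$-valued $Q$-fractional Brownian motion with Hurst index $H$, let $\mathbb{X}$ be a Lévy area for $X$ such that $\mathbb{P}$-almost surely $\mathbf{X}:=(X,\mathbb{X})\in\mathscr{C}_g^{\alpha}([0,T],V)$, and let $N$ be a $\mathbb{P}$-nullset such that for every $\omega\in N^c$ we have $\mathbf{X}(\omega)\in\mathscr{C}_g^{\alpha}([0,T],V)$ and $X(\omega)$ is truly rough. Then the following statements are equivalent: (i) $\mathcal{M}$ is locally invariant on $N^c$ for the random rough differential equation $dY_t=f_0(Y_t)\,dt+f(Y_t)\,d\mathbf{X}_t$, $Y_0=\xi$. (ii) For each $y\in\mathcal{M}$ we have $$f_0(y)\in T_y\mathcal{M},\qquad\text{and}\qquad f(y)v\in T_y\mathcal{M}\ \text{ for all } v\in V.$$ Moreover, if the equivalent statements (i) and (ii) are fulfilled and $\mathcal{M}$ is closed as a subset of $W$, then $\mathcal{M}$ is globally invariant on $N^c$.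
   Context: Driving noise: a $V$-valued centered Gaussian process $X$ is a $Q$-fractional Brownian motion with Hurst index $H$ if $\mathbb{E}[X_s\otimes X_t]=\frac12\big(s^{2H}+t^{2H}-|t-s|^{2H}\big)Q$ for all $s,t\ge0$; equivalently $\mathbb{E}[\langle X_s,v\rangle\langle X_t,w\rangle]=\frac12\langle Qv,w\rangle(s^{2H}+t^{2H}-|t-s|^{2H})$. A Lévy area $\mathbb{X}$ for $X$ is a random second-order process turning $X$ into a rough path; the paper takes the existence of $\mathbb{X}$ and of $N$ from known results and almost sure true roughness of $X$. Random equation: for each $\omega\in N^c$ the equation is the deterministic equation driven by $\mathbf{X}(\omega)$. "Locally (globally) invariant on $N^c$" means that for every $\omega\in N^c$ the submanifold is locally (globally) invariant, in the sense below, for the equation driven by $\mathbf{X}(\omega)$. Notation: $L(V,W)$ is the space of bounded linear operators. For a path $X$ write $X_{s,t}=X_t-X_s$. $C_b^k$ denotes $k$ times continuously Fréchet differentiable mappings which are bounded together with their derivatives up to order $k$. $\mathcal{C}^{\alpha}([0,T],W)$ is the space of $\alpha$-Hölder continuous paths. $V\otimes V$ is a completed tensor product with a symmetric cross-norm for which the canonical injection $L(V,L(V,W))\hookrightarrow L(V\otimes V,W)$, $A\mapsto(v\otimes w\mapsto (Av)w)$, is used. Rough paths: $\mathscr{C}^{\alpha}([0,T],V)$ is the set of pairs $(X,\mathbb{X})$ with $X\in\mathcal{C}^{\alpha}([0,T],V)$ and $\mathbb{X}:[0,T]^2\to V\otimes V$ satisfying $\sup_{s\ne t}|\mathbb{X}_{s,t}|/|t-s|^{2\alpha}<\infty$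 and Chen's relation $\mathbb{X}_{s,t}-\mathbb{X}_{s,u}-\mathbb{X}_{u,t}=X_{s,u}\otimes X_{u,t}$. The set $\mathscr{C}_g^{\alpha}([0,T],V)$ of weakly geometric rough paths consists of all $(X,\mathbb{X})\in\mathscr{C}^{\alpha}([0,T],V)$ with $\mathrm{Sym}(\mathbb{X}_{s,t})=\frac12X_{s,t}\otimes X_{s,t}$ for all $s,t\in[0,T]$. Truly rough: $X\in\mathcal{C}^{\alpha}([0,T],V)$ is truly rough if there is a dense subset $D\subset[0,T)$ such that $\limsup_{t\downarrow s}|\langle v,X_{s,t}\rangle|/|t-s|^{2\alpha}=\infty$ for all $s\in D$ and all $v\in V\setminus\{0\}$. Controlled rough paths: $\mathscr{D}_X^{2\alpha}([0,T],W)$ is the space of pairs $(Y,Y')$ with $Y\in\mathcal{C}^{\alpha}([0,T],W)$, $Y'\in\mathcal{C}^{\alpha}([0,T],L(V,W))$ and $\sup_{s\neq t}|Y_{s,t}-Y'_sX_{s,t}|/|t-s|^{2\alpha}<\infty$. For $(Y,Y')\in\mathscr{D}_X^{2\alpha}([0,T],L(V,W))$ the rough integral over $[0,t]$ is $\int_0^tY_s\,d\mathbf{X}_s=\lim_{|\Pi|\to0}\sum_{[u,v]\in\Pi}(Y_uX_{u,v}+Y'_u\mathbb{X}_{u,v})$, the limit being over partitions $\Pi$ of $[0,t]$ with mesh tending to $0$. For $(Y,Y')\in\mathscr{D}_X^{2\alpha}([0,T],W)$ the path $f(Y)$ is controlled with Gubinelli derivative $f(Y)'_t=Df(Y_t)Y'_t$.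 Solutions: a solution of the equation with $Y_0=\xi$ is $(Y,Y')\in\mathscr{D}_X^{2\alpha}([0,T],W)$ with $Y'=f(Y)$ and $Y_t=\xi+\int_0^tf_0(Y_s)\,ds+\int_0^tf(Y_s)\,d\mathbf{X}_s$ for $t\in[0,T]$. Under the stated assumptions on $f_0,f$ it is known that for every $\xi\in W$ there is a unique solution on $[0,T]$. Invariance: $\mathcal{M}$ is locally invariant if for each $\xi\in\mathcal{M}$ there is $T_0\in(0,T]$ such that the solution $Y$ with $Y_0=\xi$ satisfies $Y_t\in\mathcal{M}$ for all $t\in[0,T_0]$; it is globally invariant if for each $\xi\in\mathcal{M}$ this holds for all $t\in[0,T]$. Submanifolds: $\mathcal{M}\subset W$ is an $m$-dimensional $C^k$-submanifold ($m,k\ge1$) if for every $y\in\mathcal{M}$ there are an open neighborhood $U\subset W$ of $y$, an open set $O\subset\mathbb{R}^m$ and $\phi\in C^k(O,W)$ such that $\phi:O\to U\cap\mathcal{M}$ is a homeomorphism and $D\phi(z)\in L(\mathbb{R}^m,W)$ is one-to-one for all $z\in O$. The tangent space is $T_y\mathcal{M}:=D\phi(z)\mathbb{R}^m$ with $z=\phi^{-1}(y)$ (independent of the choice of $\phi$). *)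

theory Defs
  imports "HOL-Probability.Probability"
begin

section \<open>Continuously Frechet differentiable maps\<close>

definition fderiv :: "('a::real_normed_vector \<Rightarrow> 'b::real_normed_vector) \<Rightarrow> 'a \<Rightarrow> ('a \<Rightarrow>\<^sub>L 'b)" where
  "fderiv f x = Blinfun (frechet_derivative f (at x))"

text \<open>The set \<open>S\<close> is meant to be open in the following three predicates. The \<open>k\<close>-th derivative
  takes values in the iterated spaces of bounded linear operators with the operator norm.\<close>

definition C1_on :: "'a::real_normed_vector set \<Rightarrow> ('a \<Rightarrow> 'b::real_normed_vector) \<Rightarrow> bool" where
  "C1_on S f \<longleftrightarrow> (\<forall>x\<in>S. f differentiable (at x)) \<and> continuous_on S (fderiv f)"

definition C2_on :: "'a::real_normed_vector set \<Rightarrow> ('a \<Rightarrow> 'b::real_normed_vector) \<Rightarrow> bool" where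
  "C2_on S f \<longleftrightarrow> (\<forall>x\<in>S. f differentiable (at x)) \<and> C1_on S (fderiv f)"

definition C3_on :: "'a::real_normed_vector set \<Rightarrow> ('a \<Rightarrow> 'b::real_normed_vector) \<Rightarrow> bool" where
  "C3_on S f \<longleftrightarrow> (\<forall>x\<in>S. f differentiable (at x)) \<and> C2_on S (fderiv f)"

definition Cb3 :: "('a::real_normed_vector \<Rightarrow> 'b::real_normed_vector) \<Rightarrow> bool" where
  "Cb3 f \<longleftrightarrow> C3_on UNIV f \<and> bounded (range f) \<and> bounded (range (fderiv f)) \<and>
     bounded (range (fderiv (fderiv f))) \<and> bounded (range (fderiv (fderiv (fderiv f))))"


section \<open>Finite dimensional submanifolds\<close>

definition local_parametrization ::
  "'w::real_normed_vector set \<Rightarrow> (real^'m \<Rightarrow> 'w) \<Rightarrow> (real^'m) set \<Rightarrow> 'w set \<Rightarrow> bool" where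
  "local_parametrization M \<phi> O' U \<longleftrightarrow> open O' \<and> open U \<and> C3_on O' \<phi> \<and>
     (\<exists>\<psi>. homeomorphism O' (U \<inter> M) \<phi> \<psi>) \<and> (\<forall>z\<in>O'. inj (blinfun_apply (fderiv \<phi> z)))"

text \<open>The dimension of the submanifold is \<open>CARD('m)\<close>, which is at least one.\<close>

definition C3_submanifold :: "'m::finite itself \<Rightarrow> 'w::real_normed_vector set \<Rightarrow> bool" where
  "C3_submanifold _ M \<longleftrightarrow>
     (\<forall>y\<in>M. \<exists>(\<phi> :: real^'m \<Rightarrow> 'w) O' U. y \<in> U \<and> local_parametrization M \<phi> O' U)"

text \<open>Since \<open>D\<phi>(z) \<real>\<^sup>m\<close> with \<open>\<phi>(z) = y\<close> is the same space for all local parametrizations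
  \<open>\<phi>\<close> around \<open>y\<close>, the union over all of them is this common space.\<close>

definition tangent_space :: "'m::finite itself \<Rightarrow> 'w::real_normed_vector set \<Rightarrow> 'w \<Rightarrow> 'w set" where
  "tangent_space _ M y =
     {fderiv \<phi> z h | (\<phi> :: real^'m \<Rightarrow> 'w) O' U z h.
        local_parametrization M \<phi> O' U \<and> z \<in> O' \<and> \<phi> z = y}"


section \<open>Completed tensor products\<close>

text \<open>\<open>tens\<close> exhibits the Banach space \<open>'z\<close> as the completion of the algebraic tensor product
  of \<open>'v\<close> with itself with respect to a symmetric cross-norm. The condition on independent
  sets says that the linear map from the algebraic tensor product to \<open>'z\<close> is injective.\<close>

definition completed_tensor_product ::
  "('v::real_normed_vector \<Rightarrow> 'v \<Rightarrow> 'z::banach) \<Rightarrow> bool" where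
  "completed_tensor_product tens \<longleftrightarrow>
     bounded_bilinear tens \<and>
     (\<forall>B a. finite B \<and> independent B \<and> (\<Sum>b\<in>B. tens (a b) b) = 0 \<longrightarrow> (\<forall>b\<in>B. a b = 0)) \<and>
     closure (span (range (\<lambda>(v, w). tens v w))) = UNIV \<and>
     (\<forall>v w. norm (tens v w) = norm v * norm w) \<and>
     (\<forall>(n::nat) a b. norm (\<Sum>i<n. tens (b i) (a i)) = norm (\<Sum>i<n. tens (a i) (b i)))"

text \<open>The continuous canonical injection of \<open>L(V, L(V, W))\<close> into \<open>L(V \<otimes> V, W)\<close> exists. This is
  a requirement on the cross-norm (satisfied by the projective one).\<close>

definition has_canonical_injection ::
  "'w::real_normed_vector itself \<Rightarrow> ('v::real_normed_vector \<Rightarrow> 'v \<Rightarrow> 'z::banach) \<Rightarrow> bool" where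
  "has_canonical_injection _ tens \<longleftrightarrow>
     (\<exists>C. \<forall>A :: 'v \<Rightarrow>\<^sub>L 'v \<Rightarrow>\<^sub>L 'w. \<exists>B :: 'z \<Rightarrow>\<^sub>L 'w.
        norm B \<le> C * norm A \<and> (\<forall>v w. blinfun_apply B (tens v w) = blinfun_apply (blinfun_apply A v) w))"

definition tensor_lift ::
  "('v::real_normed_vector \<Rightarrow> 'v \<Rightarrow> 'z::banach) \<Rightarrow> ('v \<Rightarrow>\<^sub>L 'v \<Rightarrow>\<^sub>L 'w::real_normed_vector) \<Rightarrow> 'z \<Rightarrow>\<^sub>L 'w" where
  "tensor_lift tens A = (THE B. \<forall>v w. blinfun_apply B (tens v w) = blinfun_apply (blinfun_apply A v) w)"

definition tensor_swap ::
  "('v::real_normed_vector \<Rightarrow> 'v \<Rightarrow> 'z::banach) \<Rightarrow> 'z \<Rightarrow>\<^sub>L 'z" where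
  "tensor_swap tens = (THE S. \<forall>v w. blinfun_apply S (tens v w) = tens w v)"

definition tensor_sym ::
  "('v::real_normed_vector \<Rightarrow> 'v \<Rightarrow> 'z::banach) \<Rightarrow> 'z \<Rightarrow> 'z" where
  "tensor_sym tens z = (1/2) *\<^sub>R (z + tensor_swap tens z)"


section \<open>Rough paths and controlled rough paths\<close>

definition holder_path :: "real \<Rightarrow> real \<Rightarrow> (real \<Rightarrow> 'b::real_normed_vector) \<Rightarrow> bool" where
  "holder_path \<alpha> T Y \<longleftrightarrow>
     (\<exists>C. \<forall>s\<in>{0..T}. \<forall>t\<in>{0..T}. norm (Y t - Y s) \<le> C * \<bar>t - s\<bar> powr \<alpha>)"

definition rough_path ::
  "('v::real_normed_vector \<Rightarrow> 'v \<Rightarrow> 'z::banach) \<Rightarrow> real \<Rightarrow> real \<Rightarrow>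
   (real \<Rightarrow> 'v) \<Rightarrow> (real \<Rightarrow> real \<Rightarrow> 'z) \<Rightarrow> bool" where
  "rough_path tens \<alpha> T X XX \<longleftrightarrow>
     holder_path \<alpha> T X \<and>
     (\<exists>C. \<forall>s\<in>{0..T}. \<forall>t\<in>{0..T}. s \<noteq> t \<longrightarrow> norm (XX s t) \<le> C * \<bar>t - s\<bar> powr (2 * \<alpha>)) \<and>
     (\<forall>s\<in>{0..T}. \<forall>u\<in>{0..T}. \<forall>t\<in>{0..T}.
        XX s t - XX s u - XX u t = tens (X u - X s) (X t - X u))"

definition weakly_geometric_rough_path ::
  "('v::real_normed_vector \<Rightarrow> 'v \<Rightarrow> 'z::banach) \<Rightarrow> real \<Rightarrow> real \<Rightarrow>
   (real \<Rightarrow> 'v) \<Rightarrow> (real \<Rightarrow> real \<Rightarrow> 'z) \<Rightarrow> bool" where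
  "weakly_geometric_rough_path tens \<alpha> T X XX \<longleftrightarrow>
     rough_path tens \<alpha> T X XX \<and>
     (\<forall>s\<in>{0..T}. \<forall>t\<in>{0..T}.
        tensor_sym tens (XX s t) = (1/2) *\<^sub>R tens (X t - X s) (X t - X s))"

definition truly_rough :: "real \<Rightarrow> real \<Rightarrow> (real \<Rightarrow> 'v::real_inner) \<Rightarrow> bool" where
  "truly_rough \<alpha> T X \<longleftrightarrow>
     holder_path \<alpha> T X \<and>
     (\<exists>D. D \<subseteq> {0..<T} \<and> {0..<T} \<subseteq> closure D \<and>
       (\<forall>s\<in>D. \<forall>v. v \<noteq> 0 \<longrightarrow>
         Limsup (at_right s) (\<lambda>t. ereal (\<bar>v \<bullet> (X t - X s)\<bar> / \<bar>t - s\<bar> powr (2 * \<alpha>))) = \<infinity>))"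

definition controlled ::
  "real \<Rightarrow> real \<Rightarrow> (real \<Rightarrow> 'v::real_normed_vector) \<Rightarrow>
   (real \<Rightarrow> 'b::real_normed_vector) \<Rightarrow> (real \<Rightarrow> 'v \<Rightarrow>\<^sub>L 'b) \<Rightarrow> bool" where
  "controlled \<alpha> T X Y Y' \<longleftrightarrow>
     holder_path \<alpha> T Y \<and> holder_path \<alpha> T Y' \<and>
     (\<exists>C. \<forall>s\<in>{0..T}. \<forall>t\<in>{0..T}. s \<noteq> t \<longrightarrow>
        norm (Y t - Y s - blinfun_apply (Y' s) (X t - X s)) \<le> C * \<bar>t - s\<bar> powr (2 * \<alpha>))"

text \<open>The limit runs over the partitions \<open>0 = p 0 < \<dots> < p n = t\<close> with mesh tending to zero.\<close>

definition has_rough_integral ::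
  "('v::real_normed_vector \<Rightarrow> 'v \<Rightarrow> 'z::banach) \<Rightarrow> (real \<Rightarrow> 'v) \<Rightarrow> (real \<Rightarrow> real \<Rightarrow> 'z) \<Rightarrow>
   (real \<Rightarrow> 'v \<Rightarrow>\<^sub>L 'w::real_normed_vector) \<Rightarrow> (real \<Rightarrow> 'v \<Rightarrow>\<^sub>L 'v \<Rightarrow>\<^sub>L 'w) \<Rightarrow> real \<Rightarrow> 'w \<Rightarrow> bool" where
  "has_rough_integral tens X XX Y Y' t I \<longleftrightarrow>
     (\<forall>\<epsilon>>0. \<exists>\<delta>>0. \<forall>(n::nat) p.
        p 0 = 0 \<and> p n = t \<and> (\<forall>i<n. p i < p (Suc i) \<and> p (Suc i) - p i < \<delta>) \<longrightarrow>
        norm ((\<Sum>i<n. blinfun_apply (Y (p i)) (X (p (Suc i)) - X (p i)) +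
                 blinfun_apply (tensor_lift tens (Y' (p i))) (XX (p i) (p (Suc i)))) - I) < \<epsilon>)"


section \<open>Rough differential equations and invariance\<close>

definition rde_solution ::
  "('v::real_normed_vector \<Rightarrow> 'v \<Rightarrow> 'z::banach) \<Rightarrow> real \<Rightarrow> real \<Rightarrow> ('w::banach \<Rightarrow> 'w) \<Rightarrow> ('w \<Rightarrow> 'v \<Rightarrow>\<^sub>L 'w) \<Rightarrow>
   (real \<Rightarrow> 'v) \<Rightarrow> (real \<Rightarrow> real \<Rightarrow> 'z) \<Rightarrow> 'w \<Rightarrow> (real \<Rightarrow> 'w) \<Rightarrow> (real \<Rightarrow> 'v \<Rightarrow>\<^sub>L 'w) \<Rightarrow> bool" where
  "rde_solution tens \<alpha> T f0 f X XX \<xi> Y Y' \<longleftrightarrow>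
     controlled \<alpha> T X Y Y' \<and>
     (\<forall>t\<in>{0..T}. Y' t = f (Y t)) \<and>
     (\<forall>t\<in>{0..T}. \<exists>I.
        has_rough_integral tens X XX (\<lambda>s. f (Y s)) (\<lambda>s. fderiv f (Y s) o\<^sub>L Y' s) t I \<and>
        Y t = \<xi> + integral {0..t} (\<lambda>s. f0 (Y s)) + I)"

text \<open>\<open>Y\<close> is the unique solution; paths are compared on \<open>[0,T]\<close> only, and the Gubinelli
  derivative is determined there by \<open>Y' = f(Y)\<close>.\<close>

definition the_rde_solution ::
  "('v::real_normed_vector \<Rightarrow> 'v \<Rightarrow> 'z::banach) \<Rightarrow> real \<Rightarrow> real \<Rightarrow> ('w::banach \<Rightarrow> 'w) \<Rightarrow> ('w \<Rightarrow> 'v \<Rightarrow>\<^sub>L 'w) \<Rightarrow>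
   (real \<Rightarrow> 'v) \<Rightarrow> (real \<Rightarrow> real \<Rightarrow> 'z) \<Rightarrow> 'w \<Rightarrow> (real \<Rightarrow> 'w) \<Rightarrow> bool" where
  "the_rde_solution tens \<alpha> T f0 f X XX \<xi> Y \<longleftrightarrow>
     (\<exists>Y'. rde_solution tens \<alpha> T f0 f X XX \<xi> Y Y') \<and>
     (\<forall>Z Z'. rde_solution tens \<alpha> T f0 f X XX \<xi> Z Z' \<longrightarrow> (\<forall>t\<in>{0..T}. Z t = Y t))"

definition locally_invariant ::
  "('v::real_normed_vector \<Rightarrow> 'v \<Rightarrow> 'z::banach) \<Rightarrow> real \<Rightarrow> real \<Rightarrow> ('w::banach \<Rightarrow> 'w) \<Rightarrow> ('w \<Rightarrow> 'v \<Rightarrow>\<^sub>L 'w) \<Rightarrow>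
   (real \<Rightarrow> 'v) \<Rightarrow> (real \<Rightarrow> real \<Rightarrow> 'z) \<Rightarrow> 'w set \<Rightarrow> bool" where
  "locally_invariant tens \<alpha> T f0 f X XX M \<longleftrightarrow>
     (\<forall>\<xi>\<in>M. \<exists>T0\<in>{0<..T}. \<exists>Y. the_rde_solution tens \<alpha> T f0 f X XX \<xi> Y \<and> (\<forall>t\<in>{0..T0}. Y t \<in> M))"

definition globally_invariant ::
  "('v::real_normed_vector \<Rightarrow> 'v \<Rightarrow> 'z::banach) \<Rightarrow> real \<Rightarrow> real \<Rightarrow> ('w::banach \<Rightarrow> 'w) \<Rightarrow> ('w \<Rightarrow> 'v \<Rightarrow>\<^sub>L 'w) \<Rightarrow>
   (real \<Rightarrow> 'v) \<Rightarrow> (real \<Rightarrow> real \<Rightarrow> 'z) \<Rightarrow> 'w set \<Rightarrow> bool" where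
  "globally_invariant tens \<alpha> T f0 f X XX M \<longleftrightarrow>
     (\<forall>\<xi>\<in>M. \<exists>Y. the_rde_solution tens \<alpha> T f0 f X XX \<xi> Y \<and> (\<forall>t\<in>{0..T}. Y t \<in> M))"


section \<open>The driving noise\<close>

definition usual_conditions :: "'a measure \<Rightarrow> (real \<Rightarrow> 'a measure) \<Rightarrow> bool" where
  "usual_conditions P F \<longleftrightarrow>
     complete_measure P \<and>
     (\<forall>t\<ge>0. subalgebra P (F t)) \<and>
     (\<forall>s t. 0 \<le> s \<and> s \<le> t \<longrightarrow> sets (F s) \<subseteq> sets (F t)) \<and>
     (\<forall>t\<ge>0. sets (F t) = (\<Inter>u\<in>{t<..}. sets (F u))) \<and>
     null_sets P \<subseteq> sets (F 0)"

definition nuclear :: "('v::real_inner \<Rightarrow>\<^sub>L 'v) \<Rightarrow> bool" where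
  "nuclear Q \<longleftrightarrow> (\<exists>(a :: nat \<Rightarrow> 'v) b. summable (\<lambda>n. norm (a n) * norm (b n)) \<and>
     (\<forall>v. (\<lambda>n. (a n \<bullet> v) *\<^sub>R b n) sums Q v))"

definition self_adjoint :: "('v::real_inner \<Rightarrow>\<^sub>L 'v) \<Rightarrow> bool" where
  "self_adjoint Q \<longleftrightarrow> (\<forall>v w. Q v \<bullet> w = v \<bullet> Q w)"

definition positive_definite :: "('v::real_inner \<Rightarrow>\<^sub>L 'v) \<Rightarrow> bool" where
  "positive_definite Q \<longleftrightarrow> (\<forall>v. v \<noteq> 0 \<longrightarrow> Q v \<bullet> v > 0)"

text \<open>Real Gaussian random variables, including the degenerate ones.\<close>

definition gaussian_rv :: "'a measure \<Rightarrow> ('a \<Rightarrow> real) \<Rightarrow> bool" where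
  "gaussian_rv P Z \<longleftrightarrow> Z \<in> borel_measurable P \<and>
     (\<exists>\<mu>. (AE \<omega> in P. Z \<omega> = \<mu>) \<or> (\<exists>\<sigma>>0. distributed P lborel Z (normal_density \<mu> \<sigma>)))"

definition centered_gaussian_process ::
  "'a measure \<Rightarrow> (real \<Rightarrow> 'a \<Rightarrow> 'v::{real_inner,banach,second_countable_topology}) \<Rightarrow> bool" where
  "centered_gaussian_process P X \<longleftrightarrow>
     (\<forall>t\<ge>0. X t \<in> borel_measurable P) \<and>
     (\<forall>(n::nat) \<tau> v. (\<forall>i<n. 0 \<le> \<tau> i) \<longrightarrow> gaussian_rv P (\<lambda>\<omega>. \<Sum>i<n. X (\<tau> i) \<omega> \<bullet> v i)) \<and>
     (\<forall>t\<ge>0. has_bochner_integral P (X t) 0)"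

definition Q_fractional_brownian_motion ::
  "'a measure \<Rightarrow> real \<Rightarrow> ('v \<Rightarrow>\<^sub>L 'v) \<Rightarrow>
   (real \<Rightarrow> 'a \<Rightarrow> 'v::{real_inner,banach,second_countable_topology}) \<Rightarrow> bool" where
  "Q_fractional_brownian_motion P H Q X \<longleftrightarrow>
     centered_gaussian_process P X \<and>
     (\<forall>s\<ge>0. \<forall>t\<ge>0. \<forall>v w. has_bochner_integral P (\<lambda>\<omega>. (X s \<omega> \<bullet> v) * (X t \<omega> \<bullet> w))
        ((1/2) * (Q v \<bullet> w) * (s powr (2 * H) + t powr (2 * H) - \<bar>t - s\<bar> powr (2 * H))))"

end

theory Submission
  imports Defs
begin

text \<open>
  The equivalence holds for each single path outside \<open>N\<close>, so the proof is deterministic.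

  Let \<open>incr y s t = f(y) X(s,t) + (Df(y) f(y)) XX(s,t)\<close> be the second order Euler step. A path \<open>Y\<close>
  solves the equation if and only if
  \<open>Y(t) - Y(s) = (t - s) f0(Y(s)) + incr (Y(s)) s t + O(|t - s|^(3 \<alpha>))\<close>
  (lemma \<open>the_rde_solution_iff\<close>). With this description of solutions the rough integral disappears,
  and everything reduces to one step maps. As \<open>3 \<alpha> > 1\<close>, a discrete sewing lemma shows that any two
  schemes of step size \<open>h\<close> which agree with the Euler steps up to errors of order \<open>h^(3 \<alpha>)\<close> stay
  within a distance of order \<open>h^(3 \<alpha> - 1)\<close> (lemma \<open>approx_stability\<close>). This estimate yields existence
  of solutions (Euler schemes on dyadic grids form a Cauchy sequence), uniqueness (samples of
  solutions are such schemes), and convergence of any such scheme to the solution.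

  Tangency implies invariance: let \<open>\<phi>\<close> be a local parametrization. If \<open>f\<close> is tangent, with
  \<open>f(\<phi>(z)) v = D\<phi>(z) \<sigma> v\<close>, then differentiating this identity shows that
  \<open>Df(y)(f(y) v) w - D\<^sup>2\<phi>(z)(\<sigma> v, \<sigma> w)\<close> is tangent as well. For a weakly geometric driver, applying
  \<open>D\<^sup>2\<phi>(z)(\<sigma> \<cdot>, \<sigma> \<cdot>)\<close> to \<open>XX(s,t)\<close> gives half of \<open>D\<^sup>2\<phi>(z)(\<sigma> X(s,t), \<sigma> X(s,t))\<close>, the quadratic term of
  the Taylor expansion of \<open>\<phi>\<close>. Hence Euler steps that start on the submanifold end on it up to an
  error of order \<open>3 \<alpha>\<close> (lemma \<open>chart_step\<close>), and some scheme that stays on the submanifold converges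
  to the solution. In this argument two solutions are compared in the ambient space alone, where \<open>f\<close>
  has three bounded derivatives; the vector field in coordinates, which is less regular, is never
  integrated. If the submanifold is closed, there is no first exit time.

  Invariance implies tangency: at a time \<open>s\<close> at which the driver is truly rough, the increments
  \<open>f(Y(s)) X(s,t)\<close> are tangent up to order \<open>2 \<alpha>\<close>. If not all of the range of \<open>f(Y(s))\<close> were tangent, a
  projection in the Hilbert space would produce a vector \<open>u \<noteq> 0\<close> whose inner product with \<open>X(s,t)\<close> is
  of order \<open>2 \<alpha>\<close>, which true roughness forbids (lemma \<open>truly_rough_tangent\<close>). Such times are
  dense, so \<open>f\<close> is tangent at the initial point. Comparing the solution with the step along the
  submanifold that omits the drift then isolates \<open>f0\<close> (lemma \<open>drift_tangent\<close>).
\<close>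

section \<open>Sewing on a uniform grid\<close>

text \<open>The fixed point of \<open>c = 2 powr (1 - \<theta>) * c + 2\<close>, the recursion that the bisection of an
  interval imposes on the constant of the sewing estimate.\<close>

definition sew_const :: "real \<Rightarrow> real" where
  "sew_const \<theta> = 2 / (1 - 2 powr (1 - \<theta>))"

lemma sew_const_pos: "1 < \<theta> \<Longrightarrow> 0 < sew_const \<theta>"
  unfolding sew_const_def by (simp add: powr_less_one)

lemma sew_const_eq:
  assumes "1 < \<theta>"
  shows "sew_const \<theta> * (2 powr (1 - \<theta>)) + 2 = sew_const \<theta>"
proof -
  define r :: real where "r = 2 powr (1 - \<theta>)"
  have "r < 1" using assms by (simp add: r_def powr_less_one)
  then have "1 - r \<noteq> 0" by simp
  then show ?thesis unfolding sew_const_def r_def[symmetric] by (simp add: divide_simps)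
qed

text \<open>An interval of \<open>d\<close> cells is cut around its middle cell. The two outer pieces have at most
  \<open>d / 2\<close> cells each, so by induction they contribute \<open>2 powr (1 - \<theta>)\<close> times the bound for \<open>d\<close>,
  the middle cell contributes nothing, and the two cuts cost one defect of additivity each. As
  \<open>\<theta> > 1\<close>, the resulting recursion for the constant has a finite fixed point.\<close>

lemma discrete_sewing:
  fixes J :: "nat \<Rightarrow> nat \<Rightarrow> 'a::real_normed_vector"
  assumes \<theta>: "1 < \<theta>" and A: "0 \<le> A"
    and J0: "\<And>i. i \<le> n \<Longrightarrow> J i i = 0" and J1: "\<And>i. i < n \<Longrightarrow> J i (Suc i) = 0"
    and dJ: "\<And>i j k. i \<le> j \<Longrightarrow> j \<le> k \<Longrightarrow> k \<le> n \<Longrightarrow>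
               norm (J i k - J i j - J j k) \<le> A * real (k - i) powr \<theta>"
  shows "i \<le> j \<Longrightarrow> j \<le> n \<Longrightarrow> norm (J i j) \<le> sew_const \<theta> * A * real (j - i) powr \<theta>"
proof (induction "j - i" arbitrary: i j rule: less_induct)
  case less
  have K: "0 < sew_const \<theta>" using sew_const_pos[OF \<theta>] .
  consider "j = i" | "j = Suc i" | "j - i \<ge> 2" using less.prems by linarith
  then show ?case
  proof cases
    case 1 then show ?thesis using J0 less.prems A K by simp
  next
    case 2 then show ?thesis using J1[of i] less.prems A K by simp
  next
    case 3
    define d where "d = j - i"
    define m where "m = i + d div 2"
    have d2: "d \<ge> 2" and jd: "j = i + d" using 3 less.prems by (auto simp: d_def)
    have im: "i \<le> m" "Suc m \<le> j" "m \<le> j" "m < n" using d2 less.prems by (auto simp: m_def jd)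
    have half: "real (m - i) \<le> real d / 2" "real (j - Suc m) \<le> real d / 2"
      unfolding m_def jd by linarith+
    have pow: "(real d / 2) powr \<theta> = 2 powr (- \<theta>) * real d powr \<theta>"
      by (simp add: powr_divide powr_minus_divide)
    have mono: "sew_const \<theta> * A * x powr \<theta> \<le> sew_const \<theta> * A * (2 powr (-\<theta>) * real d powr \<theta>)"
      if "0 \<le> x" "x \<le> real d / 2" for x
      unfolding pow[symmetric] using that \<theta> A K by (intro mult_left_mono powr_mono2) auto
    have l: "norm (J i m) \<le> sew_const \<theta> * A * (2 powr (-\<theta>) * real d powr \<theta>)"
      using less.hyps[of m i] im d2 less.prems mono[of "real (m - i)"] half
      by (force simp: m_def jd intro: order_trans)
    have r: "norm (J (Suc m) j) \<le> sew_const \<theta> * A * (2 powr (-\<theta>) * real d powr \<theta>)"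
      using less.hyps[of j "Suc m"] im d2 less.prems mono[of "real (j - Suc m)"] half
      by (force simp: m_def jd intro: order_trans)
    have d1: "norm (J i j - J i m - J m j) \<le> A * real d powr \<theta>"
      using dJ[of i m j] im less.prems by (simp add: d_def)
    have "norm (J m j - J m (Suc m) - J (Suc m) j) \<le> A * real (j - m) powr \<theta>"
      using dJ[of m "Suc m" j] im less.prems by simp
    also have "\<dots> \<le> A * real d powr \<theta>"
      using A \<theta> im by (intro mult_left_mono powr_mono2) (auto simp: d_def)
    finally have d3: "norm (J m j - J m (Suc m) - J (Suc m) j) \<le> A * real d powr \<theta>" .
    have split: "J i j = (J i j - J i m - J m j) + (J m j - J m (Suc m) - J (Suc m) j) + J i m + J (Suc m) j"
      using J1[OF im(4)] by simp
    have "norm (J i j) \<le> norm (J i j - J i m - J m j) + norm (J m j - J m (Suc m) - J (Suc m) j)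
       + norm (J i m) + norm (J (Suc m) j)"
      by (subst split) (intro norm_triangle_le add_mono order_refl)
    also have "\<dots> \<le> 2 * A * real d powr \<theta> + 2 * (sew_const \<theta> * A * (2 powr (-\<theta>) * real d powr \<theta>))"
      using d1 d3 l r by linarith
    also have "\<dots> = (sew_const \<theta> * (2 powr (1 - \<theta>)) + 2) * A * real d powr \<theta>"
      by (simp add: powr_diff powr_minus_divide algebra_simps)
    finally show ?thesis unfolding sew_const_eq[OF \<theta>] by (simp add: d_def)
  qed
qed

lemma discrete_sewing_step:
  fixes J :: "nat \<Rightarrow> nat \<Rightarrow> 'a::real_normed_vector"
  assumes \<theta>: "1 < \<theta>" and A: "0 \<le> A" and h: "0 < h"
    and J0: "\<And>i. i \<le> n \<Longrightarrow> J i i = 0" and J1: "\<And>i. i < n \<Longrightarrow> J i (Suc i) = 0"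
    and dJ: "\<And>i j k. i \<le> j \<Longrightarrow> j \<le> k \<Longrightarrow> k \<le> n \<Longrightarrow>
               norm (J i k - J i j - J j k) \<le> A * (real (k - i) * h) powr \<theta>"
    and ij: "i \<le> j" "j \<le> n"
  shows "norm (J i j) \<le> sew_const \<theta> * A * (real (j - i) * h) powr \<theta>"
  using discrete_sewing[of \<theta> "A * h powr \<theta>" n J i j] \<theta> J0 J1 ij A h dJ
  by (simp add: powr_mult mult_ac)

text \<open>Along a numerical scheme the defect of additivity is itself controlled by the size of \<open>J\<close>.
  On a finite grid the best constant \<open>N\<close> in the bound for \<open>J\<close> exists as a maximum, so the
  inequality \<open>N \<le> sew_const \<theta> * (a + c * N)\<close> may be solved for \<open>N\<close>. Finiteness replaces the
  continuity argument that a bootstrap usually needs.\<close>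

lemma sewing_bootstrap:
  fixes J :: "nat \<Rightarrow> nat \<Rightarrow> 'a::real_normed_vector"
  assumes \<theta>: "1 < \<theta>" and a: "0 \<le> a" and c: "0 \<le> c" and h: "0 < h"
    and J0: "\<And>i. i \<le> n \<Longrightarrow> J i i = 0" and J1: "\<And>i. i < n \<Longrightarrow> J i (Suc i) = 0"
    and dJ: "\<And>N i j k. 0 \<le> N \<Longrightarrow>
        (\<And>i j. i \<le> j \<Longrightarrow> j \<le> n \<Longrightarrow> norm (J i j) \<le> N * (real (j - i) * h) powr \<theta>) \<Longrightarrow>
        i \<le> j \<Longrightarrow> j \<le> k \<Longrightarrow> k \<le> n \<Longrightarrow>
        norm (J i k - J i j - J j k) \<le> (a + c * N) * (real (k - i) * h) powr \<theta>"
    and small: "sew_const \<theta> * c \<le> 1/2"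
    and ij: "i \<le> j" "j \<le> n"
  shows "norm (J i j) \<le> 2 * sew_const \<theta> * a * (real (j - i) * h) powr \<theta>"
proof -
  define q where "q = (\<lambda>(i, j). norm (J i j) / (real (j - i) * h) powr \<theta>)"
  define S where "S = insert 0 (q ` {(i, j). i \<le> j \<and> j \<le> n})"
  have "finite {(i, j). i \<le> j \<and> j \<le> n}"
    by (rule finite_subset[of _ "{..n} \<times> {..n}"]) auto
  then have fin: "finite S" by (simp add: S_def)
  define N where "N = Max S"
  have N0: "0 \<le> N" unfolding N_def using fin by (intro Max_ge) (auto simp: S_def)
  have qN: "norm (J i j) \<le> N * (real (j - i) * h) powr \<theta>" if "i \<le> j" "j \<le> n" for i j
  proof (cases "i = j")
    case True then show ?thesis using J0 that by simp
  next
    case False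
    have "q (i, j) \<le> N" unfolding N_def using fin that by (intro Max_ge) (auto simp: S_def)
    moreover have "0 < (real (j - i) * h) powr \<theta>" using False that h by simp
    ultimately show ?thesis by (simp add: q_def pos_divide_le_eq)
  qed
  have sew: "norm (J i j) \<le> sew_const \<theta> * (a + c * N) * (real (j - i) * h) powr \<theta>"
    if "i \<le> j" "j \<le> n" for i j
    using a c N0 that by (intro discrete_sewing_step[OF \<theta> _ h J0 J1 dJ[OF N0 qN]]) auto
  have K: "0 < sew_const \<theta>" using sew_const_pos[OF \<theta>] .
  have "x \<le> sew_const \<theta> * (a + c * N)" if "x \<in> S" for x
  proof -
    have "x = 0 \<or> (\<exists>i j. i \<le> j \<and> j \<le> n \<and> x = q (i, j))" using that by (auto simp: S_def image_iff)
    then consider "x = 0" | i j where "i \<le> j" "j \<le> n" "x = q (i, j)" by blast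
    then show ?thesis
    proof cases
      case 1 then show ?thesis using a c N0 K by simp
    next
      case 2
      show ?thesis
      proof (cases "i = j")
        case True then show ?thesis using a c N0 K 2 J0 by (simp add: q_def)
      next
        case False
        then have "0 < (real (j - i) * h) powr \<theta>" using 2 h by simp
        then show ?thesis using sew[of i j] 2 by (simp add: q_def pos_divide_le_eq)
      qed
    qed
  qed
  then have "N \<le> sew_const \<theta> * (a + c * N)"
    unfolding N_def using fin by (subst Max_le_iff) (auto simp: S_def)
  also have "\<dots> = sew_const \<theta> * a + (sew_const \<theta> * c) * N" by (simp add: algebra_simps)
  also have "\<dots> \<le> sew_const \<theta> * a + 1/2 * N" using small N0 by (intro add_left_mono mult_right_mono)
  finally have "N \<le> 2 * sew_const \<theta> * a" by simp
  then have "N * (real (j - i) * h) powr \<theta> \<le> 2 * sew_const \<theta> * a * (real (j - i) * h) powr \<theta>"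
    by (rule mult_right_mono) simp
  then show ?thesis using qN[OF ij] by linarith
qed

text \<open>Bounds that hold on blocks of length at most \<open>\<tau>\<close> are chained. Each block begins at the last
  grid point before a multiple of \<open>\<tau> / 2\<close>; as the mesh is at most \<open>\<tau> / 2\<close>, the next multiple is
  still reached within length \<open>\<tau>\<close>.\<close>

lemma block_growth:
  fixes u :: "nat \<Rightarrow> real"
  assumes c: "1 \<le> c" and h: "0 < h" "h \<le> \<tau> / 2" and u0: "0 \<le> u 0"
    and step: "\<And>i j. i \<le> j \<Longrightarrow> j \<le> n \<Longrightarrow> real (j - i) * h \<le> \<tau> \<Longrightarrow> u j \<le> c * u i"
  shows "j \<le> n \<Longrightarrow> real j * h \<le> real m * (\<tau> / 2) \<Longrightarrow> u j \<le> c ^ m * u 0"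
proof (induction m arbitrary: j)
  case 0
  then have "j = 0" using h by (simp add: mult_le_0_iff)
  then show ?case by simp
next
  case (Suc m)
  have up: "c ^ m * u 0 \<le> c ^ Suc m * u 0" using c u0 by (simp add: mult_right_mono)
  show ?case
  proof (cases "real j * h \<le> real m * (\<tau> / 2)")
    case True then show ?thesis using Suc up by fastforce
  next
    case False
    define i where "i = nat \<lfloor>real m * (\<tau> / 2) / h\<rfloor>"
    have nn: "0 \<le> real m * (\<tau> / 2) / h" using h by simp
    have i1: "real i \<le> real m * (\<tau> / 2) / h" "real m * (\<tau> / 2) / h < real i + 1"
      unfolding i_def using nn by linarith+
    then have i2: "real i * h \<le> real m * (\<tau> / 2)" "real m * (\<tau> / 2) \<le> real i * h + h"
      using h by (auto simp: field_simps)
    then have "real i * h < real j * h" using False by linarith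
    then have ij: "i \<le> j" using h by simp
    have "real (j - i) * h = real j * h - real i * h" using ij by (simp add: of_nat_diff algebra_simps)
    also have "\<dots> \<le> \<tau>" using Suc.prems(2) i2 h by (simp add: algebra_simps)
    finally have "u j \<le> c * u i" using step ij Suc.prems by blast
    also have "\<dots> \<le> c * (c ^ m * u 0)"
      using Suc.IH[of i] i2 ij Suc.prems c by (intro mult_left_mono) auto
    finally show ?thesis by simp
  qed
qed

lemma Max_attained:
  fixes g :: "nat \<Rightarrow> real"
  obtains M where "\<And>i. i \<le> n \<Longrightarrow> g i \<le> M" "\<exists>i\<le>n. g i = M"
proof
  define M where "M = Max (g ` {..n})"
  show "g i \<le> M" if "i \<le> n" for i unfolding M_def using that by (intro Max_ge) auto
  have "M \<in> g ` {..n}" unfolding M_def by (intro Max_in) auto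
  then show "\<exists>i\<le>n. g i = M" by auto
qed

section \<open>Differentiable maps with Lipschitz derivatives\<close>

lemma fderiv_works:
  assumes "f differentiable (at x)"
  shows "(f has_derivative blinfun_apply (fderiv f x)) (at x)"
  using assms unfolding fderiv_def
  by (metis bounded_linear_Blinfun_apply frechet_derivative_works has_derivative_bounded_linear)

text \<open>The mean value inequality for \<open>f\<close> minus its linear part at \<open>c\<close>. Having \<open>c\<close> independent of the
  two end points makes the estimate usable for secants as well as for tangents.\<close>

lemma strict_taylor:
  fixes f :: "'a::real_normed_vector \<Rightarrow> 'b::real_normed_vector"
  assumes S: "convex S"
    and d: "\<And>x. x \<in> S \<Longrightarrow> (f has_derivative blinfun_apply (f' x)) (at x)"
    and L: "\<And>x y. x \<in> S \<Longrightarrow> y \<in> S \<Longrightarrow> norm (f' x - f' y) \<le> K * norm (x - y)"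
    and abc: "a \<in> S" "b \<in> S" "c \<in> S" and K: "0 \<le> K"
  shows "norm (f b - f a - f' c (b - a)) \<le> K * (norm (a - c) + norm (b - c)) * norm (b - a)"
proof -
  define g where "g x = f x - f' c x" for x
  have seg: "closed_segment a b \<subseteq> S" using S abc by (simp add: closed_segment_subset)
  have "norm (g b - g a) \<le> (K * (norm (a - c) + norm (b - c))) * norm (b - a)"
  proof (rule differentiable_bound[of "closed_segment a b" g "\<lambda>x. blinfun_apply (f' x - f' c)"])
    fix x assume x: "x \<in> closed_segment a b"
    then have xS: "x \<in> S" using seg by auto
    show "(g has_derivative blinfun_apply (f' x - f' c)) (at x within closed_segment a b)"
      unfolding g_def blinfun.diff_left
      by (intro has_derivative_diff has_derivative_at_withinI[OF d[OF xS]] 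
          bounded_linear_imp_has_derivative blinfun.bounded_linear_right)
    obtain u where u: "0 \<le> u" "u \<le> 1" "x = (1 - u) *\<^sub>R a + u *\<^sub>R b"
      using x by (auto simp: closed_segment_def)
    have "x - c = (1 - u) *\<^sub>R (a - c) + u *\<^sub>R (b - c)" by (simp add: u algebra_simps)
    then have "norm (x - c) \<le> (1 - u) * norm (a - c) + u * norm (b - c)"
      using norm_triangle_ineq[of "(1 - u) *\<^sub>R (a - c)" "u *\<^sub>R (b - c)"] u by simp
    also have "\<dots> \<le> 1 * norm (a - c) + 1 * norm (b - c)"
      using u by (intro add_mono mult_right_mono) auto
    finally have "K * norm (x - c) \<le> K * (norm (a - c) + norm (b - c))"
      using K by (intro mult_left_mono) auto
    then show "onorm (blinfun_apply (f' x - f' c)) \<le> K * (norm (a - c) + norm (b - c))"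
      using L[OF xS abc(3)] by (simp add: norm_blinfun.rep_eq[symmetric])
  qed auto
  then show ?thesis by (simp add: g_def blinfun.diff_right algebra_simps)
qed

definition C11 :: "('a::real_normed_vector \<Rightarrow> 'b::real_normed_vector) \<Rightarrow> ('a \<Rightarrow> 'a \<Rightarrow>\<^sub>L 'b) \<Rightarrow> real \<Rightarrow> bool" where
  "C11 f f' K \<longleftrightarrow> 0 \<le> K \<and> (\<forall>x. (f has_derivative blinfun_apply (f' x)) (at x)) \<and>
     (\<forall>x. norm (f' x) \<le> K) \<and> (\<forall>x y. norm (f' x - f' y) \<le> K * norm (x - y))"

lemma C11D:
  assumes "C11 f f' K"
  shows "0 \<le> K" "(f has_derivative blinfun_apply (f' x)) (at x)"
     "norm (f' x) \<le> K" "norm (f' x - f' y) \<le> K * norm (x - y)"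
  using assms by (auto simp: C11_def)

lemma bounded_derivative_lipschitz:
  fixes f :: "'a::real_normed_vector \<Rightarrow> 'b::real_normed_vector"
  assumes "\<And>x. (f has_derivative blinfun_apply (f' x)) (at x)" "\<And>x. norm (f' x) \<le> K"
  shows "norm (f x - f y) \<le> K * norm (x - y)"
  using assms by (intro differentiable_bound[of UNIV f "\<lambda>x. blinfun_apply (f' x)"])
    (auto simp: norm_blinfun.rep_eq[symmetric])

lemma C11_lipschitz: "C11 f f' K \<Longrightarrow> norm (f x - f y) \<le> K * norm (x - y)"
  by (rule bounded_derivative_lipschitz) (auto simp: C11_def)

lemma C11_taylor:
  assumes "C11 f f' K"
  shows "norm (f (x + h) - f x - f' x h) \<le> K * norm h ^ 2"
  using strict_taylor[of UNIV f f' K x "x + h" x] C11D[OF assms]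
  by (simp add: power2_eq_square mult_ac)

lemma has_derivative_shift:
  assumes "(f has_derivative f') (at (x + h))"
  shows "((\<lambda>x. f (x + h)) has_derivative f') (at x)"
proof -
  have "((\<lambda>x. x + h) has_derivative (\<lambda>x. x)) (at x)" by (auto intro!: derivative_eq_intros)
  from has_derivative_compose[OF this assms] show ?thesis .
qed

text \<open>The map \<open>u \<mapsto> f (u + k) - f u\<close> has derivative \<open>f' (u + k) - f' u\<close>, which is \<open>f'' x k\<close> up to
  a quadratic error.\<close>

lemma second_difference_quotient:
  fixes f :: "'a::real_normed_vector \<Rightarrow> 'b::real_normed_vector"
  assumes d: "\<And>y. y \<in> ball x r \<Longrightarrow> (f has_derivative blinfun_apply (f' y)) (at y)"
    and d': "\<And>y. y \<in> ball x r \<Longrightarrow> (f' has_derivative blinfun_apply (f'' y)) (at y)"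
    and L: "\<And>y z. y \<in> ball x r \<Longrightarrow> z \<in> ball x r \<Longrightarrow> norm (f'' y - f'' z) \<le> K * norm (y - z)"
    and K: "0 \<le> K" and small: "norm h + norm k < r"
  shows "norm (f (x + h + k) - f (x + h) - f (x + k) + f x - f'' x k h)
     \<le> K * (2 * norm h + norm k) * norm k * norm h"
proof -
  define g where "g u = f (u + k) - f u - f'' x k u" for u
  have inb: "u \<in> ball x r" "u + k \<in> ball x r" "norm (u - x) \<le> norm h"
    if useg: "u \<in> closed_segment x (x + h)" for u
  proof -
    obtain t where t: "0 \<le> t" "t \<le> 1" "u = (1 - t) *\<^sub>R x + t *\<^sub>R (x + h)"
      using useg unfolding in_segment(1) by blast
    have u: "u - x = t *\<^sub>R h" unfolding t(3) by (simp add: algebra_simps)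
    have th: "t * norm h \<le> 1 * norm h" using t by (intro mult_right_mono) auto
    then show n: "norm (u - x) \<le> norm h" using u t by simp
    then have "dist x u \<le> norm h" by (simp add: dist_norm norm_minus_commute)
    moreover have "dist x (u + k) \<le> norm h + norm k"
      using norm_triangle_ineq[of "u - x" k] n by (simp add: dist_norm norm_minus_commute algebra_simps)
    ultimately show "u \<in> ball x r" "u + k \<in> ball x r" using small norm_ge_zero[of k] by (auto simp del: norm_ge_zero)
  qed
  have r: "0 < r" using small by (smt (verit) norm_ge_zero)
  have "norm (g (x + h) - g x) \<le> (K * (2 * norm h + norm k) * norm k) * norm (x + h - x)"
  proof (rule differentiable_bound[of "closed_segment x (x + h)" g "\<lambda>u. blinfun_apply (f' (u + k) - f' u - f'' x k)"])
    fix u assume u: "u \<in> closed_segment x (x + h)"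
    show "(g has_derivative blinfun_apply (f' (u + k) - f' u - f'' x k)) (at u within closed_segment x (x + h))"
      unfolding g_def blinfun.diff_left
      by (intro has_derivative_diff has_derivative_at_withinI[OF has_derivative_shift[OF d[OF inb(2)[OF u]]]]
          has_derivative_at_withinI[OF d[OF inb(1)[OF u]]] bounded_linear_imp_has_derivative blinfun.bounded_linear_right)
    have "norm (f' (u + k) - f' u - f'' x (u + k - u)) \<le> K * (norm (u - x) + norm (u + k - x)) * norm (u + k - u)"
      using inb[OF u] r K by (intro strict_taylor[of "ball x r" f' f'' K] d' L) auto
    also have "\<dots> \<le> K * (2 * norm h + norm k) * norm k"
    proof -
      have "norm (u + k - x) \<le> norm h + norm k"
        using norm_triangle_ineq[of "u - x" k] inb(3)[OF u] by (simp add: algebra_simps)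
      then have "norm (u - x) + norm (u + k - x) \<le> 2 * norm h + norm k" using inb(3)[OF u] by simp
      then show ?thesis using K by (simp add: mult_left_mono mult_right_mono)
    qed
    finally show "onorm (blinfun_apply (f' (u + k) - f' u - f'' x k)) \<le> K * (2 * norm h + norm k) * norm k"
      by (simp add: norm_blinfun.rep_eq[symmetric])
  qed auto
  then show ?thesis by (simp add: g_def blinfun.add_right algebra_simps)
qed

text \<open>The second difference of \<open>f\<close> is symmetric in its two increments and approximates both
  \<open>f'' x k h\<close> and \<open>f'' x h k\<close>. Scaling the increments by \<open>s\<close> leaves an error of order \<open>s ^ 3\<close>
  against a main term of order \<open>s\<^sup>2\<close>.\<close>

lemma second_derivative_symmetric:
  fixes f :: "'a::real_normed_vector \<Rightarrow> 'b::real_normed_vector"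
  assumes r: "0 < r"
    and d: "\<And>y. y \<in> ball x r \<Longrightarrow> (f has_derivative blinfun_apply (f' y)) (at y)"
    and d': "\<And>y. y \<in> ball x r \<Longrightarrow> (f' has_derivative blinfun_apply (f'' y)) (at y)"
    and L: "\<And>y z. y \<in> ball x r \<Longrightarrow> z \<in> ball x r \<Longrightarrow> norm (f'' y - f'' z) \<le> K * norm (y - z)"
    and K: "0 \<le> K"
  shows "f'' x h k = f'' x k h"
proof -
  define c where "c = K * (3 * norm h + 3 * norm k) * norm h * norm k"
  define D where "D = norm (f'' x k h - f'' x h k)"
  have c0: "0 \<le> c" using K by (simp add: c_def)
  have est: "D \<le> c * s" if s: "0 < s" "s * (norm h + norm k) < r" for s
  proof -
    let ?q = "f (x + s *\<^sub>R h + s *\<^sub>R k) - f (x + s *\<^sub>R h) - f (x + s *\<^sub>R k) + f x"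
    have sm: "norm (s *\<^sub>R h) + norm (s *\<^sub>R k) < r" "norm (s *\<^sub>R k) + norm (s *\<^sub>R h) < r"
      using s by (auto simp: algebra_simps)
    have 1: "norm (?q - f'' x (s *\<^sub>R k) (s *\<^sub>R h)) \<le> K * (2 * norm (s *\<^sub>R h) + norm (s *\<^sub>R k)) * norm (s *\<^sub>R k) * norm (s *\<^sub>R h)"
      by (rule second_difference_quotient[OF d d' L K sm(1)])
    have 2: "norm (?q - f'' x (s *\<^sub>R h) (s *\<^sub>R k)) \<le> K * (2 * norm (s *\<^sub>R k) + norm (s *\<^sub>R h)) * norm (s *\<^sub>R h) * norm (s *\<^sub>R k)"
      using second_difference_quotient[OF d d' L K sm(2)] by (simp add: algebra_simps)
    have "s^2 * D = norm (f'' x (s *\<^sub>R k) (s *\<^sub>R h) - f'' x (s *\<^sub>R h) (s *\<^sub>R k))"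
      using s by (simp add: D_def blinfun.scaleR_left blinfun.scaleR_right scaleR_diff_right[symmetric] power2_eq_square)
    also have "\<dots> \<le> norm (?q - f'' x (s *\<^sub>R h) (s *\<^sub>R k)) + norm (?q - f'' x (s *\<^sub>R k) (s *\<^sub>R h))"
      using norm_triangle_ineq4[of "?q - f'' x (s *\<^sub>R h) (s *\<^sub>R k)" "?q - f'' x (s *\<^sub>R k) (s *\<^sub>R h)"] by simp
    also have "\<dots> \<le> s^2 * (c * s)"
      using add_mono[OF 1 2] s by (simp add: c_def algebra_simps power2_eq_square)
    finally show ?thesis using s by simp
  qed
  have "D \<le> 0 + e" if e: "0 < e" for e
  proof -
    define s where "s = min (e / (c + 1)) (r / (2 * (norm h + norm k + 1)))"
    have nn: "0 < norm h + norm k + 1" by (smt (verit) norm_ge_zero)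
    have s0: "0 < s" using e c0 r nn by (simp add: s_def)
    have "s * (norm h + norm k) \<le> r / (2 * (norm h + norm k + 1)) * (norm h + norm k + 1)"
      using s0 nn r by (intro mult_mono) (auto simp: s_def)
    also have "\<dots> = r / 2" using nn by (simp add: field_simps)
    finally have "s * (norm h + norm k) < r" using r by simp
    then have "D \<le> c * s" using est s0 by blast
    also have "\<dots> \<le> (c + 1) * (e / (c + 1))" using s0 c0 e by (intro mult_mono) (auto simp: s_def)
    also have "\<dots> = e" using c0 by simp
    finally show ?thesis by simp
  qed
  then have "D \<le> 0" by (rule field_le_epsilon)
  then show ?thesis by (simp add: D_def)
qed

text \<open>Exchanging \<open>h\<close> for \<open>k\<close> costs a Lipschitz bound; for a fixed increment \<open>k\<close> the map
  \<open>x \<mapsto> f (x + k) - f x\<close> has a derivative of size \<open>K * norm k\<close>.\<close>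

lemma C11_second_difference:
  assumes "C11 f f' K"
  shows "norm (f (a + h) - f a - (f (b + k) - f b)) \<le> K * norm (h - k) + K * norm k * norm (a - b)"
proof -
  note C = C11D[OF assms]
  have 1: "norm (f (a + h) - f (a + k)) \<le> K * norm (h - k)"
    using C11_lipschitz[OF assms, of "a + h" "a + k"] by simp
  have 2: "norm ((f (a + k) - f a) - (f (b + k) - f b)) \<le> K * norm k * norm (a - b)"
  proof (rule bounded_derivative_lipschitz[where f = "\<lambda>x. f (x + k) - f x" and f' = "\<lambda>x. f' (x + k) - f' x"])
    show "((\<lambda>x. f (x + k) - f x) has_derivative blinfun_apply (f' (x + k) - f' x)) (at x)" for x
      unfolding blinfun.diff_left by (intro has_derivative_diff has_derivative_shift C)
    show "norm (f' (x + k) - f' x) \<le> K * norm k" for x using C(4)[of "x + k" x] by simp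
  qed
  have "f (a + h) - f a - (f (b + k) - f b) = (f (a + h) - f (a + k)) + ((f (a + k) - f a) - (f (b + k) - f b))"
    by simp
  then show ?thesis using norm_triangle_ineq 1 2 by (smt (verit))
qed

text \<open>By symmetry of the second derivative, the derivative of the Taylor remainder in its base
  point is the Taylor remainder of \<open>f'\<close>, which is quadratic in the increment. This is where three
  bounded derivatives of the vector field enter the comparison of two solutions.\<close>

lemma C11_taylor_difference:
  assumes f: "C11 f f' K" and f': "C11 f' f'' K"
  shows "norm ((f (a + h) - f a - f' a h) - (f (b + k) - f b - f' b k))
     \<le> K * norm k ^ 2 * norm (a - b) + K * (norm h + norm k) * norm (h - k)"
proof -
  note C = C11D[OF f] and C' = C11D[OF f']
  have sym: "f'' x v w = f'' x w v" for x v w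
    by (rule second_derivative_symmetric[of 1 x f f' f'' K]) (auto intro: C C')
  have 1: "norm ((f (a + k) - f a - f' a k) - (f (b + k) - f b - f' b k)) \<le> (K * norm k ^ 2) * norm (a - b)"
  proof (rule bounded_derivative_lipschitz[where f = "\<lambda>x. f (x + k) - f x - f' x k"
        and f' = "\<lambda>x. f' (x + k) - f' x - f'' x k"])
    show "norm (f' (x + k) - f' x - f'' x k) \<le> K * (norm k)\<^sup>2" for x
      by (rule C11_taylor[OF f'])
    show "((\<lambda>x. f (x + k) - f x - f' x k) has_derivative blinfun_apply (f' (x + k) - f' x - f'' x k)) (at x)" for x
    proof -
      have "((\<lambda>x. f' x k) has_derivative (\<lambda>v. f'' x v k)) (at x)"
        using bounded_linear.has_derivative[OF blinfun.bounded_linear_left C'(2)] .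
      then have "((\<lambda>x. f' x k) has_derivative f'' x k) (at x)" by (simp add: sym[of x _ k])
      then show ?thesis unfolding blinfun.diff_left
        by (intro has_derivative_diff has_derivative_shift C)
    qed
  qed
  have 2: "norm (f (a + h) - f (a + k) - f' a (a + h - (a + k))) \<le> K * (norm (a + k - a) + norm (a + h - a)) * norm (a + h - (a + k))"
    by (rule strict_taylor[of UNIV]) (auto intro: C)
  have "(f (a + h) - f a - f' a h) - (f (b + k) - f b - f' b k)
     = ((f (a + k) - f a - f' a k) - (f (b + k) - f b - f' b k)) + (f (a + h) - f (a + k) - f' a (a + h - (a + k)))"
    by (simp add: blinfun.diff_right)
  then have "norm ((f (a + h) - f a - f' a h) - (f (b + k) - f b - f' b k))
     \<le> norm ((f (a + k) - f a - f' a k) - (f (b + k) - f b - f' b k)) + norm (f (a + h) - f (a + k) - f' a (a + h - (a + k)))"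
    using norm_triangle_ineq by metis
  then show ?thesis using 1 2 by (simp add: algebra_simps)
qed

section \<open>Euler steps of a rough differential equation\<close>

lemma norm_compose_le:
  "norm A \<le> a \<Longrightarrow> norm B \<le> b \<Longrightarrow> norm (A o\<^sub>L B) \<le> a * b"
  by (rule order_trans[OF norm_blinfun_compose]) (rule mult_mono, auto intro: order_trans[OF norm_ge_zero])

lemma norm_apply_le:
  "norm A \<le> a \<Longrightarrow> norm x \<le> b \<Longrightarrow> norm (blinfun_apply A x) \<le> a * b"
  by (rule order_trans[OF norm_blinfun]) (rule mult_mono, auto intro: order_trans[OF norm_ge_zero])

text \<open>One constant \<open>K\<close> dominates the driver, the vector fields and the lifting operator, so that
  all later constants are polynomials in \<open>K\<close>. The operator \<open>lft B\<close> is the linear map on the tensor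
  product induced by the bilinear map \<open>B\<close>.\<close>

locale rough_equation =
  fixes tens :: "'v::real_normed_vector \<Rightarrow> 'v \<Rightarrow> 'z::banach"
    and \<alpha> T K :: real
    and X :: "real \<Rightarrow> 'v" and XX :: "real \<Rightarrow> real \<Rightarrow> 'z"
    and f0 :: "'w::banach \<Rightarrow> 'w" and f :: "'w \<Rightarrow> 'v \<Rightarrow>\<^sub>L 'w"
    and Df :: "'w \<Rightarrow> 'w \<Rightarrow>\<^sub>L 'v \<Rightarrow>\<^sub>L 'w" and D2f :: "'w \<Rightarrow> 'w \<Rightarrow>\<^sub>L 'w \<Rightarrow>\<^sub>L 'v \<Rightarrow>\<^sub>L 'w"
    and lft :: "('v \<Rightarrow>\<^sub>L 'v \<Rightarrow>\<^sub>L 'w) \<Rightarrow> 'z \<Rightarrow>\<^sub>L 'w"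
  assumes \<alpha>: "1/3 < \<alpha>" "\<alpha> \<le> 1/2" and T: "0 < T" and K: "1 \<le> K"
    and X_le: "\<And>s t. 0 \<le> s \<Longrightarrow> s \<le> t \<Longrightarrow> t \<le> T \<Longrightarrow> norm (X t - X s) \<le> K * (t - s) powr \<alpha>"
    and XX_le: "\<And>s t. 0 \<le> s \<Longrightarrow> s \<le> t \<Longrightarrow> t \<le> T \<Longrightarrow> norm (XX s t) \<le> K * ((t - s) powr \<alpha>)\<^sup>2"
    and chen: "\<And>s u t. 0 \<le> s \<Longrightarrow> s \<le> u \<Longrightarrow> u \<le> t \<Longrightarrow> t \<le> T \<Longrightarrow>
        XX s t - XX s u - XX u t = tens (X u - X s) (X t - X u)"
    and lft_tens: "\<And>B v w. lft B (tens v w) = B v w"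
    and lft_diff: "\<And>B C. lft (B - C) = lft B - lft C"
    and lft_le: "\<And>B. norm (lft B) \<le> K * norm B"
    and f_le: "\<And>y. norm (f y) \<le> K"
    and f_C11: "C11 f Df K" and Df_C11: "C11 Df D2f K"
    and f0_lip: "\<And>y z. norm (f0 y - f0 z) \<le> K * norm (y - z)"
begin

definition level2 :: "'w \<Rightarrow> 'v \<Rightarrow>\<^sub>L 'v \<Rightarrow>\<^sub>L 'w" where
  "level2 y = Df y o\<^sub>L f y"

text \<open>The second order Euler step of the equation without its drift.\<close>

definition incr :: "'w \<Rightarrow> real \<Rightarrow> real \<Rightarrow> 'w" where
  "incr y s t = f y (X t - X s) + lft (level2 y) (XX s t)"

lemma K0: "0 \<le> K" "0 < K" using K by auto

lemma powr3: "0 \<le> x \<Longrightarrow> x powr (3 * \<alpha>) = (x powr \<alpha>) ^ 3"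
  by (simp add: powr_powr[symmetric] powr_realpow' mult.commute flip: powr_numeral)

lemma le_powr2: "0 \<le> x \<Longrightarrow> x \<le> 1 \<Longrightarrow> x \<le> (x powr \<alpha>)\<^sup>2"
proof -
  assume x: "0 \<le> x" "x \<le> 1"
  have "x powr 1 \<le> x powr (\<alpha> * 2)"
    by (rule powr_mono') (use x \<alpha> in auto)
  then show "x \<le> (x powr \<alpha>)\<^sup>2" using x by (simp add: powr_powr[symmetric])
qed

lemma powr_le1: "0 \<le> x \<Longrightarrow> x \<le> 1 \<Longrightarrow> x powr \<alpha> \<le> 1"
  using \<alpha> by (simp add: powr_le1)

lemma level2_le: "norm (level2 y) \<le> K\<^sup>2"
proof -
  have "norm (level2 y) \<le> norm (Df y) * norm (f y)" unfolding level2_def by (rule norm_blinfun_compose)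
  also have "\<dots> \<le> K * K" using C11D(3)[OF f_C11] f_le K0 by (intro mult_mono) auto
  finally show ?thesis by (simp add: power2_eq_square)
qed

lemma f_lip: "norm (f y - f z) \<le> K * norm (y - z)" by (rule C11_lipschitz[OF f_C11])
lemma Df_le: "norm (Df y) \<le> K" by (rule C11D(3)[OF f_C11])
lemma Df_lip: "norm (Df y - Df z) \<le> K * norm (y - z)" by (rule C11D(4)[OF f_C11])

lemmas compose_diffs = bounded_bilinear.diff_left[OF bounded_bilinear_blinfun_compose]
  bounded_bilinear.diff_right[OF bounded_bilinear_blinfun_compose]

lemma compose_diff: "level2 y - level2 z = ((Df y - Df z) o\<^sub>L f y) + (Df z o\<^sub>L (f y - f z))"
  unfolding level2_def by (simp add: compose_diffs)

lemma level2_lip: "norm (level2 y - level2 z) \<le> 2 * K\<^sup>2 * norm (y - z)"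
proof -
  have "norm (level2 y - level2 z) \<le> norm ((Df y - Df z) o\<^sub>L f y) + norm (Df z o\<^sub>L (f y - f z))"
    unfolding compose_diff by (rule norm_triangle_ineq)
  also have "\<dots> \<le> (K * norm (y - z)) * K + K * (K * norm (y - z))"
    by (intro add_mono norm_compose_le f_le Df_le Df_lip f_lip)
  finally show ?thesis by (simp add: power2_eq_square algebra_simps)
qed

lemma lft_apply_le: "norm B \<le> b \<Longrightarrow> norm x \<le> c \<Longrightarrow> norm (lft B x) \<le> K * b * c"
  by (rule norm_apply_le[OF order_trans[OF lft_le]]) (auto intro: mult_left_mono simp: K0)

lemma incr_refl: "0 \<le> s \<Longrightarrow> s \<le> T \<Longrightarrow> incr y s s = 0"
  using XX_le[of s s] by (simp add: incr_def)

text \<open>The amount by which the Euler steps fail to be additive when the step from \<open>p\<close> to \<open>r\<close> is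
  interrupted at \<open>q\<close> and resumed from the point \<open>b\<close>.\<close>

definition defect :: "'w \<Rightarrow> 'w \<Rightarrow> real \<Rightarrow> real \<Rightarrow> real \<Rightarrow> 'w" where
  "defect a b p q r = incr a p q + incr b q r - incr a p r"

text \<open>Chen's relation cancels the product of the two increments against the Gubinelli derivative
  of \<open>f\<close>. What remains is small when \<open>b\<close> is close to the first order expansion from \<open>a\<close>.\<close>

lemma defect_eq:
  assumes "0 \<le> p" "p \<le> q" "q \<le> r" "r \<le> T"
  shows "defect a b p q r = (f b - f a - Df a (f a (X q - X p))) (X r - X q) + lft (level2 b - level2 a) (XX q r)"
proof -
  have c: "XX p r = XX p q + XX q r + tens (X q - X p) (X r - X q)"
    using chen[OF assms] by (simp add: algebra_simps)
  show ?thesis unfolding defect_def incr_def c lft_diff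
    by (simp add: blinfun.add_right blinfun.diff_left blinfun.diff_right lft_tens level2_def)
qed

lemma increments_le:
  assumes "0 \<le> p" "p \<le> q" "q \<le> r" "r \<le> T"
  shows "norm (X q - X p) \<le> K * (r - p) powr \<alpha>" "norm (X r - X q) \<le> K * (r - p) powr \<alpha>"
    "norm (XX q r) \<le> K * ((r - p) powr \<alpha>)\<^sup>2" "norm (XX p q) \<le> K * ((r - p) powr \<alpha>)\<^sup>2"
proof -
  have m: "(q - p) powr \<alpha> \<le> (r - p) powr \<alpha>" "(r - q) powr \<alpha> \<le> (r - p) powr \<alpha>"
    using assms \<alpha> by (auto intro!: powr_mono2)
  then have m2: "((q - p) powr \<alpha>)\<^sup>2 \<le> ((r - p) powr \<alpha>)\<^sup>2" "((r - q) powr \<alpha>)\<^sup>2 \<le> ((r - p) powr \<alpha>)\<^sup>2"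
    by (auto intro!: power_mono)
  note k = mult_left_mono[OF _ K0(1)]
  show "norm (X q - X p) \<le> K * (r - p) powr \<alpha>" using X_le[of p q] k[OF m(1)] assms by linarith
  show "norm (X r - X q) \<le> K * (r - p) powr \<alpha>" using X_le[of q r] k[OF m(2)] assms by linarith
  show "norm (XX q r) \<le> K * ((r - p) powr \<alpha>)\<^sup>2" using XX_le[of q r] k[OF m2(2)] assms by linarith
  show "norm (XX p q) \<le> K * ((r - p) powr \<alpha>)\<^sup>2" using XX_le[of p q] k[OF m2(1)] assms by linarith
qed

text \<open>The bound is linear in the remainder \<open>\<rho>\<close>: \<open>f b\<close> is first compared with \<open>f\<close> at the point
  predicted by the first order expansion, and only there is a Taylor expansion used, so that no
  square of \<open>b - a\<close> appears. The linearity is what later allows drifts of linear growth.\<close>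

lemma defect_le:
  assumes pqr: "0 \<le> p" "p \<le> q" "q \<le> r" "r \<le> T" and short: "r - p \<le> 1"
    and R: "norm (b - a - f a (X q - X p)) \<le> \<rho> * ((r - p) powr \<alpha>)\<^sup>2" and \<rho>: "0 \<le> \<rho>"
  shows "norm (defect a b p q r) \<le> 3 * K ^ 6 * (1 + \<rho>) * ((r - p) powr \<alpha>) ^ 3"
proof -
  define w where "w = (r - p) powr \<alpha>"
  have w: "0 \<le> w" "w \<le> 1" using short pqr powr_le1 by (auto simp: w_def)
  note inc = increments_le[OF pqr, folded w_def]
  note R = R[folded w_def]
  have fx: "norm (f a (X q - X p)) \<le> K\<^sup>2 * w"
    using norm_apply_le[OF f_le inc(1), of a] by (simp add: power2_eq_square mult_ac)
  have "f b - f a - Df a (f a (X q - X p)) = (f b - f (a + f a (X q - X p)))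
      + (f (a + f a (X q - X p)) - f a - Df a (f a (X q - X p)))" by simp
  then have "norm (f b - f a - Df a (f a (X q - X p))) \<le> norm (f b - f (a + f a (X q - X p)))
      + norm (f (a + f a (X q - X p)) - f a - Df a (f a (X q - X p)))" by (metis norm_triangle_ineq)
  also have "\<dots> \<le> K * (\<rho> * w\<^sup>2) + K * (K\<^sup>2 * w)\<^sup>2"
  proof (intro add_mono)
    have "norm (f b - f (a + f a (X q - X p))) \<le> K * norm (b - a - f a (X q - X p))"
      using f_lip[of b "a + f a (X q - X p)"] by (simp add: algebra_simps)
    also have "\<dots> \<le> K * (\<rho> * w\<^sup>2)" using R K0 by (intro mult_left_mono) auto
    finally show "norm (f b - f (a + f a (X q - X p))) \<le> K * (\<rho> * w\<^sup>2)" .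
    have "norm (f (a + f a (X q - X p)) - f a - Df a (f a (X q - X p))) \<le> K * (norm (f a (X q - X p)))\<^sup>2"
      by (rule C11_taylor[OF f_C11])
    also have "\<dots> \<le> K * (K\<^sup>2 * w)\<^sup>2" using fx K0 by (intro mult_left_mono power_mono) auto
    finally show "norm (f (a + f a (X q - X p)) - f a - Df a (f a (X q - X p))) \<le> K * (K\<^sup>2 * w)\<^sup>2" .
  qed
  finally have 1: "norm (f b - f a - Df a (f a (X q - X p))) \<le> (K * \<rho> + K ^ 5) * w\<^sup>2"
    by (simp add: algebra_simps eval_nat_numeral)
  have "norm (b - a) \<le> norm (b - a - f a (X q - X p)) + norm (f a (X q - X p))"
    using norm_triangle_ineq[of "b - a - f a (X q - X p)" "f a (X q - X p)"] by simp
  also have "\<dots> \<le> \<rho> * w + K\<^sup>2 * w"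
    using R fx mult_left_mono[OF mult_left_mono[OF w(2) w(1)] \<rho>] by (simp add: power2_eq_square)
  finally have ba: "norm (b - a) \<le> (\<rho> + K\<^sup>2) * w" by (simp add: algebra_simps)
  have 2: "norm (level2 b - level2 a) \<le> 2 * K\<^sup>2 * ((\<rho> + K\<^sup>2) * w)"
    using level2_lip[of b a] mult_left_mono[OF ba, of "2 * K\<^sup>2"] by simp
  have "norm (defect a b p q r) \<le> (K * \<rho> + K ^ 5) * w\<^sup>2 * (K * w) + K * (2 * K\<^sup>2 * ((\<rho> + K\<^sup>2) * w)) * (K * w\<^sup>2)"
    unfolding defect_eq[OF pqr]
    by (rule order_trans[OF norm_triangle_ineq add_mono[OF norm_apply_le[OF 1 inc(2)] lft_apply_le[OF 2 inc(3)]]])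
  also have "\<dots> = (K\<^sup>2 * \<rho> + 2 * K ^ 4 * \<rho> + 3 * K ^ 6) * w ^ 3"
    by (simp add: algebra_simps eval_nat_numeral)
  also have "\<dots> \<le> (K ^ 6 * \<rho> + 2 * K ^ 6 * \<rho> + 3 * K ^ 6) * w ^ 3"
    using K \<rho> w by (intro mult_right_mono add_mono power_increasing mult_left_mono) auto
  also have "\<dots> = 3 * K ^ 6 * (1 + \<rho>) * w ^ 3" by (simp add: algebra_simps)
  finally show ?thesis unfolding w_def .
qed

text \<open>Each term of the defect is a product of quantities of total order three in
  \<open>(r - p) powr \<alpha>\<close>. Exchanging one path for another replaces one factor by its difference, whence
  the same order with the additional factor \<open>\<sigma> + \<delta>\<close>.\<close>

lemma defect_difference_le:
  assumes pqr: "0 \<le> p" "p \<le> q" "q \<le> r" "r \<le> T" and short: "r - p \<le> 1"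
    and R: "norm (b - a - f a (X q - X p)) \<le> \<rho> * ((r - p) powr \<alpha>)\<^sup>2"
    and R': "norm (b' - a' - f a' (X q - X p)) \<le> \<rho> * ((r - p) powr \<alpha>)\<^sup>2"
    and RR: "norm ((b - a - f a (X q - X p)) - (b' - a' - f a' (X q - X p))) \<le> \<sigma> * ((r - p) powr \<alpha>)\<^sup>2"
    and aa: "norm (a - a') \<le> \<delta>"
    and nn: "0 \<le> \<rho>" "0 \<le> \<sigma>" and m: "m = \<rho> + K\<^sup>2"
  shows "norm (defect a b p q r - defect a' b' p q r) \<le> 14 * m ^ 6 * (\<sigma> + \<delta>) * ((r - p) powr \<alpha>) ^ 3"
proof -
  define w where "w = (r - p) powr \<alpha>"
  define e where "e = \<sigma> + \<delta>"
  define x where "x = X q - X p"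
  define S where "S = b - a - f a x"
  define S' where "S' = b' - a' - f a' x"
  have w: "0 \<le> w" "w \<le> 1" using short pqr powr_le1 by (auto simp: w_def)
  have ww: "w\<^sup>2 \<le> w" using w by (simp add: power2_eq_square mult_left_le)
  have \<delta>: "0 \<le> \<delta>" using aa norm_ge_zero by (rule order_trans[rotated])
  have K2: "K \<le> K\<^sup>2" using K self_le_power[of K 2] by simp
  have mK: "K \<le> m" "K\<^sup>2 \<le> m" "\<rho> \<le> m" "1 \<le> m" using K2 K nn by (auto simp: m)
  have m0: "0 \<le> m" using mK by simp
  have e: "\<sigma> \<le> e" "\<delta> \<le> e" "0 \<le> e" using nn \<delta> by (auto simp: e_def)
  note inc = increments_le[OF pqr, folded w_def x_def]
  note R = R[folded w_def x_def, folded S_def] and R' = R'[folded w_def x_def, folded S'_def]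
    and RR = RR[folded w_def x_def, folded S_def S'_def]
  have km: "norm u \<le> K * c \<Longrightarrow> 0 \<le> c \<Longrightarrow> norm u \<le> m * c" for u :: "'q::real_normed_vector" and c
    using mK by (meson mult_right_mono order_trans)
  have aae: "norm (a - a') \<le> e" using aa e by linarith
  have fle: "norm (f y) \<le> m" for y using f_le mK order_trans by blast
  have Dfle: "norm (Df y) \<le> m" for y using Df_le mK order_trans by blast
  have lipm: "norm (f y - f z) \<le> m * c" "norm (Df y - Df z) \<le> m * c" if "norm (y - z) \<le> c" for y z c
  proof -
    have "K * norm (y - z) \<le> m * c" using that mK K0 by (intro mult_mono) auto
    then show "norm (f y - f z) \<le> m * c" "norm (Df y - Df z) \<le> m * c"
      using f_lip[of y z] Df_lip[of y z] by linarith+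
  qed
  have xw: "norm x \<le> m * w" using km[OF inc(1)] w by simp
  have fxa: "norm (f c x) \<le> K\<^sup>2 * w" for c
    using norm_apply_le[OF f_le inc(1)] by (simp add: power2_eq_square mult_ac)
  have ba: "b - a = S + f a x" "b' - a' = S' + f a' x" by (auto simp: S_def S'_def)
  have len: "norm (c + f d x) \<le> m * w" if "norm c \<le> \<rho> * w\<^sup>2" for c d
  proof -
    have "norm (c + f d x) \<le> \<rho> * w\<^sup>2 + K\<^sup>2 * w" using norm_triangle_le add_mono[OF that fxa] by blast
    also have "\<dots> \<le> \<rho> * w + K\<^sup>2 * w" using ww nn by (intro add_mono mult_left_mono) auto
    finally show ?thesis by (simp add: m algebra_simps)
  qed
  have ba_le: "norm (b - a) \<le> m * w" "norm (b' - a') \<le> m * w"  unfolding ba using len[OF R] len[OF R'] by auto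
  have "(b - a) - (b' - a') = (S - S') + (f a - f a') x" by (simp add: ba blinfun.diff_left)
  then have "norm ((b - a) - (b' - a')) \<le> \<sigma> * w\<^sup>2 + K * \<delta> * (K * w)"
    using norm_triangle_le[OF add_mono[OF RR norm_apply_le[OF order_trans[OF f_lip mult_left_mono[OF aa K0(1)]] inc(1)]]]
    by simp
  also have "\<dots> \<le> m * \<sigma> * w + m * \<delta> * w"
  proof (intro add_mono)
    have "\<sigma> * w\<^sup>2 \<le> \<sigma> * w" using ww nn by (intro mult_left_mono) auto
    also have "\<dots> \<le> m * (\<sigma> * w)" using mK nn w by (intro mult_right_mono[of 1 m, simplified]) auto
    finally show "\<sigma> * w\<^sup>2 \<le> m * \<sigma> * w" by simp
    have "K * \<delta> * (K * w) = K\<^sup>2 * (\<delta> * w)" by (simp add: power2_eq_square)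
    also have "\<dots> \<le> m * (\<delta> * w)" using mK \<delta> w by (intro mult_right_mono) auto
    finally show "K * \<delta> * (K * w) \<le> m * \<delta> * w" by simp
  qed
  finally have dba: "norm ((b - a) - (b' - a')) \<le> m * e * w" by (simp add: e_def algebra_simps)
  have "b - b' = (a - a') + ((b - a) - (b' - a'))" by simp
  then have "norm (b - b') \<le> e + m * e * w" using norm_triangle_le[OF add_mono[OF aae dba]] by simp
  also have "\<dots> \<le> m * e + m * e * 1"
    using mK e w m0 by (intro add_mono mult_left_mono mult_right_mono[of 1 m, simplified]) auto
  finally have bb: "norm (b - b') \<le> 2 * m * e" by (simp add: mult_ac)
  have m1: "m ^ i \<le> m ^ j" if "i \<le> j" for i j using mK that by (simp add: power_increasing)
  \<comment> \<open>The first level of the defect: a Taylor remainder at the base point plus the linear image of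
    the remainder \<open>S\<close>, each compared between the two paths.\<close>
  have f_G: "f b - f a - Df a (f a x) = (f (a + (b - a)) - f a - Df a (b - a)) + Df a S"
    "f b' - f a' - Df a' (f a' x) = (f (a' + (b' - a')) - f a' - Df a' (b' - a')) + Df a' S'"
    using arg_cong[OF ba(1), of "blinfun_apply (Df a)"] arg_cong[OF ba(2), of "blinfun_apply (Df a')"]
    by (simp_all add: blinfun.add_right)
  have G: "norm ((f (a + (b - a)) - f a - Df a (b - a)) - (f (a' + (b' - a')) - f a' - Df a' (b' - a')))
      \<le> m * (m * w)\<^sup>2 * e + m * (m * w + m * w) * (m * e * w)"
  proof (rule order_trans[OF C11_taylor_difference[OF f_C11 Df_C11]], intro add_mono mult_mono power_mono)
  qed (use mK m0 K0 w e aae ba_le dba in \<open>auto intro: add_mono\<close>)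
  have "Df a S - Df a' S' = (Df a - Df a') S + Df a' (S - S')"
    by (simp add: blinfun.diff_left blinfun.diff_right)
  then have DS: "norm (Df a S - Df a' S') \<le> m * e * (m * w\<^sup>2) + m * (e * w\<^sup>2)"
    using mK e w nn
    by (auto intro!: norm_triangle_le add_mono norm_apply_le lipm aae Dfle order_trans[OF R] order_trans[OF RR] mult_right_mono)
  have 1: "norm ((f b - f a - Df a (f a x)) - (f b' - f a' - Df a' (f a' x))) \<le> 5 * m ^ 3 * e * w\<^sup>2"
  proof -
    have "norm ((f b - f a - Df a (f a x)) - (f b' - f a' - Df a' (f a' x))) \<le>
       (m * (m * w)\<^sup>2 * e + m * (m * w + m * w) * (m * e * w)) + (m * e * (m * w\<^sup>2) + m * (e * w\<^sup>2))"
      unfolding f_G using norm_triangle_le[OF add_mono[OF G DS]] by (simp add: algebra_simps)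
    also have "\<dots> = (3 * m ^ 3 + m ^ 2 + m ^ 1) * (e * w\<^sup>2)" by (simp add: algebra_simps eval_nat_numeral)
    also have "\<dots> \<le> (3 * m ^ 3 + m ^ 3 + m ^ 3) * (e * w\<^sup>2)" using e w m0 by (intro mult_right_mono add_mono m1) auto
    finally show ?thesis by simp
  qed
  \<comment> \<open>The second level: the coefficient is a composition, so its second difference is split by
    the product rule into second differences of the two factors and products of first ones.\<close>
  have sd: "norm ((g b - g a) - (g b' - g a')) \<le> 2 * m ^ 2 * e * w" if "C11 g g' K" for g :: "'w \<Rightarrow> 'q::real_normed_vector" and g'
  proof -
    have "norm ((g (a + (b - a)) - g a) - (g (a' + (b' - a')) - g a')) \<le> m * (m * e * w) + m * (m * w) * e"
    proof (rule order_trans[OF C11_second_difference[OF that]], intro add_mono mult_mono)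
    qed (use mK m0 K0 w e aae ba_le dba in auto)
    then show ?thesis by (simp add: algebra_simps power2_eq_square)
  qed
  have "(level2 b - level2 a) - (level2 b' - level2 a') =
     (((Df b - Df a) - (Df b' - Df a')) o\<^sub>L f b) + ((Df b' - Df a') o\<^sub>L (f b - f b'))
     + ((Df a - Df a') o\<^sub>L (f b - f a)) + (Df a' o\<^sub>L ((f b - f a) - (f b' - f a')))"
    unfolding compose_diff by (simp add: compose_diffs)
  also have "norm \<dots> \<le> 2 * m ^ 2 * e * w * m + m * (m * w) * (m * (2 * m * e)) + m * e * (m * (m * w)) + m * (2 * m ^ 2 * e * w)"
    by (intro norm_triangle_le add_mono norm_compose_le sd[OF f_C11] sd[OF Df_C11] lipm ba_le bb aae fle Dfle)
  also have "\<dots> = (2 * m ^ 4 + 5 * m ^ 3) * (e * w)" by (simp add: algebra_simps eval_nat_numeral)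
  also have "\<dots> \<le> (2 * m ^ 4 + 5 * m ^ 4) * (e * w)" using e w m0 by (intro mult_right_mono add_mono mult_left_mono m1) auto
  finally have 2: "norm ((level2 b - level2 a) - (level2 b' - level2 a')) \<le> 7 * m ^ 4 * e * w" by simp
  have "defect a b p q r - defect a' b' p q r =
     ((f b - f a - Df a (f a x)) - (f b' - f a' - Df a' (f a' x))) (X r - X q)
     + lft ((level2 b - level2 a) - (level2 b' - level2 a')) (XX q r)"
    unfolding defect_eq[OF pqr] x_def[symmetric] lft_diff by (simp add: blinfun.diff_left)
  also have "norm \<dots> \<le> 5 * m ^ 3 * e * w\<^sup>2 * (m * w) + K * (7 * m ^ 4 * e * w) * (m * w\<^sup>2)"
    using w m0 by (intro norm_triangle_le add_mono norm_apply_le[OF 1 km[OF inc(2)]] lft_apply_le[OF 2 km[OF inc(3)]]) auto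
  also have "\<dots> \<le> 5 * m ^ 3 * e * w\<^sup>2 * (m * w) + m * (7 * m ^ 4 * e * w) * (m * w\<^sup>2)"
    using e w m0 mK by (intro add_mono mult_right_mono) auto
  also have "\<dots> = (5 * m ^ 4 + 7 * m ^ 6) * (e * w ^ 3)" by (simp add: algebra_simps eval_nat_numeral)
  also have "\<dots> \<le> (5 * m ^ 6 + 7 * m ^ 6) * (e * w ^ 3)" using e w m0 by (intro mult_right_mono add_mono mult_left_mono m1) auto
  also have "\<dots> \<le> 14 * m ^ 6 * e * w ^ 3" using e w m0 by simp
  finally show ?thesis unfolding w_def e_def .
qed

end

section \<open>Perturbed Euler schemes\<close>

context rough_equation
begin

text \<open>The Euler scheme of step size \<open>h\<close> with a prescribed drift \<open>b\<close>. The drift is left free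
  because the one step errors of any other scheme, divided by \<open>h\<close>, can be counted as drift.\<close>

definition driven :: "real \<Rightarrow> real \<Rightarrow> nat \<Rightarrow> (nat \<Rightarrow> 'w) \<Rightarrow> (nat \<Rightarrow> 'w) \<Rightarrow> bool" where
  "driven s h n y b \<longleftrightarrow> 0 < h \<and> 0 \<le> s \<and> s + real n * h \<le> T \<and>
     (\<forall>i<n. y (Suc i) = y i + h *\<^sub>R b i + incr (y i) (s + real i * h) (s + real (Suc i) * h))"

text \<open>The remainder of the increment over several steps after the accumulated drift and one long
  Euler step. It vanishes on a single cell, and its defect of additivity is that of the Euler steps
  because the accumulated drift is additive; so it can be estimated by sewing.\<close>

definition remd :: "real \<Rightarrow> real \<Rightarrow> (nat \<Rightarrow> 'w) \<Rightarrow> (nat \<Rightarrow> 'w) \<Rightarrow> nat \<Rightarrow> nat \<Rightarrow> 'w" where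
  "remd s h y b i j = y j - y i - h *\<^sub>R (\<Sum>k=i..<j. b k) - incr (y i) (s + real i * h) (s + real j * h)"

lemma drivenD:
  assumes "driven s h n y b"
  shows "0 < h" "0 \<le> s" "s + real n * h \<le> T"
    "\<And>i. i < n \<Longrightarrow> y (Suc i) = y i + h *\<^sub>R b i + incr (y i) (s + real i * h) (s + real (Suc i) * h)"
  using assms by (auto simp: driven_def)

lemma grid_points:
  assumes "driven s h n y b" "i \<le> j" "j \<le> k" "k \<le> n"
  shows "0 \<le> s + real i * h" "s + real i * h \<le> s + real j * h" "s + real j * h \<le> s + real k * h"
    "s + real k * h \<le> T" "s + real k * h - (s + real i * h) = real (k - i) * h"
proof -
  note D = drivenD[OF assms(1)]
  have "real k * h \<le> real n * h" "real i * h \<le> real j * h" "real j * h \<le> real k * h"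
    using D assms by (auto intro!: mult_right_mono)
  then show "0 \<le> s + real i * h" "s + real i * h \<le> s + real j * h" "s + real j * h \<le> s + real k * h"
    "s + real k * h \<le> T" using D(1-3) 
    by (simp_all only: add_le_cancel_left add_nonneg_nonneg mult_nonneg_nonneg of_nat_0_le_iff less_imp_le)
  show "s + real k * h - (s + real i * h) = real (k - i) * h"
    using assms by (simp add: of_nat_diff algebra_simps)
qed

lemma remd_refl: "driven s h n y b \<Longrightarrow> i \<le> n \<Longrightarrow> remd s h y b i i = 0"
  using grid_points[of s h n y b i i i] by (simp add: remd_def incr_refl)

lemma remd_Suc: "driven s h n y b \<Longrightarrow> i < n \<Longrightarrow> remd s h y b i (Suc i) = 0"
  using drivenD(4)[of s h n y b i] by (simp add: remd_def)

lemma remd_defect: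
  assumes "i \<le> j" "j \<le> k"
  shows "remd s h y b i k - remd s h y b i j - remd s h y b j k
    = defect (y i) (y j) (s + real i * h) (s + real j * h) (s + real k * h)"
proof -
  have "(\<Sum>l=i..<k. b l) = (\<Sum>l=i..<j. b l) + (\<Sum>l=j..<k. b l)"
    using assms by (simp add: sum.atLeastLessThan_concat)
  then show ?thesis by (simp add: remd_def defect_def scaleR_add_right)
qed

lemma driven_shift:
  assumes "driven s h n y b" "i \<le> j" "j \<le> n"
  shows "driven (s + real i * h) h (j - i) (\<lambda>k. y (i + k)) (\<lambda>k. b (i + k))"
proof -
  note D = drivenD[OF assms(1)]
  have e: "s + real i * h + real k * h = s + real (i + k) * h" for k by (simp add: algebra_simps)
  have "s + real i * h + real (j - i) * h \<le> T"
    unfolding e using grid_points[OF assms(1), of i j j] assms by simp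
  moreover have "0 \<le> s + real i * h" using D by simp
  ultimately show ?thesis unfolding driven_def e using D assms by auto
qed

lemma remd_shift:
  "remd (s + real i * h) h (\<lambda>k. y (i + k)) (\<lambda>k. b (i + k)) p q = remd s h y b (i + p) (i + q)"
proof -
  have "(\<Sum>k=i+p..<i+q. b k) = (\<Sum>k=p..<q. b (i + k))"
    using sum.shift_bounds_nat_ivl[of b p i q] by (simp add: add.commute)
  then show ?thesis by (simp add: remd_def algebra_simps)
qed

lemma sum_drift_le:
  assumes "\<And>k. i \<le> k \<Longrightarrow> k < j \<Longrightarrow> norm (b k) \<le> B" "0 \<le> h"
  shows "norm (h *\<^sub>R (\<Sum>k=i..<j. b k)) \<le> B * (real (j - i) * h)"
proof -
  have "norm (\<Sum>k=i..<j. b k) \<le> real (card {i..<j}) * B"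
    by (rule sum_norm_bound) (use assms in auto)
  then show ?thesis using mult_left_mono[OF _ assms(2)] by (fastforce simp: assms mult_ac)
qed

lemma block_first_order:
  assumes dr: "driven s h n y b" and n: "real n * h \<le> 1" and ij: "i \<le> j" "j \<le> n"
    and B: "\<And>i. i < n \<Longrightarrow> norm (b i) \<le> B" "0 \<le> B"
    and N: "norm (remd s h y b i j) \<le> N * ((real (j - i) * h) powr \<alpha>) ^ 3" "0 \<le> N"
  shows "norm (y j - y i - f (y i) (X (s + real j * h) - X (s + real i * h)))
     \<le> (B + K ^ 4 + N * (real n * h) powr \<alpha>) * ((real (j - i) * h) powr \<alpha>)\<^sup>2"
proof -
  note g = grid_points[OF dr ij(1) order_refl ij(2)]
  define l where "l = real (j - i) * h"
  define w where "w = l powr \<alpha>"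
  have h: "0 < h" using drivenD[OF dr] by simp
  have l: "0 \<le> l" "l \<le> real n * h" unfolding l_def using h ij by (auto intro!: mult_right_mono)
  then have l1: "l \<le> 1" using n by simp
  have w: "0 \<le> w" "w \<le> (real n * h) powr \<alpha>" using l \<alpha> by (auto simp: w_def intro!: powr_mono2)
  have XX: "norm (XX (s + real i * h) (s + real j * h)) \<le> K * w\<^sup>2"
    using XX_le[of "s + real i * h" "s + real j * h"] g by (simp add: w_def l_def)
  have "y j - y i - f (y i) (X (s + real j * h) - X (s + real i * h))
    = h *\<^sub>R (\<Sum>k=i..<j. b k) + lft (level2 (y i)) (XX (s + real i * h) (s + real j * h)) + remd s h y b i j"
    by (simp add: remd_def incr_def)
  also have "norm \<dots> \<le> B * w\<^sup>2 + K * K\<^sup>2 * (K * w\<^sup>2) + N * (real n * h) powr \<alpha> * w\<^sup>2"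
  proof (intro norm_triangle_le add_mono lft_apply_le level2_le XX)
    have "norm (h *\<^sub>R (\<Sum>k=i..<j. b k)) \<le> B * l" unfolding l_def using B ij h by (intro sum_drift_le) auto
    also have "\<dots> \<le> B * w\<^sup>2" unfolding w_def using le_powr2[OF l(1) l1] B by (intro mult_left_mono) auto
    finally show "norm (h *\<^sub>R (\<Sum>k=i..<j. b k)) \<le> B * w\<^sup>2" .
    have "N * w ^ 3 = N * w * w\<^sup>2" by (simp add: eval_nat_numeral)
    also have "\<dots> \<le> N * (real n * h) powr \<alpha> * w\<^sup>2" using N w by (intro mult_right_mono mult_left_mono) auto
    finally show "norm (remd s h y b i j) \<le> N * (real n * h) powr \<alpha> * w\<^sup>2"
      using N by (simp add: w_def l_def)
  qed
  also have "\<dots> = (B + K ^ 4 + N * (real n * h) powr \<alpha>) * w\<^sup>2" by (simp add: algebra_simps eval_nat_numeral)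
  finally show ?thesis by (simp add: w_def l_def)
qed

text \<open>The exponent \<open>3 * \<alpha>\<close> exceeds one, which is what sewing requires.\<close>

abbreviation "S3 \<equiv> sew_const (3 * \<alpha>)"

lemma S3_pos: "0 < S3" using \<alpha> by (intro sew_const_pos) auto

text \<open>A bound \<open>N\<close> for the remainder enters the defect with the factor \<open>(n * h) powr \<alpha>\<close>. On a block
  where this factor is small the bootstrap closes. The admissible length of the block does not
  depend on the drift.\<close>

lemma block_apriori:
  assumes dr: "driven s h n y b" and n: "real n * h \<le> 1"
    and B: "\<And>i. i < n \<Longrightarrow> norm (b i) \<le> B" "0 \<le> B"
    and small: "S3 * (3 * K ^ 6 * (real n * h) powr \<alpha>) \<le> 1/2"
    and ij: "i \<le> j" "j \<le> n"
  shows "norm (remd s h y b i j) \<le> 2 * S3 * (3 * K ^ 6 * (1 + B + K ^ 4)) * ((real (j - i) * h) powr \<alpha>) ^ 3" (is ?A)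
    and "norm (y j - y i - f (y i) (X (s + real j * h) - X (s + real i * h)))
     \<le> (2 * B + 2 * K ^ 4 + 1) * ((real (j - i) * h) powr \<alpha>)\<^sup>2" (is ?B)
proof -
  have h: "0 < h" using drivenD[OF dr] by simp
  define \<epsilon> where "\<epsilon> = (real n * h) powr \<alpha>"
  have \<epsilon>: "0 \<le> \<epsilon>" by (simp add: \<epsilon>_def)
  have nn: "0 \<le> real (j - i) * h" for i j using h by simp
  have "norm (remd s h y b i j) \<le> 2 * S3 * (3 * K ^ 6 * (1 + B + K ^ 4)) * (real (j - i) * h) powr (3 * \<alpha>)"
  proof (rule sewing_bootstrap[where J = "remd s h y b" and n = n, OF _ _ _ h remd_refl[OF dr] remd_Suc[OF dr] _ small ij])
    show "1 < 3 * \<alpha>" using \<alpha> by simp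
    show "0 \<le> 3 * K ^ 6 * (1 + B + K ^ 4)" "0 \<le> 3 * K ^ 6 * (real n * h) powr \<alpha>" using B K0 by auto
    fix N i j k assume N: "0 \<le> N" 
      and NJ: "\<And>i j. i \<le> j \<Longrightarrow> j \<le> n \<Longrightarrow> norm (remd s h y b i j) \<le> N * (real (j - i) * h) powr (3 * \<alpha>)"
      and ijk: "i \<le> j" "j \<le> k" "k \<le> n"
    note g = grid_points[OF dr ijk]
    have jk: "real (j - i) * h \<le> real (k - i) * h" using ijk h by (intro mult_right_mono) auto
    have l1: "real (k - i) * h \<le> 1" using ijk h n by (intro order_trans[OF mult_right_mono n]) auto
    have "norm (y j - y i - f (y i) (X (s + real j * h) - X (s + real i * h)))
       \<le> (B + K ^ 4 + N * \<epsilon>) * ((real (j - i) * h) powr \<alpha>)\<^sup>2"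
      unfolding \<epsilon>_def using NJ[of i j, unfolded powr3[OF nn]] ijk N B
      by (intro block_first_order[OF dr n]) auto
    also have "\<dots> \<le> (B + K ^ 4 + N * \<epsilon>) * ((real (k - i) * h) powr \<alpha>)\<^sup>2"
      using jk nn B N \<epsilon> K0 \<alpha> by (intro mult_left_mono power_mono powr_mono2) auto
    finally have fo: "norm (y j - y i - f (y i) (X (s + real j * h) - X (s + real i * h)))
       \<le> (B + K ^ 4 + N * \<epsilon>) * ((s + real k * h - (s + real i * h)) powr \<alpha>)\<^sup>2" unfolding g(5) .
    have "norm (defect (y i) (y j) (s + real i * h) (s + real j * h) (s + real k * h))
       \<le> 3 * K ^ 6 * (1 + (B + K ^ 4 + N * \<epsilon>)) * ((s + real k * h - (s + real i * h)) powr \<alpha>) ^ 3"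
      using g l1 B N \<epsilon> K0 by (intro defect_le fo) auto
    also have "\<dots> = (3 * K ^ 6 * (1 + B + K ^ 4) + 3 * K ^ 6 * (real n * h) powr \<alpha> * N) * (real (k - i) * h) powr (3 * \<alpha>)"
      unfolding g(5) powr3[OF nn] by (simp add: algebra_simps \<epsilon>_def)
    finally show "norm (remd s h y b i k - remd s h y b i j - remd s h y b j k)
       \<le> (3 * K ^ 6 * (1 + B + K ^ 4) + 3 * K ^ 6 * (real n * h) powr \<alpha> * N) * (real (k - i) * h) powr (3 * \<alpha>)"
      unfolding remd_defect[OF ijk(1,2)] .
  qed
  then show A: ?A by (simp add: powr3[OF nn])
  have "2 * S3 * (3 * K ^ 6 * (1 + B + K ^ 4)) * \<epsilon> = (2 * (S3 * (3 * K ^ 6 * \<epsilon>))) * (1 + B + K ^ 4)"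
    by simp
  also have "\<dots> \<le> 1 * (1 + B + K ^ 4)" using small B K0 by (intro mult_right_mono) (auto simp: \<epsilon>_def)
  finally have "B + K ^ 4 + 2 * S3 * (3 * K ^ 6 * (1 + B + K ^ 4)) * \<epsilon> \<le> 2 * B + 2 * K ^ 4 + 1" by simp
  then have "(B + K ^ 4 + 2 * S3 * (3 * K ^ 6 * (1 + B + K ^ 4)) * \<epsilon>) * ((real (j - i) * h) powr \<alpha>)\<^sup>2
     \<le> (2 * B + 2 * K ^ 4 + 1) * ((real (j - i) * h) powr \<alpha>)\<^sup>2" by (rule mult_right_mono) simp
  moreover have "0 \<le> 2 * S3 * (3 * K ^ 6 * (1 + B + K ^ 4))" using S3_pos B K0 by simp
  ultimately show ?B using block_first_order[OF dr n ij B A] by (simp add: \<epsilon>_def)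
qed

text \<open>For a drift of linear growth, the maximum \<open>M\<close> of the scheme over a short block reappears on
  the right hand side with a factor at most one half.\<close>

lemma block_growth_bound:
  assumes dr: "driven s h n y b" and n: "real n * h \<le> 1"
    and b: "\<And>i. i < n \<Longrightarrow> norm (b i) \<le> E + K * norm (y i)" and E: "0 \<le> E"
    and small: "S3 * (3 * K ^ 6 * (real n * h) powr \<alpha>) \<le> 1/2" "4 * K * (real n * h) powr \<alpha> \<le> 1"
    and j: "j \<le> n"
  shows "norm (y j) \<le> 2 * norm (y 0) + 6 * (E + K ^ 4 + 1)"
proof -
  obtain M where M: "\<And>i. i \<le> n \<Longrightarrow> norm (y i) \<le> M" "\<exists>i\<le>n. norm (y i) = M"
    using Max_attained[of n "\<lambda>i. norm (y i)"] by blast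
  define \<epsilon> where "\<epsilon> = (real n * h) powr \<alpha>"
  have h: "0 < h" using drivenD[OF dr] by simp
  have nh: "0 \<le> real n * h" using h by simp
  have \<epsilon>: "0 \<le> \<epsilon>" "\<epsilon> \<le> 1" using powr_le1[OF nh n] by (auto simp: \<epsilon>_def)
  have M0: "0 \<le> M" using M(1)[of 0] norm_ge_zero[of "y 0"] by linarith
  have B: "norm (b i) \<le> E + K * M" if "i < n" for i
    using b[OF that] mult_left_mono[OF M(1)[of i] K0(1)] that by linarith
  have incr: "norm (y i) \<le> norm (y 0) + (2 * (E + K * M) + 3 * K ^ 4 + 1) * \<epsilon>" if i: "i \<le> n" for i
  proof -
    define w where "w = (real i * h) powr \<alpha>"
    have w: "0 \<le> w" "w \<le> \<epsilon>" unfolding w_def \<epsilon>_def using i h \<alpha> by (auto intro!: powr_mono2 mult_right_mono)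
    have w2: "w\<^sup>2 \<le> \<epsilon>" using w \<epsilon> mult_mono[of w 1 w \<epsilon>] by (simp add: power2_eq_square)
    note g = grid_points[OF dr le0 order_refl i]
    have "norm (y i - y 0 - f (y 0) (X (s + real i * h) - X (s + real 0 * h))) \<le> (2 * (E + K * M) + 2 * K ^ 4 + 1) * w\<^sup>2"
      using block_apriori(2)[OF dr n B _ small(1) le0 i] E M0 K0 by (simp add: w_def)
    also have "\<dots> \<le> (2 * (E + K * M) + 2 * K ^ 4 + 1) * \<epsilon>" using w2 E M0 K0 by (intro mult_left_mono) auto
    finally have 1: "norm (y i - y 0 - f (y 0) (X (s + real i * h) - X (s + real 0 * h))) \<le> (2 * (E + K * M) + 2 * K ^ 4 + 1) * \<epsilon>" .
    have "norm (X (s + real i * h) - X (s + real 0 * h)) \<le> K * w"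
      using X_le[of "s + real 0 * h" "s + real i * h"] g by (simp add: w_def)
    then have "norm (f (y 0) (X (s + real i * h) - X (s + real 0 * h))) \<le> K * (K * w)" by (intro norm_apply_le f_le)
    also have "\<dots> \<le> K ^ 4 * \<epsilon>"
    proof -
      have "K * (K * w) = K ^ 2 * w" by (simp add: power2_eq_square)
      also have "\<dots> \<le> K ^ 4 * \<epsilon>" using K w by (intro mult_mono power_increasing) auto
      finally show ?thesis .
    qed
    finally have 2: "norm (f (y 0) (X (s + real i * h) - X (s + real 0 * h))) \<le> K ^ 4 * \<epsilon>" .
    have "y i = y 0 + (y i - y 0 - f (y 0) (X (s + real i * h) - X (s + real 0 * h))) + f (y 0) (X (s + real i * h) - X (s + real 0 * h))"
      by simp
    then have "norm (y i) \<le> norm (y 0) + (2 * (E + K * M) + 2 * K ^ 4 + 1) * \<epsilon> + K ^ 4 * \<epsilon>"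
      using norm_triangle_le[OF add_mono[OF norm_triangle_le[OF add_mono[OF order_refl 1]] 2]] by metis
    then show ?thesis by (simp add: algebra_simps)
  qed
  obtain i where i: "i \<le> n" "norm (y i) = M" using M(2) by blast
  have "M \<le> norm (y 0) + (2 * (E + K * M) + 3 * K ^ 4 + 1) * \<epsilon>" using incr[OF i(1)] i(2) by simp
  also have "\<dots> = norm (y 0) + (2 * E + 3 * K ^ 4 + 1) * \<epsilon> + (4 * K * \<epsilon>) * (M / 2)" by (simp add: algebra_simps)
  also have "\<dots> \<le> norm (y 0) + (2 * E + 3 * K ^ 4 + 1) * 1 + 1 * (M / 2)"
    using \<epsilon> small(2) E K0 M0 by (intro add_mono mult_left_mono mult_right_mono) (auto simp: \<epsilon>_def)
  finally have "M \<le> 2 * norm (y 0) + 2 * (2 * E + 3 * K ^ 4 + 1)" by simp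
  then show ?thesis using M(1)[OF j] E by simp
qed

text \<open>The bootstrap is repeated for the difference of the remainders of two schemes, with the
  largest distance \<open>M\<close> of the schemes as a parameter. The first order expansion then bounds \<open>M\<close> by
  the initial distance, the perturbation \<open>\<eta>\<close> and a small multiple of \<open>M\<close>.\<close>

lemma block_stability:
  assumes dy: "driven s h n y b" and dz: "driven s h n z c" and n: "real n * h \<le> 1"
    and b: "\<And>i. i < n \<Longrightarrow> norm (b i) \<le> B" and c: "\<And>i. i < n \<Longrightarrow> norm (c i) \<le> B" and B: "0 \<le> B"
    and bc: "\<And>i. i < n \<Longrightarrow> norm (b i - c i) \<le> K * norm (y i - z i) + \<eta>" and \<eta>: "0 \<le> \<eta>"
    and m: "m = 2 * B + 2 * K ^ 4 + 1 + K\<^sup>2"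
    and small: "S3 * (3 * K ^ 6 * (real n * h) powr \<alpha>) \<le> 1/2" "16 * K ^ 4 * (real n * h) powr \<alpha> \<le> 1"
      "S3 * (14 * m ^ 6 * (real n * h) powr \<alpha>) \<le> 1/2"
    and j: "j \<le> n"
  shows "norm (y j - z j) \<le> 2 * norm (y 0 - z 0) + 2 * \<eta>"
proof -
  obtain M where M: "\<And>i. i \<le> n \<Longrightarrow> norm (y i - z i) \<le> M" "\<exists>i\<le>n. norm (y i - z i) = M"
    using Max_attained[of n "\<lambda>i. norm (y i - z i)"] by blast
  define \<epsilon> where "\<epsilon> = (real n * h) powr \<alpha>"
  define \<rho> where "\<rho> = 2 * B + 2 * K ^ 4 + 1"
  define J where "J i j = remd s h y b i j - remd s h z c i j" for i j
  define x where "x i j = X (s + real j * h) - X (s + real i * h)" for i j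
  have h: "0 < h" using drivenD[OF dy] by simp
  have nh: "0 \<le> real n * h" using h by simp
  have \<epsilon>: "0 \<le> \<epsilon>" "\<epsilon> \<le> 1" using powr_le1[OF nh n] by (auto simp: \<epsilon>_def)
  have M0: "0 \<le> M" using M(1)[of 0] norm_ge_zero[of "y 0 - z 0"] by linarith
  have \<rho>: "0 \<le> \<rho>" using B by (simp add: \<rho>_def)
  have m0: "0 \<le> m" using B by (simp add: m)
  have K4: "K \<le> K ^ 4" "1 \<le> K ^ 4" using K self_le_power[of K 4] by auto
  have nn: "0 \<le> real (j - i) * h" for i j using h by simp
  have bM: "norm (b i - c i) \<le> K * M + \<eta>" if "i < n" for i
    using bc[OF that] mult_left_mono[OF M(1)[of i] K0(1)] that by linarith
  have fo: "norm ((y j - y i - f (y i) (x i j)) - (z j - z i - f (z i) (x i j)))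
      \<le> (3 * K ^ 4 * M + \<eta> + N * \<epsilon>) * ((real (j - i) * h) powr \<alpha>)\<^sup>2"
    if ij: "i \<le> j" "j \<le> n" and N: "norm (J i j) \<le> N * ((real (j - i) * h) powr \<alpha>) ^ 3" "0 \<le> N" for i j N
  proof -
    note g = grid_points[OF dy ij(1) order_refl ij(2)]
    define l where "l = real (j - i) * h"
    define w where "w = l powr \<alpha>"
    have l: "0 \<le> l" "l \<le> real n * h" unfolding l_def using h ij by (auto intro!: mult_right_mono)
    then have l1: "l \<le> 1" using n by simp
    have w: "0 \<le> w" "w \<le> \<epsilon>" using l \<alpha> by (auto simp: w_def \<epsilon>_def intro!: powr_mono2)
    have XX: "norm (XX (s + real i * h) (s + real j * h)) \<le> K * w\<^sup>2"
      using XX_le[of "s + real i * h" "s + real j * h"] g by (simp add: w_def l_def)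
    have lev: "norm (level2 (y i) - level2 (z i)) \<le> 2 * K\<^sup>2 * M"
      using level2_lip[of "y i" "z i"] mult_left_mono[OF M(1)[of i], of "2 * K\<^sup>2"] ij by simp
    have "(y j - y i - f (y i) (x i j)) - (z j - z i - f (z i) (x i j))
      = h *\<^sub>R (\<Sum>k=i..<j. b k - c k) + lft (level2 (y i) - level2 (z i)) (XX (s + real i * h) (s + real j * h)) + J i j"
      by (simp add: J_def x_def remd_def incr_def lft_diff blinfun.diff_left sum_subtractf scaleR_diff_right)
    also have "norm \<dots> \<le> (K * M + \<eta>) * w\<^sup>2 + K * (2 * K\<^sup>2 * M) * (K * w\<^sup>2) + N * \<epsilon> * w\<^sup>2"
    proof (intro norm_triangle_le add_mono lft_apply_le lev XX)
      have "norm (h *\<^sub>R (\<Sum>k=i..<j. b k - c k)) \<le> (K * M + \<eta>) * l"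
        unfolding l_def using bM ij h by (intro sum_drift_le) auto
      also have "\<dots> \<le> (K * M + \<eta>) * w\<^sup>2" unfolding w_def using le_powr2[OF l(1) l1] K0 M0 \<eta> by (intro mult_left_mono) auto
      finally show "norm (h *\<^sub>R (\<Sum>k=i..<j. b k - c k)) \<le> (K * M + \<eta>) * w\<^sup>2" .
      have "N * w ^ 3 = N * w * w\<^sup>2" by (simp add: eval_nat_numeral)
      also have "\<dots> \<le> N * \<epsilon> * w\<^sup>2" using N w by (intro mult_right_mono mult_left_mono) auto
      finally show "norm (J i j) \<le> N * \<epsilon> * w\<^sup>2" using N by (simp add: w_def l_def)
    qed
    also have "\<dots> = (K * M + 2 * K ^ 4 * M + \<eta> + N * \<epsilon>) * w\<^sup>2" by (simp add: algebra_simps eval_nat_numeral)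
    also have "\<dots> \<le> (3 * K ^ 4 * M + \<eta> + N * \<epsilon>) * w\<^sup>2"
      using mult_right_mono[OF K4(1) M0] by (intro mult_right_mono) (auto simp: mult_ac)
    finally show ?thesis by (simp add: w_def l_def)
  qed
  define a where "a = 14 * m ^ 6 * (4 * K ^ 4 * M + \<eta>)"
  have a0: "0 \<le> a" using m0 M0 \<eta> K0 by (simp add: a_def)
  have J: "norm (J i j) \<le> 2 * S3 * a * ((real (j - i) * h) powr \<alpha>) ^ 3" if ij: "i \<le> j" "j \<le> n" for i j
  proof -
    have "norm (J i j) \<le> 2 * S3 * a * (real (j - i) * h) powr (3 * \<alpha>)"
    proof (rule sewing_bootstrap[where J = J and n = n, OF _ a0 _ h _ _ _ small(3) ij])
      show "1 < 3 * \<alpha>" using \<alpha> by simp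
      show "0 \<le> 14 * m ^ 6 * (real n * h) powr \<alpha>" using m0 by simp
      show "J i i = 0" if "i \<le> n" for i using remd_refl[OF dy that] remd_refl[OF dz that] by (simp add: J_def)
      show "J i (Suc i) = 0" if "i < n" for i using remd_Suc[OF dy that] remd_Suc[OF dz that] by (simp add: J_def)
      fix N i j k assume N: "0 \<le> N"
        and NJ: "\<And>i j. i \<le> j \<Longrightarrow> j \<le> n \<Longrightarrow> norm (J i j) \<le> N * (real (j - i) * h) powr (3 * \<alpha>)"
        and ijk: "i \<le> j" "j \<le> k" "k \<le> n"
      note g = grid_points[OF dy ijk]
      have jk: "real (j - i) * h \<le> real (k - i) * h" using ijk h by (intro mult_right_mono) auto
      have l1: "real (k - i) * h \<le> 1" using ijk h n by (intro order_trans[OF mult_right_mono n]) auto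
      have up: "norm v \<le> C * ((real (j - i) * h) powr \<alpha>)\<^sup>2 \<Longrightarrow> 0 \<le> C \<Longrightarrow>
          norm v \<le> C * ((s + real k * h - (s + real i * h)) powr \<alpha>)\<^sup>2" for v :: 'w and C
        unfolding g(5) using jk nn \<alpha> by (elim order_trans) (intro mult_left_mono power_mono powr_mono2, auto)
      have jn: "j \<le> n" using ijk by simp
      have "norm (defect (y i) (y j) (s + real i * h) (s + real j * h) (s + real k * h)
           - defect (z i) (z j) (s + real i * h) (s + real j * h) (s + real k * h))
        \<le> 14 * m ^ 6 * ((3 * K ^ 4 * M + \<eta> + N * \<epsilon>) + M) * ((s + real k * h - (s + real i * h)) powr \<alpha>) ^ 3"
      proof (rule defect_difference_le[OF g(1-4) _ _ _ _ _ \<rho>])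
        show "s + real k * h - (s + real i * h) \<le> 1" using g(5) l1 by simp
        show "m = \<rho> + K\<^sup>2" by (simp add: m \<rho>_def)
        show "norm (y i - z i) \<le> M" using M(1) ijk by simp
        show nn': "0 \<le> 3 * K ^ 4 * M + \<eta> + N * \<epsilon>" using K0 M0 \<eta> N \<epsilon> by simp
        show "norm (y j - y i - f (y i) (X (s + real j * h) - X (s + real i * h)))
           \<le> \<rho> * ((s + real k * h - (s + real i * h)) powr \<alpha>)\<^sup>2"
          using block_apriori(2)[OF dy n b B small(1) ijk(1) jn] \<rho> by (intro up) (auto simp: \<rho>_def)
        show "norm (z j - z i - f (z i) (X (s + real j * h) - X (s + real i * h)))
           \<le> \<rho> * ((s + real k * h - (s + real i * h)) powr \<alpha>)\<^sup>2"
          using block_apriori(2)[OF dz n c B small(1) ijk(1) jn] \<rho> by (intro up) (auto simp: \<rho>_def)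
        show "norm ((y j - y i - f (y i) (X (s + real j * h) - X (s + real i * h))) - (z j - z i - f (z i) (X (s + real j * h) - X (s + real i * h))))
           \<le> (3 * K ^ 4 * M + \<eta> + N * \<epsilon>) * ((s + real k * h - (s + real i * h)) powr \<alpha>)\<^sup>2"
          using fo[OF ijk(1) jn NJ[OF ijk(1) jn, unfolded powr3[OF nn]] N] by (intro up nn') (auto simp: x_def)
      qed
      also have "\<dots> \<le> 14 * m ^ 6 * (4 * K ^ 4 * M + \<eta> + N * \<epsilon>) * ((s + real k * h - (s + real i * h)) powr \<alpha>) ^ 3"
        using mult_right_mono[OF K4(2) M0] m0 by (intro mult_right_mono mult_left_mono) (auto simp: mult_ac)
      also have "\<dots> = (a + 14 * m ^ 6 * (real n * h) powr \<alpha> * N) * (real (k - i) * h) powr (3 * \<alpha>)"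
        unfolding g(5) powr3[OF nn] by (simp add: a_def \<epsilon>_def algebra_simps)
      finally show "norm (J i k - J i j - J j k) \<le> (a + 14 * m ^ 6 * (real n * h) powr \<alpha> * N) * (real (k - i) * h) powr (3 * \<alpha>)"
        using remd_defect[OF ijk(1,2), of s h y b] remd_defect[OF ijk(1,2), of s h z c]
        by (simp add: J_def algebra_simps)
    qed
    then show ?thesis by (simp add: powr3[OF nn])
  qed
  have "2 * S3 * a * \<epsilon> = (2 * (S3 * (14 * m ^ 6 * \<epsilon>))) * (4 * K ^ 4 * M + \<eta>)" by (simp add: a_def)
  also have "\<dots> \<le> 1 * (4 * K ^ 4 * M + \<eta>)" using small(3) M0 \<eta> K0 by (intro mult_right_mono) (auto simp: \<epsilon>_def)
  finally have aS: "2 * S3 * a * \<epsilon> \<le> 4 * K ^ 4 * M + \<eta>" by simp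
  have incr: "norm (y i - z i) \<le> norm (y 0 - z 0) + (8 * K ^ 4 * M + 2 * \<eta>) * \<epsilon>" if i: "i \<le> n" for i
  proof -
    define w where "w = (real i * h) powr \<alpha>"
    have w: "0 \<le> w" "w \<le> \<epsilon>" unfolding w_def \<epsilon>_def using i h \<alpha> by (auto intro!: powr_mono2 mult_right_mono)
    have w2: "w\<^sup>2 \<le> \<epsilon>" using w \<epsilon> mult_mono[of w 1 w \<epsilon>] by (simp add: power2_eq_square)
    note g = grid_points[OF dy le0 order_refl i]
    have "norm ((y i - y 0 - f (y 0) (x 0 i)) - (z i - z 0 - f (z 0) (x 0 i)))
        \<le> (3 * K ^ 4 * M + \<eta> + 2 * S3 * a * \<epsilon>) * w\<^sup>2"
      using fo[OF le0 i J[OF le0 i]] S3_pos a0 by (simp add: w_def)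
    also have "\<dots> \<le> (7 * K ^ 4 * M + 2 * \<eta>) * \<epsilon>" 
    proof (rule mult_mono)
      show "3 * K ^ 4 * M + \<eta> + 2 * S3 * a * \<epsilon> \<le> 7 * K ^ 4 * M + 2 * \<eta>" using aS by linarith
    qed (use w2 M0 \<eta> K0 in auto)
    finally have 1: "norm ((y i - y 0 - f (y 0) (x 0 i)) - (z i - z 0 - f (z 0) (x 0 i))) \<le> (7 * K ^ 4 * M + 2 * \<eta>) * \<epsilon>" .
    have "norm (x 0 i) \<le> K * w"
      using X_le[of "s + real 0 * h" "s + real i * h"] g by (simp add: w_def x_def)
    moreover have "norm (f (y 0) - f (z 0)) \<le> K * M"
      using f_lip[of "y 0" "z 0"] mult_left_mono[OF M(1)[of 0] K0(1)] by simp
    ultimately have "norm ((f (y 0) - f (z 0)) (x 0 i)) \<le> K * M * (K * w)" by (intro norm_apply_le)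
    also have "\<dots> = K ^ 2 * (M * w)" by (simp add: power2_eq_square)
    also have "\<dots> \<le> K ^ 4 * (M * \<epsilon>)" using K w M0 by (intro mult_mono power_increasing) auto
    finally have 2: "norm ((f (y 0) - f (z 0)) (x 0 i)) \<le> K ^ 4 * M * \<epsilon>" by simp
    have "y i - z i = (y 0 - z 0) + ((y i - y 0 - f (y 0) (x 0 i)) - (z i - z 0 - f (z 0) (x 0 i))) + (f (y 0) - f (z 0)) (x 0 i)"
      by (simp add: blinfun.diff_left)
    then have "norm (y i - z i) \<le> norm (y 0 - z 0) + (7 * K ^ 4 * M + 2 * \<eta>) * \<epsilon> + K ^ 4 * M * \<epsilon>"
      using norm_triangle_le[OF add_mono[OF norm_triangle_le[OF add_mono[OF order_refl 1]] 2]] by metis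
    then show ?thesis by (simp add: algebra_simps)
  qed
  obtain i where i: "i \<le> n" "norm (y i - z i) = M" using M(2) by blast
  have "\<epsilon> \<le> 16 * K ^ 4 * \<epsilon>" using K4 \<epsilon> by (intro mult_right_mono[of 1 "16 * K ^ 4" \<epsilon>, simplified]) auto
  then have e: "16 * K ^ 4 * \<epsilon> \<le> 1" "2 * \<epsilon> \<le> 1" using small(2) K4(2) mult_right_mono[OF K4(2) \<epsilon>(1)] by (auto simp: \<epsilon>_def)
  have "M \<le> norm (y 0 - z 0) + (8 * K ^ 4 * M + 2 * \<eta>) * \<epsilon>" using incr[OF i(1)] i(2) by simp
  also have "\<dots> = norm (y 0 - z 0) + (16 * K ^ 4 * \<epsilon>) * (M / 2) + (2 * \<epsilon>) * \<eta>" by (simp add: algebra_simps)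
  also have "\<dots> \<le> norm (y 0 - z 0) + 1 * (M / 2) + 1 * \<eta>"
    using e \<eta> M0 by (intro add_mono mult_right_mono) auto
  finally show ?thesis using M(1)[OF j] by simp
qed

lemma powr_small:
  assumes "0 < c"
  obtains \<tau> where "0 < \<tau>" "\<tau> \<le> 1" "\<And>x. 0 \<le> x \<Longrightarrow> x \<le> \<tau> \<Longrightarrow> x powr \<alpha> \<le> c"
proof
  define \<tau> where "\<tau> = min 1 (c powr (1 / \<alpha>))"
  show "0 < \<tau>" "\<tau> \<le> 1" using assms by (auto simp: \<tau>_def)
  fix x assume x: "0 \<le> x" "x \<le> \<tau>"
  then have "x powr \<alpha> \<le> (c powr (1 / \<alpha>)) powr \<alpha>" using \<alpha> by (intro powr_mono2) (auto simp: \<tau>_def)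
  also have "\<dots> = c" using assms \<alpha> by (simp add: powr_powr)
  finally show "x powr \<alpha> \<le> c" .
qed

text \<open>One block length serves all smallness conditions above.\<close>

lemma small_blocks:
  assumes "0 \<le> m"
  obtains \<tau> where "0 < \<tau>" "\<tau> \<le> 1"
    "\<And>x. 0 \<le> x \<Longrightarrow> x \<le> \<tau> \<Longrightarrow> S3 * (3 * K ^ 6 * x powr \<alpha>) \<le> 1/2 \<and> 16 * K ^ 4 * x powr \<alpha> \<le> 1 \<and>
        S3 * (14 * m ^ 6 * x powr \<alpha>) \<le> 1/2 \<and> 4 * K * x powr \<alpha> \<le> 1"
proof -
  define c where "c = S3 * (3 * K ^ 6) + 16 * K ^ 4 + S3 * (14 * m ^ 6) + 4 * K"
  have p: "0 \<le> S3 * (3 * K ^ 6)" "0 \<le> 16 * K ^ 4" "0 \<le> S3 * (14 * m ^ 6)" "0 < 4 * K"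
    using S3_pos K0 assms by auto
  then have c: "0 < c" unfolding c_def by linarith
  obtain \<tau> where \<tau>: "0 < \<tau>" "\<tau> \<le> 1" "\<And>x. 0 \<le> x \<Longrightarrow> x \<le> \<tau> \<Longrightarrow> x powr \<alpha> \<le> 1 / (2 * c)"
    using powr_small[of "1 / (2 * c)"] c by auto
  show thesis
  proof (rule that[OF \<tau>(1,2)])
    fix x assume x: "0 \<le> x" "x \<le> \<tau>"
    have q: "d * x powr \<alpha> \<le> 1 / 2" if d: "d \<le> c" for d
    proof -
      have "d * x powr \<alpha> \<le> c * x powr \<alpha>" using d by (intro mult_right_mono) auto
      also have "\<dots> \<le> c * (1 / (2 * c))" using \<tau>(3)[OF x] c by (intro mult_left_mono) auto
      finally show ?thesis using c by simp
    qed
    have "S3 * (3 * K ^ 6) \<le> c" "16 * K ^ 4 \<le> c" "S3 * (14 * m ^ 6) \<le> c" "4 * K \<le> c" using p by (auto simp: c_def)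
    from this[THEN q] show "S3 * (3 * K ^ 6 * x powr \<alpha>) \<le> 1/2 \<and> 16 * K ^ 4 * x powr \<alpha> \<le> 1 \<and>
        S3 * (14 * m ^ 6 * x powr \<alpha>) \<le> 1/2 \<and> 4 * K * x powr \<alpha> \<le> 1" by (simp add: mult_ac)
  qed
qed

lemma length_le_T: "driven s h n y b \<Longrightarrow> j \<le> n \<Longrightarrow> real j * h \<le> T"
  using grid_points[of s h n y b 0 0 j] drivenD(2)[of s h n y b] by simp

lemma global_growth:
  assumes E: "0 \<le> E" and R: "0 \<le> R"
  obtains B h0 where "0 \<le> B" "0 < h0" 
    "\<And>s h n y b j. driven s h n y b \<Longrightarrow> h \<le> h0 \<Longrightarrow> norm (y 0) \<le> R \<Longrightarrow>
       (\<And>i. i < n \<Longrightarrow> norm (b i) \<le> E + K * norm (y i)) \<Longrightarrow> j \<le> n \<Longrightarrow> norm (y j) \<le> B"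
proof -
  obtain \<tau> where \<tau>: "0 < \<tau>" "\<tau> \<le> 1"
    "\<And>x. 0 \<le> x \<Longrightarrow> x \<le> \<tau> \<Longrightarrow> S3 * (3 * K ^ 6 * x powr \<alpha>) \<le> 1/2 \<and> 4 * K * x powr \<alpha> \<le> 1"
    using small_blocks[of 0] by (metis order_refl)
  define c where "c = 6 * (E + K ^ 4 + 1)"
  have c0: "0 \<le> c" using E by (simp add: c_def)
  define m where "m = nat \<lceil>T / (\<tau> / 2)\<rceil>"
  have mT: "T \<le> real m * (\<tau> / 2)" using \<tau> T by (simp add: m_def pos_divide_le_eq[symmetric])
  show thesis
  proof (rule that[of "2 ^ m * (R + c)" "\<tau> / 2"])
    show "0 \<le> 2 ^ m * (R + c)" using R c0 by simp
    show "0 < \<tau> / 2" using \<tau> by simp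
    fix s h n y b j assume dr: "driven s h n y b" and h: "h \<le> \<tau> / 2" and y0: "norm (y 0) \<le> R"
      and b: "\<And>i. i < n \<Longrightarrow> norm (b i) \<le> E + K * norm (y i)" and j: "j \<le> n"
    have h0: "0 < h" using drivenD(1)[OF dr] .
    have "norm (y j) + c \<le> 2 ^ m * (norm (y 0) + c)"
    proof (rule block_growth[where u = "\<lambda>i. norm (y i) + c" and n = n, OF _ h0 h _ _ j])
      show "real j * h \<le> real m * (\<tau> / 2)" using length_le_T[OF dr j] mT by simp
      fix i j assume ij: "i \<le> j" "j \<le> n" "real (j - i) * h \<le> \<tau>"
      note sh = driven_shift[OF dr ij(1,2)]
      have "norm (y (i + (j - i))) \<le> 2 * norm (y (i + 0)) + c" unfolding c_def
        using \<tau>(3)[of "real (j - i) * h"] ij h0 \<tau>(2) E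
        by (intro block_growth_bound[OF sh]) (auto intro: b)
      then show "norm (y j) + c \<le> 2 * (norm (y i) + c)" using ij by simp
    qed (use c0 in auto)
    also have "\<dots> \<le> 2 ^ m * (R + c)" using y0 by simp
    finally show "norm (y j) \<le> 2 ^ m * (R + c)" using c0 by simp
  qed
qed

text \<open>Chaining the short blocks turns block stability into a Gronwall type estimate on the whole
  time interval. The block length depends on the bound \<open>B\<close> for the drifts, which is known in advance
  from the growth estimate.\<close>

lemma global_stability:
  assumes B: "0 \<le> B"
  obtains C h0 where "0 \<le> C" "0 < h0" 
    "\<And>s h n y b z c \<eta> j. driven s h n y b \<Longrightarrow> driven s h n z c \<Longrightarrow> h \<le> h0 \<Longrightarrow>
       (\<And>i. i < n \<Longrightarrow> norm (b i) \<le> B) \<Longrightarrow> (\<And>i. i < n \<Longrightarrow> norm (c i) \<le> B) \<Longrightarrow> 0 \<le> \<eta> \<Longrightarrow>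
       (\<And>i. i < n \<Longrightarrow> norm (b i - c i) \<le> K * norm (y i - z i) + \<eta>) \<Longrightarrow> j \<le> n \<Longrightarrow>
       norm (y j - z j) \<le> C * (norm (y 0 - z 0) + \<eta>)"
proof -
  define k where "k = 2 * B + 2 * K ^ 4 + 1 + K\<^sup>2"
  have k0: "0 \<le> k" using B by (simp add: k_def)
  obtain \<tau> where \<tau>: "0 < \<tau>" "\<tau> \<le> 1"
    "\<And>x. 0 \<le> x \<Longrightarrow> x \<le> \<tau> \<Longrightarrow> S3 * (3 * K ^ 6 * x powr \<alpha>) \<le> 1/2 \<and> 16 * K ^ 4 * x powr \<alpha> \<le> 1 \<and>
        S3 * (14 * k ^ 6 * x powr \<alpha>) \<le> 1/2"
    using small_blocks[OF k0] by metis
  define m where "m = nat \<lceil>T / (\<tau> / 2)\<rceil>"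
  have mT: "T \<le> real m * (\<tau> / 2)" using \<tau> T by (simp add: m_def pos_divide_le_eq[symmetric])
  show thesis
  proof (rule that[of "3 ^ m" "\<tau> / 2"])
    show "0 < \<tau> / 2" using \<tau> by simp
    fix s h n y b z c \<eta> j assume dy: "driven s h n y b" and dz: "driven s h n z c" and h: "h \<le> \<tau> / 2"
      and b: "\<And>i. i < n \<Longrightarrow> norm (b i) \<le> B" and c: "\<And>i. i < n \<Longrightarrow> norm (c i) \<le> B" and \<eta>: "0 \<le> (\<eta>::real)"
      and bc: "\<And>i. i < n \<Longrightarrow> norm (b i - c i) \<le> K * norm (y i - z i) + \<eta>" and j: "j \<le> n"
    have h0: "0 < h" using drivenD(1)[OF dy] .
    have "norm (y j - z j) + \<eta> \<le> 3 ^ m * (norm (y 0 - z 0) + \<eta>)"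
    proof (rule block_growth[where u = "\<lambda>i. norm (y i - z i) + \<eta>" and n = n, OF _ h0 h _ _ j])
      show "real j * h \<le> real m * (\<tau> / 2)" using length_le_T[OF dy j] mT by simp
      fix i j assume ij: "i \<le> j" "j \<le> n" "real (j - i) * h \<le> \<tau>"
      have "norm (y (i + (j - i)) - z (i + (j - i))) \<le> 2 * norm (y (i + 0) - z (i + 0)) + 2 * \<eta>"
        using \<tau>(3)[of "real (j - i) * h"] ij h0 \<tau>(2) B \<eta>
        by (intro block_stability[OF driven_shift[OF dy ij(1,2)] driven_shift[OF dz ij(1,2)] _ _ _ _ _ _ k_def])
          (auto intro: b c bc)
      then show "norm (y j - z j) + \<eta> \<le> 3 * (norm (y i - z i) + \<eta>)"
        using ij \<eta> norm_ge_zero[of "y i - z i"] by (simp del: norm_ge_zero)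
    qed (use \<eta> in auto)
    then show "norm (y j - z j) \<le> 3 ^ m * (norm (y 0 - z 0) + \<eta>)" using \<eta> by simp
  qed simp
qed

lemma local_apriori:
  assumes B: "0 \<le> B"
  obtains C \<tau> where "0 \<le> C" "0 < \<tau>" "\<tau> \<le> 1"
    "\<And>s h n y b i j. driven s h n y b \<Longrightarrow> (\<And>i. i < n \<Longrightarrow> norm (b i) \<le> B) \<Longrightarrow> i \<le> j \<Longrightarrow> j \<le> n \<Longrightarrow>
       real (j - i) * h \<le> \<tau> \<Longrightarrow>
       norm (remd s h y b i j) \<le> C * ((real (j - i) * h) powr \<alpha>) ^ 3 \<and>
       norm (y j - y i) \<le> C * (real (j - i) * h) powr \<alpha>"
proof -
  obtain \<tau> where \<tau>: "0 < \<tau>" "\<tau> \<le> 1"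
    "\<And>x. 0 \<le> x \<Longrightarrow> x \<le> \<tau> \<Longrightarrow> S3 * (3 * K ^ 6 * x powr \<alpha>) \<le> 1/2"
    using small_blocks[of 0] by (metis order_refl)
  define C1 where "C1 = 2 * S3 * (3 * K ^ 6 * (1 + B + K ^ 4))"
  define C2 where "C2 = 2 * B + 2 * K ^ 4 + 1 + K\<^sup>2"
  have C: "0 \<le> C1" "0 \<le> C2" using B S3_pos K0 by (auto simp: C1_def C2_def)
  show thesis
  proof (rule that[of "C1 + C2" \<tau>])
    fix s h n y b i j assume dr: "driven s h n y b" and b: "\<And>i. i < n \<Longrightarrow> norm (b i) \<le> B"
      and ij: "i \<le> j" "j \<le> n" "real (j - i) * h \<le> \<tau>"
    define w where "w = (real (j - i) * h) powr \<alpha>"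
    note sh = driven_shift[OF dr ij(1,2)]
    note g = grid_points[OF dr ij(1) order_refl ij(2)]
    have h: "0 < h" using drivenD(1)[OF dr] .
    have n: "real (j - i) * h \<le> 1" using ij \<tau> by simp
    have w: "0 \<le> w" "w \<le> 1" using powr_le1[OF _ n] h by (auto simp: w_def)
    have b': "norm (b (i + k)) \<le> B" if "k < j - i" for k using b that ij by simp
    have small: "S3 * (3 * K ^ 6 * (real (j - i) * h) powr \<alpha>) \<le> 1/2" using \<tau>(3) ij h by simp
    have "norm (remd s h y b i j) \<le> C1 * w ^ 3"
      using block_apriori(1)[OF sh n b' B small le0 order_refl] ij by (simp add: remd_shift C1_def w_def)
    also have "\<dots> \<le> (C1 + C2) * w ^ 3" using C w by (intro mult_right_mono) auto
    finally have 1: "norm (remd s h y b i j) \<le> (C1 + C2) * w ^ 3" .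
    have e: "s + real i * h + real (j - i) * h = s + real j * h" using g(5) by linarith
    have 2: "norm (y j - y i - f (y i) (X (s + real j * h) - X (s + real i * h))) \<le> (2 * B + 2 * K ^ 4 + 1) * w\<^sup>2"
      using block_apriori(2)[OF sh n b' B small le0 order_refl] ij unfolding e by (simp add: w_def)
    have "norm (X (s + real j * h) - X (s + real i * h)) \<le> K * w"
      using X_le[of "s + real i * h" "s + real j * h"] g by (simp add: w_def)
    then have 3: "norm (f (y i) (X (s + real j * h) - X (s + real i * h))) \<le> K * (K * w)" by (intro norm_apply_le f_le)
    have "norm (y j - y i) \<le> (2 * B + 2 * K ^ 4 + 1) * w\<^sup>2 + K * (K * w)"
      using norm_triangle_le[OF add_mono[OF 2 3]] by simp
    also have "\<dots> \<le> (2 * B + 2 * K ^ 4 + 1) * w + K * (K * w)"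
      using w B K0 by (intro add_mono mult_left_mono) (auto simp: power2_eq_square mult_left_le)
    also have "\<dots> = C2 * w" by (simp add: C2_def algebra_simps power2_eq_square)
    also have "\<dots> \<le> (C1 + C2) * w" using C w by (intro mult_right_mono) auto
    finally show "norm (remd s h y b i j) \<le> (C1 + C2) * ((real (j - i) * h) powr \<alpha>) ^ 3 \<and>
       norm (y j - y i) \<le> (C1 + C2) * (real (j - i) * h) powr \<alpha>" using 1 by (simp add: w_def)
  qed (use C \<tau> in auto)
qed

end

section \<open>Approximate schemes and uniqueness of solutions\<close>

context rough_equation
begin

definition approx_scheme :: "real \<Rightarrow> real \<Rightarrow> real \<Rightarrow> nat \<Rightarrow> (nat \<Rightarrow> 'w) \<Rightarrow> bool" where
  "approx_scheme E s h n y \<longleftrightarrow> 0 < h \<and> 0 \<le> s \<and> s + real n * h \<le> T \<and>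
     (\<forall>i<n. norm (y (Suc i) - y i - h *\<^sub>R f0 (y i) - incr (y i) (s + real i * h) (s + real (Suc i) * h))
        \<le> E * (h powr \<alpha>) ^ 3)"

text \<open>The drift which makes a given sequence an exact Euler scheme.\<close>

definition drift :: "real \<Rightarrow> real \<Rightarrow> (nat \<Rightarrow> 'w) \<Rightarrow> nat \<Rightarrow> 'w" where
  "drift s h y i = (1 / h) *\<^sub>R (y (Suc i) - y i - incr (y i) (s + real i * h) (s + real (Suc i) * h))"

lemma powr2: "0 \<le> x \<Longrightarrow> x powr (2 * \<alpha>) = (x powr \<alpha>)\<^sup>2"
  by (simp add: powr_powr[symmetric] powr_realpow' mult.commute flip: powr_numeral)

lemma f0_le: "norm (f0 y) \<le> norm (f0 0) + K * norm y"
  using f0_lip[of y 0] norm_triangle_sub[of "f0 y" "f0 0"] by simp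

text \<open>One step errors of order \<open>h powr (3 * \<alpha>)\<close> amount to a drift of order \<open>h powr (3 * \<alpha> - 1)\<close>, which
  vanishes with the step size because \<open>3 * \<alpha> > 1\<close>.\<close>

lemma cube_div_le:
  assumes "0 < h" "h \<le> 1"
  shows "(h powr \<alpha>) ^ 3 / h \<le> 1" "0 \<le> (h powr \<alpha>) ^ 3 / h" "(h powr \<alpha>) ^ 3 / h = h powr (3 * \<alpha> - 1)"
proof -
  have "(h powr \<alpha>) ^ 3 / h = h powr (3 * \<alpha>) / h powr 1" using assms by (simp add: powr3)
  also have "\<dots> = h powr (3 * \<alpha> - 1)" by (rule powr_diff[symmetric])
  finally show e: "(h powr \<alpha>) ^ 3 / h = h powr (3 * \<alpha> - 1)" .
  show "(h powr \<alpha>) ^ 3 / h \<le> 1" unfolding e using assms \<alpha> by (intro Transcendental.powr_le1) auto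
  show "0 \<le> (h powr \<alpha>) ^ 3 / h" unfolding e by simp
qed

lemma approx_driven:
  assumes "approx_scheme E s h n y"
  shows "driven s h n y (drift s h y)"
  using assms by (auto simp: approx_scheme_def driven_def drift_def)

lemma approx_drift:
  assumes "approx_scheme E s h n y" "i < n"
  shows "norm (drift s h y i - f0 (y i)) \<le> E * ((h powr \<alpha>) ^ 3 / h)"
proof -
  have h: "0 < h" using assms by (simp add: approx_scheme_def)
  have "drift s h y i - f0 (y i) = (1 / h) *\<^sub>R (y (Suc i) - y i - h *\<^sub>R f0 (y i) - incr (y i) (s + real i * h) (s + real (Suc i) * h))"
    using h by (simp add: drift_def algebra_simps)
  then have "norm (drift s h y i - f0 (y i)) = 1 / h * norm (y (Suc i) - y i - h *\<^sub>R f0 (y i) - incr (y i) (s + real i * h) (s + real (Suc i) * h))"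
    using h by simp
  also have "\<dots> \<le> 1 / h * (E * (h powr \<alpha>) ^ 3)"
    using assms h by (intro mult_left_mono) (auto simp: approx_scheme_def)
  finally show ?thesis by (simp add: field_simps)
qed

lemma approx_bounded:
  assumes E: "0 \<le> E" and R: "0 \<le> R"
  obtains B h0 where "0 \<le> B" "0 < h0" "h0 \<le> 1"
    "\<And>s h n y. approx_scheme E s h n y \<Longrightarrow> h \<le> h0 \<Longrightarrow> norm (y 0) \<le> R \<Longrightarrow>
       (\<forall>j\<le>n. norm (y j) \<le> B) \<and> (\<forall>j<n. norm (drift s h y j) \<le> B)"
proof -
  define E' where "E' = norm (f0 0) + E"
  have E': "0 \<le> E'" using E by (simp add: E'_def)
  obtain B h0 where Bh: "0 \<le> B" "0 < h0" 
    and gg: "\<And>s h n y b j. driven s h n y b \<Longrightarrow> h \<le> h0 \<Longrightarrow> norm (y 0) \<le> R \<Longrightarrow>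
       (\<And>i. i < n \<Longrightarrow> norm (b i) \<le> E' + K * norm (y i)) \<Longrightarrow> j \<le> n \<Longrightarrow> norm (y j) \<le> B"
    using global_growth[OF E' R] by blast
  show thesis
  proof (rule that[of "B + (E' + K * B)" "min 1 h0"])
    show "0 \<le> B + (E' + K * B)" using Bh E' K0 by simp
    fix s h n y assume ap: "approx_scheme E s h n y" and h: "h \<le> min 1 h0" and y0: "norm (y 0) \<le> R"
    have hp: "0 < h" using ap by (simp add: approx_scheme_def)
    have dr: "norm (drift s h y i) \<le> E' + K * norm (y i)" if "i < n" for i
    proof -
      have "norm (drift s h y i) \<le> norm (drift s h y i - f0 (y i)) + norm (f0 (y i))"
        using norm_triangle_sub[of "drift s h y i" "f0 (y i)"] by simp
      also have "\<dots> \<le> E * 1 + (norm (f0 0) + K * norm (y i))"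
        using approx_drift[OF ap that] f0_le[of "y i"] mult_left_mono[OF cube_div_le(1)[of h] E] hp h by simp
      finally show ?thesis by (simp add: E'_def)
    qed
    have y: "norm (y j) \<le> B" if "j \<le> n" for j
      using gg[OF approx_driven[OF ap] _ y0 dr that] h by simp
    have "norm (drift s h y j) \<le> E' + K * B" if "j < n" for j
      using dr[OF that] mult_left_mono[OF y[of j] K0(1)] that by simp
    moreover have "0 \<le> E' + K * B" using Bh E' K0 by simp
    ultimately show "(\<forall>j\<le>n. norm (y j) \<le> B + (E' + K * B)) \<and> (\<forall>j<n. norm (drift s h y j) \<le> B + (E' + K * B))"
      using y Bh(1) by (meson add_increasing add_increasing2)
  qed (use Bh in auto)
qed

text \<open>The estimate behind existence, uniqueness and invariance: all schemes which make one step
  errors of order \<open>h powr (3 * \<alpha>)\<close> stay together, up to an error that vanishes with the step size.\<close>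

lemma approx_stability:
  assumes E: "0 \<le> E" and R: "0 \<le> R"
  obtains C h0 where "0 \<le> C" "0 < h0" "h0 \<le> 1"
    "\<And>s h n y z j. approx_scheme E s h n y \<Longrightarrow> approx_scheme E s h n z \<Longrightarrow> h \<le> h0 \<Longrightarrow>
       norm (y 0) \<le> R \<Longrightarrow> y 0 = z 0 \<Longrightarrow> j \<le> n \<Longrightarrow> norm (y j - z j) \<le> C * h powr (3 * \<alpha> - 1)"
proof -
  obtain B h1 where Bh: "0 \<le> B" "0 < h1" "h1 \<le> 1"
    and bd: "\<And>s h n y. approx_scheme E s h n y \<Longrightarrow> h \<le> h1 \<Longrightarrow> norm (y 0) \<le> R \<Longrightarrow>
       (\<forall>j\<le>n. norm (y j) \<le> B) \<and> (\<forall>j<n. norm (drift s h y j) \<le> B)"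
    using approx_bounded[OF E R] by blast
  obtain C h2 where Ch: "0 \<le> C" "0 < h2" 
    and st: "\<And>s h n y b z c \<eta> j. driven s h n y b \<Longrightarrow> driven s h n z c \<Longrightarrow> h \<le> h2 \<Longrightarrow>
       (\<And>i. i < n \<Longrightarrow> norm (b i) \<le> B) \<Longrightarrow> (\<And>i. i < n \<Longrightarrow> norm (c i) \<le> B) \<Longrightarrow> 0 \<le> \<eta> \<Longrightarrow>
       (\<And>i. i < n \<Longrightarrow> norm (b i - c i) \<le> K * norm (y i - z i) + \<eta>) \<Longrightarrow> j \<le> n \<Longrightarrow>
       norm (y j - z j) \<le> C * (norm (y 0 - z 0) + \<eta>)"
    using global_stability[OF Bh(1)] by blast
  show thesis
  proof (rule that[of "C * (2 * E)" "min h1 h2"])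
    fix s h n y z j
    assume ay: "approx_scheme E s h n y" and az: "approx_scheme E s h n z" and h: "h \<le> min h1 h2"
      and y0: "norm (y 0) \<le> R" and yz: "y 0 = z 0" and j: "j \<le> n"
    have hp: "0 < h" "h \<le> 1" using ay h Bh by (auto simp: approx_scheme_def)
    define \<eta> where "\<eta> = 2 * E * ((h powr \<alpha>) ^ 3 / h)"
    have "norm (y j - z j) \<le> C * (norm (y 0 - z 0) + \<eta>)"
    proof (rule st[OF approx_driven[OF ay] approx_driven[OF az] _ _ _ _ _ j])
      show "h \<le> h2" using h by simp
      show "norm (drift s h y i) \<le> B" "norm (drift s h z i) \<le> B" if "i < n" for i
        using bd[OF ay] bd[OF az] y0 yz h that by auto
      show "0 \<le> \<eta>" unfolding \<eta>_def using E cube_div_le(2)[OF hp] by (intro mult_nonneg_nonneg) auto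
      fix i assume i: "i < n"
      have "drift s h y i - drift s h z i = (drift s h y i - f0 (y i)) + (f0 (y i) - f0 (z i)) - (drift s h z i - f0 (z i))"
        by simp
      also have "norm \<dots> \<le> E * ((h powr \<alpha>) ^ 3 / h) + K * norm (y i - z i) + E * ((h powr \<alpha>) ^ 3 / h)"
        by (intro norm_triangle_le norm_triangle_le_diff add_mono approx_drift[OF ay i] approx_drift[OF az i] f0_lip)
      finally show "norm (drift s h y i - drift s h z i) \<le> K * norm (y i - z i) + \<eta>" by (simp add: \<eta>_def)
    qed
    then show "norm (y j - z j) \<le> C * (2 * E) * h powr (3 * \<alpha> - 1)"
      using yz by (simp add: \<eta>_def cube_div_le(3)[OF hp])
  qed (use Ch Bh E in auto)
qed

text \<open>Davie's notion of a solution: a local expansion whose error is of an order greater than one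
  replaces the integral equation.\<close>

definition davie_solution :: "real \<Rightarrow> (real \<Rightarrow> 'w) \<Rightarrow> bool" where
  "davie_solution s0 Y \<longleftrightarrow> (\<exists>C\<ge>0. \<forall>s t. s0 \<le> s \<and> s \<le> t \<and> t \<le> T \<longrightarrow>
     norm (Y t - Y s - (t - s) *\<^sub>R f0 (Y s) - incr (Y s) s t) \<le> C * ((t - s) powr \<alpha>) ^ 3)"

lemma davie_mono: "davie_solution s0 Y \<Longrightarrow> s0 \<le> s1 \<Longrightarrow> davie_solution s1 Y"
  unfolding davie_solution_def by (meson order_trans)

lemma davie_approx:
  assumes C: "\<And>s t. s0 \<le> s \<Longrightarrow> s \<le> t \<Longrightarrow> t \<le> T \<Longrightarrow>
      norm (Y t - Y s - (t - s) *\<^sub>R f0 (Y s) - incr (Y s) s t) \<le> C * ((t - s) powr \<alpha>) ^ 3"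
    and "0 \<le> s0" "0 < h" "s0 + real n * h \<le> T"
  shows "approx_scheme C s0 h n (\<lambda>i. Y (s0 + real i * h))"
  unfolding approx_scheme_def
proof (intro conjI allI impI)
  fix i assume i: "i < n"
  have "real (Suc i) * h \<le> real n * h" using i assms by (intro mult_right_mono) auto
  then have "s0 + real (Suc i) * h \<le> T" using assms by linarith
  moreover have "s0 + real (Suc i) * h - (s0 + real i * h) = h" by (simp add: algebra_simps)
  moreover have "s0 \<le> s0 + real i * h" "s0 + real i * h \<le> s0 + real (Suc i) * h"
    using assms by (auto simp: algebra_simps)
  ultimately show "norm (Y (s0 + real (Suc i) * h) - Y (s0 + real i * h) - h *\<^sub>R f0 (Y (s0 + real i * h)) -
          incr (Y (s0 + real i * h)) (s0 + real i * h) (s0 + real (Suc i) * h)) \<le> C * (h powr \<alpha>) ^ 3"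
    using C[of "s0 + real i * h" "s0 + real (Suc i) * h"] by metis
qed (use assms in auto)

lemma approx_mono: "approx_scheme E s h n y \<Longrightarrow> E \<le> E' \<Longrightarrow> approx_scheme E' s h n y"
proof -
  assume a: "approx_scheme E s h n y" "E \<le> E'"
  have "E * (h powr \<alpha>) ^ 3 \<le> E' * (h powr \<alpha>) ^ 3" using a by (intro mult_right_mono) auto
  then show ?thesis using a(1) unfolding approx_scheme_def by (meson order_trans)
qed

text \<open>A solution sampled on a grid is an approximate scheme, so the stability of schemes applies
  to it.\<close>

lemma davie_scheme:
  assumes Y: "davie_solution s0 Y" and s0: "0 \<le> s0" and E: "0 \<le> E"
  obtains C h0 where "0 \<le> C" "0 < h0" "h0 \<le> 1"
    "\<And>h n z j. approx_scheme E s0 h n z \<Longrightarrow> h \<le> h0 \<Longrightarrow> z 0 = Y s0 \<Longrightarrow> j \<le> n \<Longrightarrow>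
       norm (z j - Y (s0 + real j * h)) \<le> C * h powr (3 * \<alpha> - 1)"
proof -
  obtain C1 where C1: "0 \<le> C1" "\<And>s t. s0 \<le> s \<Longrightarrow> s \<le> t \<Longrightarrow> t \<le> T \<Longrightarrow>
      norm (Y t - Y s - (t - s) *\<^sub>R f0 (Y s) - incr (Y s) s t) \<le> C1 * ((t - s) powr \<alpha>) ^ 3"
    using Y unfolding davie_solution_def by blast
  have E1: "0 \<le> E + C1" using E C1 by simp
  obtain C h0 where Ch: "0 \<le> C" "0 < h0" "h0 \<le> 1"
    and st: "\<And>s h n y z j. approx_scheme (E + C1) s h n y \<Longrightarrow> approx_scheme (E + C1) s h n z \<Longrightarrow> h \<le> h0 \<Longrightarrow>
       norm (y 0) \<le> norm (Y s0) \<Longrightarrow> y 0 = z 0 \<Longrightarrow> j \<le> n \<Longrightarrow> norm (y j - z j) \<le> C * h powr (3 * \<alpha> - 1)"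
    using approx_stability[OF E1, of "norm (Y s0)"] by (metis norm_ge_zero)
  show thesis
  proof (rule that[OF Ch])
    fix h n z j assume ap: "approx_scheme E s0 h n z" and h: "h \<le> h0" and z0: "z 0 = Y s0" and j: "j \<le> n"
    have "approx_scheme C1 s0 h n (\<lambda>i. Y (s0 + real i * h))"
      using ap s0 C1 by (intro davie_approx) (auto simp: approx_scheme_def)
    then have "approx_scheme (E + C1) s0 h n (\<lambda>i. Y (s0 + real i * h))" by (rule approx_mono) (use E in simp)
    then show "norm (z j - Y (s0 + real j * h)) \<le> C * h powr (3 * \<alpha> - 1)"
      using C1 by (intro st[OF approx_mono[OF ap] _ h _ _ j]) (auto simp: z0)
  qed
qed

lemma grid_powr_tendsto_0:
  assumes "0 < d"
  shows "(\<lambda>n. C * (d / real (Suc n)) powr (3 * \<alpha> - 1)) \<longlonglongrightarrow> 0"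
proof -
  have "(\<lambda>n. d * inverse (real (Suc n))) \<longlonglongrightarrow> d * 0" by (intro tendsto_mult tendsto_const LIMSEQ_inverse_real_of_nat)
  then have "(\<lambda>n. d / real (Suc n)) \<longlonglongrightarrow> 0" by (simp add: divide_inverse)
  then have "(\<lambda>n. (d / real (Suc n)) powr (3 * \<alpha> - 1)) \<longlonglongrightarrow> 0 powr (3 * \<alpha> - 1)"
    using \<alpha> assms by (intro tendsto_powr2) (auto intro!: always_eventually)
  then show ?thesis using tendsto_mult_left[of _ 0 sequentially C] by simp
qed

lemma grid_eventually_small:
  assumes "0 < d" "0 < h0"
  shows "eventually (\<lambda>n. d / real (Suc n) \<le> h0) sequentially"
proof -
  have "(\<lambda>n. d * inverse (real (Suc n))) \<longlonglongrightarrow> d * 0" by (intro tendsto_mult tendsto_const LIMSEQ_inverse_real_of_nat)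
  then have "eventually (\<lambda>n. d * inverse (real (Suc n)) < h0) sequentially"
    using assms by (intro order_tendstoD) auto
  then show ?thesis by eventually_elim (simp add: divide_inverse)
qed

lemma davie_scheme_tendsto:
  assumes Y: "davie_solution s0 Y" and t: "0 \<le> s0" "s0 < t" "t \<le> T" and E: "0 \<le> E"
    and ap: "eventually (\<lambda>n. approx_scheme E s0 ((t - s0) / real (Suc n)) (Suc n) (z n) \<and> z n 0 = Y s0) sequentially"
  shows "(\<lambda>n. z n (Suc n)) \<longlonglongrightarrow> Y t"
proof -
  obtain C h0 where Ch: "0 \<le> C" "0 < h0" "h0 \<le> 1"
    and st: "\<And>h n z j. approx_scheme E s0 h n z \<Longrightarrow> h \<le> h0 \<Longrightarrow> z 0 = Y s0 \<Longrightarrow> j \<le> n \<Longrightarrow>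
       norm (z j - Y (s0 + real j * h)) \<le> C * h powr (3 * \<alpha> - 1)"
    using davie_scheme[OF Y t(1) E] by blast
  have d: "0 < t - s0" using t by simp
  have "eventually (\<lambda>n. norm (z n (Suc n) - Y t) \<le> C * ((t - s0) / real (Suc n)) powr (3 * \<alpha> - 1)) sequentially"
    using ap grid_eventually_small[OF d Ch(2)]
  proof eventually_elim
    case (elim n)
    then show ?case using st[of "(t - s0) / real (Suc n)" "Suc n" "z n" "Suc n"] by simp
  qed
  then have "(\<lambda>n. z n (Suc n) - Y t) \<longlonglongrightarrow> 0"
    by (rule Lim_null_comparison) (rule grid_powr_tendsto_0[OF d])
  then show ?thesis by (simp add: LIM_zero_iff)
qed

text \<open>The samples of \<open>Z\<close> form a scheme that converges to \<open>Y\<close>.\<close>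

lemma davie_unique:
  assumes Y: "davie_solution s0 Y" and Z: "davie_solution s0 Z" and eq: "Y s0 = Z s0"
    and t: "0 \<le> s0" "s0 \<le> t" "t \<le> T"
  shows "Y t = Z t"
proof (cases "t = s0")
  case False
  then have s0t: "s0 < t" using t by simp
  obtain C1 where C1: "0 \<le> C1" "\<And>s t. s0 \<le> s \<Longrightarrow> s \<le> t \<Longrightarrow> t \<le> T \<Longrightarrow>
      norm (Z t - Z s - (t - s) *\<^sub>R f0 (Z s) - incr (Z s) s t) \<le> C1 * ((t - s) powr \<alpha>) ^ 3"
    using Z unfolding davie_solution_def by blast
  have ap: "approx_scheme C1 s0 ((t - s0) / real (Suc n)) (Suc n) (\<lambda>i. Z (s0 + real i * ((t - s0) / real (Suc n))))" for n
    using t s0t by (intro davie_approx C1(2)) (auto simp del: of_nat_Suc)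
  have "(\<lambda>n. Z (s0 + real (Suc n) * ((t - s0) / real (Suc n)))) \<longlonglongrightarrow> Y t"
    by (rule davie_scheme_tendsto[OF Y t(1) s0t t(3) C1(1), of "\<lambda>n i. Z (s0 + real i * ((t - s0) / real (Suc n)))"])
      (simp only: ap, simp add: eq)
  then have "(\<lambda>n. Z t) \<longlonglongrightarrow> Y t" by simp
  then show ?thesis using LIMSEQ_unique tendsto_const by blast
qed (use eq in simp)

lemma incr_le:
  assumes "0 \<le> p" "p \<le> q" "q \<le> T"
  shows "norm (incr y p q) \<le> (K\<^sup>2 + K ^ 4 * T powr \<alpha>) * (q - p) powr \<alpha>"
proof -
  define w where "w = (q - p) powr \<alpha>"
  have w: "0 \<le> w" "w \<le> T powr \<alpha>" using assms \<alpha> by (auto simp: w_def intro!: powr_mono2)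
  have "norm (incr y p q) \<le> K * (K * w) + K * K\<^sup>2 * (K * w\<^sup>2)"
    unfolding incr_def w_def using X_le[OF assms] XX_le[OF assms]
    by (intro norm_triangle_le add_mono norm_apply_le f_le lft_apply_le level2_le)
  also have "\<dots> = K\<^sup>2 * w + K ^ 4 * w * w" by (simp add: algebra_simps eval_nat_numeral)
  also have "\<dots> \<le> K\<^sup>2 * w + K ^ 4 * T powr \<alpha> * w"
    using w K0 by (intro add_mono mult_right_mono mult_left_mono) auto
  finally show ?thesis by (simp add: w_def algebra_simps)
qed

lemma incr_lip:
  assumes "0 \<le> p" "p \<le> q" "q \<le> T"
  shows "norm (incr y p q - incr z p q) \<le> (K\<^sup>2 * T powr \<alpha> + 2 * K ^ 4 * (T powr \<alpha>)\<^sup>2) * norm (y - z)"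
proof -
  define w where "w = T powr \<alpha>"
  have pw: "(q - p) powr \<alpha> \<le> w" using assms \<alpha> by (auto simp: w_def intro!: powr_mono2)
  have x: "norm (X q - X p) \<le> K * w" using X_le[OF assms] mult_left_mono[OF pw K0(1)] by linarith
  have "((q - p) powr \<alpha>)\<^sup>2 \<le> w\<^sup>2" using pw by (intro power_mono) auto
  then have xx: "norm (XX p q) \<le> K * w\<^sup>2" using XX_le[OF assms] mult_left_mono[OF _ K0(1)] order_trans by blast
  have "incr y p q - incr z p q = (f y - f z) (X q - X p) + lft (level2 y - level2 z) (XX p q)"
    by (simp add: incr_def lft_diff blinfun.diff_left)
  also have "norm \<dots> \<le> (K * norm (y - z)) * (K * w) + K * (2 * K\<^sup>2 * norm (y - z)) * (K * w\<^sup>2)"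
    using x xx by (intro norm_triangle_le add_mono norm_apply_le f_lip lft_apply_le level2_lip)
  finally show ?thesis by (simp add: w_def algebra_simps eval_nat_numeral)
qed

text \<open>By the definition of the defect, moving both end points changes the Euler step by the steps
  over the two gaps and by two defects with constant base point.\<close>

lemma incr_time_diff:
  assumes "0 \<le> s'" "s' \<le> s" "s \<le> t" "s' \<le> t'" "t' \<le> t" "t \<le> T"
  shows "norm (incr y s' t' - incr y s t) \<le> (K\<^sup>2 + 2 * K ^ 4 * T powr \<alpha>) * ((s - s') powr \<alpha> + (t - t') powr \<alpha>)"
proof -
  have dd: "norm (defect y y p q r) \<le> K\<^sup>2 * (norm (X q - X p) * norm (X r - X q))"
    if "0 \<le> p" "p \<le> q" "q \<le> r" "r \<le> T" for p q r
  proof -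
    have "norm (Df y (f y (X q - X p)) (X r - X q)) \<le> K * (K * norm (X q - X p)) * norm (X r - X q)"
      by (intro norm_apply_le Df_le f_le order_refl)
    then show ?thesis using defect_eq[OF that, of y y] by (simp add: power2_eq_square blinfun.diff_left blinfun.minus_left blinfun.zero_left lft_diff[of "level2 y" "level2 y", simplified])
  qed
  have xT: "norm (X q - X p) \<le> K * T powr \<alpha>" if "0 \<le> p" "p \<le> q" "q \<le> T" for p q
  proof -
    have "(q - p) powr \<alpha> \<le> T powr \<alpha>" using that \<alpha> by (intro powr_mono2) auto
    then show ?thesis using X_le[OF that] mult_left_mono[OF _ K0(1)] order_trans by blast
  qed
  have d1: "norm (defect y y s' t' t) \<le> K ^ 4 * T powr \<alpha> * (t - t') powr \<alpha>"
  proof -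
    have "norm (X t' - X s') * norm (X t - X t') \<le> (K * T powr \<alpha>) * (K * (t - t') powr \<alpha>)"
      using assms by (intro mult_mono xT X_le) (auto simp: K0)
    then have "norm (defect y y s' t' t) \<le> K\<^sup>2 * ((K * T powr \<alpha>) * (K * (t - t') powr \<alpha>))"
      using dd[of s' t' t] assms mult_left_mono[of _ _ "K\<^sup>2"] by (meson order_trans zero_le_power2)
    then show ?thesis by (simp add: algebra_simps eval_nat_numeral)
  qed
  have d2: "norm (defect y y s' s t) \<le> K ^ 4 * T powr \<alpha> * (s - s') powr \<alpha>"
  proof -
    have "norm (X s - X s') * norm (X t - X s) \<le> (K * (s - s') powr \<alpha>) * (K * T powr \<alpha>)"
      using assms by (intro mult_mono xT X_le) (auto simp: K0)
    then have "norm (defect y y s' s t) \<le> K\<^sup>2 * ((K * (s - s') powr \<alpha>) * (K * T powr \<alpha>))"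
      using dd[of s' s t] assms mult_left_mono[of _ _ "K\<^sup>2"] by (meson order_trans zero_le_power2)
    then show ?thesis by (simp add: algebra_simps eval_nat_numeral)
  qed
  have "incr y s' t' - incr y s t = defect y y s' t' t - incr y t' t - defect y y s' s t + incr y s' s"
    by (simp add: defect_def)
  also have "norm \<dots> \<le> K ^ 4 * T powr \<alpha> * (t - t') powr \<alpha> + (K\<^sup>2 + K ^ 4 * T powr \<alpha>) * (t - t') powr \<alpha>
      + K ^ 4 * T powr \<alpha> * (s - s') powr \<alpha> + (K\<^sup>2 + K ^ 4 * T powr \<alpha>) * (s - s') powr \<alpha>"
    using assms by (intro norm_triangle_le norm_triangle_le_diff add_mono d1 d2 incr_le) auto
  finally show ?thesis by (simp add: algebra_simps)
qed

text \<open>Grid samples satisfy the growth estimate of approximate schemes, and every time lies on a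
  fine grid.\<close>

lemma davie_bounded:
  assumes Y: "davie_solution s0 Y" and s0: "0 \<le> s0"
  obtains B where "0 \<le> B" "\<And>t. s0 \<le> t \<Longrightarrow> t \<le> T \<Longrightarrow> norm (Y t) \<le> B"
proof -
  obtain C1 where C1: "0 \<le> C1" "\<And>s t. s0 \<le> s \<Longrightarrow> s \<le> t \<Longrightarrow> t \<le> T \<Longrightarrow>
      norm (Y t - Y s - (t - s) *\<^sub>R f0 (Y s) - incr (Y s) s t) \<le> C1 * ((t - s) powr \<alpha>) ^ 3"
    using Y unfolding davie_solution_def by blast
  obtain B h0 where B: "0 \<le> B" "0 < h0"
    and bd: "\<And>s h n y. approx_scheme C1 s h n y \<Longrightarrow> h \<le> h0 \<Longrightarrow> norm (y 0) \<le> norm (Y s0) \<Longrightarrow> (\<forall>j\<le>n. norm (y j) \<le> B)"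
    using approx_bounded[OF C1(1), of "norm (Y s0)"] by (metis norm_ge_zero)
  show thesis
  proof (rule that[of "B + norm (Y s0)"])
    fix t assume t: "s0 \<le> t" "t \<le> T"
    show "norm (Y t) \<le> B + norm (Y s0)"
    proof (cases "t = s0")
      case False
      then have d: "0 < t - s0" using t by simp
      obtain n where n: "(t - s0) / real (Suc n) \<le> h0"
        using eventually_happens'[OF sequentially_bot grid_eventually_small[OF d B(2)]] by blast
      have "approx_scheme C1 s0 ((t - s0) / real (Suc n)) (Suc n) (\<lambda>i. Y (s0 + real i * ((t - s0) / real (Suc n))))"
        using d t s0 by (intro davie_approx C1(2)) auto
      from bd[OF this n] have "norm (Y (s0 + real (Suc n) * ((t - s0) / real (Suc n)))) \<le> B" by auto
      then show ?thesis by (simp add: add_increasing2)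
    qed (use B in simp)
  qed (use B in simp)
qed

lemma davie_holder:
  assumes Y: "davie_solution s0 Y" and s0: "0 \<le> s0"
  obtains C where "0 \<le> C" 
    "\<And>s t. s0 \<le> s \<Longrightarrow> s \<le> t \<Longrightarrow> t \<le> T \<Longrightarrow> norm (Y t - Y s) \<le> C * (t - s) powr \<alpha>"
    "\<And>s t. s0 \<le> s \<Longrightarrow> s \<le> t \<Longrightarrow> t \<le> T \<Longrightarrow> norm (Y t - Y s - f (Y s) (X t - X s)) \<le> C * ((t - s) powr \<alpha>)\<^sup>2"
proof -
  obtain C1 where C1: "0 \<le> C1" "\<And>s t. s0 \<le> s \<Longrightarrow> s \<le> t \<Longrightarrow> t \<le> T \<Longrightarrow>
      norm (Y t - Y s - (t - s) *\<^sub>R f0 (Y s) - incr (Y s) s t) \<le> C1 * ((t - s) powr \<alpha>) ^ 3"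
    using Y unfolding davie_solution_def by blast
  obtain B where B: "0 \<le> B" "\<And>t. s0 \<le> t \<Longrightarrow> t \<le> T \<Longrightarrow> norm (Y t) \<le> B"
    using davie_bounded[OF Y s0] by blast
  define F where "F = norm (f0 0) + K * B"
  have F: "0 \<le> F" "norm (f0 (Y s)) \<le> F" if "s0 \<le> s" "s \<le> T" for s
    using f0_le[of "Y s"] mult_left_mono[OF B(2)[OF that] K0(1)] mult_nonneg_nonneg[OF K0(1) B(1)] norm_ge_zero[of "f0 0"]
    unfolding F_def by linarith+
  define W where "W = T powr \<alpha>"
  define Q where "Q = T powr (1 - 2 * \<alpha>)"
  have W0: "0 \<le> W" "0 \<le> Q" by (auto simp: W_def Q_def)
  define C2 where "C2 = Q * F + K ^ 4 + C1 * W"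
  have F0: "0 \<le> F" using B(1) K0 by (simp add: F_def)
  have C2: "0 \<le> C2" unfolding C2_def using F0 W0 K0 C1 by simp
  have fo: "norm (Y t - Y s - f (Y s) (X t - X s)) \<le> C2 * ((t - s) powr \<alpha>)\<^sup>2"
    if st: "s0 \<le> s" "s \<le> t" "t \<le> T" for s t
  proof -
    define w where "w = (t - s) powr \<alpha>"
    have st0: "0 \<le> s" using st s0 by simp
    have w: "0 \<le> w" "w \<le> W" using st st0 \<alpha> by (auto simp: w_def W_def intro!: powr_mono2)
    have tsw: "t - s \<le> Q * w\<^sup>2"
    proof (cases "t = s")
      case False
      have "t - s = (t - s) powr (1 - 2 * \<alpha>) * (t - s) powr (2 * \<alpha>)"
        using st False by (simp flip: powr_add)
      also have "(t - s) powr (2 * \<alpha>) = w\<^sup>2" unfolding w_def using st by (intro powr2) simp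
      also have "(t - s) powr (1 - 2 * \<alpha>) * w\<^sup>2 \<le> Q * w\<^sup>2"
        using st st0 \<alpha> by (intro mult_right_mono) (auto simp: Q_def intro!: powr_mono2)
      finally show ?thesis .
    qed (use W0 w in simp)
    have "Y t - Y s - f (Y s) (X t - X s) = (Y t - Y s - (t - s) *\<^sub>R f0 (Y s) - incr (Y s) s t) + (t - s) *\<^sub>R f0 (Y s) + lft (level2 (Y s)) (XX s t)"
      by (simp add: incr_def)
    also have "norm \<dots> \<le> C1 * W * w\<^sup>2 + Q * w\<^sup>2 * F + K * K\<^sup>2 * (K * w\<^sup>2)"
    proof (intro norm_triangle_le add_mono lft_apply_le level2_le)
      have "norm (Y t - Y s - (t - s) *\<^sub>R f0 (Y s) - incr (Y s) s t) \<le> C1 * w * w\<^sup>2"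
        using C1(2)[OF st] by (simp add: w_def eval_nat_numeral)
      also have "\<dots> \<le> C1 * W * w\<^sup>2" using C1 w by (intro mult_right_mono mult_left_mono) auto
      finally show "norm (Y t - Y s - (t - s) *\<^sub>R f0 (Y s) - incr (Y s) s t) \<le> C1 * W * w\<^sup>2" .
      show "norm ((t - s) *\<^sub>R f0 (Y s)) \<le> Q * w\<^sup>2 * F"
        using tsw st F F0 w W0 by (auto intro!: mult_mono)
      show "norm (XX s t) \<le> K * w\<^sup>2" using XX_le[of s t] st st0 by (simp add: w_def)
    qed
    also have "\<dots> = C2 * w\<^sup>2" by (simp add: C2_def algebra_simps eval_nat_numeral)
    finally show ?thesis by (simp add: w_def)
  qed
  show thesis
  proof (rule that[of "C2 + (C2 * W + K\<^sup>2)"])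
    show "0 \<le> C2 + (C2 * W + K\<^sup>2)" using C2 W0 by simp
    fix s t assume st: "s0 \<le> s" "s \<le> t" "t \<le> T"
    define w where "w = (t - s) powr \<alpha>"
    have st0: "0 \<le> s" using st s0 by simp
    have w: "0 \<le> w" "w \<le> W" using st st0 \<alpha> by (auto simp: w_def W_def intro!: powr_mono2)
    have "C2 * w\<^sup>2 \<le> (C2 + (C2 * W + K\<^sup>2)) * w\<^sup>2" using C2 W0 by (intro mult_right_mono) auto
    then show "norm (Y t - Y s - f (Y s) (X t - X s)) \<le> (C2 + (C2 * W + K\<^sup>2)) * ((t - s) powr \<alpha>)\<^sup>2"
      using fo[OF st] by (simp add: w_def)
    have "norm (Y t - Y s) \<le> C2 * w\<^sup>2 + K * (K * w)"
      using norm_triangle_le[OF add_mono[OF fo[OF st] norm_apply_le[OF f_le X_le[OF st0 st(2,3)]]], of "Y s"]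
      by (simp add: w_def)
    also have "\<dots> \<le> C2 * W * w + K\<^sup>2 * w"
      using mult_right_mono[OF mult_left_mono[OF w(2) C2] w(1)] by (simp add: power2_eq_square mult_ac)
    also have "\<dots> \<le> (C2 + (C2 * W + K\<^sup>2)) * w" using C2 w by (simp add: algebra_simps)
    finally show "norm (Y t - Y s) \<le> (C2 + (C2 * W + K\<^sup>2)) * (t - s) powr \<alpha>" by (simp add: w_def)
  qed
qed

text \<open>The expansion over a long interval is a matter of boundedness, since its error bound is then
  bounded away from zero.\<close>

lemma davie_intro:
  assumes loc: "\<And>s t. s0 \<le> s \<Longrightarrow> s \<le> t \<Longrightarrow> t \<le> T \<Longrightarrow> t - s \<le> \<tau> \<Longrightarrow>
      norm (Y t - Y s - (t - s) *\<^sub>R f0 (Y s) - incr (Y s) s t) \<le> C * ((t - s) powr \<alpha>) ^ 3"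
    and C: "0 \<le> C" and \<tau>: "0 < \<tau>" and s0: "0 \<le> s0"
    and B: "\<And>t. s0 \<le> t \<Longrightarrow> t \<le> T \<Longrightarrow> norm (Y t) \<le> B"
  shows "davie_solution s0 Y"
proof -
  define D where "D = B + B + T * (norm (f0 0) + K * B) + (K\<^sup>2 + K ^ 4 * T powr \<alpha>) * T powr \<alpha>"
  define p where "p = (\<tau> powr \<alpha>) ^ 3"
  have p: "0 < p" using \<tau> by (simp add: p_def)
  define C' where "C' = C + \<bar>D\<bar> / p"
  show ?thesis unfolding davie_solution_def
  proof (intro exI[of _ C'] conjI allI impI)
    show "0 \<le> C'" using C p by (simp add: C'_def)
    fix s t assume st: "s0 \<le> s \<and> s \<le> t \<and> t \<le> T"
    define w3 where "w3 = ((t - s) powr \<alpha>) ^ 3"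
    show "norm (Y t - Y s - (t - s) *\<^sub>R f0 (Y s) - incr (Y s) s t) \<le> C' * ((t - s) powr \<alpha>) ^ 3"
    proof (cases "t - s \<le> \<tau>")
      case True
      have "C * w3 \<le> C' * w3" using p by (intro mult_right_mono) (auto simp: C'_def w3_def)
      then show ?thesis using loc[of s t] st True by (simp add: w3_def)
    next
      case False
      have "p \<le> w3" unfolding p_def w3_def using False \<tau> \<alpha> by (intro power_mono powr_mono2) auto
      then have "\<bar>D\<bar> \<le> \<bar>D\<bar> / p * w3" using p mult_left_mono[of p w3 "\<bar>D\<bar>"] by (simp add: field_simps)
      also have "\<dots> \<le> C' * w3" using C by (intro mult_right_mono) (auto simp: C'_def w3_def)
      finally have D: "D \<le> C' * w3" by simp
      have B0: "norm (Y s) \<le> B" "norm (Y t) \<le> B" "0 \<le> B" using B st norm_ge_zero[of "Y s"] order_trans by (blast, blast, meson)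
      have "norm (Y t - Y s - (t - s) *\<^sub>R f0 (Y s) - incr (Y s) s t) \<le> D" unfolding D_def
      proof (intro norm_triangle_le_diff add_mono B0)
        have "norm (f0 (Y s)) \<le> norm (f0 0) + K * B" using f0_le[of "Y s"] mult_left_mono[OF B0(1) K0(1)] by linarith
        then show "norm ((t - s) *\<^sub>R f0 (Y s)) \<le> T * (norm (f0 0) + K * B)"
          using st s0 T by (auto intro!: mult_mono)
        have "norm (incr (Y s) s t) \<le> (K\<^sup>2 + K ^ 4 * T powr \<alpha>) * (t - s) powr \<alpha>" using st s0 by (intro incr_le) auto
        also have "\<dots> \<le> (K\<^sup>2 + K ^ 4 * T powr \<alpha>) * T powr \<alpha>"
          using st s0 \<alpha> K0 by (intro mult_left_mono powr_mono2) auto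
        finally show "norm (incr (Y s) s t) \<le> (K\<^sup>2 + K ^ 4 * T powr \<alpha>) * T powr \<alpha>" .
      qed
      then show ?thesis using D by (simp add: w3_def)
    qed
  qed
qed

end

section \<open>Existence of solutions\<close>

lemma geometric_steps_convergent:
  fixes u :: "nat \<Rightarrow> 'a::banach"
  assumes "\<And>n. N \<le> n \<Longrightarrow> norm (u (Suc n) - u n) \<le> c * r ^ n" and r: "0 \<le> r" "r < 1"
  shows "convergent u"
proof -
  have "summable (\<lambda>n. c * r ^ n)" using r by (intro summable_mult summable_geometric) simp
  then have "summable (\<lambda>n. u (Suc n) - u n)"
    by (rule summable_comparison_test'[where N = N]) (rule assms)
  then have "(\<lambda>n. \<Sum>i<n. u (Suc i) - u i) \<longlonglongrightarrow> (\<Sum>i. u (Suc i) - u i)" by (rule summable_LIMSEQ)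
  then have "(\<lambda>n. u n - u 0 + u 0) \<longlonglongrightarrow> (\<Sum>i. u (Suc i) - u i) + u 0"
    by (intro tendsto_add tendsto_const) (simp add: sum_lessThan_telescope)
  then show ?thesis by (auto simp: convergent_def)
qed

context rough_equation
begin

primrec euler :: "'w \<Rightarrow> real \<Rightarrow> nat \<Rightarrow> 'w" where
  "euler \<xi> h 0 = \<xi>"
| "euler \<xi> h (Suc i) = euler \<xi> h i + h *\<^sub>R f0 (euler \<xi> h i) + incr (euler \<xi> h i) (real i * h) (real (Suc i) * h)"

lemma euler_approx:
  assumes "0 < h" "real n * h \<le> T" "0 \<le> E"
  shows "approx_scheme E 0 h n (euler \<xi> h)"
  using assms by (simp add: approx_scheme_def)

lemma euler_estimates:
  obtains B C \<tau> h0 where "0 \<le> B" "0 \<le> C" "0 < \<tau>" "0 < h0"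
    "\<And>h n j. 0 < h \<Longrightarrow> h \<le> h0 \<Longrightarrow> real n * h \<le> T \<Longrightarrow> j \<le> n \<Longrightarrow> norm (euler \<xi> h j) \<le> B"
    "\<And>h n i j. 0 < h \<Longrightarrow> h \<le> h0 \<Longrightarrow> real n * h \<le> T \<Longrightarrow> i \<le> j \<Longrightarrow> j \<le> n \<Longrightarrow> real (j - i) * h \<le> \<tau> \<Longrightarrow>
       norm (euler \<xi> h j - euler \<xi> h i - (real (j - i) * h) *\<^sub>R f0 (euler \<xi> h i) - incr (euler \<xi> h i) (real i * h) (real j * h))
         \<le> C * ((real (j - i) * h) powr \<alpha>) ^ 3"
    "\<And>h n i j. 0 < h \<Longrightarrow> h \<le> h0 \<Longrightarrow> real n * h \<le> T \<Longrightarrow> i \<le> j \<Longrightarrow> j \<le> n \<Longrightarrow> real (j - i) * h \<le> \<tau> \<Longrightarrow>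
       norm (euler \<xi> h j - euler \<xi> h i) \<le> C * (real (j - i) * h) powr \<alpha>"
proof -
  obtain B h0 where B: "0 \<le> B" "0 < h0" "h0 \<le> 1"
    and bd: "\<And>s h n y. approx_scheme 0 s h n y \<Longrightarrow> h \<le> h0 \<Longrightarrow> norm (y 0) \<le> norm \<xi> \<Longrightarrow>
       (\<forall>j\<le>n. norm (y j) \<le> B) \<and> (\<forall>j<n. norm (drift s h y j) \<le> B)"
    using approx_bounded[OF order_refl norm_ge_zero[of \<xi>]] by blast
  obtain C \<tau> where C: "0 \<le> C" "0 < \<tau>" "\<tau> \<le> 1"
    and la: "\<And>s h n y b i j. driven s h n y b \<Longrightarrow> (\<And>i. i < n \<Longrightarrow> norm (b i) \<le> B) \<Longrightarrow> i \<le> j \<Longrightarrow> j \<le> n \<Longrightarrow>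
       real (j - i) * h \<le> \<tau> \<Longrightarrow> norm (remd s h y b i j) \<le> C * ((real (j - i) * h) powr \<alpha>) ^ 3 \<and>
       norm (y j - y i) \<le> C * (real (j - i) * h) powr \<alpha>"
    using local_apriori[OF B(1)] by blast
  show thesis
  proof (rule that[of B "C + K * C" \<tau> h0])
    fix h n j assume h: "0 < h" "h \<le> h0" "real n * h \<le> T"
    note ap = euler_approx[OF h(1,3) order_refl, of \<xi>]
    have bd': "(\<forall>j\<le>n. norm (euler \<xi> h j) \<le> B) \<and> (\<forall>j<n. norm (drift 0 h (euler \<xi> h) j) \<le> B)"
      using bd[OF ap h(2)] by simp
    then show "j \<le> n \<Longrightarrow> norm (euler \<xi> h j) \<le> B" by simp
    have dr: "drift 0 h (euler \<xi> h) i = f0 (euler \<xi> h i)" for i using h by (simp add: drift_def)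
    fix i assume ij: "i \<le> j" "j \<le> n" "real (j - i) * h \<le> \<tau>"
    define l where "l = real (j - i) * h"
    define w where "w = l powr \<alpha>"
    have l: "0 \<le> l" "l \<le> 1" using h ij C by (auto simp: l_def)
    have w: "0 \<le> w" by (simp add: w_def)
    have la': "norm (remd 0 h (euler \<xi> h) (drift 0 h (euler \<xi> h)) i j) \<le> C * w ^ 3"
        "norm (euler \<xi> h j - euler \<xi> h i) \<le> C * w"
      using la[OF approx_driven[OF ap] _ ij] bd' by (auto simp: w_def l_def)
    have CK: "C \<le> C + K * C" using C K0 by simp
    show "norm (euler \<xi> h j - euler \<xi> h i) \<le> (C + K * C) * (real (j - i) * h) powr \<alpha>"
      using la'(2) mult_right_mono[OF CK w] by (simp add: w_def l_def)
    have "norm (h *\<^sub>R (\<Sum>k=i..<j. f0 (euler \<xi> h k) - f0 (euler \<xi> h i))) \<le> (K * (C * w)) * l" unfolding l_def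
    proof (rule sum_drift_le)
      fix k assume k: "i \<le> k" "k < j"
      have kl: "real (k - i) * h \<le> l" unfolding l_def using k h by (intro mult_right_mono) auto
      then have "norm (euler \<xi> h k - euler \<xi> h i) \<le> C * (real (k - i) * h) powr \<alpha>"
        using la[OF approx_driven[OF ap] _ k(1), of] bd' k ij by (auto simp: l_def)
      also have "\<dots> \<le> C * w" unfolding w_def using kl h C \<alpha> by (intro mult_left_mono powr_mono2) auto
      finally have "K * norm (euler \<xi> h k - euler \<xi> h i) \<le> K * (C * w)" using K0 by (intro mult_left_mono) auto
      then show "norm (f0 (euler \<xi> h k) - f0 (euler \<xi> h i)) \<le> K * (C * w)" using f0_lip order_trans by blast
    qed (use h in simp)
    also have "\<dots> \<le> (K * (C * w)) * w\<^sup>2" unfolding w_def using le_powr2[OF l] K0 C by (intro mult_left_mono) auto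
    also have "\<dots> = K * C * w ^ 3" by (simp add: eval_nat_numeral)
    finally have sm: "norm (h *\<^sub>R (\<Sum>k=i..<j. f0 (euler \<xi> h k) - f0 (euler \<xi> h i))) \<le> K * C * w ^ 3" .
    have "euler \<xi> h j - euler \<xi> h i - (real (j - i) * h) *\<^sub>R f0 (euler \<xi> h i) - incr (euler \<xi> h i) (real i * h) (real j * h)
      = remd 0 h (euler \<xi> h) (drift 0 h (euler \<xi> h)) i j + h *\<^sub>R (\<Sum>k=i..<j. f0 (euler \<xi> h k) - f0 (euler \<xi> h i))"
      by (simp add: remd_def dr sum_subtractf scaleR_diff_right sum_constant_scaleR mult_ac)
    then have "norm (euler \<xi> h j - euler \<xi> h i - (real (j - i) * h) *\<^sub>R f0 (euler \<xi> h i) - incr (euler \<xi> h i) (real i * h) (real j * h))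
      \<le> C * w ^ 3 + K * C * w ^ 3" using norm_triangle_le[OF add_mono[OF la'(1) sm]] by simp
    then show "norm (euler \<xi> h j - euler \<xi> h i - (real (j - i) * h) *\<^sub>R f0 (euler \<xi> h i) - incr (euler \<xi> h i) (real i * h) (real j * h))
         \<le> (C + K * C) * ((real (j - i) * h) powr \<alpha>) ^ 3" by (simp add: w_def l_def algebra_simps)
  qed (use B C K0 in auto)
qed

lemma dyadic_tendsto: "(\<lambda>n. T / 2 ^ n) \<longlonglongrightarrow> 0"
proof -
  have "(\<lambda>n. T * (1/2) ^ n) \<longlonglongrightarrow> T * 0" by (intro tendsto_mult tendsto_const LIMSEQ_power_zero) simp
  then show ?thesis by (simp add: power_divide)
qed

text \<open>The index of the last point of the dyadic grid of level \<open>n\<close> that does not exceed \<open>t\<close>.\<close>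

definition dindex :: "nat \<Rightarrow> real \<Rightarrow> nat" where "dindex n t = nat \<lfloor>t / (T / 2 ^ n)\<rfloor>"

lemma dindex:
  assumes "0 \<le> t"
  shows "real (dindex n t) * (T / 2 ^ n) \<le> t" "t < (real (dindex n t) + 1) * (T / 2 ^ n)"
    "t \<le> T \<Longrightarrow> dindex n t \<le> 2 ^ n" "s \<le> t \<Longrightarrow> dindex n s \<le> dindex n t"
    "dindex (Suc n) t = 2 * dindex n t \<or> dindex (Suc n) t = 2 * dindex n t + 1"
proof -
  define x where "x = t / (T / 2 ^ n)"
  have h: "0 < T / 2 ^ n" using T by simp
  have x0: "0 \<le> x" using assms T by (simp add: x_def)
  have tx: "t = x * (T / 2 ^ n)" using T by (simp add: x_def)
  have d: "real (dindex n t) = of_int \<lfloor>x\<rfloor>" using x0 by (simp add: dindex_def x_def)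
  show 1: "real (dindex n t) * (T / 2 ^ n) \<le> t" unfolding d by (subst tx) (intro mult_right_mono, use h in auto)
  show "t < (real (dindex n t) + 1) * (T / 2 ^ n)" unfolding d by (subst tx) (intro mult_strict_right_mono, use h in auto)
  show "s \<le> t \<Longrightarrow> dindex n s \<le> dindex n t" unfolding dindex_def using h by (intro nat_mono floor_mono divide_right_mono) auto
  show "dindex n t \<le> 2 ^ n" if "t \<le> T"
  proof -
    have "real (dindex n t) * (T / 2 ^ n) \<le> 2 ^ n * (T / 2 ^ n)" using 1 that by simp
    then have "real (dindex n t) \<le> 2 ^ n" using h by (simp only: mult_le_cancel_right_pos)
    then show ?thesis by simp
  qed
  have "t / (T / 2 ^ Suc n) = 2 * x" by (simp add: x_def)
  then have "dindex (Suc n) t = nat \<lfloor>2 * x\<rfloor>" by (simp add: dindex_def)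
  moreover have "\<lfloor>2 * x\<rfloor> = 2 * \<lfloor>x\<rfloor> \<or> \<lfloor>2 * x\<rfloor> = 2 * \<lfloor>x\<rfloor> + 1" by linarith
  moreover have "dindex n t = nat \<lfloor>x\<rfloor>" by (simp add: dindex_def x_def)
  moreover have "0 \<le> \<lfloor>x\<rfloor>" using x0 by simp
  ultimately show "dindex (Suc n) t = 2 * dindex n t \<or> dindex (Suc n) t = 2 * dindex n t + 1"
    by (auto simp: nat_add_distrib nat_mult_distrib)
qed

lemma dindex_tendsto:
  assumes "0 \<le> t"
  shows "(\<lambda>n. real (dindex n t) * (T / 2 ^ n)) \<longlonglongrightarrow> t"
proof (rule real_tendsto_sandwich[of "\<lambda>n. t - T / 2 ^ n" _ _ "\<lambda>n. t"])
  show "\<forall>\<^sub>F n in sequentially. t - T / 2 ^ n \<le> real (dindex n t) * (T / 2 ^ n)"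
  proof (intro always_eventually allI)
    show "t - T / 2 ^ n \<le> real (dindex n t) * (T / 2 ^ n)" for n
      using dindex(2)[OF assms, of n] by (simp add: algebra_simps add_divide_distrib)
  qed
  show "\<forall>\<^sub>F n in sequentially. real (dindex n t) * (T / 2 ^ n) \<le> t"
    using dindex(1)[OF assms] by (auto intro!: always_eventually)
  show "(\<lambda>n. t - T / 2 ^ n) \<longlonglongrightarrow> t" using tendsto_diff[OF tendsto_const dyadic_tendsto, of t] by simp
qed simp

text \<open>The exact Euler scheme of step size \<open>h / 2\<close>, observed at every second point, makes one step
  errors of order \<open>h powr (3 * \<alpha>)\<close> with respect to step size \<open>h\<close>.\<close>

lemma euler_coarse:
  assumes est: "\<And>h n i j. 0 < h \<Longrightarrow> h \<le> h0 \<Longrightarrow> real n * h \<le> T \<Longrightarrow> i \<le> j \<Longrightarrow> j \<le> n \<Longrightarrow> real (j - i) * h \<le> \<tau> \<Longrightarrow>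
       norm (euler \<xi> h j - euler \<xi> h i - (real (j - i) * h) *\<^sub>R f0 (euler \<xi> h i) - incr (euler \<xi> h i) (real i * h) (real j * h))
         \<le> C * ((real (j - i) * h) powr \<alpha>) ^ 3"
    and h: "0 < h" "h \<le> h0" "h \<le> \<tau>" "real n * h \<le> T"
  shows "approx_scheme C 0 h n (\<lambda>i. euler \<xi> (h / 2) (2 * i))"
  unfolding approx_scheme_def
proof (intro conjI allI impI)
  fix i assume i: "i < n"
  have e: "real (2 * Suc i - 2 * i) * (h / 2) = h" "real (2 * i) * (h / 2) = 0 + real i * h"
     "real (2 * Suc i) * (h / 2) = 0 + real (Suc i) * h" by (auto simp: algebra_simps)
  have "norm (euler \<xi> (h/2) (2 * Suc i) - euler \<xi> (h/2) (2 * i) - (real (2 * Suc i - 2 * i) * (h/2)) *\<^sub>R f0 (euler \<xi> (h/2) (2 * i))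
     - incr (euler \<xi> (h/2) (2 * i)) (real (2 * i) * (h/2)) (real (2 * Suc i) * (h/2))) \<le> C * ((real (2 * Suc i - 2 * i) * (h/2)) powr \<alpha>) ^ 3"
    using h i by (intro est[where n = "2 * n"]) (auto simp: e(1))
  then show "norm (euler \<xi> (h / 2) (2 * Suc i) - euler \<xi> (h / 2) (2 * i) - h *\<^sub>R f0 (euler \<xi> (h / 2) (2 * i)) -
           incr (euler \<xi> (h / 2) (2 * i)) (0 + real i * h) (0 + real (Suc i) * h)) \<le> C * (h powr \<alpha>) ^ 3"
    unfolding e .
qed (use h in auto)

text \<open>The Euler schemes on consecutive dyadic grids differ by a multiple of
  \<open>(T / 2 ^ n) powr (3 * \<alpha> - 1)\<close>, which is summable in \<open>n\<close>. Hence they converge at every time, and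
  their local expansions, which have uniform constants, pass to the limit.\<close>

theorem davie_exists:
  obtains Y where "davie_solution 0 Y" "Y 0 = \<xi>"
proof -
  obtain B C \<tau> h0 where c: "0 \<le> B" "0 \<le> C" "0 < \<tau>" "0 < h0"
    and bd: "\<And>h n j. 0 < h \<Longrightarrow> h \<le> h0 \<Longrightarrow> real n * h \<le> T \<Longrightarrow> j \<le> n \<Longrightarrow> norm (euler \<xi> h j) \<le> B"
    and est: "\<And>h n i j. 0 < h \<Longrightarrow> h \<le> h0 \<Longrightarrow> real n * h \<le> T \<Longrightarrow> i \<le> j \<Longrightarrow> j \<le> n \<Longrightarrow> real (j - i) * h \<le> \<tau> \<Longrightarrow>
       norm (euler \<xi> h j - euler \<xi> h i - (real (j - i) * h) *\<^sub>R f0 (euler \<xi> h i) - incr (euler \<xi> h i) (real i * h) (real j * h))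
         \<le> C * ((real (j - i) * h) powr \<alpha>) ^ 3"
    and hol: "\<And>h n i j. 0 < h \<Longrightarrow> h \<le> h0 \<Longrightarrow> real n * h \<le> T \<Longrightarrow> i \<le> j \<Longrightarrow> j \<le> n \<Longrightarrow> real (j - i) * h \<le> \<tau> \<Longrightarrow>
       norm (euler \<xi> h j - euler \<xi> h i) \<le> C * (real (j - i) * h) powr \<alpha>"
    using euler_estimates[of \<xi>] by blast
  obtain C3 h3 where c3: "0 \<le> C3" "0 < h3" "h3 \<le> 1"
    and st: "\<And>s h n y z j. approx_scheme C s h n y \<Longrightarrow> approx_scheme C s h n z \<Longrightarrow> h \<le> h3 \<Longrightarrow>
       norm (y 0) \<le> norm \<xi> \<Longrightarrow> y 0 = z 0 \<Longrightarrow> j \<le> n \<Longrightarrow> norm (y j - z j) \<le> C3 * h powr (3 * \<alpha> - 1)"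
    using approx_stability[OF c(2) norm_ge_zero[of \<xi>]] by metis
  define h where "h n = T / 2 ^ n" for n :: nat
  \<comment> \<open>The Euler scheme of level \<open>n\<close>, extended to all times as a step function.\<close>
  define u where "u t n = euler \<xi> (h n) (dindex n t)" for t n
  have hp: "0 < h n" for n using T by (simp add: h_def)
  have hT: "real (2 ^ n) * h n \<le> T" for n by (simp add: h_def)
  have hs: "h (Suc n) = h n / 2" for n by (simp add: h_def)
  define hm where "hm = min (min h0 h3) (\<tau> / 2)"
  have hm: "0 < hm" using c c3 by (simp add: hm_def)
  have "eventually (\<lambda>n. T / 2 ^ n < hm) sequentially" using dyadic_tendsto hm by (rule order_tendstoD)
  then obtain N where N: "\<And>n. N \<le> n \<Longrightarrow> h n < hm" unfolding h_def eventually_sequentially by blast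
  define r where "r = (1 / 2) powr (3 * \<alpha> - 1)"
  have r: "0 \<le> r" "r < 1" using \<alpha> powr01_less_one[of "1/2" "3 * \<alpha> - 1"] by (auto simp: r_def)
  have hr: "h n powr (3 * \<alpha> - 1) = T powr (3 * \<alpha> - 1) * r ^ n" for n
  proof -
    have "r ^ n = ((1 / 2) ^ n) powr (3 * \<alpha> - 1)" unfolding r_def
    proof (induction n)
      case (Suc n)
      then show ?case using powr_mult[of "1 / 2" "(1 / 2) ^ n" "3 * \<alpha> - 1"] by (simp only: power_Suc)
    qed simp
    then show ?thesis using T by (simp add: h_def powr_mult[symmetric] power_one_over)
  qed
  have conv: "convergent (u t)" if t: "0 \<le> t" "t \<le> T" for t
  proof (rule geometric_steps_convergent[OF _ r])
    fix n assume n: "N \<le> n"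
    define k where "k = dindex n t"
    have k: "k \<le> 2 ^ n" using dindex(3)[OF t] by (simp add: k_def)
    have hn: "h n \<le> h0" "h n \<le> h3" "h n \<le> \<tau>" "h n \<le> 1" using N[OF n] c3 c by (auto simp: hm_def)
    have 1: "norm (euler \<xi> (h n) k - euler \<xi> (h n / 2) (2 * k)) \<le> C3 * h n powr (3 * \<alpha> - 1)"
      using st[OF euler_approx[OF hp hT c(2)] euler_coarse[OF est hp hn(1) hn(3) hT] hn(2) _ _ k] by simp
    have "h (Suc n) powr \<alpha> \<le> h n powr (3 * \<alpha> - 1)"
    proof -
      have "h (Suc n) powr \<alpha> \<le> h n powr \<alpha>" using hp[of n] \<alpha> by (intro powr_mono2) (auto simp: hs)
      also have "\<dots> \<le> h n powr (3 * \<alpha> - 1)" using hn hp[of n] \<alpha> by (intro powr_mono') auto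
      finally show ?thesis .
    qed
    then have Ch: "C * h (Suc n) powr \<alpha> \<le> C * h n powr (3 * \<alpha> - 1)" using c by (intro mult_left_mono)
    have 2: "norm (u t (Suc n) - euler \<xi> (h n / 2) (2 * k)) \<le> C * h n powr (3 * \<alpha> - 1)"
      using dindex(5)[OF t(1), of n, folded k_def]
    proof
      assume "dindex (Suc n) t = 2 * k"
      then show ?thesis using c by (simp add: u_def hs)
    next
      assume k2: "dindex (Suc n) t = 2 * k + 1"
      then have "2 * k + 1 \<le> 2 ^ Suc n" using dindex(3)[OF t, of "Suc n"] by simp
      then have "norm (euler \<xi> (h (Suc n)) (2 * k + 1) - euler \<xi> (h (Suc n)) (2 * k)) \<le> C * (real (2 * k + 1 - 2 * k) * h (Suc n)) powr \<alpha>"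
        using hn hp[of n] by (intro hol[OF hp _ hT]) (auto simp: hs)
      then show ?thesis using Ch k2 by (simp add: u_def hs)
    qed
    have "norm (u t (Suc n) - u t n) \<le> norm (u t (Suc n) - euler \<xi> (h n / 2) (2 * k)) + norm (euler \<xi> (h n / 2) (2 * k) - u t n)"
      by (rule norm_triangle_ineq4[of "u t (Suc n) - euler \<xi> (h n / 2) (2 * k)" "u t n - euler \<xi> (h n / 2) (2 * k)", simplified, THEN order_trans])
        (simp add: norm_minus_commute)
    also have "\<dots> \<le> C * h n powr (3 * \<alpha> - 1) + C3 * h n powr (3 * \<alpha> - 1)"
      using 1 2 by (intro add_mono) (auto simp: u_def k_def norm_minus_commute)
    also have "\<dots> = (C + C3) * T powr (3 * \<alpha> - 1) * r ^ n" unfolding hr by (simp add: algebra_simps)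
    finally show "norm (u t (Suc n) - u t n) \<le> (C + C3) * T powr (3 * \<alpha> - 1) * r ^ n" .
  qed
  define Y where "Y t = lim (u t)" for t
  have Y: "u t \<longlonglongrightarrow> Y t" if "0 \<le> t" "t \<le> T" for t
    using conv[OF that] by (simp add: Y_def convergent_LIMSEQ_iff)
  have YB: "norm (Y t) \<le> B" if t: "0 \<le> t" "t \<le> T" for t
  proof (rule LIMSEQ_le_const2[OF tendsto_norm[OF Y[OF t]]])
    show "\<exists>N. \<forall>n\<ge>N. norm (u t n) \<le> B"
    proof (intro exI allI impI)
      fix n assume "N \<le> n"
      then show "norm (u t n) \<le> B" unfolding u_def using N[of n] dindex(3)[OF t]
        by (intro bd[OF hp _ hT]) (auto simp: hm_def)
    qed
  qed
  have loc: "norm (Y t - Y s - (t - s) *\<^sub>R f0 (Y s) - incr (Y s) s t) \<le> C * ((t - s) powr \<alpha>) ^ 3"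
    if st: "0 \<le> s" "s \<le> t" "t \<le> T" "t - s \<le> \<tau> / 2" for s t
  proof -
    define ti where "ti n = real (dindex n s) * h n" for n
    define tj where "tj n = real (dindex n t) * h n" for n
    have t0: "0 \<le> t" "s \<le> T" using st by auto
    have ti: "ti \<longlonglongrightarrow> s" using dindex_tendsto[OF st(1)] by (simp add: ti_def[abs_def] h_def)
    have tj: "tj \<longlonglongrightarrow> t" using dindex_tendsto[OF t0(1)] by (simp add: tj_def[abs_def] h_def)
    note le = dindex(1)[OF st(1), folded h_def, folded ti_def] dindex(1)[OF t0(1), folded h_def, folded tj_def]
    have ij: "dindex n s \<le> dindex n t" for n by (rule dindex(4)[OF t0(1) st(2)])
    have tij: "ti n \<le> tj n" for n unfolding ti_def tj_def using ij hp[of n] by (intro mult_right_mono) auto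
    have tip: "0 \<le> ti n" for n using hp[of n] by (simp add: ti_def)
    have dif: "real (dindex n t - dindex n s) * h n = tj n - ti n" for n
      using ij[of n] by (simp add: of_nat_diff ti_def tj_def algebra_simps)
    have ev: "eventually (\<lambda>n. norm (u t n - u s n - (tj n - ti n) *\<^sub>R f0 (u s n) - incr (u s n) (ti n) (tj n)) \<le> C * ((tj n - ti n) powr \<alpha>) ^ 3) sequentially"
      using eventually_ge_at_top[of N]
    proof eventually_elim
      case (elim n)
      have "s < ti n + h n" using dindex(2)[OF st(1), of n, folded h_def] by (simp add: ti_def algebra_simps)
      then have "tj n - ti n \<le> \<tau>" using le(2)[of n] st(4) N[OF elim] by (auto simp: hm_def)
      then show ?case unfolding u_def dif[symmetric] unfolding ti_def tj_def
        using N[OF elim] dindex(3)[OF t0(1) st(3)] by (intro est[OF hp _ hT ij]) (auto simp: hm_def)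
    qed
    have inc: "(\<lambda>n. incr (u s n) (ti n) (tj n)) \<longlonglongrightarrow> incr (Y s) s t"
    proof -
      define c1 where "c1 = K\<^sup>2 * T powr \<alpha> + 2 * K ^ 4 * (T powr \<alpha>)\<^sup>2"
      define c2 where "c2 = K\<^sup>2 + 2 * K ^ 4 * T powr \<alpha>"
      have bnd: "norm (incr (u s n) (ti n) (tj n) - incr (Y s) s t) \<le> c1 * norm (u s n - Y s) + c2 * ((s - ti n) powr \<alpha> + (t - tj n) powr \<alpha>)" for n
      proof -
        have "norm (incr (u s n) (ti n) (tj n) - incr (Y s) (ti n) (tj n)) \<le> c1 * norm (u s n - Y s)"
          unfolding c1_def using le(2)[of n] st by (intro incr_lip tip tij) auto
        moreover have "norm (incr (Y s) (ti n) (tj n) - incr (Y s) s t) \<le> c2 * ((s - ti n) powr \<alpha> + (t - tj n) powr \<alpha>)"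
          unfolding c2_def using le[of n] st by (intro incr_time_diff tip tij) auto
        ultimately show ?thesis
          using norm_triangle_ineq[of "incr (u s n) (ti n) (tj n) - incr (Y s) (ti n) (tj n)" "incr (Y s) (ti n) (tj n) - incr (Y s) s t"] by simp
      qed
      have lim: "(\<lambda>n. c1 * norm (u s n - Y s) + c2 * ((s - ti n) powr \<alpha> + (t - tj n) powr \<alpha>)) \<longlonglongrightarrow> c1 * norm (Y s - Y s) + c2 * ((s - s) powr \<alpha> + (t - t) powr \<alpha>)"
        using \<alpha> le by (intro tendsto_intros Y st t0 ti tj tendsto_powr2) (auto intro!: always_eventually)
      have "(\<lambda>n. incr (u s n) (ti n) (tj n) - incr (Y s) s t) \<longlonglongrightarrow> 0"
        by (rule Lim_null_comparison[OF always_eventually[OF allI[OF bnd]]]) (use lim in simp)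
      then show ?thesis by (simp add: LIM_zero_iff)
    qed
    have f0c: "(\<lambda>n. f0 (u s n)) \<longlonglongrightarrow> f0 (Y s)"
    proof -
      have "(\<lambda>n. K * norm (u s n - Y s)) \<longlonglongrightarrow> K * norm (Y s - Y s)" by (intro tendsto_intros Y st t0)
      then have "(\<lambda>n. f0 (u s n) - f0 (Y s)) \<longlonglongrightarrow> 0"
        by (intro Lim_null_comparison[OF always_eventually[OF allI[OF f0_lip]]]) simp
      then show ?thesis by (simp add: LIM_zero_iff)
    qed
    show ?thesis
    proof (rule tendsto_le[OF sequentially_bot _ _ ev])
      show "(\<lambda>n. C * ((tj n - ti n) powr \<alpha>) ^ 3) \<longlonglongrightarrow> C * ((t - s) powr \<alpha>) ^ 3"
        using \<alpha> tij by (intro tendsto_mult tendsto_const tendsto_power tendsto_powr2 tendsto_diff ti tj) (auto intro!: always_eventually)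
      show "(\<lambda>n. norm (u t n - u s n - (tj n - ti n) *\<^sub>R f0 (u s n) - incr (u s n) (ti n) (tj n)))
         \<longlonglongrightarrow> norm (Y t - Y s - (t - s) *\<^sub>R f0 (Y s) - incr (Y s) s t)"
        by (intro tendsto_intros Y st t0 ti tj inc f0c)
    qed
  qed
  show thesis
  proof (rule that)
    show "davie_solution 0 Y" by (rule davie_intro[of 0 "\<tau> / 2" Y C B]) (use loc c YB in auto)
    have "u 0 n = \<xi>" for n by (simp add: u_def dindex_def)
    then have "u 0 = (\<lambda>n. \<xi>)" by (intro ext)
    moreover have "u 0 \<longlonglongrightarrow> Y 0" using T by (intro Y) auto
    ultimately show "Y 0 = \<xi>" by (simp add: LIMSEQ_const_iff)
  qed
qed

end

section \<open>Rough integral equations and local expansions\<close>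

lemma partition_range:
  assumes p: "p 0 = (0::real)" "p n = t" "\<And>i. i < n \<Longrightarrow> p i < p (Suc i)" and i: "i \<le> n"
  shows "0 \<le> p i \<and> p i \<le> t"
proof
  show "0 \<le> p i" using i
  proof (induction i)
    case (Suc i) then show ?case using p(3)[of i] by simp
  qed (simp add: p)
  show "p i \<le> t" using i
  proof (induction rule: inc_induct)
    case base then show ?case by (simp add: p)
  next
    case (step m) then show ?case using p(3)[of m] by simp
  qed
qed

locale rough_diffeq = rough_equation tens \<alpha> T K X XX f0 f Df D2f lft
  for tens :: "'v::real_normed_vector \<Rightarrow> 'v \<Rightarrow> 'z::banach"
    and \<alpha> T K :: real
    and X :: "real \<Rightarrow> 'v" and XX :: "real \<Rightarrow> real \<Rightarrow> 'z"
    and f0 :: "'w::banach \<Rightarrow> 'w" and f :: "'w \<Rightarrow> 'v \<Rightarrow>\<^sub>L 'w"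
    and Df :: "'w \<Rightarrow> 'w \<Rightarrow>\<^sub>L 'v \<Rightarrow>\<^sub>L 'w" and D2f :: "'w \<Rightarrow> 'w \<Rightarrow>\<^sub>L 'w \<Rightarrow>\<^sub>L 'v \<Rightarrow>\<^sub>L 'w"
    and lft :: "('v \<Rightarrow>\<^sub>L 'v \<Rightarrow>\<^sub>L 'w) \<Rightarrow> 'z \<Rightarrow>\<^sub>L 'w" +
  assumes lft_eq: "lft = tensor_lift tens" and Df_eq: "Df = fderiv f"
begin

lemma germ_eq: "f y (X t - X s) + tensor_lift tens (fderiv f y o\<^sub>L f y) (XX s t) = incr y s t"
  unfolding incr_def level2_def by (simp add: lft_eq Df_eq)

lemma holder_continuous:
  assumes Y: "\<And>s t. 0 \<le> s \<Longrightarrow> s \<le> t \<Longrightarrow> t \<le> T \<Longrightarrow> norm (Y t - Y s) \<le> C * (t - s) powr \<alpha>" and C: "0 \<le> C"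
  shows "continuous_on {0..T} (Y :: real \<Rightarrow> 'w)"
proof (rule continuous_onI)
  fix t e :: real assume t: "t \<in> {0..T}" and e: "0 < e"
  have ec: "0 < e / (C + 1)" using e C by simp
  obtain \<tau> where \<tau>: "0 < \<tau>" "\<And>x. 0 \<le> x \<Longrightarrow> x \<le> \<tau> \<Longrightarrow> x powr \<alpha> \<le> e / (C + 1)"
    using powr_small[OF ec] by metis
  show "\<exists>d>0. \<forall>s\<in>{0..T}. dist s t < d \<longrightarrow> dist (Y s) (Y t) \<le> e"
  proof (intro exI conjI ballI impI)
    fix s assume s: "s \<in> {0..T}" "dist s t < \<tau>"
    have "norm (Y s - Y t) \<le> C * \<bar>s - t\<bar> powr \<alpha>"
      using Y[of s t] Y[of t s] s t by (cases "s \<le> t") (auto simp: norm_minus_commute)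
    also have "\<dots> \<le> (C + 1) * (e / (C + 1))" using \<tau>(2)[of "\<bar>s - t\<bar>"] s C by (intro mult_mono) (auto simp: dist_real_def)
    also have "\<dots> = e" using C by simp
    finally show "dist (Y s) (Y t) \<le> e" by (simp add: dist_norm)
  qed (rule \<tau>)
qed

lemma f0_continuous: "continuous_on S f0"
proof (rule continuous_onI)
  fix x e assume e: "0 < (e::real)"
  show "\<exists>d>0. \<forall>x'\<in>S. dist x' x < d \<longrightarrow> dist (f0 x') (f0 x) \<le> e"
  proof (intro exI conjI ballI impI)
    show "0 < e / K" using e K0 by simp
    fix x' assume "dist x' x < e / K"
    then have "K * norm (x' - x) \<le> e" using K0 by (simp add: dist_norm field_simps)
    then show "dist (f0 x') (f0 x) \<le> e" using f0_lip[of x' x] by (simp add: dist_norm)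
  qed
qed

lemma drift_integral:
  assumes Y: "\<And>s t. 0 \<le> s \<Longrightarrow> s \<le> t \<Longrightarrow> t \<le> T \<Longrightarrow> norm (Y t - Y s) \<le> C * (t - s) powr \<alpha>" and C: "0 \<le> C"
    and st: "0 \<le> s" "s \<le> t" "t \<le> T"
  shows "norm (integral {0..t} (\<lambda>s. f0 (Y s)) - integral {0..s} (\<lambda>s. f0 (Y s)) - (t - s) *\<^sub>R f0 (Y s))
     \<le> K * C * (t - s) powr \<alpha> * (t - s)"
proof -
  have "continuous_on {0..T} (\<lambda>s. f0 (Y s))"
    by (rule continuous_on_compose2[OF f0_continuous holder_continuous[OF Y C]]) auto
  then have cont: "continuous_on {a..b} (\<lambda>s. f0 (Y s))" if "0 \<le> a" "b \<le> T" for a b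
    by (rule continuous_on_subset) (use that in auto)
  have "integral {0..s} (\<lambda>s. f0 (Y s)) + integral {s..t} (\<lambda>s. f0 (Y s)) = integral {0..t} (\<lambda>s. f0 (Y s))"
    using st by (intro Henstock_Kurzweil_Integration.integral_combine integrable_continuous_real cont) auto
  then have "integral {0..t} (\<lambda>s. f0 (Y s)) - integral {0..s} (\<lambda>s. f0 (Y s)) - (t - s) *\<^sub>R f0 (Y s)
     = integral {s..t} (\<lambda>r. f0 (Y r)) - integral {s..t} (\<lambda>r. f0 (Y s))" using st by (simp add: algebra_simps)
  also have "\<dots> = integral {s..t} (\<lambda>r. f0 (Y r) - f0 (Y s))"
    using st by (intro Henstock_Kurzweil_Integration.integral_diff[symmetric] integrable_continuous_real cont) auto
  also have "norm \<dots> \<le> K * C * (t - s) powr \<alpha> * (t - s)"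
  proof (rule integral_bound[OF st(2)])
    show "continuous_on {s..t} (\<lambda>r. f0 (Y r) - f0 (Y s))" using st by (intro continuous_on_diff cont continuous_on_const) auto
    fix r assume r: "r \<in> {s..t}"
    have "norm (f0 (Y r) - f0 (Y s)) \<le> K * (C * (r - s) powr \<alpha>)"
      using f0_lip[of "Y r" "Y s"] mult_left_mono[OF Y[of s r] K0(1)] r st by simp
    also have "\<dots> \<le> K * (C * (t - s) powr \<alpha>)" using r st C K0 \<alpha> by (intro mult_left_mono powr_mono2) auto
    finally show "norm (f0 (Y r) - f0 (Y s)) \<le> K * C * (t - s) powr \<alpha>" by simp
  qed
  finally show ?thesis .
qed

text \<open>By the local expansion, the summands of the Riemann sums are increments of \<open>Y\<close> minus its
  drift, up to errors of order \<open>3 * \<alpha>\<close>. The increments telescope, and the sum of the errors vanishes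
  with the mesh because \<open>3 * \<alpha> > 1\<close>.\<close>

lemma davie_rde:
  assumes Y: "davie_solution 0 Y"
  shows "rde_solution tens \<alpha> T f0 f X XX (Y 0) Y (\<lambda>t. f (Y t))"
proof -
  obtain C1 where C1: "0 \<le> C1" "\<And>s t. 0 \<le> s \<Longrightarrow> s \<le> t \<Longrightarrow> t \<le> T \<Longrightarrow>
      norm (Y t - Y s - (t - s) *\<^sub>R f0 (Y s) - incr (Y s) s t) \<le> C1 * ((t - s) powr \<alpha>) ^ 3"
    using Y unfolding davie_solution_def by blast
  obtain C where C: "0 \<le> C" 
    and hol: "\<And>s t. 0 \<le> s \<Longrightarrow> s \<le> t \<Longrightarrow> t \<le> T \<Longrightarrow> norm (Y t - Y s) \<le> C * (t - s) powr \<alpha>"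
    and fo: "\<And>s t. 0 \<le> s \<Longrightarrow> s \<le> t \<Longrightarrow> t \<le> T \<Longrightarrow> norm (Y t - Y s - f (Y s) (X t - X s)) \<le> C * ((t - s) powr \<alpha>)\<^sup>2"
    using davie_holder[OF Y order_refl] by blast
  have sym: "norm (Y t - Y s) \<le> C * \<bar>t - s\<bar> powr \<alpha>" if "s \<in> {0..T}" "t \<in> {0..T}" for s t
    using hol[of s t] hol[of t s] that by (cases "s \<le> t") (auto simp: norm_minus_commute)
  have symf: "norm (f (Y t) - f (Y s)) \<le> K * C * \<bar>t - s\<bar> powr \<alpha>" if "s \<in> {0..T}" "t \<in> {0..T}" for s t
    using f_lip[of "Y t" "Y s"] mult_left_mono[OF sym[OF that] K0(1)] by simp
  have contr: "norm (Y t - Y s - f (Y s) (X t - X s)) \<le> (C + K * C * K) * \<bar>t - s\<bar> powr (2 * \<alpha>)"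
    if st: "s \<in> {0..T}" "t \<in> {0..T}" for s t
  proof -
    define w where "w = \<bar>t - s\<bar> powr \<alpha>"
    have w2: "\<bar>t - s\<bar> powr (2 * \<alpha>) = w\<^sup>2" by (simp add: w_def powr2)
    have CC: "C * w\<^sup>2 \<le> (C + K * C * K) * w\<^sup>2" using C K0 by (intro mult_right_mono) auto
    show ?thesis
    proof (cases "s \<le> t")
      case True
      then show ?thesis using fo[of s t] st CC unfolding w2 by (simp add: w_def)
    next
      case False
      then have ts: "norm (Y s - Y t - f (Y t) (X s - X t)) \<le> C * w\<^sup>2"
        using fo[of t s] st by (simp add: w_def)
      have x: "norm (X s - X t) \<le> K * w" using X_le[of t s] st False by (simp add: w_def)
      have "Y t - Y s - f (Y s) (X t - X s) = (f (Y s) - f (Y t)) (X s - X t) - (Y s - Y t - f (Y t) (X s - X t))"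
        by (simp add: blinfun.diff_left blinfun.diff_right)
      also have "norm \<dots> \<le> (K * C * w) * (K * w) + C * w\<^sup>2"
        using symf[OF st(2,1)] x ts
        by (intro norm_triangle_le_diff[OF add_mono[OF norm_apply_le]]) (auto simp only: w_def abs_minus_commute)
      also have "\<dots> = (C + K * C * K) * w\<^sup>2" by (simp add: algebra_simps power2_eq_square)
      finally show ?thesis unfolding w2 .
    qed
  qed
  have controlled: "controlled \<alpha> T X Y (\<lambda>t. f (Y t))"
    unfolding controlled_def holder_path_def using sym symf contr by blast
  define G where "G t = Y t - integral {0..t} (\<lambda>s. f0 (Y s))" for t
  define D where "D = C1 + K * C"
  have D0: "0 \<le> D" using C1 C K0 by (simp add: D_def)
  have G: "norm (incr (Y s) s t - (G t - G s)) \<le> D * (t - s) powr (3 * \<alpha>)"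
    if st: "0 \<le> s" "s \<le> t" "t \<le> T" "t - s \<le> 1" for s t
  proof -
    define w where "w = (t - s) powr \<alpha>"
    have w: "0 \<le> w" "t - s \<le> w\<^sup>2" using le_powr2[of "t - s"] st by (auto simp: w_def)
    have "incr (Y s) s t - (G t - G s) = (integral {0..t} (\<lambda>s. f0 (Y s)) - integral {0..s} (\<lambda>s. f0 (Y s)) - (t - s) *\<^sub>R f0 (Y s))
       - (Y t - Y s - (t - s) *\<^sub>R f0 (Y s) - incr (Y s) s t)" by (simp add: G_def)
    also have "norm \<dots> \<le> K * C * w * (t - s) + C1 * w ^ 3"
      unfolding w_def by (rule norm_triangle_le_diff[OF add_mono[OF drift_integral[OF hol C st(1-3)] C1(2)[OF st(1-3)]]])
    also have "\<dots> \<le> K * C * w * w\<^sup>2 + C1 * w ^ 3" using w K0 C C1 by (intro add_mono mult_left_mono) auto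
    also have "\<dots> = D * w ^ 3" by (simp add: D_def algebra_simps eval_nat_numeral)
    finally show ?thesis using st by (simp add: w_def powr3)
  qed
  have "has_rough_integral tens X XX (\<lambda>s. f (Y s)) (\<lambda>s. fderiv f (Y s) o\<^sub>L f (Y s)) t (G t - G 0)"
    if t: "t \<in> {0..T}" for t
    unfolding has_rough_integral_def germ_eq
  proof (intro allI impI)
    fix \<epsilon> :: real assume \<epsilon>: "0 < \<epsilon>"
    define q where "q = 3 * \<alpha> - 1"
    have q: "0 < q" using \<alpha> by (simp add: q_def)
    define c where "c = \<epsilon> / (D * T + 1)"
    have c: "0 < c" using \<epsilon> D0 T by (simp add: c_def add_nonneg_pos)
    define \<delta> where "\<delta> = min 1 (c powr (1 / q))"
    show "\<exists>\<delta>>0. \<forall>n p. p 0 = 0 \<and> p n = t \<and> (\<forall>i<n. p i < p (Suc i) \<and> p (Suc i) - p i < \<delta>) \<longrightarrow>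
        norm ((\<Sum>i<n. incr (Y (p i)) (p i) (p (Suc i))) - (G t - G 0)) < \<epsilon>"
    proof (intro exI conjI allI impI)
      show "0 < \<delta>" using c by (simp add: \<delta>_def)
      fix n :: nat and p assume p: "p 0 = 0 \<and> p n = t \<and> (\<forall>i<n. p i < p (Suc i) \<and> p (Suc i) - p i < \<delta>)"
      have rng: "0 \<le> p i \<and> p i \<le> t" if "i \<le> n" for i using partition_range[of p n t i] p that by blast
      have step: "norm (incr (Y (p i)) (p i) (p (Suc i)) - (G (p (Suc i)) - G (p i))) \<le> (D * c) * (p (Suc i) - p i)" if i: "i < n" for i
      proof -
        define l where "l = p (Suc i) - p i"
        have l: "0 < l" "l \<le> 1" "l \<le> c powr (1 / q)" using p i by (auto simp: l_def \<delta>_def less_imp_le)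
        have "l powr q \<le> (c powr (1 / q)) powr q" using l q by (intro powr_mono2) auto
        then have lq: "l powr q \<le> c" using c q by (simp add: powr_powr)
        have "norm (incr (Y (p i)) (p i) (p (Suc i)) - (G (p (Suc i)) - G (p i))) \<le> D * l powr (3 * \<alpha>)"
          unfolding l_def using rng[of i] rng[of "Suc i"] i t l by (intro G) (auto simp: l_def)
        also have "l powr (3 * \<alpha>) = l powr q * l"
          using l powr_add[of l q 1] by (simp add: q_def)
        also have "D * (l powr q * l) \<le> D * (c * l)" using lq l D0 by (intro mult_left_mono mult_right_mono) auto
        finally show ?thesis by (simp add: l_def)
      qed
      have "(\<Sum>i<n. incr (Y (p i)) (p i) (p (Suc i))) - (G t - G 0)
         = (\<Sum>i<n. incr (Y (p i)) (p i) (p (Suc i)) - (G (p (Suc i)) - G (p i)))"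
        using sum_lessThan_telescope[of "\<lambda>i. G (p i)" n] p by (simp add: sum_subtractf)
      also have "norm \<dots> \<le> (\<Sum>i<n. (D * c) * (p (Suc i) - p i))" by (intro sum_norm_le step) simp
      also have "\<dots> = D * c * t" using sum_lessThan_telescope[of p n] p by (simp add: sum_distrib_left[symmetric])
      also have "\<dots> \<le> D * T * c" using t D0 c by (simp add: mult_left_mono mult_ac)
      also have "\<dots> < (D * T + 1) * c" using c by (simp add: algebra_simps)
      also have "\<dots> = \<epsilon>" using D0 T by (simp add: c_def add_nonneg_pos less_imp_neq[THEN not_sym])
      finally show "norm ((\<Sum>i<n. incr (Y (p i)) (p i) (p (Suc i))) - (G t - G 0)) < \<epsilon>" .
    qed
  qed
  moreover have "Y t = Y 0 + integral {0..t} (\<lambda>s. f0 (Y s)) + (G t - G 0)" for t by (simp add: G_def)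
  ultimately show ?thesis unfolding rde_solution_def using controlled by blast
qed

text \<open>Fine partitions of \<open>[0, s]\<close> are continued by uniform partitions of \<open>[s, t]\<close>. Subtracting the
  sums over \<open>[0, s]\<close> shows that the increment of the integral is the limit of sums over \<open>[s, t]\<close>
  alone.\<close>

lemma rough_integral_step:
  assumes Is: "has_rough_integral tens X XX A A' s Is" and It: "has_rough_integral tens X XX A A' t It"
    and st: "0 \<le> s" "s < t" "t \<le> T"
    and germ: "\<And>r r'. 0 \<le> r \<Longrightarrow> r \<le> T \<Longrightarrow> A r (X r' - X r) + tensor_lift tens (A' r) (XX r r') = g r r'"
    and bd: "\<And>n. norm ((\<Sum>i<Suc n. g (s + real i * ((t - s) / real (Suc n))) (s + real (Suc i) * ((t - s) / real (Suc n)))) - G) \<le> c"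
  shows "norm (It - Is - G) \<le> c"
proof (rule field_le_epsilon)
  fix e :: real assume e: "0 < e"
  then have e2: "0 < e / 2" by simp
  obtain d1 where d1: "0 < d1" "\<And>n p. p 0 = 0 \<Longrightarrow> p n = s \<Longrightarrow> (\<And>i. i < n \<Longrightarrow> p i < p (Suc i) \<and> p (Suc i) - p i < d1) \<Longrightarrow>
     norm ((\<Sum>i<n. A (p i) (X (p (Suc i)) - X (p i)) + tensor_lift tens (A' (p i)) (XX (p i) (p (Suc i)))) - Is) < e / 2"
    using Is e2 unfolding has_rough_integral_def by meson
  obtain d2 where d2: "0 < d2" "\<And>n p. p 0 = 0 \<Longrightarrow> p n = t \<Longrightarrow> (\<And>i. i < n \<Longrightarrow> p i < p (Suc i) \<and> p (Suc i) - p i < d2) \<Longrightarrow>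
     norm ((\<Sum>i<n. A (p i) (X (p (Suc i)) - X (p i)) + tensor_lift tens (A' (p i)) (XX (p i) (p (Suc i)))) - It) < e / 2"
    using It e2 unfolding has_rough_integral_def by meson
  define d where "d = min d1 d2 / 2"
  have d: "0 < d" "d < d1" "d < d2" using d1(1) d2(1) by (auto simp: d_def)
  have tsp: "0 < t - s" using st by simp
  obtain N where N: "(t - s) / real (Suc N) \<le> d"
    using eventually_happens'[OF sequentially_bot grid_eventually_small[OF tsp d(1)]] by blast
  \<comment> \<open>For \<open>s = 0\<close> the partition consists of the single point zero, since partitions are strictly
    increasing.\<close>
  obtain p m where pm: "p 0 = 0" "p m = s" "\<And>i. i < m \<Longrightarrow> p i < p (Suc i) \<and> p (Suc i) - p i \<le> d"
  proof (cases "s = 0")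
    case True then show ?thesis using that[of "\<lambda>i. 0" 0] by simp
  next
    case False
    then have s: "0 < s" using st by simp
    obtain M where M: "s / real (Suc M) \<le> d"
      using eventually_happens'[OF sequentially_bot grid_eventually_small[OF s d(1)]] by blast
    have e: "real (Suc i) * (s / real (Suc M)) - real i * (s / real (Suc M)) = s / real (Suc M)" for i
      unfolding left_diff_distrib[symmetric] by simp
    show ?thesis
    proof (rule that[of "\<lambda>i. real i * (s / real (Suc M))" "Suc M"])
      fix i
      have "0 < s / real (Suc M)" using s by simp
      then show "real i * (s / real (Suc M)) < real (Suc i) * (s / real (Suc M)) \<and> real (Suc i) * (s / real (Suc M)) - real i * (s / real (Suc M)) \<le> d"
        using e[of i] M by linarith
    qed (simp_all del: of_nat_Suc)
  qed
  define h where "h = (t - s) / real (Suc N)"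
  have h: "0 < h" "h \<le> d" "real (Suc N) * h = t - s" using tsp N by (auto simp: h_def)
  define r where "r i = (if i \<le> m then p i else s + real (i - m) * h)" for i
  have r1: "r i = p i" if "i \<le> m" for i using that by (simp add: r_def)
  have r2: "r (m + i) = s + real i * h" for i by (simp add: r_def pm)
  have rt: "r (m + Suc N) = t" unfolding r2 h(3) by simp
  have rstep: "r i < r (Suc i) \<and> r (Suc i) - r i \<le> d" if "i < m + Suc N" for i
  proof (cases "i < m")
    case True then show ?thesis using pm(3) by (simp add: r_def)
  next
    case False
    then obtain j where j: "i = m + j" using le_Suc_ex not_less by blast
    have "r (Suc i) - r i = h" using r2[of j] r2[of "Suc j"] j by (simp add: algebra_simps)
    then show ?thesis using h by linarith
  qed
  define germs where "germs i = A (r i) (X (r (Suc i)) - X (r i)) + tensor_lift tens (A' (r i)) (XX (r i) (r (Suc i)))" for i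
  have s1: "norm ((\<Sum>i<m. germs i) - Is) < e / 2"
  proof -
    have "(\<Sum>i<m. germs i) = (\<Sum>i<m. A (p i) (X (p (Suc i)) - X (p i)) + tensor_lift tens (A' (p i)) (XX (p i) (p (Suc i))))"
      by (intro sum.cong) (auto simp: germs_def r1)
    moreover have "p i < p (Suc i) \<and> p (Suc i) - p i < d1" if "i < m" for i
      using pm(3)[OF that] d by linarith
    ultimately show ?thesis using d1(2)[OF pm(1,2)] by metis
  qed
  have s2: "norm ((\<Sum>i<m + Suc N. germs i) - It) < e / 2"
    unfolding germs_def
  proof (rule d2(2))
    show "r 0 = 0" using pm by (simp add: r_def)
    show "r i < r (Suc i) \<and> r (Suc i) - r i < d2" if "i < m + Suc N" for i
      using rstep[OF that] d by linarith
  qed (rule rt)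
  have s3: "(\<Sum>i<m + Suc N. germs i) = (\<Sum>i<m. germs i) + (\<Sum>i<Suc N. germs (m + i))"
    by (induction N) (simp_all add: add_ac)
  have "germs (m + i) = g (s + real i * h) (s + real (Suc i) * h)" if "i < Suc N" for i
  proof -
    have "real i * h \<le> real (Suc N) * h" using that h by (intro mult_right_mono) auto
    then have "0 \<le> s + real i * h" "s + real i * h \<le> T" using st h by (simp, linarith)
    moreover have "r (Suc (m + i)) = s + real (Suc i) * h" using r2[of "Suc i"] by simp
    ultimately show ?thesis unfolding germs_def r2 by (simp only: germ)
  qed
  then have s4: "(\<Sum>i<Suc N. germs (m + i)) = (\<Sum>i<Suc N. g (s + real i * h) (s + real (Suc i) * h))"
    by (intro sum.cong) auto
  have "(\<Sum>i<Suc N. g (s + real i * h) (s + real (Suc i) * h)) - (It - Is)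
      = ((\<Sum>i<m + Suc N. germs i) - It) - ((\<Sum>i<m. germs i) - Is)"
    unfolding s4[symmetric] s3 by (simp add: algebra_simps)
  also have "norm \<dots> \<le> e / 2 + e / 2"
    by (rule norm_triangle_le_diff[OF add_mono[OF less_imp_le[OF s2] less_imp_le[OF s1]]])
  finally have "norm ((\<Sum>i<Suc N. g (s + real i * h) (s + real (Suc i) * h)) - (It - Is)) \<le> e" by simp
  then have "norm ((It - Is) - (\<Sum>i<Suc N. g (s + real i * h) (s + real (Suc i) * h))) \<le> e"
    by (simp add: norm_minus_commute)
  from norm_triangle_le[OF add_mono[OF this bd[of N, folded h_def]]]
  show "norm (It - Is - G) \<le> c + e" by simp
qed

text \<open>The sums of Euler steps over uniform partitions of \<open>[s, t]\<close> differ from one Euler step by a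
  quantity that vanishes on single cells and whose defect of additivity is of order \<open>3 * \<alpha>\<close>. Sewing
  bounds this difference uniformly in the partition, hence also in the limit.\<close>

lemma rde_davie:
  assumes "rde_solution tens \<alpha> T f0 f X XX \<xi> Y Y'"
  shows "davie_solution 0 Y" "Y 0 = \<xi>"
proof -
  have Y': "Y' t = f (Y t)" if "t \<in> {0..T}" for t using assms that by (simp add: rde_solution_def)
  obtain C0 where "\<forall>s\<in>{0..T}. \<forall>t\<in>{0..T}. norm (Y t - Y s) \<le> C0 * \<bar>t - s\<bar> powr \<alpha>"
    using assms by (auto simp: rde_solution_def controlled_def holder_path_def)
  then have C0: "norm (Y t - Y s) \<le> C0 * \<bar>t - s\<bar> powr \<alpha>" if "s \<in> {0..T}" "t \<in> {0..T}" for s t using that by blast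
  define C where "C = max C0 0"
  have C: "0 \<le> C" by (simp add: C_def)
  have hol: "norm (Y t - Y s) \<le> C * (t - s) powr \<alpha>" if "0 \<le> s" "s \<le> t" "t \<le> T" for s t
  proof -
    have "norm (Y t - Y s) \<le> C0 * (t - s) powr \<alpha>" using C0[of s t] that by simp
    also have "\<dots> \<le> C * (t - s) powr \<alpha>" by (intro mult_right_mono) (auto simp: C_def)
    finally show ?thesis .
  qed
  obtain R0 where "\<forall>s\<in>{0..T}. \<forall>t\<in>{0..T}. s \<noteq> t \<longrightarrow> norm (Y t - Y s - Y' s (X t - X s)) \<le> R0 * \<bar>t - s\<bar> powr (2 * \<alpha>)"
    using assms by (auto simp: rde_solution_def controlled_def)
  then have R0: "norm (Y t - Y s - Y' s (X t - X s)) \<le> R0 * \<bar>t - s\<bar> powr (2 * \<alpha>)" if "s \<in> {0..T}" "t \<in> {0..T}" "s \<noteq> t" for s t using that by blast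
  define \<rho> where "\<rho> = max R0 0"
  have \<rho>: "0 \<le> \<rho>" by (simp add: \<rho>_def)
  have fo: "norm (Y t - Y s - f (Y s) (X t - X s)) \<le> \<rho> * ((t - s) powr \<alpha>)\<^sup>2" if "0 \<le> s" "s \<le> t" "t \<le> T" for s t
  proof (cases "s = t")
    case False
    then have "norm (Y t - Y s - f (Y s) (X t - X s)) \<le> R0 * ((t - s) powr \<alpha>)\<^sup>2"
      using R0[of s t] Y'[of s] that by (simp add: powr2)
    also have "\<dots> \<le> \<rho> * ((t - s) powr \<alpha>)\<^sup>2" by (intro mult_right_mono) (auto simp: \<rho>_def)
    finally show ?thesis .
  qed simp
  have ex: "\<exists>I. has_rough_integral tens X XX (\<lambda>s. f (Y s)) (\<lambda>s. fderiv f (Y s) o\<^sub>L Y' s) t I \<and>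
        Y t = \<xi> + integral {0..t} (\<lambda>s. f0 (Y s)) + I" if "t \<in> {0..T}" for t
    using assms that by (simp add: rde_solution_def)
  define D where "D = S3 * (3 * K ^ 6 * (1 + \<rho>))"
  have D0: "0 \<le> D" using S3_pos \<rho> K0 by (simp add: D_def)
  have main: "norm (Y t - Y s - (t - s) *\<^sub>R f0 (Y s) - incr (Y s) s t) \<le> (D + K * C) * ((t - s) powr \<alpha>) ^ 3"
    if st: "0 \<le> s" "s < t" "t \<le> T" "t - s \<le> 1" for s t
  proof -
    obtain Is where Is: "has_rough_integral tens X XX (\<lambda>s. f (Y s)) (\<lambda>s. fderiv f (Y s) o\<^sub>L Y' s) s Is"
       "Y s = \<xi> + integral {0..s} (\<lambda>s. f0 (Y s)) + Is" using ex[of s] st by auto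
    obtain It where It: "has_rough_integral tens X XX (\<lambda>s. f (Y s)) (\<lambda>s. fderiv f (Y s) o\<^sub>L Y' s) t It"
       "Y t = \<xi> + integral {0..t} (\<lambda>s. f0 (Y s)) + It" using ex[of t] st by auto
    have "norm (It - Is - incr (Y s) s t) \<le> D * (t - s) powr (3 * \<alpha>)"
    proof (rule rough_integral_step[OF Is(1) It(1) st(1-3), where g = "\<lambda>r r'. incr (Y r) r r'"])
      show "f (Y r) (X r' - X r) + tensor_lift tens (fderiv f (Y r) o\<^sub>L Y' r) (XX r r') = incr (Y r) r r'"
        if "0 \<le> r" "r \<le> T" for r r' using Y'[of r] that germ_eq by simp
      fix n
      define h where "h = (t - s) / real (Suc n)"
      have h: "0 < h" "real (Suc n) * h = t - s" using st by (auto simp: h_def)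
      define \<tau> where "\<tau> i = s + real i * h" for i
      have \<tau>_mono: "i \<le> j \<Longrightarrow> \<tau> i \<le> \<tau> j" for i j using h by (auto simp: \<tau>_def intro!: mult_right_mono)
      have \<tau>0: "\<tau> 0 = s" "\<tau> (Suc n) = t" unfolding \<tau>_def using h by auto
      have \<tau>_rng: "0 \<le> \<tau> i" "i \<le> Suc n \<Longrightarrow> \<tau> i \<le> T" for i
        using \<tau>_mono[of 0 i] \<tau>_mono[of i "Suc n"] \<tau>0 st by auto
      have \<tau>_diff: "i \<le> j \<Longrightarrow> \<tau> j - \<tau> i = real (j - i) * h" for i j by (simp add: \<tau>_def of_nat_diff algebra_simps)
      define J where "J i j = (\<Sum>k=i..<j. incr (Y (\<tau> k)) (\<tau> k) (\<tau> (Suc k))) - incr (Y (\<tau> i)) (\<tau> i) (\<tau> j)" for i j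
      have "norm (J 0 (Suc n)) \<le> S3 * (3 * K ^ 6 * (1 + \<rho>)) * (real (Suc n - 0) * h) powr (3 * \<alpha>)"
      proof (rule discrete_sewing_step[where n = "Suc n", OF _ _ h(1)])
        show "1 < 3 * \<alpha>" using \<alpha> by simp
        show "0 \<le> 3 * K ^ 6 * (1 + \<rho>)" using K0 \<rho> by simp
        show "J i i = 0" if "i \<le> Suc n" for i using \<tau>_rng that by (simp add: J_def incr_refl)
        show "J i (Suc i) = 0" for i by (simp add: J_def)
        fix i j k assume ijk: "i \<le> j" "j \<le> k" "k \<le> Suc n"
        have "(\<Sum>l=i..<k. incr (Y (\<tau> l)) (\<tau> l) (\<tau> (Suc l))) = (\<Sum>l=i..<j. incr (Y (\<tau> l)) (\<tau> l) (\<tau> (Suc l))) + (\<Sum>l=j..<k. incr (Y (\<tau> l)) (\<tau> l) (\<tau> (Suc l)))"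
          using ijk by (simp add: sum.atLeastLessThan_concat)
        then have "J i k - J i j - J j k = defect (Y (\<tau> i)) (Y (\<tau> j)) (\<tau> i) (\<tau> j) (\<tau> k)"
          by (simp add: J_def defect_def)
        also have "norm \<dots> \<le> 3 * K ^ 6 * (1 + \<rho>) * ((\<tau> k - \<tau> i) powr \<alpha>) ^ 3"
        proof (rule defect_le[OF _ _ _ _ _ _ \<rho>])
          show "\<tau> k - \<tau> i \<le> 1" using \<tau>_mono[of 0 i] \<tau>_mono[OF ijk(3)] \<tau>0 st by simp
          have "norm (Y (\<tau> j) - Y (\<tau> i) - f (Y (\<tau> i)) (X (\<tau> j) - X (\<tau> i))) \<le> \<rho> * ((\<tau> j - \<tau> i) powr \<alpha>)\<^sup>2"
            using ijk by (intro fo \<tau>_rng \<tau>_mono) auto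
          also have "\<dots> \<le> \<rho> * ((\<tau> k - \<tau> i) powr \<alpha>)\<^sup>2"
            using \<tau>_mono ijk \<alpha> \<rho> by (intro mult_left_mono power_mono powr_mono2) auto
          finally show "norm (Y (\<tau> j) - Y (\<tau> i) - f (Y (\<tau> i)) (X (\<tau> j) - X (\<tau> i))) \<le> \<rho> * ((\<tau> k - \<tau> i) powr \<alpha>)\<^sup>2" .
        qed (use ijk in \<open>auto intro!: \<tau>_rng \<tau>_mono\<close>)
        also have "\<dots> = 3 * K ^ 6 * (1 + \<rho>) * (real (k - i) * h) powr (3 * \<alpha>)"
          using \<tau>_diff[of i k] ijk h by (simp add: powr3)
        finally show "norm (J i k - J i j - J j k) \<le> 3 * K ^ 6 * (1 + \<rho>) * (real (k - i) * h) powr (3 * \<alpha>)" .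
      qed simp_all
      moreover have "J 0 (Suc n) = (\<Sum>i<Suc n. incr (Y (s + real i * h)) (s + real i * h) (s + real (Suc i) * h)) - incr (Y s) s t"
        unfolding J_def \<tau>0 by (simp only: \<tau>_def atLeast0LessThan)
      ultimately show "norm ((\<Sum>i<Suc n. incr (Y (s + real i * ((t - s) / real (Suc n)))) (s + real i * ((t - s) / real (Suc n))) (s + real (Suc i) * ((t - s) / real (Suc n)))) - incr (Y s) s t)
         \<le> D * (t - s) powr (3 * \<alpha>)"
        using h(2) unfolding h_def[symmetric] D_def by simp
    qed
    then have 1: "norm (It - Is - incr (Y s) s t) \<le> D * ((t - s) powr \<alpha>) ^ 3" using st by (simp add: powr3)
    define w where "w = (t - s) powr \<alpha>"
    have w: "0 \<le> w" "t - s \<le> w\<^sup>2" using le_powr2[of "t - s"] st by (auto simp: w_def)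
    have "norm (integral {0..t} (\<lambda>s. f0 (Y s)) - integral {0..s} (\<lambda>s. f0 (Y s)) - (t - s) *\<^sub>R f0 (Y s)) \<le> K * C * w * (t - s)"
      using drift_integral[OF hol C st(1) less_imp_le[OF st(2)] st(3)] by (simp add: w_def)
    also have "\<dots> \<le> K * C * w * w\<^sup>2" using w K0 C by (intro mult_left_mono) auto
    finally have 2: "norm (integral {0..t} (\<lambda>s. f0 (Y s)) - integral {0..s} (\<lambda>s. f0 (Y s)) - (t - s) *\<^sub>R f0 (Y s)) \<le> K * C * w ^ 3"
      by (simp add: eval_nat_numeral mult_ac)
    have "Y t - Y s - (t - s) *\<^sub>R f0 (Y s) - incr (Y s) s t = (It - Is - incr (Y s) s t) + (integral {0..t} (\<lambda>s. f0 (Y s)) - integral {0..s} (\<lambda>s. f0 (Y s)) - (t - s) *\<^sub>R f0 (Y s))"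
      by (simp add: Is(2) It(2))
    then have "norm (Y t - Y s - (t - s) *\<^sub>R f0 (Y s) - incr (Y s) s t) \<le> D * w ^ 3 + K * C * w ^ 3"
      using norm_triangle_le[OF add_mono[OF 1[folded w_def] 2]] by metis
    then show ?thesis by (simp add: w_def distrib_right)
  qed
  show "davie_solution 0 Y"
  proof (rule davie_intro[of 0 1 Y "D + K * C" "norm (Y 0) + C * T powr \<alpha>"])
    show "norm (Y t - Y s - (t - s) *\<^sub>R f0 (Y s) - incr (Y s) s t) \<le> (D + K * C) * ((t - s) powr \<alpha>) ^ 3"
      if "0 \<le> s" "s \<le> t" "t \<le> T" "t - s \<le> 1" for s t
      using main[of s t] that by (cases "s = t") (auto simp: incr_refl)
    show "norm (Y t) \<le> norm (Y 0) + C * T powr \<alpha>" if t: "0 \<le> t" "t \<le> T" for t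
    proof -
      have "norm (Y t - Y 0) \<le> C * t powr \<alpha>" using hol[of 0 t] t by simp
      also have "\<dots> \<le> C * T powr \<alpha>" using t C \<alpha> by (intro mult_left_mono powr_mono2) auto
      finally show ?thesis using norm_triangle_sub[of "Y t" "Y 0"] by simp
    qed
  qed (use D0 C K0 in auto)
  obtain I where I: "has_rough_integral tens X XX (\<lambda>s. f (Y s)) (\<lambda>s. fderiv f (Y s) o\<^sub>L Y' s) 0 I"
       "Y 0 = \<xi> + integral {0..0} (\<lambda>s. f0 (Y s)) + I" using ex[of 0] T by auto
  have "norm I \<le> 0 + e" if e: "0 < e" for e
  proof -
    have "\<exists>d>0. \<forall>(n::nat) p. p 0 = 0 \<and> p n = 0 \<and> (\<forall>i<n. p i < p (Suc i) \<and> p (Suc i) - p i < d) \<longrightarrow>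
       norm ((\<Sum>i<n. f (Y (p i)) (X (p (Suc i)) - X (p i)) + tensor_lift tens (fderiv f (Y (p i)) o\<^sub>L Y' (p i)) (XX (p i) (p (Suc i)))) - I) < e"
      using I(1) e unfolding has_rough_integral_def by simp
    then obtain d where d: "\<forall>(n::nat) p. p 0 = 0 \<and> p n = 0 \<and> (\<forall>i<n. p i < p (Suc i) \<and> p (Suc i) - p i < d) \<longrightarrow>
       norm ((\<Sum>i<n. f (Y (p i)) (X (p (Suc i)) - X (p i)) + tensor_lift tens (fderiv f (Y (p i)) o\<^sub>L Y' (p i)) (XX (p i) (p (Suc i)))) - I) < e"
      by blast
    show ?thesis using d[rule_format, of "\<lambda>_. 0" 0] by simp
  qed
  then have "norm I \<le> 0" by (rule field_le_epsilon)
  then show "Y 0 = \<xi>" using I(2) by simp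
qed

theorem the_rde_solution_iff:
  "the_rde_solution tens \<alpha> T f0 f X XX \<xi> Y \<longleftrightarrow> davie_solution 0 Y \<and> Y 0 = \<xi>"
proof
  assume "the_rde_solution tens \<alpha> T f0 f X XX \<xi> Y"
  then show "davie_solution 0 Y \<and> Y 0 = \<xi>" using rde_davie unfolding the_rde_solution_def by blast
next
  assume Y: "davie_solution 0 Y \<and> Y 0 = \<xi>"
  then have "rde_solution tens \<alpha> T f0 f X XX \<xi> Y (\<lambda>t. f (Y t))" using davie_rde by blast
  moreover have "Z t = Y t" if "rde_solution tens \<alpha> T f0 f X XX \<xi> Z Z'" "t \<in> {0..T}" for Z Z' t
    using rde_davie[OF that(1)] Y that(2) by (auto intro: davie_unique[of 0 Z Y])
  ultimately show "the_rde_solution tens \<alpha> T f0 f X XX \<xi> Y" unfolding the_rde_solution_def by blast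
qed

end

section \<open>Linear maps on the completed tensor product\<close>

lemma tensor_ext:
  fixes B C :: "'z::banach \<Rightarrow>\<^sub>L 'w::real_normed_vector"
  assumes "completed_tensor_product (tens :: 'v::real_normed_vector \<Rightarrow> 'v \<Rightarrow> 'z)" "\<And>v w. B (tens v w) = C (tens v w)"
  shows "B = C"
proof (rule blinfun_eqI)
  fix z
  have "closure (span (range (\<lambda>(v, w). tens v w))) \<subseteq> {z. B z = C z}"
  proof (intro closure_minimal span_minimal)
    show "subspace {z. B z = C z}"
      by (auto simp: subspace_def blinfun.add_right blinfun.scaleR_right)
    show "closed {z. B z = C z}" by (intro closed_Collect_eq continuous_intros)
  qed (use assms(2) in auto)
  then show "B z = C z" using assms(1) by (auto simp: completed_tensor_product_def)
qed

lemma tensor_lift_exists: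
  assumes "completed_tensor_product tens" "has_canonical_injection TYPE('w::real_normed_vector) (tens :: 'v::real_normed_vector \<Rightarrow> 'v \<Rightarrow> 'z::banach)"
  obtains C where "\<And>(A :: 'v \<Rightarrow>\<^sub>L 'v \<Rightarrow>\<^sub>L 'w) v w. tensor_lift tens A (tens v w) = A v w"
    "\<And>A :: 'v \<Rightarrow>\<^sub>L 'v \<Rightarrow>\<^sub>L 'w. norm (tensor_lift tens A) \<le> C * norm A"
proof -
  obtain C where C: "\<And>A :: 'v \<Rightarrow>\<^sub>L 'v \<Rightarrow>\<^sub>L 'w. \<exists>B :: 'z \<Rightarrow>\<^sub>L 'w. norm B \<le> C * norm A \<and> (\<forall>v w. blinfun_apply B (tens v w) = blinfun_apply (blinfun_apply A v) w)"
    using assms(2) unfolding has_canonical_injection_def by blast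
  have lift: "norm (tensor_lift tens A) \<le> C * norm A \<and> (\<forall>v w. tensor_lift tens A (tens v w) = A v w)"
    for A :: "'v \<Rightarrow>\<^sub>L 'v \<Rightarrow>\<^sub>L 'w"
  proof -
    obtain B :: "'z \<Rightarrow>\<^sub>L 'w" where B: "norm B \<le> C * norm A" "\<forall>v w. B (tens v w) = A v w" using C by blast
    have "tensor_lift tens A = B" unfolding tensor_lift_def
      using B(2) by (intro the_equality) (auto intro!: tensor_ext[OF assms(1)])
    then show ?thesis using B by simp
  qed
  then show thesis using that by blast
qed

text \<open>All the asserted identities and inequalities are closed conditions.\<close>

lemma linear_of_dense:
  fixes g :: "'a::real_normed_vector \<Rightarrow> 'b::real_normed_vector"
  assumes S: "closure S = UNIV" and g: "continuous_on UNIV g"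
    and add: "\<And>x y. x \<in> S \<Longrightarrow> y \<in> S \<Longrightarrow> g (x + y) = g x + g y"
    and scale: "\<And>c x. x \<in> S \<Longrightarrow> g (c *\<^sub>R x) = c *\<^sub>R g x"
    and bound: "\<And>x. x \<in> S \<Longrightarrow> norm (g x) \<le> norm x"
  shows "bounded_linear g"
proof -
  note cont = continuous_on_compose2[OF g, of UNIV]
  have 1: "g (x + y) = g x + g y" if x: "x \<in> S" for x y
  proof -
    have "closure S \<subseteq> {y. g (x + y) = g x + g y}"
      using add x by (intro closure_minimal closed_Collect_eq continuous_intros cont) auto
    then show ?thesis using S by auto
  qed
  have 2: "g (x + y) = g x + g y" for x y
  proof -
    have "closure S \<subseteq> {x. g (x + y) = g x + g y}"
      using 1 by (intro closure_minimal closed_Collect_eq continuous_intros cont) auto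
    then show ?thesis using S by auto
  qed
  have 3: "g (c *\<^sub>R x) = c *\<^sub>R g x" for c x
  proof -
    have "closure S \<subseteq> {x. g (c *\<^sub>R x) = c *\<^sub>R g x}"
      using scale by (intro closure_minimal closed_Collect_eq continuous_intros cont) auto
    then show ?thesis using S by auto
  qed
  have 4: "norm (g x) \<le> norm x" for x
  proof -
    have "closure S \<subseteq> {x. norm (g x) \<le> norm x}"
      using bound by (intro closure_minimal closed_Collect_le continuous_intros cont) auto
    then show ?thesis using S by auto
  qed
  show ?thesis by (rule bounded_linear_intro[of g 1]) (use 2 3 4 in auto)
qed

text \<open>The swap of the factors is given on finite sums of elementary tensors, here represented by
  lists of pairs. Symmetry of the cross norm makes it isometric there; in particular it is well
  defined, and it extends to the completion by uniform continuity.\<close>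

lemma tensor_swap_tens:
  assumes ct: "completed_tensor_product (tens :: 'v::real_normed_vector \<Rightarrow> 'v \<Rightarrow> 'z::banach)"
  shows "tensor_swap tens (tens v w) = tens w v"
proof -
  interpret tens: bounded_bilinear tens using ct by (simp add: completed_tensor_product_def)
  define tp where "tp ps = sum_list (map (\<lambda>p. tens (fst p) (snd p)) ps)" for ps
  define sw where "sw ps = sum_list (map (\<lambda>p. tens (snd p) (fst p)) ps)" for ps
  have iso: "norm (sw ps) = norm (tp ps)" for ps
  proof -
    have "norm (\<Sum>i<length ps. tens (snd (ps ! i)) (fst (ps ! i))) = norm (\<Sum>i<length ps. tens (fst (ps ! i)) (snd (ps ! i)))"
      using ct[unfolded completed_tensor_product_def, THEN conjunct2, THEN conjunct2, THEN conjunct2, THEN conjunct2]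
      by (elim allE)
    then show ?thesis by (simp add: sw_def tp_def sum_list_sum_nth atLeast0LessThan)
  qed
  define scl where "scl c ps = map (\<lambda>p. (c *\<^sub>R fst p, snd p)) ps" for c :: real and ps :: "('v \<times> 'v) list"
  have app: "tp (ps @ qs) = tp ps + tp qs" "sw (ps @ qs) = sw ps + sw qs" for ps qs by (auto simp: tp_def sw_def)
  have scl: "tp (scl c ps) = c *\<^sub>R tp ps" "sw (scl c ps) = c *\<^sub>R sw ps" for c ps
    by (induction ps) (auto simp: tp_def sw_def scl_def tens.scaleR_left tens.scaleR_right scaleR_add_right)
  have diff: "norm (sw ps - sw qs) = norm (tp ps - tp qs)" for ps qs
    using iso[of "ps @ scl (-1) qs"] by (simp add: app scl)
  define g0 where "g0 z = sw (SOME ps. tp ps = z)" for z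
  have g0: "g0 (tp ps) = sw ps" for ps
  proof -
    have "tp (SOME qs. tp qs = tp ps) = tp ps" by (rule someI[of "\<lambda>qs. tp qs = tp ps"]) simp
    then show ?thesis using diff[of "SOME qs. tp qs = tp ps" ps] by (simp add: g0_def)
  qed
  have "span (range (\<lambda>(v, w). tens v w)) \<subseteq> range tp"
  proof (rule span_minimal)
    show "range (\<lambda>(v, w). tens v w) \<subseteq> range tp"
    proof (clarsimp)
      fix v w
      have "tens v w = tp [(v, w)]" by (simp add: tp_def)
      then show "tens v w \<in> range tp" by blast
    qed
    show "subspace (range tp)"
    proof (rule subspaceI)
      have "0 = tp []" by (simp add: tp_def)
      then show "0 \<in> range tp" by blast
    qed (auto simp: app[symmetric] scl[symmetric])
  qed
  then have dense: "closure (range tp) = UNIV"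
    using closure_mono[of _ "range tp"]
      ct[unfolded completed_tensor_product_def, THEN conjunct2, THEN conjunct2, THEN conjunct1] by blast
  have "uniformly_continuous_on (range tp) g0"
    unfolding uniformly_continuous_on_def by (auto simp: g0 dist_norm diff)
  then obtain g where uc: "uniformly_continuous_on (closure (range tp)) g" and g: "\<And>x. x \<in> range tp \<Longrightarrow> g0 x = g x"
    using uniformly_continuous_on_extension_on_closure by metis
  have cont: "continuous_on UNIV g" using uc dense uniformly_continuous_imp_continuous by metis
  have gtp: "g (tp ps) = sw ps" for ps using g[of "tp ps"] g0 by simp
  have "bounded_linear g"
    by (rule linear_of_dense[OF dense cont]) (auto simp: gtp app[symmetric] scl[symmetric] iso)
  then have "blinfun_apply (Blinfun g) (tens v w) = tens w v" for v w
    using gtp[of "[(v, w)]"] by (simp add: bounded_linear_Blinfun_apply tp_def sw_def)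
  then have "\<exists>!S :: 'z \<Rightarrow>\<^sub>L 'z. \<forall>v w. S (tens v w) = tens w v"
    by (intro ex1I[of _ "Blinfun g"]) (auto intro: tensor_ext[OF ct])
  from theI'[OF this] show ?thesis unfolding tensor_swap_def by blast
qed

text \<open>The map induced by a symmetric bilinear map does not change when the factors are swapped, so
  it sees the symmetric part of a tensor only.\<close>

lemma lift_symmetric:
  assumes ct: "completed_tensor_product (tens :: 'v::real_normed_vector \<Rightarrow> 'v \<Rightarrow> 'z::banach)"
    and B: "\<And>v w. blinfun_apply B (tens v w) = A v w" and sym: "\<And>v w. A v w = A w v"
  shows "blinfun_apply B (tensor_sym tens z) = B z"
proof -
  have "B o\<^sub>L tensor_swap tens = B"
    by (rule tensor_ext[OF ct]) (simp add: tensor_swap_tens[OF ct] B sym)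
  then have "B (tensor_swap tens z) = B z" by (metis blinfun_apply_blinfun_compose)
  then show ?thesis by (simp add: tensor_sym_def blinfun.scaleR_right blinfun.add_right scaleR_2[symmetric])
qed

lemma lift_in_subspace:
  assumes ct: "completed_tensor_product (tens :: 'v::real_normed_vector \<Rightarrow> 'v \<Rightarrow> 'z::banach)"
    and B: "\<And>v w. blinfun_apply B (tens v w) \<in> S" and S: "subspace S" "closed S"
  shows "blinfun_apply B z \<in> S"
proof -
  have "closure (span (range (\<lambda>(v, w). tens v w))) \<subseteq> blinfun_apply B -` S"
  proof (intro closure_minimal span_minimal)
    show "subspace (blinfun_apply B -` S)"
      using S(1) by (auto simp: subspace_def blinfun.add_right blinfun.scaleR_right)
    show "closed (blinfun_apply B -` S)" using S(2) by (intro continuous_closed_vimage) (auto intro!: continuous_intros)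
  qed (use B in auto)
  then show ?thesis using ct by (auto simp: completed_tensor_product_def)
qed

section \<open>Charts of a submanifold\<close>

text \<open>Compactness of the unit sphere of the parameter space.\<close>

lemma inj_bounded_below:
  fixes A :: "(real^'m) \<Rightarrow>\<^sub>L 'w::real_normed_vector"
  assumes "inj A"
  obtains c where "0 < c" "\<And>h. c * norm h \<le> norm (A h)"
proof -
  have "norm (axis undefined 1 :: real^'m) = 1" by (simp add: norm_axis_1)
  then have ne: "sphere 0 1 \<noteq> ({} :: (real^'m) set)" by (metis empty_iff mem_sphere_0)
  obtain x :: "real^'m" where x: "x \<in> sphere 0 1" "\<And>y. y \<in> sphere 0 1 \<Longrightarrow> norm (A x) \<le> norm (A y)"
  proof -
    have "continuous_on (sphere 0 1) (\<lambda>x. norm (A x))" by (intro continuous_intros)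
    from continuous_attains_inf[OF compact_sphere ne this] show ?thesis using that by blast
  qed
  have "A x \<noteq> 0" using x(1) assms by (metis blinfun.zero_right injD mem_sphere_0 norm_zero zero_neq_one)
  show thesis
  proof (rule that[of "norm (A x)"])
    show "0 < norm (A x)" using \<open>A x \<noteq> 0\<close> by simp
    fix h show "norm (A x) * norm h \<le> norm (A h)"
    proof (cases "h = 0")
      case False
      have "norm (A x) \<le> norm (A ((1 / norm h) *\<^sub>R h))" using False by (intro x(2)) simp
      also have "\<dots> = norm (A h) / norm h" by (simp add: blinfun.scaleR_right)
      finally show ?thesis using False by (simp add: pos_le_divide_eq)
    qed simp
  qed
qed

text \<open>A parametrization restricted to a ball on which it is bi-Lipschitz and on which its first
  two derivatives obey uniform bounds; \<open>c\<close> is the lower and \<open>L\<close> the upper constant. The last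
  assumption says that the inverse of the parametrization is continuous.\<close>

locale chart =
  fixes M :: "'w::banach set" and \<phi> :: "real^'m \<Rightarrow> 'w" and \<phi>' and \<phi>'' and z0 :: "real^'m" and r c L :: real
  assumes r: "0 < r" and c: "0 < c" and L: "1 \<le> L"
    and D1: "\<And>z. z \<in> ball z0 r \<Longrightarrow> (\<phi> has_derivative blinfun_apply (\<phi>' z)) (at z)"
    and D2: "\<And>z. z \<in> ball z0 r \<Longrightarrow> (\<phi>' has_derivative blinfun_apply (\<phi>'' z)) (at z)"
    and lip1: "\<And>z z'. z \<in> ball z0 r \<Longrightarrow> z' \<in> ball z0 r \<Longrightarrow> norm (\<phi>' z - \<phi>' z') \<le> L * norm (z - z')"
    and lip2: "\<And>z z'. z \<in> ball z0 r \<Longrightarrow> z' \<in> ball z0 r \<Longrightarrow> norm (\<phi>'' z - \<phi>'' z') \<le> L * norm (z - z')"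
    and le1: "\<And>z. z \<in> ball z0 r \<Longrightarrow> norm (\<phi>' z) \<le> L"
    and le2: "\<And>z. z \<in> ball z0 r \<Longrightarrow> norm (\<phi>'' z) \<le> L"
    and below1: "\<And>z h. z \<in> ball z0 r \<Longrightarrow> c * norm h \<le> norm (\<phi>' z h)"
    and below: "\<And>z z'. z \<in> ball z0 r \<Longrightarrow> z' \<in> ball z0 r \<Longrightarrow> c * norm (z - z') \<le> norm (\<phi> z - \<phi> z')"
    and in_M: "\<And>z. z \<in> ball z0 r \<Longrightarrow> \<phi> z \<in> M"
    and near: "\<And>z e. z \<in> ball z0 r \<Longrightarrow> 0 < e \<Longrightarrow> \<exists>\<rho>>0. M \<inter> ball (\<phi> z) \<rho> \<subseteq> \<phi> ` (ball z0 r \<inter> ball z e)"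
begin

lemma range_closed:
  assumes "z \<in> ball z0 r"
  shows "closed (range (\<phi>' z))"
proof (rule complete_imp_closed[OF complete_isometric_image[OF c subspace_UNIV blinfun.bounded_linear_right]])
  show "\<forall>h\<in>UNIV. c * norm h \<le> norm (\<phi>' z h)" using below1[OF assms] by blast
qed (rule complete_UNIV)

lemma range_subspace: "subspace (range (blinfun_apply (\<phi>' z)))"
  by (rule subspaceI) (auto intro: image_eqI[where x = 0] simp: blinfun.add_right[symmetric] blinfun.scaleR_right[symmetric])

lemma strict:
  assumes "z \<in> ball z0 r" "a \<in> ball z0 r" "b \<in> ball z0 r"
  shows "norm (\<phi> b - \<phi> a - \<phi>' z (b - a)) \<le> L * (norm (a - z) + norm (b - z)) * norm (b - a)"
  by (rule strict_taylor[of "ball z0 r"]) (use assms D1 lip1 L in auto)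

text \<open>Near \<open>z\<close> a secant of the submanifold differs from the image under \<open>\<phi>' z\<close> of the secant in
  the parameters by a vanishing fraction of its length; here the lower bound for \<open>\<phi>\<close> is used. Since
  the range of \<open>\<phi>' z\<close> is closed, limits of rescaled secants belong to it.\<close>

lemma secant_limit_tangent:
  assumes z: "z \<in> ball z0 r" and ab: "\<And>n. a n \<in> ball z0 r" "\<And>n. b n \<in> ball z0 r" "a \<longlonglongrightarrow> z" "b \<longlonglongrightarrow> z"
    and lim: "(\<lambda>n. t n *\<^sub>R (\<phi> (b n) - \<phi> (a n))) \<longlonglongrightarrow> v"
  shows "v \<in> range (\<phi>' z)"
proof -
  have "(\<lambda>n. t n *\<^sub>R (\<phi> (b n) - \<phi> (a n)) - \<phi>' z (t n *\<^sub>R (b n - a n))) \<longlonglongrightarrow> 0"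
  proof (rule Lim_null_comparison)
    show "eventually (\<lambda>n. norm (t n *\<^sub>R (\<phi> (b n) - \<phi> (a n)) - \<phi>' z (t n *\<^sub>R (b n - a n)))
        \<le> L * (norm (a n - z) + norm (b n - z)) * (norm (t n *\<^sub>R (\<phi> (b n) - \<phi> (a n))) / c)) sequentially"
    proof (intro always_eventually allI)
      fix n
      have "norm (b n - a n) \<le> norm (\<phi> (b n) - \<phi> (a n)) / c"
        using below[OF ab(2,1), of n n] c by (simp add: pos_le_divide_eq mult.commute)
      then have "norm (\<phi> (b n) - \<phi> (a n) - \<phi>' z (b n - a n)) \<le> L * (norm (a n - z) + norm (b n - z)) * (norm (\<phi> (b n) - \<phi> (a n)) / c)"
        using L by (intro order_trans[OF strict[OF z ab(1,2)] mult_left_mono]) auto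
      then have "\<bar>t n\<bar> * norm (\<phi> (b n) - \<phi> (a n) - \<phi>' z (b n - a n)) \<le> \<bar>t n\<bar> * (L * (norm (a n - z) + norm (b n - z)) * (norm (\<phi> (b n) - \<phi> (a n)) / c))"
        by (intro mult_left_mono) auto
      moreover have "t n *\<^sub>R (\<phi> (b n) - \<phi> (a n)) - \<phi>' z (t n *\<^sub>R (b n - a n)) = t n *\<^sub>R (\<phi> (b n) - \<phi> (a n) - \<phi>' z (b n - a n))"
        unfolding blinfun.scaleR_right by (simp add: scaleR_diff_right)
      ultimately show "norm (t n *\<^sub>R (\<phi> (b n) - \<phi> (a n)) - \<phi>' z (t n *\<^sub>R (b n - a n)))
        \<le> L * (norm (a n - z) + norm (b n - z)) * (norm (t n *\<^sub>R (\<phi> (b n) - \<phi> (a n))) / c)"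
        by (simp add: mult_ac)
    qed
    have "(\<lambda>n. L * (norm (a n - z) + norm (b n - z)) * (norm (t n *\<^sub>R (\<phi> (b n) - \<phi> (a n))) / c)) \<longlonglongrightarrow>
       L * (norm (z - z) + norm (z - z)) * (norm v / c)"
      using c by (intro tendsto_intros ab lim) auto
    then show "(\<lambda>n. L * (norm (a n - z) + norm (b n - z)) * (norm (t n *\<^sub>R (\<phi> (b n) - \<phi> (a n))) / c)) \<longlonglongrightarrow> 0" by simp
  qed
  from tendsto_diff[OF lim this] have "(\<lambda>n. \<phi>' z (t n *\<^sub>R (b n - a n))) \<longlonglongrightarrow> v" by simp
  then show ?thesis by (rule closed_sequentially[OF range_closed[OF z], rotated]) blast
qed

text \<open>Finitely many of the points may lie outside the range of the chart; they get the preimage \<open>z\<close>.\<close>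

lemma near_preimage:
  assumes z: "z \<in> ball z0 r" and y: "\<And>n. y n \<in> M" "y \<longlonglongrightarrow> \<phi> z"
  obtains b where "eventually (\<lambda>n. \<phi> (b n) = y n) sequentially" "\<And>n. b n \<in> ball z0 r" "b \<longlonglongrightarrow> z"
proof -
  obtain \<rho> where \<rho>: "0 < \<rho>" "M \<inter> ball (\<phi> z) \<rho> \<subseteq> \<phi> ` (ball z0 r \<inter> ball z 1)" using near[OF z, of 1] by auto
  define b where "b n = (if y n \<in> \<phi> ` ball z0 r then SOME x. x \<in> ball z0 r \<and> \<phi> x = y n else z)" for n
  have b1: "\<phi> (b n) = y n \<and> b n \<in> ball z0 r" if "y n \<in> \<phi> ` ball z0 r" for n
  proof -
    have "\<exists>x. x \<in> ball z0 r \<and> \<phi> x = y n" using that by auto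
    from someI_ex[OF this] show ?thesis using that by (simp add: b_def)
  qed
  have "eventually (\<lambda>n. y n \<in> ball (\<phi> z) \<rho>) sequentially"
    by (rule topological_tendstoD[OF y(2)]) (use \<rho> in auto)
  then have ev: "eventually (\<lambda>n. \<phi> (b n) = y n) sequentially"
  proof eventually_elim
    case (elim n)
    then have "y n \<in> \<phi> ` ball z0 r" using \<rho>(2) y(1)[of n] by auto
    then show ?case using b1 by blast
  qed
  have bin: "b n \<in> ball z0 r" for n using b1[of n] z by (cases "y n \<in> \<phi> ` ball z0 r") (auto simp: b_def)
  have "(\<lambda>n. b n - z) \<longlonglongrightarrow> 0"
  proof (rule Lim_null_comparison)
    show "eventually (\<lambda>n. norm (b n - z) \<le> norm (y n - \<phi> z) / c) sequentially" using ev
    proof eventually_elim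
      case (elim n)
      then show ?case using below[OF bin[of n] z] c by (simp add: pos_le_divide_eq mult.commute)
    qed
    have "(\<lambda>n. norm (y n - \<phi> z) / c) \<longlonglongrightarrow> norm (\<phi> z - \<phi> z) / c" using c by (intro tendsto_intros y) auto
    then show "(\<lambda>n. norm (y n - \<phi> z) / c) \<longlonglongrightarrow> 0" by simp
  qed
  then have "b \<longlonglongrightarrow> z" by (simp add: LIM_zero_iff)
  with ev bin show thesis using that by blast
qed

end

lemma shrinking_segment:
  fixes z u :: "'a::real_normed_vector"
  assumes "open S" "z \<in> S"
  obtains t :: "nat \<Rightarrow> real" where "\<And>n. 0 < t n" "t \<longlonglongrightarrow> 0" "\<And>n. z + t n *\<^sub>R u \<in> S"
proof -
  obtain e where e: "0 < e" "ball z e \<subseteq> S" using assms openE by blast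
  define q where "q = e / (norm u + 1)"
  have nu: "0 < norm u + 1" by (simp add: add_nonneg_pos)
  then have q: "0 < q" using e by (simp add: q_def)
  have "q * norm u < q * (norm u + 1)" using q by (intro mult_strict_left_mono) auto
  also have "\<dots> = e" using nu by (simp add: q_def)
  finally have qe: "q * norm u < e" .
  define t where "t n = q * inverse (real (Suc n))" for n
  have t: "0 < t n" "t n \<le> q" for n using q by (auto simp: t_def field_simps)
  show thesis
  proof (rule that[of t])
    show "0 < t n" for n by (rule t)
    show "t \<longlonglongrightarrow> 0" using tendsto_mult[OF tendsto_const LIMSEQ_inverse_real_of_nat, of q] by (simp add: t_def[abs_def])
    show "z + t n *\<^sub>R u \<in> S" for n
    proof -
      have "t n * norm u \<le> q * norm u" using t by (intro mult_right_mono) auto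
      then have "dist z (z + t n *\<^sub>R u) < e" using qe t[of n] by (simp add: dist_norm)
      then show ?thesis using e by auto
    qed
  qed
qed

lemma difference_quotient_tendsto:
  fixes g :: "'a::real_normed_vector \<Rightarrow> 'b::real_normed_vector"
  assumes g: "(g has_derivative g') (at x)" and t: "t \<longlonglongrightarrow> 0" "\<And>n. t n \<noteq> (0::real)"
  shows "(\<lambda>n. (1 / t n) *\<^sub>R (g (x + t n *\<^sub>R v) - g x)) \<longlonglongrightarrow> g' v"
proof -
  have lin: "linear g'" using g has_derivative_linear by blast
  have 1: "((\<lambda>s. x + s *\<^sub>R v) has_derivative (\<lambda>s. s *\<^sub>R v)) (at 0)" by (auto intro!: derivative_eq_intros)
  have "((\<lambda>s. g (x + s *\<^sub>R v)) has_derivative (\<lambda>s. g' (s *\<^sub>R v))) (at 0)"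
    using has_derivative_compose[OF 1, of g g'] g by simp
  then have "((\<lambda>s. norm (g (x + s *\<^sub>R v) - g x - g' (s *\<^sub>R v)) / norm s) \<longlongrightarrow> 0) (at 0)"
    unfolding has_derivative_at by simp
  moreover have "filterlim t (at 0) sequentially" using t by (auto simp: filterlim_at)
  ultimately have "(\<lambda>n. norm (g (x + t n *\<^sub>R v) - g x - g' (t n *\<^sub>R v)) / norm (t n)) \<longlonglongrightarrow> 0"
    by (rule filterlim_compose)
  moreover have "norm ((1 / t n) *\<^sub>R (g (x + t n *\<^sub>R v) - g x) - g' v) = norm (g (x + t n *\<^sub>R v) - g x - g' (t n *\<^sub>R v)) / norm (t n)" for n
  proof -
    have "(1 / t n) *\<^sub>R (g (x + t n *\<^sub>R v) - g x) - g' v = (1 / t n) *\<^sub>R (g (x + t n *\<^sub>R v) - g x - g' (t n *\<^sub>R v))"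
      using t(2)[of n] by (simp add: linear_scale[OF lin] scaleR_diff_right)
    then show ?thesis by simp
  qed
  ultimately have "(\<lambda>n. norm ((1 / t n) *\<^sub>R (g (x + t n *\<^sub>R v) - g x) - g' v)) \<longlonglongrightarrow> 0" by simp
  then show ?thesis using tendsto_norm_zero_iff LIM_zero_iff by blast
qed

context chart
begin

text \<open>A tangent vector of another parametrization is a limit of rescaled secants of the
  submanifold, and these secants can be read in the given chart.\<close>

lemma parametrization_tangent:
  assumes p: "local_parametrization M \<psi> O2 U2" and w: "w \<in> O2" "\<psi> w = \<phi> z" and z: "z \<in> ball z0 r"
  shows "fderiv \<psi> w h \<in> range (\<phi>' z)"
proof -
  have O2: "open O2" and diff: "\<psi> differentiable (at w)" and maps: "\<And>x. x \<in> O2 \<Longrightarrow> \<psi> x \<in> M"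
    using p w by (auto simp: local_parametrization_def C3_on_def homeomorphism_def)
  have der: "(\<psi> has_derivative blinfun_apply (fderiv \<psi> w)) (at w)" by (rule fderiv_works[OF diff])
  obtain t where t: "\<And>n. 0 < t n" and t0: "t \<longlonglongrightarrow> 0" and inO: "\<And>n. w + t n *\<^sub>R h \<in> O2"
    using shrinking_segment[OF O2 w(1)] by blast
  define y where "y n = \<psi> (w + t n *\<^sub>R h)" for n
  have yM: "y n \<in> M" for n using maps inO by (simp add: y_def)
  have "isCont \<psi> w" using der has_derivative_continuous by blast
  moreover have "(\<lambda>n. w + t n *\<^sub>R h) \<longlonglongrightarrow> w + 0 *\<^sub>R h" by (intro tendsto_intros t0)
  ultimately have yz: "y \<longlonglongrightarrow> \<phi> z" unfolding y_def using isCont_tendsto_compose[of w \<psi>] w(2) by simp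
  obtain b where b: "eventually (\<lambda>n. \<phi> (b n) = y n) sequentially" "\<And>n. b n \<in> ball z0 r" "b \<longlonglongrightarrow> z"
    by (rule near_preimage[OF z yM yz]) (rule that)
  have "(\<lambda>n. (1 / t n) *\<^sub>R (\<psi> (w + t n *\<^sub>R h) - \<psi> w)) \<longlonglongrightarrow> fderiv \<psi> w h"
    by (rule difference_quotient_tendsto[OF der t0]) (use t in \<open>simp add: less_imp_neq[THEN not_sym]\<close>)
  moreover have "eventually (\<lambda>n. (1 / t n) *\<^sub>R (\<psi> (w + t n *\<^sub>R h) - \<psi> w) = (1 / t n) *\<^sub>R (\<phi> (b n) - \<phi> z)) sequentially"
    using b(1) by eventually_elim (simp add: y_def w(2))
  ultimately have lim: "(\<lambda>n. (1 / t n) *\<^sub>R (\<phi> (b n) - \<phi> z)) \<longlonglongrightarrow> fderiv \<psi> w h"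
    by (rule Lim_transform_eventually)
  show ?thesis by (rule secant_limit_tangent[OF z z b(2) tendsto_const b(3) lim])
qed

end

text \<open>Continuity of the first three derivatives at one point provides bounds on a small ball. The
  ball is shrunk further until the derivative varies by a small fraction of its lower bound.\<close>

lemma chart_exists:
  fixes M :: "'w::banach set"
  assumes M: "C3_submanifold TYPE('m::finite) M" and y: "y \<in> M"
  obtains \<phi> :: "real^'m \<Rightarrow> 'w" and z0 r c L where "chart M \<phi> (fderiv \<phi>) (fderiv (fderiv \<phi>)) z0 r c L" "\<phi> z0 = y"
    "\<And>z. z \<in> ball z0 r \<Longrightarrow> tangent_space TYPE('m) M (\<phi> z) = range (fderiv \<phi> z)"
proof -
  obtain \<phi> :: "real^'m \<Rightarrow> 'w" and O' U where p: "y \<in> U" "local_parametrization M \<phi> O' U"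
    using M y unfolding C3_submanifold_def by blast
  obtain \<psi> where hom: "homeomorphism O' (U \<inter> M) \<phi> \<psi>" using p(2) unfolding local_parametrization_def by blast
  have op: "open O'" "open U" and inj: "\<And>z. z \<in> O' \<Longrightarrow> inj (fderiv \<phi> z)" and C3: "C3_on O' \<phi>"
    using p(2) by (auto simp: local_parametrization_def)
  define z0 where "z0 = \<psi> y"
  have z0: "z0 \<in> O'" "\<phi> z0 = y" using hom p(1) y by (auto simp: homeomorphism_def z0_def)
  define d1 where "d1 = fderiv \<phi>"
  define d2 where "d2 = fderiv d1"
  define d3 where "d3 = fderiv d2"
  have der1: "(\<phi> has_derivative blinfun_apply (d1 z)) (at z)" 
    and der2: "(d1 has_derivative blinfun_apply (d2 z)) (at z)"
    and der3: "(d2 has_derivative blinfun_apply (d3 z)) (at z)" if "z \<in> O'" for z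
    using C3 that by (auto simp: C3_on_def C2_on_def C1_on_def d1_def d2_def d3_def intro!: fderiv_works)
  have cont3: "continuous_on O' d3" using C3 by (simp add: C3_on_def C2_on_def C1_on_def d1_def d2_def d3_def)
  have c1: "isCont d1 z0" and c2: "isCont d2 z0" using der2[OF z0(1)] der3[OF z0(1)] has_derivative_continuous by blast+
  have c3: "isCont d3 z0" using cont3 op z0 continuous_on_eq_continuous_at by blast
  obtain k where k: "0 < k" "\<And>h. k * norm h \<le> norm (d1 z0 h)" using inj_bounded_below[OF inj[OF z0(1)]] by (auto simp: d1_def)
  define L where "L = norm (d1 z0) + norm (d2 z0) + norm (d3 z0) + 1 + k"
  have L: "1 \<le> L" "norm (d1 z0) < L" "norm (d2 z0) < L" "norm (d3 z0) < L" using k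
    by (auto simp: L_def add_nonneg_pos add_pos_nonneg intro: add_strict_increasing2 add_strict_increasing)
  have ev: "eventually (\<lambda>z. norm (d1 z) < L \<and> norm (d2 z) < L \<and> norm (d3 z) < L) (nhds z0)"
    using c1 c2 c3 L unfolding isCont_def tendsto_at_iff_tendsto_nhds
    by (intro eventually_conj; intro order_tendstoD(2)[OF tendsto_norm])
  moreover have "eventually (\<lambda>z. z \<in> O') (nhds z0)" using op z0 eventually_nhds by blast
  ultimately have "eventually (\<lambda>z. norm (d1 z) < L \<and> norm (d2 z) < L \<and> norm (d3 z) < L \<and> z \<in> O') (nhds z0)"
    by eventually_elim simp
  then obtain e where e: "0 < e" "\<And>z. z \<in> ball z0 e \<Longrightarrow> norm (d1 z) < L \<and> norm (d2 z) < L \<and> norm (d3 z) < L \<and> z \<in> O'"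
    unfolding eventually_nhds_metric by (metis dist_commute mem_ball)
  define r where "r = min e (k / (8 * L))"
  have r: "0 < r" "r \<le> e" "L * r \<le> k / 8" using e k L by (auto simp: r_def min_def field_simps)
  have B: "z \<in> O'" "norm (d1 z) \<le> L" "norm (d2 z) \<le> L" "norm (d3 z) \<le> L" if "z \<in> ball z0 r" for z
    using e(2)[of z] r that by auto
  have lip1: "norm (d1 z - d1 z') \<le> L * norm (z - z')" if "z \<in> ball z0 r" "z' \<in> ball z0 r" for z z'
    by (rule differentiable_bound[of "ball z0 r" d1 "\<lambda>z. blinfun_apply (d2 z)"])
      (use that B in \<open>auto intro!: has_derivative_at_withinI der2 simp: norm_blinfun.rep_eq[symmetric]\<close>)
  have lip2: "norm (d2 z - d2 z') \<le> L * norm (z - z')" if "z \<in> ball z0 r" "z' \<in> ball z0 r" for z z'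
    by (rule differentiable_bound[of "ball z0 r" d2 "\<lambda>z. blinfun_apply (d3 z)"])
      (use that B in \<open>auto intro!: has_derivative_at_withinI der3 simp: norm_blinfun.rep_eq[symmetric]\<close>)
  have nr: "norm (z - z0) \<le> r" if "z \<in> ball z0 r" for z using that by (simp add: dist_norm norm_minus_commute)
  have below1: "k / 2 * norm h \<le> norm (d1 z h)" if z: "z \<in> ball z0 r" for z h
  proof -
    have "norm (d1 z0 - d1 z) \<le> L * r"
    proof -
      have "L * norm (z0 - z) \<le> L * r" using nr[OF z] L by (intro mult_left_mono) (auto simp: norm_minus_commute)
      then show ?thesis using lip1[of z0 z] z r by auto
    qed
    then have "norm ((d1 z0 - d1 z) h) \<le> k / 8 * norm h"
      using norm_blinfun[of "d1 z0 - d1 z" h] r(3) by (meson mult_right_mono norm_ge_zero order_trans)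
    moreover have "norm (d1 z0 h) \<le> norm ((d1 z0 - d1 z) h) + norm (d1 z h)"
      using norm_triangle_sub[of "d1 z0 h" "d1 z h"] by (simp add: blinfun.diff_left add.commute)
    moreover have "k / 8 * norm h \<le> k / 2 * norm h" using k by (intro mult_right_mono) auto
    ultimately show ?thesis using k(2)[of h] by linarith
  qed
  have below: "k / 2 * norm (z - z') \<le> norm (\<phi> z - \<phi> z')" if zz: "z \<in> ball z0 r" "z' \<in> ball z0 r" for z z'
  proof -
    have "norm (\<phi> z - \<phi> z' - d1 z0 (z - z')) \<le> L * (norm (z' - z0) + norm (z - z0)) * norm (z - z')"
      by (rule strict_taylor[of "ball z0 r"]) (use zz B der1 lip1 L r in auto)
    also have "\<dots> \<le> (2 * (L * r)) * norm (z - z')"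
    proof -
      have "L * (norm (z' - z0) + norm (z - z0)) \<le> L * (r + r)" using nr zz L by (intro mult_left_mono add_mono) auto
      then show ?thesis by (intro mult_right_mono) auto
    qed
    also have "\<dots> \<le> k / 2 * norm (z - z')"
    proof (rule mult_right_mono)
      show "2 * (L * r) \<le> k / 2" using r(3) k(1) by linarith
    qed simp
    finally have "norm (d1 z0 (z - z')) \<le> k / 2 * norm (z - z') + norm (\<phi> z - \<phi> z')"
      using norm_triangle_sub[of "d1 z0 (z - z')" "\<phi> z - \<phi> z'"] by (simp add: norm_minus_commute)
    then show ?thesis using k(2)[of "z - z'"] by simp
  qed
  have near: "\<exists>\<rho>>0. M \<inter> ball (\<phi> z) \<rho> \<subseteq> \<phi> ` (ball z0 r \<inter> ball z e')" if z: "z \<in> ball z0 r" and e': "0 < e'" for z e'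
  proof -
    have "openin (top_of_set (U \<inter> M)) (\<phi> ` (ball z0 r \<inter> ball z e'))"
      using homeomorphism_imp_open_map[OF hom] B(1) op
      by (meson Int_lower1 openin_open_eq open_Int open_ball subsetI subset_trans)
    then obtain V where V: "open V" "\<phi> ` (ball z0 r \<inter> ball z e') = (U \<inter> M) \<inter> V" by (auto simp: openin_open)
    have "\<phi> z \<in> U \<inter> V" using V(2) z e' by (metis IntE IntI centre_in_ball imageI)
    then obtain \<rho> where "0 < \<rho>" "ball (\<phi> z) \<rho> \<subseteq> U \<inter> V" using op V openE[of "U \<inter> V" "\<phi> z"] by blast
    then show ?thesis using V(2) by blast
  qed
  have ch: "chart M \<phi> d1 d2 z0 r (k / 2) L"
  proof
    show "\<phi> z \<in> M" if "z \<in> ball z0 r" for z using hom B(1)[OF that] by (auto simp: homeomorphism_def)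
  qed (use r k L B der1 der2 lip1 lip2 below1 below near in auto)
  show thesis
  proof (rule that[OF ch[unfolded d2_def d1_def] z0(2)])
    fix z assume z: "z \<in> ball z0 r"
    interpret chart M \<phi> d1 d2 z0 r "k / 2" L by (rule ch)
    show "tangent_space TYPE('m) M (\<phi> z) = range (fderiv \<phi> z)"
    proof
      show "tangent_space TYPE('m) M (\<phi> z) \<subseteq> range (fderiv \<phi> z)"
        using parametrization_tangent[OF _ _ _ z] by (auto simp: tangent_space_def d1_def)
      show "range (fderiv \<phi> z) \<subseteq> tangent_space TYPE('m) M (\<phi> z)"
        using p(2) B(1)[OF z] unfolding tangent_space_def by blast
    qed
  qed
qed

section \<open>Steps along a submanifold\<close>

context chart
begin

text \<open>The expansion is differentiated along the segment from \<open>z\<close> to \<open>z + \<zeta>\<close>, where the first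
  order expansion of \<open>\<phi>'\<close> applies.\<close>

lemma third_order_taylor:
  assumes z: "z \<in> ball z0 r" and z': "z + \<zeta> \<in> ball z0 r"
  shows "norm (\<phi> (z + \<zeta>) - \<phi> z - \<phi>' z \<zeta> - (1/2) *\<^sub>R \<phi>'' z \<zeta> \<zeta>) \<le> L * norm \<zeta> ^ 3"
proof -
  define e where "e t = \<phi> (z + t *\<^sub>R \<zeta>) - t *\<^sub>R \<phi>' z \<zeta> - (t\<^sup>2 / 2) *\<^sub>R \<phi>'' z \<zeta> \<zeta>" for t
  have inb: "z + t *\<^sub>R \<zeta> \<in> ball z0 r" if t: "t \<in> {0..1}" for t
  proof -
    have "(1 - t) *\<^sub>R z + t *\<^sub>R (z + \<zeta>) \<in> ball z0 r" using t by (intro convexD_alt[OF convex_ball z z']) auto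
    then show ?thesis by (simp add: algebra_simps)
  qed
  have "norm (e 1 - e 0) \<le> (L * norm \<zeta> ^ 3) * norm (1 - 0 :: real)"
  proof (rule differentiable_bound[of "{0..1}" e "\<lambda>t s. s *\<^sub>R (\<phi>' (z + t *\<^sub>R \<zeta>) \<zeta> - \<phi>' z \<zeta> - t *\<^sub>R \<phi>'' z \<zeta> \<zeta>)"])
    fix t :: real assume t: "t \<in> {0..1}"
    have 1: "((\<lambda>t. z + t *\<^sub>R \<zeta>) has_derivative (\<lambda>s. s *\<^sub>R \<zeta>)) (at t)" by (auto intro!: derivative_eq_intros)
    have "((\<lambda>t. \<phi> (z + t *\<^sub>R \<zeta>)) has_derivative (\<lambda>s. \<phi>' (z + t *\<^sub>R \<zeta>) (s *\<^sub>R \<zeta>))) (at t)"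
      by (rule has_derivative_compose[OF 1 D1[OF inb[OF t]]])
    then have 2: "((\<lambda>t. \<phi> (z + t *\<^sub>R \<zeta>)) has_derivative (\<lambda>s. s *\<^sub>R \<phi>' (z + t *\<^sub>R \<zeta>) \<zeta>)) (at t)"
      by (simp add: blinfun.scaleR_right)
    have "(e has_derivative (\<lambda>s. s *\<^sub>R \<phi>' (z + t *\<^sub>R \<zeta>) \<zeta> - s *\<^sub>R \<phi>' z \<zeta> - (s * t) *\<^sub>R \<phi>'' z \<zeta> \<zeta>)) (at t)"
      unfolding e_def by (rule derivative_eq_intros refl 2 | simp)+
    then have "(e has_derivative (\<lambda>s. s *\<^sub>R (\<phi>' (z + t *\<^sub>R \<zeta>) \<zeta> - \<phi>' z \<zeta> - t *\<^sub>R \<phi>'' z \<zeta> \<zeta>))) (at t)"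
      by (simp add: scaleR_diff_right)
    then show "(e has_derivative (\<lambda>s. s *\<^sub>R (\<phi>' (z + t *\<^sub>R \<zeta>) \<zeta> - \<phi>' z \<zeta> - t *\<^sub>R \<phi>'' z \<zeta> \<zeta>))) (at t within {0..1})"
      by (rule has_derivative_at_withinI)
    have "norm (\<phi>' (z + t *\<^sub>R \<zeta>) - \<phi>' z - \<phi>'' z (z + t *\<^sub>R \<zeta> - z)) \<le> L * (norm (z - z) + norm (z + t *\<^sub>R \<zeta> - z)) * norm (z + t *\<^sub>R \<zeta> - z)"
      by (rule strict_taylor[OF convex_ball D2 lip2 z inb[OF t] z]) (use L in auto)
    also have "\<dots> = L * (t * norm \<zeta>)\<^sup>2" using t by (simp add: power2_eq_square)
    also have "\<dots> \<le> L * (1 * norm \<zeta>)\<^sup>2" using t L by (intro mult_left_mono power_mono mult_right_mono) auto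
    finally have "norm ((\<phi>' (z + t *\<^sub>R \<zeta>) - \<phi>' z - \<phi>'' z (z + t *\<^sub>R \<zeta> - z)) \<zeta>) \<le> L * (1 * norm \<zeta>)\<^sup>2 * norm \<zeta>"
      by (rule order_trans[OF norm_blinfun mult_right_mono]) simp
    then have *: "norm (\<phi>' (z + t *\<^sub>R \<zeta>) \<zeta> - \<phi>' z \<zeta> - t *\<^sub>R \<phi>'' z \<zeta> \<zeta>) \<le> L * norm \<zeta> ^ 3"
      by (simp add: blinfun.diff_left blinfun.scaleR_left blinfun.scaleR_right eval_nat_numeral mult_ac)
    show "onorm (\<lambda>s. s *\<^sub>R (\<phi>' (z + t *\<^sub>R \<zeta>) \<zeta> - \<phi>' z \<zeta> - t *\<^sub>R \<phi>'' z \<zeta> \<zeta>)) \<le> L * norm \<zeta> ^ 3"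
      by (rule onorm_le) (use mult_left_mono[OF *] in \<open>simp add: mult.commute\<close>)
  qed auto
  then show ?thesis by (simp add: e_def algebra_simps)
qed

lemma second_symmetric: "z \<in> ball z0 r \<Longrightarrow> \<phi>'' z h k = \<phi>'' z k h"
proof -
  assume z: "z \<in> ball z0 r"
  define e where "e = r - dist z0 z"
  have e: "0 < e" using z by (simp add: e_def)
  have sub: "y \<in> ball z0 r" if "y \<in> ball z e" for y
    using that dist_triangle[of z0 y z] by (simp add: e_def)
  show ?thesis
    by (rule second_derivative_symmetric[OF e D1[OF sub] D2[OF sub] lip2[OF sub sub]]) (use L in simp_all)
qed

text \<open>The coordinates of convergent tangent vectors are bounded, so replacing \<open>\<phi>' (z n)\<close> by its
  limit changes them by a null sequence.\<close>

lemma tangent_closed: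
  assumes "\<And>n. z n \<in> ball z0 r" "z \<longlonglongrightarrow> zl" "zl \<in> ball z0 r" "\<And>n. u n \<in> range (\<phi>' (z n))" "u \<longlonglongrightarrow> v"
  shows "v \<in> range (\<phi>' zl)"
proof -
  have "\<forall>n. \<exists>h. u n = \<phi>' (z n) h" using assms(4) by blast
  then obtain h where h: "\<And>n. u n = \<phi>' (z n) (h n)" by metis
  have "(\<lambda>n. u n - \<phi>' zl (h n)) \<longlonglongrightarrow> 0"
  proof (rule Lim_null_comparison)
    show "eventually (\<lambda>n. norm (u n - \<phi>' zl (h n)) \<le> L * norm (z n - zl) * (norm (u n) / c)) sequentially"
    proof (intro always_eventually allI)
      fix n
      have "norm (h n) \<le> norm (u n) / c" using below1[OF assms(1)[of n], of "h n"] c by (simp add: h pos_le_divide_eq mult.commute)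
      then have "norm ((\<phi>' (z n) - \<phi>' zl) (h n)) \<le> L * norm (z n - zl) * (norm (u n) / c)"
        using lip1[OF assms(1)[of n] assms(3)] L by (intro order_trans[OF norm_blinfun] mult_mono) auto
      then show "norm (u n - \<phi>' zl (h n)) \<le> L * norm (z n - zl) * (norm (u n) / c)" by (simp add: h blinfun.diff_left)
    qed
    have "(\<lambda>n. L * norm (z n - zl) * (norm (u n) / c)) \<longlonglongrightarrow> L * norm (zl - zl) * (norm v / c)"
      using c by (intro tendsto_intros assms) auto
    then show "(\<lambda>n. L * norm (z n - zl) * (norm (u n) / c)) \<longlonglongrightarrow> 0" by simp
  qed
  from tendsto_diff[OF assms(5) this] have "(\<lambda>n. \<phi>' zl (h n)) \<longlonglongrightarrow> v" by simp
  then show ?thesis by (rule closed_sequentially[OF range_closed[OF assms(3)], rotated]) blast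
qed

end

locale rough_geometric = rough_diffeq tens \<alpha> T K X XX f0 f Df D2f lft
  for tens :: "'v::real_normed_vector \<Rightarrow> 'v \<Rightarrow> 'z::banach"
    and \<alpha> T K :: real
    and X :: "real \<Rightarrow> 'v" and XX :: "real \<Rightarrow> real \<Rightarrow> 'z"
    and f0 :: "'w::banach \<Rightarrow> 'w" and f :: "'w \<Rightarrow> 'v \<Rightarrow>\<^sub>L 'w"
    and Df :: "'w \<Rightarrow> 'w \<Rightarrow>\<^sub>L 'v \<Rightarrow>\<^sub>L 'w" and D2f :: "'w \<Rightarrow> 'w \<Rightarrow>\<^sub>L 'w \<Rightarrow>\<^sub>L 'v \<Rightarrow>\<^sub>L 'w"
    and lft :: "('v \<Rightarrow>\<^sub>L 'v \<Rightarrow>\<^sub>L 'w) \<Rightarrow> 'z \<Rightarrow>\<^sub>L 'w" +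
  assumes ct: "completed_tensor_product tens"
    and geometric: "\<And>s t. 0 \<le> s \<Longrightarrow> s \<le> t \<Longrightarrow> t \<le> T \<Longrightarrow>
      tensor_sym tens (XX s t) = (1/2) *\<^sub>R tens (X t - X s) (X t - X s)"
begin

text \<open>Weak geometricity prescribes the symmetric part of the second level of the driver.\<close>

lemma lft_symmetric:
  fixes A :: "'v \<Rightarrow>\<^sub>L 'v \<Rightarrow>\<^sub>L 'w"
  assumes "\<And>v w. A v w = A w v" "0 \<le> s" "s \<le> t" "t \<le> T"
  shows "lft A (XX s t) = (1/2) *\<^sub>R A (X t - X s) (X t - X s)"
proof -
  have "lft A (XX s t) = lft A (tensor_sym tens (XX s t))"
    by (rule lift_symmetric[OF ct lft_tens assms(1), symmetric])
  then show ?thesis by (simp add: geometric[OF assms(2-4)] blinfun.scaleR_right lft_tens)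
qed

text \<open>The vector field in the coordinates of the chart.\<close>

lemma lifted_field:
  fixes \<phi> :: "real^'m \<Rightarrow> 'w"
  assumes "chart M \<phi> \<phi>' \<phi>'' z0 r c L" and z: "z \<in> ball z0 r" and tan: "\<And>v. f (\<phi> z) v \<in> range (\<phi>' z)"
  obtains \<sigma> :: "'v \<Rightarrow>\<^sub>L (real^'m)" where "\<And>v. \<phi>' z (\<sigma> v) = f (\<phi> z) v" "norm \<sigma> \<le> K / c"
proof -
  interpret chart M \<phi> \<phi>' \<phi>'' z0 r c L by fact
  have inj: "h = k" if "\<phi>' z h = \<phi>' z k" for h k
  proof -
    have "c * norm (h - k) \<le> 0" using below1[OF z, of "h - k"] that by (simp add: blinfun.diff_right)
    then show ?thesis using c by (simp add: mult_le_0_iff)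
  qed
  define g where "g v = (SOME h. \<phi>' z h = f (\<phi> z) v)" for v
  have g: "\<phi>' z (g v) = f (\<phi> z) v" for v
    unfolding g_def by (rule someI_ex) (use tan[of v] in \<open>metis imageE\<close>)
  have gle: "norm (g v) \<le> K / c * norm v" for v
  proof -
    have "c * norm (g v) \<le> K * norm v" using below1[OF z, of "g v"] norm_apply_le[OF f_le order_refl, of "\<phi> z" v] by (simp add: g)
    then show ?thesis using c by (simp add: field_simps)
  qed
  have bl: "bounded_linear g"
  proof (rule bounded_linear_intro)
    show "g (v + w) = g v + g w" for v w by (rule inj) (simp add: g blinfun.add_right)
    show "g (a *\<^sub>R v) = a *\<^sub>R g v" for a v by (rule inj) (simp add: g blinfun.scaleR_right)
    show "norm (g v) \<le> norm v * (K / c)" for v using gle[of v] by (simp add: mult.commute)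
  qed
  show thesis
  proof (rule that[of "Blinfun g"])
    show "\<phi>' z (Blinfun g v) = f (\<phi> z) v" for v by (simp add: bounded_linear_Blinfun_apply[OF bl] g)
    show "norm (Blinfun g) \<le> K / c"
      by (rule norm_blinfun_bound) (use c K0 gle in \<open>auto simp: bounded_linear_Blinfun_apply[OF bl]\<close>)
  qed
qed

text \<open>The identity \<open>f (\<phi> z) w = \<phi>' z (\<sigma> w)\<close>, in which \<open>\<sigma>\<close> depends on \<open>z\<close>, is differentiated in
  the direction \<open>\<sigma> v\<close>. By the product rule the left hand side gives the second level coefficient
  and the right hand side gives \<open>\<phi>'' z (\<sigma> v) (\<sigma> w)\<close> plus the image under \<open>\<phi>' z\<close> of a derivative of
  \<open>\<sigma>\<close>. The latter is treated as a limit of difference quotients in the closed range of \<open>\<phi>' z\<close>, so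
  that continuity of \<open>\<sigma>\<close> suffices.\<close>

lemma second_order_tangent:
  fixes \<phi> :: "real^'m \<Rightarrow> 'w" and \<sigma> :: "'v \<Rightarrow>\<^sub>L (real^'m)"
  assumes ch: "chart M \<phi> \<phi>' \<phi>'' z0 r c L" and z: "z \<in> ball z0 r"
    and tan: "\<And>z v. z \<in> ball z0 r \<Longrightarrow> f (\<phi> z) v \<in> range (\<phi>' z)"
    and \<sigma>: "\<And>v. \<phi>' z (\<sigma> v) = f (\<phi> z) v"
  shows "level2 (\<phi> z) v w - \<phi>'' z (\<sigma> v) (\<sigma> w) \<in> range (\<phi>' z)"
proof -
  interpret chart M \<phi> \<phi>' \<phi>'' z0 r c L by fact
  obtain t where t: "\<And>n. 0 < t n" "t \<longlonglongrightarrow> 0" "\<And>n. z + t n *\<^sub>R \<sigma> v \<in> ball z0 r"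
    using shrinking_segment[OF open_ball z, of "\<sigma> v"] by blast
  have tn: "t n \<noteq> 0" for n using t(1)[of n] by simp
  define y where "y n = z + t n *\<^sub>R \<sigma> v" for n
  have yb: "y n \<in> ball z0 r" for n using t(3) by (simp add: y_def)
  have "\<exists>h. \<phi>' (y n) h = f (\<phi> (y n)) w" for n using tan[OF yb[of n], of w] by (metis imageE)
  then obtain k where k: "\<And>n. \<phi>' (y n) (k n) = f (\<phi> (y n)) w" by metis
  have k_le: "norm (k n) \<le> K * norm w / c" for n
  proof -
    have "c * norm (k n) \<le> K * norm w" using below1[OF yb[of n], of "k n"] norm_apply_le[OF f_le order_refl, of "\<phi> (y n)" w] by (simp add: k)
    then show ?thesis using c by (simp add: field_simps)
  qed
  have der: "((\<lambda>z. f (\<phi> z) w) has_derivative (\<lambda>u. Df (\<phi> z) (\<phi>' z u) w)) (at z)"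
    by (rule bounded_linear.has_derivative[OF blinfun.bounded_linear_left has_derivative_compose[OF D1[OF z] C11D(2)[OF f_C11]]])
  have q1: "(\<lambda>n. (1 / t n) *\<^sub>R (f (\<phi> (y n)) w - f (\<phi> z) w)) \<longlonglongrightarrow> level2 (\<phi> z) v w"
    using difference_quotient_tendsto[OF der t(2) tn, of "\<sigma> v"] by (simp add: y_def \<sigma> level2_def)
  have q2: "(\<lambda>n. (1 / t n) *\<^sub>R (\<phi>' (y n) - \<phi>' z)) \<longlonglongrightarrow> \<phi>'' z (\<sigma> v)"
    using difference_quotient_tendsto[OF D2[OF z] t(2) tn, of "\<sigma> v"] by (simp add: y_def)
  have d1: "(\<lambda>n. f (\<phi> (y n)) w - f (\<phi> z) w) \<longlonglongrightarrow> 0"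
    using tendsto_scaleR[OF t(2) q1] tn by simp
  have d2: "(\<lambda>n. \<phi>' (y n) - \<phi>' z) \<longlonglongrightarrow> 0"
    using tendsto_scaleR[OF t(2) q2] tn by simp
  have "(\<lambda>n. k n - \<sigma> w) \<longlonglongrightarrow> 0"
  proof (rule Lim_null_comparison)
    show "eventually (\<lambda>n. norm (k n - \<sigma> w) \<le> (norm (f (\<phi> (y n)) w - f (\<phi> z) w) + norm (\<phi>' (y n) - \<phi>' z) * (K * norm w / c)) / c) sequentially"
    proof (intro always_eventually allI)
      fix n
      have "\<phi>' z (k n - \<sigma> w) = (f (\<phi> (y n)) w - f (\<phi> z) w) - (\<phi>' (y n) - \<phi>' z) (k n)"
        by (simp add: blinfun.diff_right blinfun.diff_left \<sigma> k)
      also have "norm \<dots> \<le> norm (f (\<phi> (y n)) w - f (\<phi> z) w) + norm (\<phi>' (y n) - \<phi>' z) * (K * norm w / c)"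
        by (intro norm_triangle_le_diff add_mono order_refl norm_apply_le k_le)
      finally have "c * norm (k n - \<sigma> w) \<le> norm (f (\<phi> (y n)) w - f (\<phi> z) w) + norm (\<phi>' (y n) - \<phi>' z) * (K * norm w / c)"
        using below1[OF z, of "k n - \<sigma> w"] by simp
      then show "norm (k n - \<sigma> w) \<le> (norm (f (\<phi> (y n)) w - f (\<phi> z) w) + norm (\<phi>' (y n) - \<phi>' z) * (K * norm w / c)) / c"
        using c by (subst pos_le_divide_eq) (auto simp: mult.commute)
    qed
    have "(\<lambda>n. (norm (f (\<phi> (y n)) w - f (\<phi> z) w) + norm (\<phi>' (y n) - \<phi>' z) * (K * norm w / c)) / c) \<longlonglongrightarrow> (norm (0::'w) + norm (0 :: (real^'m) \<Rightarrow>\<^sub>L 'w) * (K * norm w / c)) / c"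
      using c by (intro tendsto_intros d1 d2) auto
    then show "(\<lambda>n. (norm (f (\<phi> (y n)) w - f (\<phi> z) w) + norm (\<phi>' (y n) - \<phi>' z) * (K * norm w / c)) / c) \<longlonglongrightarrow> 0" by simp
  qed
  then have kl: "k \<longlonglongrightarrow> \<sigma> w" by (simp add: LIM_zero_iff)
  have "(\<lambda>n. (1 / t n) *\<^sub>R (f (\<phi> (y n)) w - f (\<phi> z) w) - ((1 / t n) *\<^sub>R (\<phi>' (y n) - \<phi>' z)) (k n)) \<longlonglongrightarrow> level2 (\<phi> z) v w - \<phi>'' z (\<sigma> v) (\<sigma> w)"
    by (intro tendsto_diff q1 blinfun.tendsto q2 kl)
  moreover have "(1 / t n) *\<^sub>R (f (\<phi> (y n)) w - f (\<phi> z) w) - ((1 / t n) *\<^sub>R (\<phi>' (y n) - \<phi>' z)) (k n) = \<phi>' z ((1 / t n) *\<^sub>R (k n - \<sigma> w))" for n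
    by (simp add: blinfun.diff_right blinfun.diff_left blinfun.scaleR_left blinfun.scaleR_right \<sigma> k scaleR_diff_right)
  ultimately have "(\<lambda>n. \<phi>' z ((1 / t n) *\<^sub>R (k n - \<sigma> w))) \<longlonglongrightarrow> level2 (\<phi> z) v w - \<phi>'' z (\<sigma> v) (\<sigma> w)" by simp
  then show ?thesis by (rule closed_sequentially[OF range_closed[OF z], rotated]) blast
qed

text \<open>An Euler step that starts on the submanifold ends on it up to an error of order three. In
  coordinates one moves by \<open>\<zeta>1 + \<zeta>2\<close>, where \<open>\<zeta>1 = \<sigma> x\<close> follows the lifted vector field and
  \<open>\<zeta>2\<close> is chosen such that \<open>\<phi>' z \<zeta>2\<close> is the second level of the Euler step minus
  \<open>\<phi>'' z (\<sigma> \<cdot>) (\<sigma> \<cdot>)\<close> applied to the second level of the driver, a tangent vector by the previous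
  lemma. For a weakly geometric driver the subtracted term equals \<open>(1/2) *\<^sub>R \<phi>'' z \<zeta>1 \<zeta>1\<close>, and
  this is precisely the quadratic term that the curvature of \<open>\<phi>\<close> adds again.\<close>

lemma chart_step:
  fixes \<phi> :: "real^'m \<Rightarrow> 'w"
  assumes ch: "chart M \<phi> \<phi>' \<phi>'' z0 r c L"
    and tan: "\<And>z v. z \<in> ball z0 r \<Longrightarrow> f (\<phi> z) v \<in> range (\<phi>' z)"
  obtains C where "0 \<le> C"
    "\<And>z s t. z \<in> ball z0 (r / 2) \<Longrightarrow> 0 \<le> s \<Longrightarrow> s \<le> t \<Longrightarrow> t \<le> T \<Longrightarrow> t - s \<le> 1 \<Longrightarrow> C * (t - s) powr \<alpha> \<le> r / 4 \<Longrightarrow>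
       \<exists>\<zeta>. norm \<zeta> \<le> C * (t - s) powr \<alpha> \<and> norm (\<phi> (z + \<zeta>) - \<phi> z - incr (\<phi> z) s t) \<le> C * ((t - s) powr \<alpha>) ^ 3"
proof -
  interpret chart M \<phi> \<phi>' \<phi>'' z0 r c L by fact
  define a where "a = K / c * K"
  define b where "b = K * (K\<^sup>2 + L * (K / c) * (K / c)) * K / c"
  define e where "e = a + b"
  have abe: "0 \<le> a" "0 \<le> b" "0 \<le> e" using K0 c L by (auto simp: a_def b_def e_def)
  define C where "C = e + (L * e ^ 3 + (L * e * b + L * b * a))"
  have Cp: "0 \<le> L * e ^ 3 + (L * e * b + L * b * a)" using abe L by simp
  show thesis
  proof (rule that[of C])
    show "0 \<le> C" using Cp abe by (simp add: C_def)
    fix z s t assume z2: "z \<in> ball z0 (r / 2)" and st: "0 \<le> s" "s \<le> t" "t \<le> T" "t - s \<le> 1" and small: "C * (t - s) powr \<alpha> \<le> r / 4"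
    have z: "z \<in> ball z0 r" using z2 r by auto
    define w where "w = (t - s) powr \<alpha>"
    have w: "0 \<le> w" "w \<le> 1" using powr_le1[of "t - s"] st by (auto simp: w_def)
    define x where "x = X t - X s"
    have x: "norm x \<le> K * w" using X_le[OF st(1-3)] by (simp add: x_def w_def)
    obtain \<sigma> :: "'v \<Rightarrow>\<^sub>L (real^'m)" where \<sigma>: "\<And>v. \<phi>' z (\<sigma> v) = f (\<phi> z) v" "norm \<sigma> \<le> K / c"
      using lifted_field[OF ch z tan[OF z]] by blast
    define S where "S = Blinfun (\<lambda>v. \<phi>'' z (\<sigma> v) o\<^sub>L \<sigma>)"
    have "bounded_linear (\<lambda>v. \<phi>'' z (\<sigma> v) o\<^sub>L \<sigma>)"
      by (rule bounded_linear_compose[OF bounded_bilinear.bounded_linear_left[OF bounded_bilinear_blinfun_compose]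
          bounded_linear_compose[OF blinfun.bounded_linear_right blinfun.bounded_linear_right]])
    then have S: "S v = \<phi>'' z (\<sigma> v) o\<^sub>L \<sigma>" for v by (simp add: S_def bounded_linear_Blinfun_apply)
    have S_le: "norm S \<le> L * (K / c) * (K / c)"
    proof (rule norm_blinfun_bound)
      show "0 \<le> L * (K / c) * (K / c)" using L K0 c by simp
      fix v
      have "norm (S v) \<le> L * (K / c * norm v) * (K / c)"
        unfolding S by (intro norm_compose_le norm_apply_le le2[OF z] \<sigma>(2) order_refl)
      then show "norm (S v) \<le> L * (K / c) * (K / c) * norm v" by (simp add: mult_ac)
    qed
    have S_sym: "S v v' = S v' v" for v v' by (simp add: S second_symmetric[OF z])
    define \<beta> where "\<beta> = level2 (\<phi> z) - S"
    have \<beta>_le: "norm \<beta> \<le> K\<^sup>2 + L * (K / c) * (K / c)"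
      unfolding \<beta>_def by (rule norm_triangle_le_diff[OF add_mono[OF level2_le S_le]])
    have "lft \<beta> (XX s t) \<in> range (\<phi>' z)"
    proof (rule lift_in_subspace[OF ct _ range_subspace range_closed[OF z]])
      show "lft \<beta> (tens v v') \<in> range (\<phi>' z)" for v v'
        using second_order_tangent[OF ch z tan \<sigma>(1), of v v'] by (simp add: lft_tens \<beta>_def blinfun.diff_left S)
    qed
    then obtain \<zeta>2 where \<zeta>2: "\<phi>' z \<zeta>2 = lft \<beta> (XX s t)" by (metis imageE)
    define \<zeta>1 where "\<zeta>1 = \<sigma> x"
    have n1: "norm \<zeta>1 \<le> a * w" unfolding \<zeta>1_def a_def using norm_apply_le[OF \<sigma>(2) x] by (simp add: mult_ac)
    have n2: "norm \<zeta>2 \<le> b * w\<^sup>2"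
    proof -
      have "norm (lft \<beta> (XX s t)) \<le> K * (K\<^sup>2 + L * (K / c) * (K / c)) * (K * w\<^sup>2)"
        using XX_le[OF st(1-3)] by (intro lft_apply_le \<beta>_le) (simp add: w_def)
      then have "c * norm \<zeta>2 \<le> K * (K\<^sup>2 + L * (K / c) * (K / c)) * (K * w\<^sup>2)"
        using below1[OF z, of \<zeta>2] by (simp add: \<zeta>2)
      then show ?thesis using c by (simp add: b_def pos_le_divide_eq mult_ac)
    qed
    define \<zeta> where "\<zeta> = \<zeta>1 + \<zeta>2"
    have "norm \<zeta> \<le> a * w + b * w\<^sup>2" unfolding \<zeta>_def by (rule norm_triangle_le[OF add_mono[OF n1 n2]])
    also have "\<dots> \<le> a * w + b * w" using w abe by (intro add_mono mult_left_mono) (auto simp: power2_eq_square mult_left_le)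
    finally have n: "norm \<zeta> \<le> e * w" by (simp add: e_def algebra_simps)
    have eC: "e * w \<le> C * w" using Cp w by (intro mult_right_mono) (auto simp: C_def)
    have "dist z0 (z + \<zeta>) < r"
    proof -
      have "dist z0 (z + \<zeta>) \<le> dist z0 z + norm \<zeta>" using dist_triangle[of z0 "z + \<zeta>" z] by (simp add: dist_norm)
      also have "\<dots> < r / 2 + r / 4 + r / 4" using z2 n eC small r by (simp add: w_def)
      finally show ?thesis by simp
    qed
    then have z': "z + \<zeta> \<in> ball z0 r" by simp
    define E where "E = \<phi> (z + \<zeta>) - \<phi> z - \<phi>' z \<zeta> - (1/2) *\<^sub>R \<phi>'' z \<zeta> \<zeta>"
    have E: "norm E \<le> L * (e * w) ^ 3"
    proof -
      have "L * norm \<zeta> ^ 3 \<le> L * (e * w) ^ 3" using n L by (intro mult_left_mono power_mono) auto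
      then show ?thesis using third_order_taylor[OF z z'] unfolding E_def by linarith
    qed
    have lS: "lft S (XX s t) = (1/2) *\<^sub>R \<phi>'' z \<zeta>1 \<zeta>1"
      using lft_symmetric[OF S_sym st(1-3)] by (simp add: S \<zeta>1_def x_def)
    have "\<phi>' z \<zeta> = f (\<phi> z) x + lft \<beta> (XX s t)" by (simp add: \<zeta>_def blinfun.add_right \<zeta>2 \<zeta>1_def \<sigma>)
    also have "\<dots> = incr (\<phi> z) s t - (1/2) *\<^sub>R \<phi>'' z \<zeta>1 \<zeta>1"
      by (simp add: incr_def \<beta>_def lft_diff blinfun.diff_left lS x_def)
    finally have "\<phi> (z + \<zeta>) - \<phi> z - incr (\<phi> z) s t = E + (1/2) *\<^sub>R (\<phi>'' z \<zeta> \<zeta>2 + \<phi>'' z \<zeta>2 \<zeta>1)"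
      by (simp add: E_def \<zeta>_def blinfun.add_left blinfun.add_right algebra_simps)
    also have "norm \<dots> \<le> L * (e * w) ^ 3 + (L * (e * w) * (b * w\<^sup>2) + L * (b * w\<^sup>2) * (a * w))"
    proof (rule norm_triangle_le[OF add_mono[OF E]])
      have "norm ((1/2) *\<^sub>R (\<phi>'' z \<zeta> \<zeta>2 + \<phi>'' z \<zeta>2 \<zeta>1)) \<le> norm (\<phi>'' z \<zeta> \<zeta>2 + \<phi>'' z \<zeta>2 \<zeta>1)" by simp
      also have "\<dots> \<le> L * (e * w) * (b * w\<^sup>2) + L * (b * w\<^sup>2) * (a * w)"
        by (intro norm_triangle_le add_mono norm_apply_le le2[OF z] n n1 n2)
      finally show "norm ((1/2) *\<^sub>R (\<phi>'' z \<zeta> \<zeta>2 + \<phi>'' z \<zeta>2 \<zeta>1)) \<le> L * (e * w) * (b * w\<^sup>2) + L * (b * w\<^sup>2) * (a * w)" .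
    qed
    also have "\<dots> = (L * e ^ 3 + (L * e * b + L * b * a)) * w ^ 3"
      by (simp add: power_mult_distrib algebra_simps eval_nat_numeral)
    also have "\<dots> \<le> C * w ^ 3" using abe w by (intro mult_right_mono) (auto simp: C_def)
    finally have "norm (\<phi> (z + \<zeta>) - \<phi> z - incr (\<phi> z) s t) \<le> C * w ^ 3" .
    then show "\<exists>\<zeta>. norm \<zeta> \<le> C * (t - s) powr \<alpha> \<and> norm (\<phi> (z + \<zeta>) - \<phi> z - incr (\<phi> z) s t) \<le> C * ((t - s) powr \<alpha>) ^ 3"
      using n eC by (intro exI[of _ \<zeta>]) (simp add: w_def)
  qed
qed

end

section \<open>Solutions stay on the submanifold\<close>

context rough_geometric
begin

text \<open>The drift moves the coordinates further by \<open>(t - s) *\<^sub>R \<eta>\<close>. Its interaction with the rough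
  step is of order \<open>1 + \<alpha>\<close>, which is at least \<open>3 * \<alpha>\<close> as \<open>\<alpha> \<le> 1/2\<close>.\<close>

lemma chart_step_drift:
  fixes \<phi> :: "real^'m \<Rightarrow> 'w"
  assumes ch: "chart M \<phi> \<phi>' \<phi>'' z0 r c L"
    and tan: "\<And>z v. z \<in> ball z0 r \<Longrightarrow> f (\<phi> z) v \<in> range (\<phi>' z)"
    and tan0: "\<And>z. z \<in> ball z0 r \<Longrightarrow> f0 (\<phi> z) \<in> range (\<phi>' z)"
  obtains C \<tau> where "0 \<le> C" "0 < \<tau>" "\<tau> \<le> 1"
    "\<And>z s t. z \<in> ball z0 (r / 2) \<Longrightarrow> 0 \<le> s \<Longrightarrow> s \<le> t \<Longrightarrow> t \<le> T \<Longrightarrow> t - s \<le> \<tau> \<Longrightarrow>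
       \<exists>y'\<in>M. norm (y' - \<phi> z - (t - s) *\<^sub>R f0 (\<phi> z) - incr (\<phi> z) s t) \<le> C * ((t - s) powr \<alpha>) ^ 3"
proof -
  interpret chart M \<phi> \<phi>' \<phi>'' z0 r c L by fact
  obtain C1 where C1: "0 \<le> C1"
    and step: "\<And>z s t. z \<in> ball z0 (r / 2) \<Longrightarrow> 0 \<le> s \<Longrightarrow> s \<le> t \<Longrightarrow> t \<le> T \<Longrightarrow> t - s \<le> 1 \<Longrightarrow> C1 * (t - s) powr \<alpha> \<le> r / 4 \<Longrightarrow>
       \<exists>\<zeta>. norm \<zeta> \<le> C1 * (t - s) powr \<alpha> \<and> norm (\<phi> (z + \<zeta>) - \<phi> z - incr (\<phi> z) s t) \<le> C1 * ((t - s) powr \<alpha>) ^ 3"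
    using chart_step[OF ch tan] by blast
  have z0: "z0 \<in> ball z0 r" using r by simp
  define F where "F = norm (f0 (\<phi> z0)) + K * (L * r + L * r * r)"
  have F0: "0 \<le> F" using K0 L r by (simp add: F_def)
  have F: "norm (f0 (\<phi> z)) \<le> F" if z: "z \<in> ball z0 r" for z
  proof -
    have n: "norm (z - z0) \<le> r" using z by (simp add: dist_norm norm_minus_commute)
    have "norm (\<phi> z - \<phi> z0 - \<phi>' z0 (z - z0)) \<le> L * (norm (z0 - z0) + norm (z - z0)) * norm (z - z0)"
      by (rule strict[OF z0 z0 z])
    also have "\<dots> \<le> L * r * r" using n L r by (intro mult_mono) auto
    finally have 1: "norm (\<phi> z - \<phi> z0 - \<phi>' z0 (z - z0)) \<le> L * r * r" .
    have 2: "norm (\<phi>' z0 (z - z0)) \<le> L * r" by (rule norm_apply_le[OF le1[OF z0] n])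
    have "norm (\<phi> z - \<phi> z0) \<le> L * r + L * r * r"
      using norm_triangle_le[OF add_mono[OF 1 2]] by simp
    then have "K * norm (\<phi> z - \<phi> z0) \<le> K * (L * r + L * r * r)" using K0 by (intro mult_left_mono)
    then show ?thesis using f0_lip[of "\<phi> z" "\<phi> z0"] norm_triangle_sub[of "f0 (\<phi> z)" "f0 (\<phi> z0)"]
      unfolding F_def by linarith
  qed
  define G where "G = F / c"
  have G0: "0 \<le> G" using F0 c by (simp add: G_def)
  have pos: "0 < r / 4 / (C1 + G + 1)" using r C1 G0 by (simp add: add_nonneg_pos)
  obtain \<tau> where \<tau>: "0 < \<tau>" "\<tau> \<le> 1" "\<And>x. 0 \<le> x \<Longrightarrow> x \<le> \<tau> \<Longrightarrow> x powr \<alpha> \<le> r / 4 / (C1 + G + 1)"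
    using powr_small[OF pos] by blast
  define C where "C = C1 + L * (2 * C1 + G) * G"
  show thesis
  proof (rule that[of C \<tau>])
    show "0 \<le> C" using C1 G0 L by (simp add: C_def)
    fix z s t assume z2: "z \<in> ball z0 (r / 2)" and st: "0 \<le> s" "s \<le> t" "t \<le> T" "t - s \<le> \<tau>"
    have z: "z \<in> ball z0 r" using z2 r by auto
    define w where "w = (t - s) powr \<alpha>"
    have w: "0 \<le> w" "w \<le> 1" "t - s \<le> w\<^sup>2" using powr_le1[of "t - s"] le_powr2[of "t - s"] st \<tau> by (auto simp: w_def)
    have "(C1 + G + 1) * w \<le> (C1 + G + 1) * (r / 4 / (C1 + G + 1))"
      using \<tau>(3)[of "t - s"] st C1 G0 by (intro mult_left_mono) (auto simp: w_def)
    also have "\<dots> = r / 4"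
      by (subst times_divide_eq_right, subst nonzero_mult_div_cancel_left) (use C1 G0 in linarith, rule refl)
    finally have w4: "(C1 + G + 1) * w \<le> r / 4" .
    then have small: "C1 * w + G * w \<le> r / 4" using w by (simp add: algebra_simps)
    have "C1 * w \<le> r / 4" using small mult_nonneg_nonneg[OF G0 w(1)] by linarith
    then obtain \<zeta> where \<zeta>: "norm \<zeta> \<le> C1 * w" "norm (\<phi> (z + \<zeta>) - \<phi> z - incr (\<phi> z) s t) \<le> C1 * w ^ 3"
      using step[OF z2 st(1-3)] st \<tau> unfolding w_def by fastforce
    obtain \<eta> where \<eta>: "\<phi>' z \<eta> = f0 (\<phi> z)" using tan0[OF z] by (metis imageE)
    have \<eta>_le: "norm \<eta> \<le> G" using below1[OF z, of \<eta>] F[OF z] c by (simp add: \<eta> G_def pos_le_divide_eq mult.commute)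
    define h where "h = (t - s) *\<^sub>R \<eta>"
    have h: "norm h \<le> w\<^sup>2 * G" unfolding h_def using w \<eta>_le st by (auto intro!: mult_mono)
    have "w\<^sup>2 * G \<le> w * G" using w G0 by (intro mult_right_mono) (auto simp: power2_eq_square mult_left_le)
    then have h': "norm h \<le> G * w" using h by (simp add: mult.commute)
    have inb: "z + k \<in> ball z0 r" if "norm k \<le> C1 * w + G * w" for k
    proof -
      have "dist z0 (z + k) \<le> dist z0 z + norm k" using dist_triangle[of z0 "z + k" z] by (simp add: dist_norm)
      also have "\<dots> < r / 2 + r / 4 + r / 4" using z2 that small r by simp
      finally show ?thesis by simp
    qed
    have zz: "z + \<zeta> \<in> ball z0 r" using \<zeta> mult_nonneg_nonneg[OF G0 w(1)] by (intro inb) linarith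
    have zh: "z + (\<zeta> + h) \<in> ball z0 r" by (rule inb[OF norm_triangle_le[OF add_mono[OF \<zeta>(1) h']]])
    have "norm (\<phi> (z + (\<zeta> + h)) - \<phi> (z + \<zeta>) - \<phi>' z (z + (\<zeta> + h) - (z + \<zeta>)))
      \<le> L * (norm (z + \<zeta> - z) + norm (z + (\<zeta> + h) - z)) * norm (z + (\<zeta> + h) - (z + \<zeta>))"
      by (rule strict[OF z zz zh])
    also have "\<dots> = L * (norm \<zeta> + norm (\<zeta> + h)) * norm h" by simp
    also have "\<dots> \<le> L * (C1 * w + (C1 * w + G * w)) * (w\<^sup>2 * G)"
      using L C1 G0 w by (intro mult_mono mult_left_mono add_mono h \<zeta>(1) norm_triangle_le[OF add_mono[OF \<zeta>(1) h']]) auto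
    also have "\<dots> = L * (2 * C1 + G) * G * w ^ 3" by (simp add: algebra_simps eval_nat_numeral)
    finally have 1: "norm (\<phi> (z + (\<zeta> + h)) - \<phi> (z + \<zeta>) - (t - s) *\<^sub>R f0 (\<phi> z)) \<le> L * (2 * C1 + G) * G * w ^ 3"
      by (simp add: h_def blinfun.scaleR_right \<eta>)
    have "\<phi> (z + (\<zeta> + h)) - \<phi> z - (t - s) *\<^sub>R f0 (\<phi> z) - incr (\<phi> z) s t
       = (\<phi> (z + (\<zeta> + h)) - \<phi> (z + \<zeta>) - (t - s) *\<^sub>R f0 (\<phi> z)) + (\<phi> (z + \<zeta>) - \<phi> z - incr (\<phi> z) s t)" by simp
    also have "norm \<dots> \<le> L * (2 * C1 + G) * G * w ^ 3 + C1 * w ^ 3"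
      by (rule norm_triangle_le[OF add_mono[OF 1 \<zeta>(2)]])
    also have "\<dots> = C * w ^ 3" by (simp add: C_def algebra_simps)
    finally show "\<exists>y'\<in>M. norm (y' - \<phi> z - (t - s) *\<^sub>R f0 (\<phi> z) - incr (\<phi> z) s t) \<le> C * ((t - s) powr \<alpha>) ^ 3"
      using in_M[OF zh] unfolding w_def by blast
  qed (use \<tau> in auto)
qed

text \<open>A scheme that stays on the submanifold, with one step errors of order \<open>3 * \<alpha>\<close>, converges to
  the solution. By the a priori estimates it stays for a short time in a neighbourhood in which the
  submanifold is covered by the compact set \<open>Q\<close>, the image of a closed ball, so its limit lies on
  the submanifold.\<close>

lemma tangent_local_invariance:
  fixes \<phi> :: "real^'m \<Rightarrow> 'w"
  assumes ch: "chart M \<phi> \<phi>' \<phi>'' z0 r c L"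
    and tan: "\<And>z v. z \<in> ball z0 r \<Longrightarrow> f (\<phi> z) v \<in> range (\<phi>' z)"
    and tan0: "\<And>z. z \<in> ball z0 r \<Longrightarrow> f0 (\<phi> z) \<in> range (\<phi>' z)"
    and Y: "davie_solution s0 Y" and s0: "0 \<le> s0" "s0 < T" and Y0: "Y s0 = \<phi> z0"
  obtains \<epsilon> where "0 < \<epsilon>" "\<And>t. s0 \<le> t \<Longrightarrow> t \<le> T \<Longrightarrow> t \<le> s0 + \<epsilon> \<Longrightarrow> Y t \<in> M"
proof -
  interpret chart M \<phi> \<phi>' \<phi>'' z0 r c L by fact
  have z0: "z0 \<in> ball z0 r" using r by simp
  obtain C \<tau> where C: "0 \<le> C" "0 < \<tau>" "\<tau> \<le> 1"
    and st: "\<And>z s t. z \<in> ball z0 (r / 2) \<Longrightarrow> 0 \<le> s \<Longrightarrow> s \<le> t \<Longrightarrow> t \<le> T \<Longrightarrow> t - s \<le> \<tau> \<Longrightarrow>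
       \<exists>y'\<in>M. norm (y' - \<phi> z - (t - s) *\<^sub>R f0 (\<phi> z) - incr (\<phi> z) s t) \<le> C * ((t - s) powr \<alpha>) ^ 3"
    using chart_step_drift[OF ch tan tan0] by blast
  have r2: "0 < r / 2" using r by simp
  obtain \<rho> where \<rho>: "0 < \<rho>" "M \<inter> ball (\<phi> z0) \<rho> \<subseteq> \<phi> ` (ball z0 r \<inter> ball z0 (r / 2))" using near[OF z0 r2] by blast
  define G where "G = M \<inter> ball (\<phi> z0) \<rho>"
  define Q where "Q = \<phi> ` cball z0 (r / 2)"
  have sub: "cball z0 (r / 2) \<subseteq> ball z0 r" using r by auto
  have "continuous_on (cball z0 (r / 2)) \<phi>"
    by (rule continuous_at_imp_continuous_on) (use sub D1 has_derivative_continuous in blast)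
  then have Qcl: "closed Q" unfolding Q_def by (intro compact_imp_closed compact_continuous_image) auto
  have QM: "Q \<subseteq> M" using in_M sub by (auto simp: Q_def)
  have GQ: "G \<subseteq> Q" using \<rho>(2) by (force simp: G_def Q_def)
  \<comment> \<open>Outside \<open>G\<close> the exact Euler step is taken. Thus the error bound holds at every point, and the
    a priori estimates are available before the scheme is known to remain in \<open>G\<close>.\<close>
  have "\<exists>y'. norm (y' - y - (t - s) *\<^sub>R f0 y - incr y s t) \<le> C * ((t - s) powr \<alpha>) ^ 3 \<and> (y \<in> G \<longrightarrow> y' \<in> M)"
    if "0 \<le> s \<and> s \<le> t \<and> t \<le> T \<and> t - s \<le> \<tau>" for y s t
  proof (cases "y \<in> G")
    case True
    then obtain z where "z \<in> ball z0 (r / 2)" "y = \<phi> z" using \<rho>(2) by (auto simp: G_def)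
    then show ?thesis using st[of z s t] that by blast
  next
    case False
    have "norm ((y + (t - s) *\<^sub>R f0 y + incr y s t) - y - (t - s) *\<^sub>R f0 y - incr y s t) \<le> C * ((t - s) powr \<alpha>) ^ 3"
      using C by simp
    then show ?thesis using False by blast
  qed
  then have "\<forall>y s t. \<exists>y'. 0 \<le> s \<and> s \<le> t \<and> t \<le> T \<and> t - s \<le> \<tau> \<longrightarrow>
      norm (y' - y - (t - s) *\<^sub>R f0 y - incr y s t) \<le> C * ((t - s) powr \<alpha>) ^ 3 \<and> (y \<in> G \<longrightarrow> y' \<in> M)" by blast
  then obtain S where S: "\<And>y s t. 0 \<le> s \<Longrightarrow> s \<le> t \<Longrightarrow> t \<le> T \<Longrightarrow> t - s \<le> \<tau> \<Longrightarrow>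
      norm (S y s t - y - (t - s) *\<^sub>R f0 y - incr y s t) \<le> C * ((t - s) powr \<alpha>) ^ 3 \<and> (y \<in> G \<longrightarrow> S y s t \<in> M)"
    by metis
  define zz where "zz h = rec_nat (\<phi> z0) (\<lambda>i y. S y (s0 + real i * h) (s0 + real (Suc i) * h))" for h
  have zz0: "zz h 0 = \<phi> z0" and zzS: "zz h (Suc i) = S (zz h i) (s0 + real i * h) (s0 + real (Suc i) * h)" for h i
    by (simp_all add: zz_def)
  have grid: "0 \<le> s0 + real i * h \<and> s0 + real i * h \<le> s0 + real (Suc i) * h \<and> s0 + real (Suc i) * h \<le> T \<and> s0 + real (Suc i) * h - (s0 + real i * h) = h"
    if "0 < h" "s0 + real n * h \<le> T" "i < n" for h n i
  proof -
    have "real (Suc i) * h \<le> real n * h" using that by (intro mult_right_mono) auto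
    then show ?thesis using that s0 by (auto simp: algebra_simps)
  qed
  have zstep: "norm (zz h (Suc i) - zz h i - h *\<^sub>R f0 (zz h i) - incr (zz h i) (s0 + real i * h) (s0 + real (Suc i) * h)) \<le> C * (h powr \<alpha>) ^ 3
      \<and> (zz h i \<in> G \<longrightarrow> zz h (Suc i) \<in> M)"
    if h: "0 < h" "h \<le> \<tau>" "s0 + real n * h \<le> T" "i < n" for h n i
    using S[of "s0 + real i * h" "s0 + real (Suc i) * h" "zz h i"] grid[OF h(1,3,4)] h(2) unfolding zzS by metis
  have ap: "approx_scheme C s0 h n (zz h)" if h: "0 < h" "h \<le> \<tau>" "s0 + real n * h \<le> T" for h n
    unfolding approx_scheme_def using zstep[OF h] h s0 by blast
  obtain B h0 where B: "0 \<le> B" "0 < h0" "h0 \<le> 1"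
    and bd: "\<And>s h n y. approx_scheme C s h n y \<Longrightarrow> h \<le> h0 \<Longrightarrow> norm (y 0) \<le> norm (\<phi> z0) \<Longrightarrow>
       (\<forall>j\<le>n. norm (y j) \<le> B) \<and> (\<forall>j<n. norm (drift s h y j) \<le> B)"
    using approx_bounded[OF C(1) norm_ge_zero[of "\<phi> z0"]] by metis
  obtain C2 \<tau>2 where C2: "0 \<le> C2" "0 < \<tau>2" "\<tau>2 \<le> 1"
    and la: "\<And>s h n y b i j. driven s h n y b \<Longrightarrow> (\<And>i. i < n \<Longrightarrow> norm (b i) \<le> B) \<Longrightarrow> i \<le> j \<Longrightarrow> j \<le> n \<Longrightarrow>
       real (j - i) * h \<le> \<tau>2 \<Longrightarrow> norm (remd s h y b i j) \<le> C2 * ((real (j - i) * h) powr \<alpha>) ^ 3 \<and>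
       norm (y j - y i) \<le> C2 * (real (j - i) * h) powr \<alpha>"
    using local_apriori[OF B(1)] by blast
  have pos: "0 < \<rho> / 2 / (C2 + 1)" using \<rho> C2 by simp
  obtain \<tau>3 where \<tau>3: "0 < \<tau>3" "\<And>x. 0 \<le> x \<Longrightarrow> x \<le> \<tau>3 \<Longrightarrow> x powr \<alpha> \<le> \<rho> / 2 / (C2 + 1)"
    using powr_small[OF pos] by metis
  define \<epsilon> where "\<epsilon> = min \<tau>2 \<tau>3"
  show thesis
  proof (rule that[of \<epsilon>])
    show "0 < \<epsilon>" using C2 \<tau>3 by (simp add: \<epsilon>_def)
    fix t assume t: "s0 \<le> t" "t \<le> T" "t \<le> s0 + \<epsilon>"
    show "Y t \<in> M"
    proof (cases "t = s0")
      case True then show ?thesis using Y0 in_M[OF z0] by simp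
    next
      case False
      then have d: "0 < t - s0" using t by simp
      define h where "h n = (t - s0) / real (Suc n)" for n
      have hp: "0 < h n" and hn: "real (Suc n) * h n = t - s0" for n using d by (auto simp: h_def)
      have hT: "s0 + real (Suc n) * h n \<le> T" for n using hn t by simp
      have ev: "eventually (\<lambda>n. h n \<le> min \<tau> h0) sequentially"
        unfolding h_def using C B by (intro grid_eventually_small[OF d]) auto
      have inQ: "zz (h n) (Suc n) \<in> Q" if n: "h n \<le> min \<tau> h0" for n
      proof -
        have h: "h n \<le> \<tau>" "h n \<le> h0" using n by auto
        note ap' = ap[OF hp h(1) hT]
        have dr: "norm (drift s0 (h n) (zz (h n)) j) \<le> B" if "j < Suc n" for j
          using bd[OF ap' h(2)] that by (simp add: zz0)
        have close: "zz (h n) j \<in> ball (\<phi> z0) \<rho>" if j: "j \<le> Suc n" for j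
        proof -
          have "real j * h n \<le> real (Suc n) * h n" using j hp[of n] by (intro mult_right_mono) auto
          then have jh: "real j * h n \<le> \<epsilon>" using hn t by simp
          then have "norm (zz (h n) j - zz (h n) 0) \<le> C2 * (real (j - 0) * h n) powr \<alpha>"
            using la[OF approx_driven[OF ap'] dr le0 j] by (simp add: \<epsilon>_def)
          also have "\<dots> \<le> (C2 + 1) * (\<rho> / 2 / (C2 + 1))"
            using \<tau>3(2)[of "real j * h n"] jh hp[of n] C2 by (intro mult_mono) (auto simp: \<epsilon>_def)
          also have "\<dots> = \<rho> / 2" using C2 by (subst times_divide_eq_right, subst nonzero_mult_div_cancel_left) auto
          finally show ?thesis using \<rho>(1) by (simp add: zz0 dist_norm norm_minus_commute)
        qed
        have "zz (h n) j \<in> M" if "j \<le> Suc n" for j using that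
        proof (induction j)
          case 0 then show ?case using in_M[OF z0] by (simp add: zz0)
        next
          case (Suc j)
          then have "zz (h n) j \<in> G" using close[of j] by (simp add: G_def)
          then show ?case using zstep[OF hp[of n] h(1) hT[of n], of j] Suc.prems by auto
        qed
        then have "zz (h n) (Suc n) \<in> G" using close[of "Suc n"] by (simp add: G_def)
        then show ?thesis using GQ by blast
      qed
      have lim: "(\<lambda>n. zz (h n) (Suc n)) \<longlonglongrightarrow> Y t"
      proof (rule davie_scheme_tendsto[OF Y s0(1) _ t(2) C(1)])
        show "s0 < t" using d by simp
        show "eventually (\<lambda>n. approx_scheme C s0 ((t - s0) / real (Suc n)) (Suc n) (zz (h n)) \<and> zz (h n) 0 = Y s0) sequentially"
          using ev
        proof eventually_elim
          case (elim n)
          then show ?case using ap[OF hp _ hT, of n] by (simp add: h_def zz0 Y0)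
        qed
      qed
      have "Y t \<in> Q"
        by (rule Lim_in_closed_set[OF Qcl _ sequentially_bot lim]) (use ev inQ in \<open>auto elim: eventually_mono\<close>)
      then show ?thesis using QM by blast
    qed
  qed
qed

definition tangent_fields :: "'m::finite itself \<Rightarrow> 'w set \<Rightarrow> bool" where
  "tangent_fields m M \<longleftrightarrow> (\<forall>y\<in>M. f0 y \<in> tangent_space m M y \<and> (\<forall>v. f y v \<in> tangent_space m M y))"

lemma tangent_fields_invariance:
  assumes M: "C3_submanifold TYPE('m::finite) M" and tf: "tangent_fields TYPE('m) M"
    and Y: "davie_solution s0 Y" and s0: "0 \<le> s0" "s0 < T" and Y0: "Y s0 \<in> M"
  obtains \<epsilon> where "0 < \<epsilon>" "\<And>t. s0 \<le> t \<Longrightarrow> t \<le> T \<Longrightarrow> t \<le> s0 + \<epsilon> \<Longrightarrow> Y t \<in> M"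
proof -
  obtain \<phi> :: "real^'m \<Rightarrow> 'w" and z0 r c L where ch: "chart M \<phi> (fderiv \<phi>) (fderiv (fderiv \<phi>)) z0 r c L" "\<phi> z0 = Y s0"
    and ts: "\<And>z. z \<in> ball z0 r \<Longrightarrow> tangent_space TYPE('m) M (\<phi> z) = range (fderiv \<phi> z)"
    using chart_exists[OF M Y0] by blast
  interpret chart M \<phi> "fderiv \<phi>" "fderiv (fderiv \<phi>)" z0 r c L by (rule ch)
  have t: "f0 (\<phi> z) \<in> range (fderiv \<phi> z)" "f (\<phi> z) v \<in> range (fderiv \<phi> z)" if "z \<in> ball z0 r" for z v
    using tf ts[OF that] in_M[OF that] by (auto simp: tangent_fields_def)
  show thesis by (rule tangent_local_invariance[OF ch(1) t(2) t(1) Y s0 ch(2)[symmetric]]) (assumption | erule that)+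
qed

theorem tangent_locally_invariant:
  assumes M: "C3_submanifold TYPE('m::finite) M" and tf: "tangent_fields TYPE('m) M"
  shows "locally_invariant tens \<alpha> T f0 f X XX M"
  unfolding locally_invariant_def the_rde_solution_iff
proof
  fix \<xi> assume \<xi>: "\<xi> \<in> M"
  obtain Y where Y: "davie_solution 0 Y" "Y 0 = \<xi>" using davie_exists by blast
  obtain \<epsilon> where \<epsilon>: "0 < \<epsilon>" "\<And>t. 0 \<le> t \<Longrightarrow> t \<le> T \<Longrightarrow> t \<le> 0 + \<epsilon> \<Longrightarrow> Y t \<in> M"
    using tangent_fields_invariance[OF M tf Y(1) order_refl T] Y(2) \<xi> by metis
  show "\<exists>T0\<in>{0<..T}. \<exists>Y. (davie_solution 0 Y \<and> Y 0 = \<xi>) \<and> (\<forall>t\<in>{0..T0}. Y t \<in> M)"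
  proof (intro bexI[of _ "min \<epsilon> T"] exI[of _ Y] conjI ballI Y)
    show "min \<epsilon> T \<in> {0<..T}" using \<epsilon> T by auto
    show "Y t \<in> M" if "t \<in> {0..min \<epsilon> T}" for t using \<epsilon>(2)[of t] that by auto
  qed
qed

lemma davie_continuous: "davie_solution 0 Y \<Longrightarrow> continuous_on {0..T} Y"
  using davie_holder[OF _ order_refl] holder_continuous by metis

text \<open>At the first exit time a solution is still on the closed submanifold, and local invariance
  from that time on gives a contradiction.\<close>

theorem tangent_globally_invariant:
  assumes M: "C3_submanifold TYPE('m::finite) M" and tf: "tangent_fields TYPE('m) M" and cl: "closed M"
  shows "globally_invariant tens \<alpha> T f0 f X XX M"
  unfolding globally_invariant_def the_rde_solution_iff
proof
  fix \<xi> assume \<xi>: "\<xi> \<in> M"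
  obtain Y where Y: "davie_solution 0 Y" "Y 0 = \<xi>" using davie_exists by blast
  have "Y t \<in> M" if t: "t \<in> {0..T}" for t
  proof (rule ccontr)
    assume nt: "Y t \<notin> M"
    define E where "E = {t \<in> {0..T}. Y t \<notin> M}"
    define s where "s = Inf E"
    have tE: "t \<in> E" using t nt by (simp add: E_def)
    have bdd: "bdd_below E" unfolding E_def by (intro bdd_belowI[of _ 0]) auto
    have s: "0 \<le> s" "s \<le> t" using tE bdd by (auto simp: s_def E_def intro: cInf_greatest cInf_lower)
    have sT: "s \<le> T" using s t by simp
    have before: "Y u \<in> M" if "0 \<le> u" "u < s" for u
    proof (rule ccontr)
      assume "Y u \<notin> M"
      then have "u \<in> E" using that sT by (simp add: E_def)
      then have "s \<le> u" unfolding s_def using bdd by (rule cInf_lower)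
      then show False using that by simp
    qed
    have sM: "Y s \<in> M"
    proof (cases "s = 0")
      case True then show ?thesis using Y \<xi> by simp
    next
      case False
      then have sp: "0 < s" using s by simp
      define u where "u n = s - s * inverse (real (Suc n))" for n
      have "s * inverse (real (Suc n)) \<le> s * 1" for n using sp by (intro mult_left_mono) (auto simp: field_simps)
      then have u: "0 \<le> u n" "u n < s" for n using sp by (auto simp: u_def)
      have "u \<longlonglongrightarrow> s - s * 0" unfolding u_def by (intro tendsto_intros LIMSEQ_inverse_real_of_nat)
      then have "(\<lambda>n. Y (u n)) \<longlonglongrightarrow> Y s"
      proof (intro continuous_on_tendsto_compose[OF davie_continuous[OF Y(1)]] always_eventually allI)
        show "u n \<in> {0..T}" for n using u[of n] sT by simp
      qed (use s sT in auto)
      then show ?thesis by (rule closed_sequentially[OF cl, rotated]) (rule before[OF u])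
    qed
    have "s \<noteq> t" using sM nt by blast
    then have sT': "s < T" using s t by simp
    obtain \<epsilon> where \<epsilon>: "0 < \<epsilon>" "\<And>t. s \<le> t \<Longrightarrow> t \<le> T \<Longrightarrow> t \<le> s + \<epsilon> \<Longrightarrow> Y t \<in> M"
      using tangent_fields_invariance[OF M tf davie_mono[OF Y(1) s(1)] s(1) sT' sM] by metis
    have "s + \<epsilon> \<le> Inf E"
    proof (rule cInf_greatest)
      show "E \<noteq> {}" using tE by blast
      fix u assume "u \<in> E"
      then have u: "0 \<le> u" "u \<le> T" "Y u \<notin> M" by (auto simp: E_def)
      then show "s + \<epsilon> \<le> u" using before[of u] \<epsilon>(2)[of u] by (meson le_cases not_le)
    qed
    then show False using \<epsilon> by (simp add: s_def)
  qed
  then show "\<exists>Y. (davie_solution 0 Y \<and> Y 0 = \<xi>) \<and> (\<forall>t\<in>{0..T}. Y t \<in> M)" using Y by blast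
qed

end

section \<open>Necessity of tangency\<close>

text \<open>The parallelogram law makes minimizing sequences Cauchy.\<close>

lemma nearest_point_exists:
  fixes S :: "'a::{real_inner,banach} set"
  assumes S: "convex S" "closed S" "S \<noteq> {}"
  obtains k where "k \<in> S" "\<And>x. x \<in> S \<Longrightarrow> dist v k \<le> dist v x"
proof -
  define d where "d = infdist v S"
  have d0: "0 \<le> d" by (simp add: d_def infdist_nonneg)
  have dle: "d \<le> dist v x" if "x \<in> S" for x unfolding d_def using that by (rule infdist_le)
  have "\<exists>x\<in>S. dist v x < d + inverse (real (Suc n))" for n
  proof (rule ccontr)
    assume "\<not> ?thesis"
    then have "d + inverse (real (Suc n)) \<le> infdist v S"
      unfolding infdist_notempty[OF S(3)] by (intro cINF_greatest S(3)) (auto simp: not_less)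
    then show False by (simp add: d_def)
  qed
  then obtain x where x: "\<And>n. x n \<in> S" "\<And>n. dist v (x n) < d + inverse (real (Suc n))" by metis
  define a where "a n = (d + inverse (real (Suc n)))\<^sup>2 - d\<^sup>2" for n
  have par: "(norm (x n - x m))\<^sup>2 \<le> 2 * a n + 2 * a m" for n m
  proof -
    have mid: "(1/2) *\<^sub>R x n + (1/2) *\<^sub>R x m \<in> S" using S(1) x(1) by (intro convexD) auto
    have "(norm (x n - x m))\<^sup>2 + 4 * (norm (v - ((1/2) *\<^sub>R x n + (1/2) *\<^sub>R x m)))\<^sup>2 = 2 * (norm (v - x n))\<^sup>2 + 2 * (norm (v - x m))\<^sup>2"
      by (simp add: power2_norm_eq_inner inner_diff_left inner_diff_right inner_add_left inner_add_right inner_commute algebra_simps)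
    moreover have "d\<^sup>2 \<le> (norm (v - ((1/2) *\<^sub>R x n + (1/2) *\<^sub>R x m)))\<^sup>2"
      using dle[OF mid] d0 by (intro power_mono) (auto simp: dist_norm)
    moreover have "(norm (v - x k))\<^sup>2 \<le> a k + d\<^sup>2" for k
      using x(2)[of k] power_mono[of "norm (v - x k)" "d + inverse (real (Suc k))" 2] by (simp add: a_def dist_norm less_imp_le)
    ultimately show ?thesis by (smt (verit))
  qed
  have a0: "a \<longlonglongrightarrow> 0"
  proof -
    have "a \<longlonglongrightarrow> (d + 0)\<^sup>2 - d\<^sup>2" unfolding a_def by (intro tendsto_intros LIMSEQ_inverse_real_of_nat)
    then show ?thesis by simp
  qed
  have "Cauchy x"
  proof (rule metric_CauchyI)
    fix e :: real assume e: "0 < e"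
    then have "0 < e\<^sup>2 / 4" by simp
    then have "eventually (\<lambda>n. a n < e\<^sup>2 / 4) sequentially" by (rule order_tendstoD(2)[OF a0])
    then obtain N where N: "\<And>n. N \<le> n \<Longrightarrow> a n < e\<^sup>2 / 4" unfolding eventually_sequentially by blast
    show "\<exists>N. \<forall>m\<ge>N. \<forall>n\<ge>N. dist (x m) (x n) < e"
    proof (intro exI allI impI)
      fix m n assume "N \<le> m" "N \<le> n"
      then have "(norm (x m - x n))\<^sup>2 < e\<^sup>2" using par[of m n] N[of m] N[of n] by linarith
      then show "dist (x m) (x n) < e" using e by (simp add: dist_norm power2_less_imp_less)
    qed
  qed
  then obtain k where k: "x \<longlonglongrightarrow> k" using Cauchy_convergent_iff convergent_def by blast
  have kS: "k \<in> S" by (rule closed_sequentially[OF S(2) x(1) k])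
  have "dist v k \<le> d + 0"
  proof (rule LIMSEQ_le)
    show "(\<lambda>n. dist v (x n)) \<longlonglongrightarrow> dist v k" by (intro tendsto_intros k)
    show "(\<lambda>n. d + inverse (real (Suc n))) \<longlonglongrightarrow> d + 0" by (intro tendsto_intros LIMSEQ_inverse_real_of_nat)
    show "\<exists>N. \<forall>n\<ge>N. dist v (x n) \<le> d + inverse (real (Suc n))" using x(2) less_imp_le by blast
  qed
  then show thesis using that[OF kS] dle by force
qed

text \<open>The vectors \<open>v\<close> for which \<open>A v\<close> has distance at most \<open>d / 2\<close> from \<open>R\<close> form a convex symmetric
  set. The projection of \<open>v0\<close> onto its closure gives a functional on the Hilbert space that is
  bounded on this set, hence dominated by the distance of \<open>A x\<close> from \<open>R\<close>. Working in the Hilbert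
  space avoids an extension theorem for functionals on the Banach space.\<close>

lemma separating_functional:
  fixes A :: "'v::{real_inner,banach} \<Rightarrow>\<^sub>L 'w::real_normed_vector"
  assumes R: "subspace R" "closed R" and v0: "A v0 \<notin> R"
  obtains u \<kappa> where "u \<noteq> 0" "0 \<le> \<kappa>" "\<And>x q. q \<in> R \<Longrightarrow> \<bar>u \<bullet> x\<bar> \<le> \<kappa> * norm (A x - q)"
proof -
  have "open (- R)" "A v0 \<in> - R" using R v0 by auto
  then obtain d where d: "0 < d" "ball (A v0) d \<subseteq> - R" using openE by blast
  have far: "d \<le> norm (A v0 - q)" if "q \<in> R" for q
    using d(2) that by (force simp: dist_norm not_less)
  define C where "C = {v. \<exists>q\<in>R. norm (A v - q) \<le> d / 2}"
  have zero: "0 \<in> C" unfolding C_def using d subspace_0[OF R(1)] by (auto intro!: bexI[of _ 0])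
  have conv: "convex C"
  proof (rule convexI)
    fix x y and a b :: real assume xy: "x \<in> C" "y \<in> C" and ab: "0 \<le> a" "0 \<le> b" "a + b = 1"
    obtain p q where pq: "p \<in> R" "norm (A x - p) \<le> d / 2" "q \<in> R" "norm (A y - q) \<le> d / 2" using xy by (auto simp: C_def)
    have "A (a *\<^sub>R x + b *\<^sub>R y) - (a *\<^sub>R p + b *\<^sub>R q) = a *\<^sub>R (A x - p) + b *\<^sub>R (A y - q)"
      by (simp add: blinfun.add_right blinfun.scaleR_right algebra_simps)
    also have "norm \<dots> \<le> a * (d / 2) + b * (d / 2)"
      using mult_left_mono[OF pq(2) ab(1)] mult_left_mono[OF pq(4) ab(2)] ab by (intro norm_triangle_le add_mono) auto
    also have "\<dots> = d / 2" using ab(3) by (metis distrib_right mult_1)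
    finally show "a *\<^sub>R x + b *\<^sub>R y \<in> C"
      unfolding C_def using pq R(1) by (auto intro!: bexI[of _ "a *\<^sub>R p + b *\<^sub>R q"] subspace_add subspace_scale)
  qed
  have v0C: "v0 \<notin> closure C"
  proof
    assume "v0 \<in> closure C"
    have e: "0 < d / 2 / (norm A + 1)" using d by (simp add: add_nonneg_pos)
    obtain v where v: "v \<in> C" "dist v v0 < d / 2 / (norm A + 1)"
      using \<open>v0 \<in> closure C\<close> e unfolding closure_approachable by blast
    obtain q where q: "q \<in> R" "norm (A v - q) \<le> d / 2" using v by (auto simp: C_def)
    have "norm (A (v0 - v)) \<le> norm A * norm (v0 - v)" by (rule norm_blinfun)
    also have "\<dots> \<le> (norm A + 1) * norm (v0 - v)" by (intro mult_right_mono) auto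
    also have "\<dots> < d / 2"
    proof -
      have "0 < norm A + 1" by (simp add: add_nonneg_pos)
      have "norm (v0 - v) < d / 2 / (norm A + 1)" using v(2) by (simp add: dist_norm norm_minus_commute)
      then have "norm (v0 - v) * (norm A + 1) < d / 2" by (subst (asm) pos_less_divide_eq) fact
      then show ?thesis by (simp only: mult.commute)
    qed
    finally have "norm (A (v0 - v) + (A v - q)) < d"
      using q(2) norm_triangle_ineq[of "A (v0 - v)" "A v - q"] by linarith
    then show False using far[OF q(1)] by (simp add: blinfun.diff_right)
  qed
  have "closure C \<noteq> {}" using zero closure_subset by blast
  then obtain k where k: "k \<in> closure C" "\<And>x. x \<in> closure C \<Longrightarrow> dist v0 k \<le> dist v0 x"
    using nearest_point_exists[of "closure C" v0] conv by (metis closed_closure convex_closure)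
  define u where "u = v0 - k"
  have u: "u \<noteq> 0" using k v0C by (auto simp: u_def)
  have sep: "u \<bullet> x \<le> u \<bullet> k" if "x \<in> C" for x
  proof -
    have "(v0 - k) \<bullet> (x - k) \<le> 0"
      using that k closure_subset[of C] conv by (intro any_closest_point_dot[of "closure C"]) auto
    then show ?thesis by (simp add: u_def inner_diff_right)
  qed
  have k0: "0 \<le> u \<bullet> k" using sep[OF zero] by simp
  have one: "u \<bullet> x \<le> (2 * (u \<bullet> k) / d) * norm (A x - q)" if q: "q \<in> R" for x q
  proof (rule field_le_epsilon)
    fix e :: real assume e: "0 < e"
    \<comment> \<open>The distance \<open>norm (A x - q)\<close> may vanish, so it is enlarged by \<open>\<delta>\<close> before \<open>x\<close> is scaled.\<close>
    define \<delta> where "\<delta> = e * d / (2 * (u \<bullet> k) + 1)"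
    have \<delta>: "0 < \<delta>" using e d k0 by (simp add: \<delta>_def)
    define n where "n = norm (A x - q) + \<delta>"
    have n: "0 < n" using \<delta> by (simp add: n_def add_nonneg_pos)
    define l where "l = d / 2 / n"
    have l: "0 < l" using d n by (simp add: l_def)
    have "A (l *\<^sub>R x) - l *\<^sub>R q = l *\<^sub>R (A x - q)" by (simp add: blinfun.scaleR_right scaleR_diff_right)
    then have "norm (A (l *\<^sub>R x) - l *\<^sub>R q) = l * norm (A x - q)" using l by simp
    also have "\<dots> \<le> l * n" using l \<delta> by (intro mult_left_mono) (auto simp: n_def)
    also have "\<dots> = d / 2" using n by (simp add: l_def)
    finally have "l *\<^sub>R x \<in> C" unfolding C_def using subspace_scale[OF R(1) q] by blast
    from sep[OF this] have "l * (u \<bullet> x) \<le> u \<bullet> k" by simp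
    then have "u \<bullet> x \<le> (u \<bullet> k) / l" using l by (simp add: pos_le_divide_eq mult.commute)
    also have "\<dots> = (2 * (u \<bullet> k) / d) * n" using d n by (simp add: l_def)
    also have "\<dots> = (2 * (u \<bullet> k) / d) * norm (A x - q) + (2 * (u \<bullet> k) / d) * \<delta>" by (simp add: n_def distrib_left)
    also have "(2 * (u \<bullet> k) / d) * \<delta> \<le> e"
    proof -
      have "(2 * (u \<bullet> k) / d) * \<delta> = e * (2 * (u \<bullet> k) / (2 * (u \<bullet> k) + 1))" using d by (simp add: \<delta>_def)
      also have "\<dots> \<le> e * 1" using e k0 by (intro mult_left_mono) auto
      finally show ?thesis by simp
    qed
    finally show "u \<bullet> x \<le> (2 * (u \<bullet> k) / d) * norm (A x - q) + e" by simp
  qed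
  show thesis
  proof (rule that[OF u])
    show "0 \<le> 2 * (u \<bullet> k) / d" using k0 d by simp
    fix x q assume q: "q \<in> R"
    have "u \<bullet> (- x) \<le> (2 * (u \<bullet> k) / d) * norm (A (- x) - (- q))"
      using subspace_neg[OF R(1) q] by (rule one)
    also have "A (- x) - (- q) = - (A x - q)" by (simp add: blinfun.minus_right)
    finally show "\<bar>u \<bullet> x\<bar> \<le> (2 * (u \<bullet> k) / d) * norm (A x - q)"
      using one[OF q, of x] by (simp add: norm_minus_commute)
  qed
qed

locale rough_hilbert = rough_geometric tens \<alpha> T K X XX f0 f Df D2f lft
  for tens :: "'v::{real_inner,banach} \<Rightarrow> 'v \<Rightarrow> 'z::banach"
    and \<alpha> T K :: real
    and X :: "real \<Rightarrow> 'v" and XX :: "real \<Rightarrow> real \<Rightarrow> 'z"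
    and f0 :: "'w::banach \<Rightarrow> 'w" and f :: "'w \<Rightarrow> 'v \<Rightarrow>\<^sub>L 'w"
    and Df :: "'w \<Rightarrow> 'w \<Rightarrow>\<^sub>L 'v \<Rightarrow>\<^sub>L 'w" and D2f :: "'w \<Rightarrow> 'w \<Rightarrow>\<^sub>L 'w \<Rightarrow>\<^sub>L 'v \<Rightarrow>\<^sub>L 'w"
    and lft :: "('v \<Rightarrow>\<^sub>L 'v \<Rightarrow>\<^sub>L 'w) \<Rightarrow> 'z \<Rightarrow>\<^sub>L 'w"
begin

text \<open>On the submanifold the increment \<open>Y t - Y s\<close> is tangent up to the square of its size, which
  is of order \<open>2 * \<alpha>\<close>; and it equals \<open>f (Y s) (X t - X s)\<close> up to the same order. If some
  \<open>f (Y s) v\<close> were not tangent, a functional \<open>u\<close> that is dominated by the distance of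
  \<open>f (Y s) x\<close> from the tangent space would satisfy \<open>\<bar>u \<bullet> (X t - X s)\<bar> \<le> \<kappa> * D * \<bar>t - s\<bar> powr (2 * \<alpha>)\<close>,
  contrary to true roughness.\<close>

lemma truly_rough_tangent:
  fixes \<phi> :: "real^'m \<Rightarrow> 'w"
  assumes ch: "chart M \<phi> \<phi>' \<phi>'' z0 r c L" and Y: "davie_solution 0 Y" and Ys: "Y s = \<phi> z0"
    and s: "0 \<le> s" "s < T0" "T0 \<le> T" and YM: "\<And>t. 0 \<le> t \<Longrightarrow> t \<le> T0 \<Longrightarrow> Y t \<in> M"
    and rough: "\<And>u. u \<noteq> 0 \<Longrightarrow> Limsup (at_right s) (\<lambda>t. ereal (\<bar>u \<bullet> (X t - X s)\<bar> / \<bar>t - s\<bar> powr (2 * \<alpha>))) = \<infinity>"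
  shows "f (Y s) v \<in> range (\<phi>' z0)"
proof (rule ccontr)
  interpret chart M \<phi> \<phi>' \<phi>'' z0 r c L by fact
  have z0: "z0 \<in> ball z0 r" using r by simp
  assume "f (Y s) v \<notin> range (\<phi>' z0)"
  then obtain u \<kappa> where u: "u \<noteq> 0" "0 \<le> \<kappa>" 
    and sep: "\<And>x q. q \<in> range (\<phi>' z0) \<Longrightarrow> \<bar>u \<bullet> x\<bar> \<le> \<kappa> * norm (f (Y s) x - q)"
    using separating_functional[OF range_subspace range_closed[OF z0]] by metis
  obtain C where C: "0 \<le> C" 
    and hol: "\<And>s t. 0 \<le> s \<Longrightarrow> s \<le> t \<Longrightarrow> t \<le> T \<Longrightarrow> norm (Y t - Y s) \<le> C * (t - s) powr \<alpha>"
    and fo: "\<And>s t. 0 \<le> s \<Longrightarrow> s \<le> t \<Longrightarrow> t \<le> T \<Longrightarrow> norm (Y t - Y s - f (Y s) (X t - X s)) \<le> C * ((t - s) powr \<alpha>)\<^sup>2"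
    using davie_holder[OF Y order_refl] by blast
  obtain \<rho> where \<rho>: "0 < \<rho>" "M \<inter> ball (\<phi> z0) \<rho> \<subseteq> \<phi> ` (ball z0 r \<inter> ball z0 1)" using near[OF z0, of 1] by auto
  have pos: "0 < \<rho> / 2 / (C + 1)" using \<rho> C by simp
  obtain \<tau> where \<tau>: "0 < \<tau>" "\<And>x. 0 \<le> x \<Longrightarrow> x \<le> \<tau> \<Longrightarrow> x powr \<alpha> \<le> \<rho> / 2 / (C + 1)"
    using powr_small[OF pos] by metis
  define D where "D = C + L * (C / c)\<^sup>2"
  have bound: "\<bar>u \<bullet> (X t - X s)\<bar> / \<bar>t - s\<bar> powr (2 * \<alpha>) \<le> \<kappa> * D" if t: "s < t" "t < s + \<tau>" "t < T0" for t
  proof -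
    define w where "w = (t - s) powr \<alpha>"
    have w: "0 < w" using t by (simp add: w_def)
    have hY: "norm (Y t - Y s) \<le> C * w" using hol[of s t] t s by (simp add: w_def)
    also have "\<dots> \<le> (C + 1) * (\<rho> / 2 / (C + 1))" using \<tau>(2)[of "t - s"] t C by (intro mult_mono) (auto simp: w_def)
    also have "\<dots> = \<rho> / 2" using C by (subst times_divide_eq_right, subst nonzero_mult_div_cancel_left) auto
    finally have "Y t \<in> ball (\<phi> z0) \<rho>" using \<rho>(1) by (simp add: Ys[symmetric] dist_norm norm_minus_commute)
    moreover have "Y t \<in> M" using YM[of t] t s by simp
    ultimately have "Y t \<in> \<phi> ` (ball z0 r \<inter> ball z0 1)" by (intro subsetD[OF \<rho>(2)] IntI)
    then obtain b where b: "b \<in> ball z0 r" "\<phi> b = Y t" by (elim imageE IntE) simp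
    have "c * norm (b - z0) \<le> C * w" using below[OF b(1) z0] hY by (simp add: b Ys)
    then have bz: "norm (b - z0) \<le> C / c * w" using c by (simp add: field_simps)
    have "norm (\<phi> b - \<phi> z0 - \<phi>' z0 (b - z0)) \<le> L * (norm (z0 - z0) + norm (b - z0)) * norm (b - z0)"
      by (rule strict[OF z0 z0 b(1)])
    also have "\<dots> = L * (norm (b - z0))\<^sup>2" by (simp add: power2_eq_square)
    also have "\<dots> \<le> L * (C / c * w)\<^sup>2" using bz L by (intro mult_left_mono power_mono) auto
    finally have 1: "norm (\<phi> b - \<phi> z0 - \<phi>' z0 (b - z0)) \<le> L * (C / c * w)\<^sup>2" .
    have 2: "norm (Y t - Y s - f (Y s) (X t - X s)) \<le> C * w\<^sup>2" using fo[of s t] t s by (simp add: w_def)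
    have "f (Y s) (X t - X s) - \<phi>' z0 (b - z0) = (\<phi> b - \<phi> z0 - \<phi>' z0 (b - z0)) - (Y t - Y s - f (Y s) (X t - X s))"
      by (simp add: b Ys)
    also have "norm \<dots> \<le> L * (C / c * w)\<^sup>2 + C * w\<^sup>2" by (rule norm_triangle_le_diff[OF add_mono[OF 1 2]])
    also have "\<dots> = D * w\<^sup>2" by (simp add: D_def power_mult_distrib power_divide algebra_simps)
    finally have "\<kappa> * norm (f (Y s) (X t - X s) - \<phi>' z0 (b - z0)) \<le> \<kappa> * (D * w\<^sup>2)" using u by (intro mult_left_mono)
    then have "\<bar>u \<bullet> (X t - X s)\<bar> \<le> \<kappa> * (D * w\<^sup>2)" using sep[of "\<phi>' z0 (b - z0)" "X t - X s"] by simp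
    moreover have "\<bar>t - s\<bar> powr (2 * \<alpha>) = w\<^sup>2" using t by (simp add: w_def powr2)
    ultimately show ?thesis using w by (simp add: pos_divide_le_eq)
  qed
  have "eventually (\<lambda>t. ereal (\<bar>u \<bullet> (X t - X s)\<bar> / \<bar>t - s\<bar> powr (2 * \<alpha>)) \<le> ereal (\<kappa> * D)) (at_right s)"
  proof -
    have "s < min (s + \<tau>) T0" using \<tau> s by simp
    from eventually_at_right_real[OF this] show ?thesis
      by eventually_elim (use bound in auto)
  qed
  then have "Limsup (at_right s) (\<lambda>t. ereal (\<bar>u \<bullet> (X t - X s)\<bar> / \<bar>t - s\<bar> powr (2 * \<alpha>))) \<le> ereal (\<kappa> * D)"
    by (rule Limsup_bounded)
  then show False using rough[OF u(1)] by simp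
qed

text \<open>The solution is compared with the step on the submanifold that leaves out the drift. The
  difference of the two points is \<open>t *\<^sub>R f0 (\<phi> z0)\<close> up to order \<open>3 * \<alpha> > 1\<close>, and it is a secant of the
  submanifold.\<close>

lemma drift_tangent:
  fixes \<phi> :: "real^'m \<Rightarrow> 'w"
  assumes ch: "chart M \<phi> \<phi>' \<phi>'' z0 r c L" and Y: "davie_solution 0 Y" and Y0: "Y 0 = \<phi> z0"
    and T0: "0 < T0" "T0 \<le> T" and YM: "\<And>t. 0 \<le> t \<Longrightarrow> t \<le> T0 \<Longrightarrow> Y t \<in> M"
    and tan: "\<And>z v. z \<in> ball z0 r \<Longrightarrow> f (\<phi> z) v \<in> range (\<phi>' z)"
  shows "f0 (\<phi> z0) \<in> range (\<phi>' z0)"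
proof -
  interpret chart M \<phi> \<phi>' \<phi>'' z0 r c L by fact
  have z0: "z0 \<in> ball z0 r" "z0 \<in> ball z0 (r / 2)" using r by auto
  obtain C1 where C1: "0 \<le> C1"
    and step: "\<And>z s t. z \<in> ball z0 (r / 2) \<Longrightarrow> 0 \<le> s \<Longrightarrow> s \<le> t \<Longrightarrow> t \<le> T \<Longrightarrow> t - s \<le> 1 \<Longrightarrow> C1 * (t - s) powr \<alpha> \<le> r / 4 \<Longrightarrow>
       \<exists>\<zeta>. norm \<zeta> \<le> C1 * (t - s) powr \<alpha> \<and> norm (\<phi> (z + \<zeta>) - \<phi> z - incr (\<phi> z) s t) \<le> C1 * ((t - s) powr \<alpha>) ^ 3"
    using chart_step[OF ch tan] by blast
  obtain C2 where C2: "0 \<le> C2" "\<And>s t. 0 \<le> s \<Longrightarrow> s \<le> t \<Longrightarrow> t \<le> T \<Longrightarrow>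
      norm (Y t - Y s - (t - s) *\<^sub>R f0 (Y s) - incr (Y s) s t) \<le> C2 * ((t - s) powr \<alpha>) ^ 3"
    using Y unfolding davie_solution_def by blast
  have pos: "0 < r / 4 / (C1 + 1)" using r C1 by simp
  obtain \<tau> where \<tau>: "0 < \<tau>" "\<tau> \<le> 1" "\<And>x. 0 \<le> x \<Longrightarrow> x \<le> \<tau> \<Longrightarrow> x powr \<alpha> \<le> r / 4 / (C1 + 1)"
    using powr_small[OF pos] by metis
  define d where "d = min \<tau> T0"
  have d: "0 < d" "d \<le> 1" "d \<le> T0" using \<tau> T0 by (auto simp: d_def)
  define t where "t n = d / real (Suc n)" for n
  have t: "0 < t n" "t n \<le> d" for n using d by (auto simp: t_def field_simps)
  have tt: "t n \<le> \<tau>" "t n \<le> 1" "t n \<le> T0" "t n \<le> T" for n using t(2)[of n] d T0 by (auto simp: d_def)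
  have t0: "t \<longlonglongrightarrow> 0"
    using tendsto_mult[OF tendsto_const LIMSEQ_inverse_real_of_nat, of d] by (simp add: t_def[abs_def] divide_inverse)
  have tp: "(\<lambda>n. t n powr \<alpha>) \<longlonglongrightarrow> 0"
    using tendsto_powr2[OF t0 tendsto_const, of \<alpha>] \<alpha> t by (auto intro!: always_eventually less_imp_le)
  have small: "C1 * t n powr \<alpha> \<le> r / 4" for n
  proof -
    have "C1 * t n powr \<alpha> \<le> (C1 + 1) * (r / 4 / (C1 + 1))"
      using \<tau>(3)[of "t n"] t[of n] tt[of n] C1 by (intro mult_mono) auto
    also have "\<dots> = r / 4" using C1 by (subst times_divide_eq_right, subst nonzero_mult_div_cancel_left) auto
    finally show ?thesis .
  qed
  have "\<exists>\<zeta>. norm \<zeta> \<le> C1 * t n powr \<alpha> \<and> norm (\<phi> (z0 + \<zeta>) - \<phi> z0 - incr (\<phi> z0) 0 (t n)) \<le> C1 * (t n powr \<alpha>) ^ 3" for n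
    using step[OF z0(2) order_refl, of "t n"] t(1)[of n] tt[of n] small[of n] by simp
  then obtain \<zeta> where \<zeta>: "\<And>n. norm (\<zeta> n) \<le> C1 * t n powr \<alpha>"
      "\<And>n. norm (\<phi> (z0 + \<zeta> n) - \<phi> z0 - incr (\<phi> z0) 0 (t n)) \<le> C1 * (t n powr \<alpha>) ^ 3" by metis
  define a where "a n = z0 + \<zeta> n" for n
  have ab: "a n \<in> ball z0 r" for n using \<zeta>(1)[of n] small[of n] r by (simp add: a_def dist_norm)
  have \<zeta>0: "\<zeta> \<longlonglongrightarrow> 0"
    by (rule Lim_null_comparison[OF always_eventually[OF allI[OF \<zeta>(1)]]]) (use tendsto_mult_left[OF tp, of C1] in simp)
  then have az: "a \<longlonglongrightarrow> z0" unfolding a_def using tendsto_add[OF tendsto_const[of z0] \<zeta>0] by simp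
  have yM: "Y (t n) \<in> M" for n using YM t(1)[of n] tt[of n] by (simp add: less_imp_le)
  have "(\<lambda>n. Y (t n)) \<longlonglongrightarrow> Y 0"
  proof (intro continuous_on_tendsto_compose[OF davie_continuous[OF Y] t0] always_eventually allI)
    show "t n \<in> {0..T}" for n using t(1)[of n] tt[of n] by (simp add: less_imp_le)
  qed (use T in simp)
  then have yz: "(\<lambda>n. Y (t n)) \<longlonglongrightarrow> \<phi> z0" by (simp add: Y0)
  obtain b where b: "eventually (\<lambda>n. \<phi> (b n) = Y (t n)) sequentially" "\<And>n. b n \<in> ball z0 r" "b \<longlonglongrightarrow> z0"
    by (rule near_preimage[OF z0(1) yM yz]) (rule that)
  have err: "norm ((1 / t n) *\<^sub>R (Y (t n) - \<phi> (a n)) - f0 (\<phi> z0)) \<le> (C1 + C2) * t n powr (3 * \<alpha> - 1)" for n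
  proof -
    have tn: "0 < t n" using t by simp
    define w where "w = t n powr \<alpha>"
    have 1: "norm (Y (t n) - \<phi> z0 - t n *\<^sub>R f0 (\<phi> z0) - incr (\<phi> z0) 0 (t n)) \<le> C2 * w ^ 3"
      using C2(2)[of 0 "t n"] tn tt[of n] by (simp add: Y0 w_def)
    have 2: "norm (\<phi> (a n) - \<phi> z0 - incr (\<phi> z0) 0 (t n)) \<le> C1 * w ^ 3" using \<zeta>(2)[of n] by (simp add: a_def w_def)
    have "(1 / t n) *\<^sub>R (Y (t n) - \<phi> (a n)) - f0 (\<phi> z0) = (1 / t n) *\<^sub>R ((Y (t n) - \<phi> z0 - t n *\<^sub>R f0 (\<phi> z0) - incr (\<phi> z0) 0 (t n)) - (\<phi> (a n) - \<phi> z0 - incr (\<phi> z0) 0 (t n)))"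
      using tn by (simp add: scaleR_diff_right)
    then have "norm ((1 / t n) *\<^sub>R (Y (t n) - \<phi> (a n)) - f0 (\<phi> z0)) = 1 / t n * norm ((Y (t n) - \<phi> z0 - t n *\<^sub>R f0 (\<phi> z0) - incr (\<phi> z0) 0 (t n)) - (\<phi> (a n) - \<phi> z0 - incr (\<phi> z0) 0 (t n)))"
      using tn by simp
    also have "\<dots> \<le> 1 / t n * (C2 * w ^ 3 + C1 * w ^ 3)"
      using tn by (intro mult_left_mono norm_triangle_le_diff[OF add_mono[OF 1 2]]) auto
    also have "\<dots> = (C1 + C2) * (w ^ 3 / t n)" by (simp add: field_simps)
    finally show ?thesis using cube_div_le(3)[OF tn tt(2)] by (simp add: w_def)
  qed
  have "(\<lambda>n. (C1 + C2) * t n powr (3 * \<alpha> - 1)) \<longlonglongrightarrow> 0"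
    unfolding t_def by (rule grid_powr_tendsto_0[OF d(1)])
  then have "(\<lambda>n. (1 / t n) *\<^sub>R (Y (t n) - \<phi> (a n)) - f0 (\<phi> z0)) \<longlonglongrightarrow> 0"
    by (rule Lim_null_comparison[OF always_eventually[OF allI[OF err]]])
  then have "(\<lambda>n. (1 / t n) *\<^sub>R (Y (t n) - \<phi> (a n))) \<longlonglongrightarrow> f0 (\<phi> z0)" by (simp add: LIM_zero_iff)
  moreover have "eventually (\<lambda>n. (1 / t n) *\<^sub>R (Y (t n) - \<phi> (a n)) = (1 / t n) *\<^sub>R (\<phi> (b n) - \<phi> (a n))) sequentially"
    using b(1) by eventually_elim simp
  ultimately have lim: "(\<lambda>n. (1 / t n) *\<^sub>R (\<phi> (b n) - \<phi> (a n))) \<longlonglongrightarrow> f0 (\<phi> z0)"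
    by (rule Lim_transform_eventually)
  show ?thesis by (rule secant_limit_tangent[OF z0(1) ab b(2) az b(3) lim])
qed

text \<open>Tangency of \<open>f\<close> holds at \<open>Y s\<close> for the times \<open>s\<close> of the dense set in the definition of true
  roughness. Letting these times tend to zero gives tangency at the initial point. Since every point
  of the submanifold is an initial point, the tangency of \<open>f0\<close> can then be derived in a full
  chart.\<close>

theorem invariant_tangent_fields:
  assumes M: "C3_submanifold TYPE('m::finite) M" and inv: "locally_invariant tens \<alpha> T f0 f X XX M"
    and tr: "truly_rough \<alpha> T X"
  shows "tangent_fields TYPE('m) M"
proof -
  obtain D where DD: "D \<subseteq> {0..<T} \<and> {0..<T} \<subseteq> closure D \<and> (\<forall>s\<in>D. \<forall>u. u \<noteq> 0 \<longrightarrow>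
        Limsup (at_right s) (\<lambda>t. ereal (\<bar>u \<bullet> (X t - X s)\<bar> / \<bar>t - s\<bar> powr (2 * \<alpha>))) = \<infinity>)"
    using tr[unfolded truly_rough_def, THEN conjunct2] by (rule exE)
  have D: "D \<subseteq> {0..<T}" "{0..<T} \<subseteq> closure D" by (rule DD[THEN conjunct1], rule DD[THEN conjunct2, THEN conjunct1])
  have rough: "Limsup (at_right s) (\<lambda>t. ereal (\<bar>u \<bullet> (X t - X s)\<bar> / \<bar>t - s\<bar> powr (2 * \<alpha>))) = \<infinity>"
    if "s \<in> D" "u \<noteq> 0" for s u
    by (rule bspec[OF DD[THEN conjunct2, THEN conjunct2] that(1), THEN spec, THEN mp, OF that(2)])
  have sol: "\<exists>T0 Y. 0 < T0 \<and> T0 \<le> T \<and> davie_solution 0 Y \<and> Y 0 = y \<and> (\<forall>t. 0 \<le> t \<longrightarrow> t \<le> T0 \<longrightarrow> Y t \<in> M)" if "y \<in> M" for y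
    using inv that unfolding locally_invariant_def the_rde_solution_iff by fastforce
  have ft: "f y v \<in> tangent_space TYPE('m) M y" if y: "y \<in> M" for y v
  proof -
    obtain T0 Y where T0: "0 < T0" "T0 \<le> T" and Y: "davie_solution 0 Y" "Y 0 = y"
      and YM: "\<And>t. 0 \<le> t \<Longrightarrow> t \<le> T0 \<Longrightarrow> Y t \<in> M" using sol[OF y] by blast
    have "\<exists>s\<in>D. s < T0 * inverse (real (Suc n))" for n
    proof -
      have "0 \<in> closure D" using D(2) T by auto
      moreover have "0 < T0 * inverse (real (Suc n))" using T0 by simp
      ultimately obtain s where "s \<in> D" "dist s 0 < T0 * inverse (real (Suc n))" unfolding closure_approachable by blast
      moreover from this have "s < T0 * inverse (real (Suc n))" using abs_ge_self[of s] by (simp only: dist_real_def diff_0_right)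
      ultimately show ?thesis by blast
    qed
    then obtain s where s: "\<And>n. s n \<in> D" "\<And>n. s n < T0 * inverse (real (Suc n))" by metis
    have s0: "0 \<le> s n" "s n < T0" for n
    proof -
      show "0 \<le> s n" using s(1)[of n] D(1) by auto
      have "T0 * inverse (real (Suc n)) \<le> T0 * 1" using T0 by (intro mult_left_mono) (auto simp: field_simps)
      then show "s n < T0" using s(2)[of n] by simp
    qed
    have "s \<longlonglongrightarrow> 0"
    proof (rule real_tendsto_sandwich[of "\<lambda>n. 0" _ _ "\<lambda>n. T0 * inverse (real (Suc n))"])
      show "(\<lambda>n. T0 * inverse (real (Suc n))) \<longlonglongrightarrow> 0"
        using tendsto_mult[OF tendsto_const LIMSEQ_inverse_real_of_nat, of T0] by simp
    qed (use s0 s(2) in \<open>auto intro!: always_eventually less_imp_le\<close>)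
    then have "(\<lambda>n. Y (s n)) \<longlonglongrightarrow> Y 0"
    proof (intro continuous_on_tendsto_compose[OF davie_continuous[OF Y(1)]] always_eventually allI)
      show "s n \<in> {0..T}" for n using s0[of n] T0 by simp
    qed (use T in auto)
    then have Ys: "(\<lambda>n. Y (s n)) \<longlonglongrightarrow> y" by (simp add: Y)
    have YsM: "Y (s n) \<in> M" for n using YM s0[of n] by simp
    obtain \<phi> :: "real^'m \<Rightarrow> 'w" and z0 r c L where ch: "chart M \<phi> (fderiv \<phi>) (fderiv (fderiv \<phi>)) z0 r c L" "\<phi> z0 = y"
      and ts: "\<And>z. z \<in> ball z0 r \<Longrightarrow> tangent_space TYPE('m) M (\<phi> z) = range (fderiv \<phi> z)"
      using chart_exists[OF M y] by blast
    interpret chart M \<phi> "fderiv \<phi>" "fderiv (fderiv \<phi>)" z0 r c L by (rule ch)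
    have z0: "z0 \<in> ball z0 r" using r by simp
    have ty: "f (Y (s n)) v \<in> tangent_space TYPE('m) M (Y (s n))" for n
    proof -
      obtain \<psi> :: "real^'m \<Rightarrow> 'w" and z1 r1 c1 L1 where ch1: "chart M \<psi> (fderiv \<psi>) (fderiv (fderiv \<psi>)) z1 r1 c1 L1" "\<psi> z1 = Y (s n)"
        and ts1: "\<And>z. z \<in> ball z1 r1 \<Longrightarrow> tangent_space TYPE('m) M (\<psi> z) = range (fderiv \<psi> z)"
        using chart_exists[OF M YsM] by blast
      have "0 < r1" using ch1(1) by (simp add: chart_def)
      then have "tangent_space TYPE('m) M (Y (s n)) = range (fderiv \<psi> z1)" using ts1[of z1] ch1(2) by simp
      moreover have "f (Y (s n)) v \<in> range (fderiv \<psi> z1)"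
        by (rule truly_rough_tangent[OF ch1(1) Y(1) ch1(2)[symmetric] s0 T0(2) YM rough[OF s(1)]])
      ultimately show ?thesis by simp
    qed
    have Ysz: "(\<lambda>n. Y (s n)) \<longlonglongrightarrow> \<phi> z0" using Ys ch(2) by simp
    obtain b where b: "eventually (\<lambda>n. \<phi> (b n) = Y (s n)) sequentially" "\<And>n. b n \<in> ball z0 r" "b \<longlonglongrightarrow> z0"
      by (rule near_preimage[OF z0 YsM Ysz]) (rule that)
    obtain N where N: "\<And>n. N \<le> n \<Longrightarrow> \<phi> (b n) = Y (s n)" using b(1) unfolding eventually_sequentially by blast
    have "f (\<phi> z0) v \<in> range (fderiv \<phi> z0)"
    proof (rule tangent_closed[of "\<lambda>n. b (n + N)" z0 "\<lambda>n. f (\<phi> (b (n + N))) v"])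
      show "(\<lambda>n. b (n + N)) \<longlonglongrightarrow> z0" using b(3) by (rule LIMSEQ_ignore_initial_segment)
      show "f (\<phi> (b (n + N))) v \<in> range (fderiv \<phi> (b (n + N)))" for n
        using ty[of "n + N"] ts[OF b(2)[of "n + N"]] N[of "n + N"] by simp
      have Yn: "(\<lambda>n. Y (s (n + N))) \<longlonglongrightarrow> \<phi> z0" using Ysz by (rule LIMSEQ_ignore_initial_segment)
      have "(\<lambda>n. K * norm (Y (s (n + N)) - \<phi> z0)) \<longlonglongrightarrow> K * norm (\<phi> z0 - \<phi> z0)" by (intro tendsto_intros Yn)
      then have "(\<lambda>n. f (Y (s (n + N))) - f (\<phi> z0)) \<longlonglongrightarrow> 0"
        by (intro Lim_null_comparison[OF always_eventually[OF allI[OF f_lip]]]) simp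
      then have "(\<lambda>n. f (Y (s (n + N)))) \<longlonglongrightarrow> f (\<phi> z0)" by (simp add: LIM_zero_iff)
      then have "(\<lambda>n. f (Y (s (n + N))) v) \<longlonglongrightarrow> f (\<phi> z0) v" by (intro tendsto_intros)
      then show "(\<lambda>n. f (\<phi> (b (n + N))) v) \<longlonglongrightarrow> f (\<phi> z0) v" using N by simp
    qed (use b z0 in auto)
    then show ?thesis using ts[OF z0] ch(2) by simp
  qed
  have "f0 y \<in> tangent_space TYPE('m) M y" if y: "y \<in> M" for y
  proof -
    obtain T0 Y where T0: "0 < T0" "T0 \<le> T" and Y: "davie_solution 0 Y" "Y 0 = y"
      and YM: "\<And>t. 0 \<le> t \<Longrightarrow> t \<le> T0 \<Longrightarrow> Y t \<in> M" using sol[OF y] by blast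
    obtain \<phi> :: "real^'m \<Rightarrow> 'w" and z0 r c L where ch: "chart M \<phi> (fderiv \<phi>) (fderiv (fderiv \<phi>)) z0 r c L" "\<phi> z0 = y"
      and ts: "\<And>z. z \<in> ball z0 r \<Longrightarrow> tangent_space TYPE('m) M (\<phi> z) = range (fderiv \<phi> z)"
      using chart_exists[OF M y] by blast
    interpret chart M \<phi> "fderiv \<phi>" "fderiv (fderiv \<phi>)" z0 r c L by (rule ch)
    have z0: "z0 \<in> ball z0 r" using r by simp
    have tan: "f (\<phi> z) v \<in> range (fderiv \<phi> z)" if "z \<in> ball z0 r" for z v
      using ft[OF in_M[OF that]] ts[OF that] by simp
    have "f0 (\<phi> z0) \<in> range (fderiv \<phi> z0)"
      by (rule drift_tangent[OF ch(1) Y(1) _ T0 YM tan]) (simp_all add: Y ch)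
    then show ?thesis using ts[OF z0] ch(2) by simp
  qed
  then show ?thesis using ft by (simp add: tangent_fields_def)
qed

end

section \<open>The random equation\<close>

text \<open>All bounds of the data are collected in one constant.\<close>

lemma rough_hilbert_exists:
  fixes tens :: "'v::{real_inner,banach} \<Rightarrow> 'v \<Rightarrow> 'z::banach" and f0 :: "'w::banach \<Rightarrow> 'w"
  assumes ct: "completed_tensor_product tens" and ci: "has_canonical_injection TYPE('w) tens"
    and T: "0 < T" and \<alpha>: "1/3 < \<alpha>" "\<alpha> \<le> 1/2" and f0: "\<exists>L. L-lipschitz_on UNIV f0" and f: "Cb3 f"
    and X: "weakly_geometric_rough_path tens \<alpha> T X XX"
  obtains K where "rough_hilbert tens \<alpha> T K X XX f0 f (fderiv f) (fderiv (fderiv f)) (tensor_lift tens)"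
proof -
  define d1 where "d1 = fderiv f"
  define d2 where "d2 = fderiv d1"
  define d3 where "d3 = fderiv d2"
  have C3: "C3_on UNIV f" and bdd: "bounded (range f)" "bounded (range d1)" "bounded (range d2)" "bounded (range d3)"
    using f by (auto simp: Cb3_def d1_def d2_def d3_def)
  have der: "(f has_derivative blinfun_apply (d1 y)) (at y)" "(d1 has_derivative blinfun_apply (d2 y)) (at y)"
    "(d2 has_derivative blinfun_apply (d3 y)) (at y)" for y
    using C3 by (auto simp: C3_on_def C2_on_def C1_on_def d1_def d2_def d3_def intro!: fderiv_works)
  obtain b0 where b0: "\<And>y. norm (f y) \<le> b0" using bdd(1) by (auto simp: bounded_iff)
  obtain b1 where b1: "\<And>y. norm (d1 y) \<le> b1" using bdd(2) by (auto simp: bounded_iff)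
  obtain b2 where b2: "\<And>y. norm (d2 y) \<le> b2" using bdd(3) by (auto simp: bounded_iff)
  obtain b3 where b3: "\<And>y. norm (d3 y) \<le> b3" using bdd(4) by (auto simp: bounded_iff)
  obtain l where l: "0 \<le> l" "\<And>y z. norm (f0 y - f0 z) \<le> l * norm (y - z)"
    using f0 by (auto simp: lipschitz_on_def dist_norm)
  obtain cl where lift: "\<And>(A :: 'v \<Rightarrow>\<^sub>L 'v \<Rightarrow>\<^sub>L 'w) v w. tensor_lift tens A (tens v w) = A v w"
    "\<And>A :: 'v \<Rightarrow>\<^sub>L 'v \<Rightarrow>\<^sub>L 'w. norm (tensor_lift tens A) \<le> cl * norm A"
    using tensor_lift_exists[OF ct ci] by blast
  have rp: "rough_path tens \<alpha> T X XX"
    and geo: "\<And>s t. s \<in> {0..T} \<Longrightarrow> t \<in> {0..T} \<Longrightarrow> tensor_sym tens (XX s t) = (1/2) *\<^sub>R tens (X t - X s) (X t - X s)"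
    using X by (auto simp: weakly_geometric_rough_path_def)
  have chen: "XX s t - XX s u - XX u t = tens (X u - X s) (X t - X u)" if "s \<in> {0..T}" "u \<in> {0..T}" "t \<in> {0..T}" for s u t
    using rp that by (simp add: rough_path_def)
  obtain cx where cx: "\<And>s t. s \<in> {0..T} \<Longrightarrow> t \<in> {0..T} \<Longrightarrow> norm (X t - X s) \<le> cx * \<bar>t - s\<bar> powr \<alpha>"
    using rp unfolding rough_path_def holder_path_def by blast
  obtain cxx where cxx: "\<And>s t. s \<in> {0..T} \<Longrightarrow> t \<in> {0..T} \<Longrightarrow> s \<noteq> t \<Longrightarrow> norm (XX s t) \<le> cxx * \<bar>t - s\<bar> powr (2 * \<alpha>)"
    using rp unfolding rough_path_def by blast
  interpret tens: bounded_bilinear tens using ct by (simp add: completed_tensor_product_def)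
  have XX0: "XX s s = 0" if "s \<in> {0..T}" for s using chen[OF that that that] by (simp add: tens.zero_left)
  define K where "K = Max {1, b0, b1, b2, b3, l, cl, cx, cxx}"
  have K: "1 \<le> K" "b0 \<le> K" "b1 \<le> K" "b2 \<le> K" "b3 \<le> K" "l \<le> K" "cl \<le> K" "cx \<le> K" "cxx \<le> K"
    unfolding K_def by (rule Max_ge; simp)+
  have up: "x \<le> K * p" if "x \<le> a * p" "a \<le> K" "0 \<le> p" for x a p :: real
    using that by (meson mult_right_mono order_trans)
  show thesis
  proof (rule that[of K], fold d1_def, fold d2_def, unfold_locales)
    fix s t u assume st: "0 \<le> s" "s \<le> t" "t \<le> T"
    show "norm (X t - X s) \<le> K * (t - s) powr \<alpha>" using cx[of s t] st K by (intro up[of _ cx]) auto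
    have "norm (XX s t) \<le> cxx * ((t - s) powr \<alpha>)\<^sup>2"
      if "s \<noteq> t" using cxx[of s t] st that powr_powr[of "t - s" \<alpha> 2] by (simp add: mult.commute)
    then show "norm (XX s t) \<le> K * ((t - s) powr \<alpha>)\<^sup>2"
      using XX0[of s] st K by (cases "s = t") (auto intro!: up[of _ cxx])
    show "tensor_sym tens (XX s t) = (1/2) *\<^sub>R tens (X t - X s) (X t - X s)" using geo st by simp
  next
    fix s u t assume "0 \<le> s" "s \<le> u" "u \<le> t" "t \<le> T"
    then show "XX s t - XX s u - XX u t = tens (X u - X s) (X t - X u)" by (intro chen) auto
  next
    fix B C :: "'v \<Rightarrow>\<^sub>L 'v \<Rightarrow>\<^sub>L 'w"
    show "tensor_lift tens (B - C) = tensor_lift tens B - tensor_lift tens C"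
      by (rule tensor_ext[OF ct]) (simp add: lift blinfun.diff_left)
    show "norm (tensor_lift tens B) \<le> K * norm B" using lift(2)[of B] K by (intro up[of _ cl]) auto
  next
    show "C11 f d1 K" unfolding C11_def
    proof (intro conjI allI)
      show "norm (d1 y) \<le> K" for y using b1[of y] K by linarith
      show "norm (d1 y - d1 z) \<le> K * norm (y - z)" for y z
        by (rule up[OF bounded_derivative_lipschitz[OF der(2) b2] K(4)]) simp
    qed (use K der in auto)
    show "C11 d1 d2 K" unfolding C11_def
    proof (intro conjI allI)
      show "norm (d2 y) \<le> K" for y using b2[of y] K by linarith
      show "norm (d2 y - d2 z) \<le> K * norm (y - z)" for y z
        by (rule up[OF bounded_derivative_lipschitz[OF der(3) b3] K(5)]) simp
    qed (use K der in auto)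
  next
    fix y show "norm (f y) \<le> K" using b0[of y] K by linarith
  next
    fix y z show "norm (f0 y - f0 z) \<le> K * norm (y - z)" using l(2)[of y z] K by (intro up[of _ l]) auto
  qed (use \<alpha> T K lift(1) ct in \<open>simp_all add: d1_def\<close>)
qed

text \<open>The tangency condition does not involve \<open>\<omega>\<close>, so invariance along a single path outside \<open>N\<close>
  already implies it, and it implies invariance along all of them. Such a path exists as \<open>N\<close> is a
  null set of a probability measure.\<close>

theorem corollary3p9:
  fixes P :: "'a measure" and F :: "real \<Rightarrow> 'a measure"
    and tens :: "'v::{real_inner,banach,second_countable_topology} \<Rightarrow> 'v \<Rightarrow> 'z::banach"
    and T H \<alpha> :: real
    and f0 :: "'w::banach \<Rightarrow> 'w" and f :: "'w \<Rightarrow> 'v \<Rightarrow>\<^sub>L 'w"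
    and M :: "'w set"
    and Q :: "'v \<Rightarrow>\<^sub>L 'v"
    and X :: "real \<Rightarrow> 'a \<Rightarrow> 'v" and XX :: "real \<Rightarrow> real \<Rightarrow> 'a \<Rightarrow> 'z"
    and N :: "'a set"
  assumes "prob_space P" and "usual_conditions P F"
    and "completed_tensor_product tens" and "has_canonical_injection TYPE('w) tens"
    and "T > 0" and "1/3 < H" and "H \<le> 1/2" and "1/3 < \<alpha>" and "\<alpha> < H"
    and "\<exists>L. L-lipschitz_on UNIV f0"
    and "Cb3 f"
    and "C3_submanifold TYPE('m::finite) M"
    and "nuclear Q" and "self_adjoint Q" and "positive_definite Q"
    and "Q_fractional_brownian_motion P H Q X"
    and "\<forall>s\<in>{0..T}. \<forall>t\<in>{0..T}. XX s t \<in> borel_measurable P"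
    and "AE \<omega> in P. weakly_geometric_rough_path tens \<alpha> T (\<lambda>t. X t \<omega>) (\<lambda>s t. XX s t \<omega>)"
    and "N \<in> null_sets P"
    and "\<forall>\<omega>\<in>space P - N.
           weakly_geometric_rough_path tens \<alpha> T (\<lambda>t. X t \<omega>) (\<lambda>s t. XX s t \<omega>) \<and>
           truly_rough \<alpha> T (\<lambda>t. X t \<omega>)"
  shows "((\<forall>\<omega>\<in>space P - N.
             locally_invariant tens \<alpha> T f0 f (\<lambda>t. X t \<omega>) (\<lambda>s t. XX s t \<omega>) M)
          \<longleftrightarrow>
          (\<forall>y\<in>M. f0 y \<in> tangent_space TYPE('m) M y \<and>
                 (\<forall>v. f y v \<in> tangent_space TYPE('m) M y)))
       \<and>
         ((\<forall>\<omega>\<in>space P - N.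
             locally_invariant tens \<alpha> T f0 f (\<lambda>t. X t \<omega>) (\<lambda>s t. XX s t \<omega>) M)
          \<and> closed M
          \<longrightarrow>
          (\<forall>\<omega>\<in>space P - N.
             globally_invariant tens \<alpha> T f0 f (\<lambda>t. X t \<omega>) (\<lambda>s t. XX s t \<omega>) M))"
proof -
  define tangent where "tangent \<longleftrightarrow> (\<forall>y\<in>M. f0 y \<in> tangent_space TYPE('m) M y \<and> (\<forall>v. f y v \<in> tangent_space TYPE('m) M y))"
  define loc where "loc \<omega> \<longleftrightarrow> locally_invariant tens \<alpha> T f0 f (\<lambda>t. X t \<omega>) (\<lambda>s t. XX s t \<omega>) M" for \<omega>
  define glob where "glob \<omega> \<longleftrightarrow> globally_invariant tens \<alpha> T f0 f (\<lambda>t. X t \<omega>) (\<lambda>s t. XX s t \<omega>) M" for \<omega>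
  have path: "(loc \<omega> \<longleftrightarrow> tangent) \<and> (tangent \<and> closed M \<longrightarrow> glob \<omega>)" if \<omega>: "\<omega> \<in> space P - N" for \<omega>
  proof -
    have geo: "weakly_geometric_rough_path tens \<alpha> T (\<lambda>t. X t \<omega>) (\<lambda>s t. XX s t \<omega>)"
      and tr: "truly_rough \<alpha> T (\<lambda>t. X t \<omega>)" using assms(20) \<omega> by auto
    have \<alpha>: "\<alpha> \<le> 1/2" using assms(7,9) by simp
    obtain K where "rough_hilbert tens \<alpha> T K (\<lambda>t. X t \<omega>) (\<lambda>s t. XX s t \<omega>) f0 f (fderiv f) (fderiv (fderiv f)) (tensor_lift tens)"
      using rough_hilbert_exists[OF assms(3-5,8) \<alpha> assms(10,11) geo] by blast
    then interpret rough_hilbert tens \<alpha> T K "\<lambda>t. X t \<omega>" "\<lambda>s t. XX s t \<omega>" f0 f "fderiv f" "fderiv (fderiv f)" "tensor_lift tens" .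
    have "tangent \<longleftrightarrow> tangent_fields TYPE('m) M" by (simp add: tangent_def tangent_fields_def)
    then show ?thesis unfolding loc_def glob_def
      using invariant_tangent_fields[OF assms(12) _ tr] tangent_locally_invariant[OF assms(12)]
        tangent_globally_invariant[OF assms(12)] by blast
  qed
  interpret prob_space P by fact
  have "space P - N \<noteq> {}"
  proof
    assume "space P - N = {}"
    then have "emeasure P (space P) \<le> emeasure P N"
      using assms(19) by (intro emeasure_mono) (auto dest: null_setsD2)
    then show False using emeasure_space_1 assms(19) by (simp add: null_setsD1)
  qed
  then show ?thesis using path unfolding tangent_def[symmetric] loc_def[symmetric] glob_def[symmetric] by blast
qed

end
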